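(* Let $d\in\mathbb N$, $\alpha\in(0,\infty)^d$, $1\le p<\infty$, $1\le q\le\infty$, $\lambda\in\mathbb Z_+^d$ with $\alpha_j-\lambda_j-(1/p-1/q)_+>0$ for all $j$, and let $l=l(\alpha)$. Then there exist constants $c_1=c_1(d,\alpha)>0$ and $c_2,c_3>0$ depending only on $d,\alpha,p,q,\lambda$ such that for every $\delta\in(0,\infty)^d$, $x^0\in\mathbb R^d$, $Q=x^0+\delta I^d$ and every $f\in(S^\alpha_pH)'(Q)$, writing $$W(f)=\sum_{\emptyset\ne J\subset\{1,\dots,d\}}\Bigl(\prod_{j\in J}\delta_j^{\lambda_j+(1/p-1/q)_+}\Bigr)\int_{\prod_{j\in J}(0,c_1\delta_j)}\Bigl(\prod_{j\in J}t_j^{-\lambda_j-1/p-(1/p-1/q)_+-1}\Bigr)\Bigl(\int_{\prod_{j\in J}[-t_j,t_j]}\int_{Q^{l\chi_J}_\xi}|\Delta^{l\chi_J}_\xi f(x)|^pdx\,d\xi^J\Bigr)^{1/p}dt^J,$$ one has $$\|\partial^\lambda f-\partial^\lambda P^{d,l-e}_{\delta,x^0}f\|_{L_q(Q)}\le c_2\prod_j\delta_j^{-\lambda_j-1/p+1/q}\,W(f),$$ $$\|\partial^\lambda f\|_{L_q(Q)}\le c_3\prod_j\delta_j^{-\lambda_j-1/p+1/q}\bigl(\|f\|_{L_p(Q)}+W(f)\bigr).$$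
   Context: $e=(1,\dots,1)$, $I^d=(0,1)^d$, $\chi_J$ is the indicator vector of $J$, $\xi^J=(\xi_j)_{j\in J}$ with $\xi_j=0$ for $j\notin J$. $l(\alpha)_j=\min\{k\in\mathbb N:\alpha_j<k\}$. For an open $G$, $h\in\mathbb R^d$, $l\in\mathbb Z_+^d$: $G^l_h=\{x\in G:x+(t_jl_jh_j)_j\in G\ \forall t\in[0,1]^d\}$, $(\Delta^l_hf)(x)=\sum_{0\le k\le l}(-1)^{\sum(l_j-k_j)}\prod_j\binom{l_j}{k_j}f(x+kh)$ on $G^l_h$; $\Omega'^{l\chi_J}(f,t^J)_{L_p(G)}=\bigl(\prod_{j\in J}(2t_j)^{-1}\int_{\prod_{j\in J}[-t_j,t_j]}\int_{G^{l\chi_J}_\xi}|\Delta^{l\chi_J}_\xi f|^pdx\,d\xi^J\bigr)^{1/p}$. $(S^\alpha_pH)'(G)$ is the set of $f\in L_p(G)$ such that $\sup_{t^J\in(0,\infty)^J}\prod_{j\in J}t_j^{-\alpha_j}\Omega'^{l(\alpha)\chi_J}(f,t^J)_{L_p(G)}<\infty$ for every nonempty $J\subset\{1,\dots,d\}$. $\mathcal P^{d,k}$ denotes real polynomials of degree $\le k_j$ in $x_j$; for $f\in L_1(Q)$, $P^{d,k}_{\delta,x^0}f$ is the unique $g\in\mathcal P^{d,k}$ with $\int_Q(f-g)h\,dx=0$ for all $h\in\mathcal P^{d,k}$. $\partial^\lambda$ is the distributional derivative. *)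

theory Defs
  imports "HOL-Analysis.Analysis" "HOL-Probability.Essential_Supremum"
begin

definition lvec :: "('n \<Rightarrow> real) \<Rightarrow> ('n \<Rightarrow> nat)" where
  "lvec \<alpha> = (\<lambda>j. LEAST k::nat. \<alpha> j < real k)"

definition restr_vec :: "'n set \<Rightarrow> ('n \<Rightarrow> real) \<Rightarrow> real^'n" where
  "restr_vec J \<xi> = (\<chi> i. if i \<in> J then \<xi> i else 0)"

definition chiJ :: "'n set \<Rightarrow> ('n \<Rightarrow> nat) \<Rightarrow> ('n \<Rightarrow> nat)" where
  "chiJ J l = (\<lambda>j. if j \<in> J then l j else 0)"

definition shrunk :: "(real^'n) set \<Rightarrow> ('n \<Rightarrow> nat) \<Rightarrow> real^'n \<Rightarrow> (real^'n) set" where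
  "shrunk G l h = {x \<in> G. \<forall>t::'n \<Rightarrow> real. (\<forall>j. 0 \<le> t j \<and> t j \<le> 1) \<longrightarrow>
      x + (\<chi> j. t j * real (l j) * h $ j) \<in> G}"

definition mdiff :: "('n::finite \<Rightarrow> nat) \<Rightarrow> real^'n \<Rightarrow> (real^'n \<Rightarrow> real) \<Rightarrow> real^'n \<Rightarrow> real" where
  "mdiff l h f x = (\<Sum>k\<in>{k. \<forall>j. k j \<le> l j}.
      (-1) ^ (\<Sum>j\<in>UNIV. l j - k j) * (\<Prod>j\<in>UNIV. real (l j choose k j)) *
      f (x + (\<chi> j. real (k j) * h $ j)))"

definition diff_int :: "(real^'n::finite \<Rightarrow> real) \<Rightarrow> (real^'n) set \<Rightarrow> real \<Rightarrow> ('n \<Rightarrow> nat)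
    \<Rightarrow> 'n set \<Rightarrow> ('n \<Rightarrow> real) \<Rightarrow> ennreal" where
  "diff_int f G p l J t =
     (\<integral>\<^sup>+ \<xi>. indicator (PiE J (\<lambda>j. {- t j .. t j})) \<xi> *
        (\<integral>\<^sup>+ x \<in> shrunk G (chiJ J l) (restr_vec J \<xi>).
            ennreal (\<bar>mdiff (chiJ J l) (restr_vec J \<xi>) f x\<bar> powr p) \<partial>lebesgue)
      \<partial>(PiM J (\<lambda>_. lborel)))"

definition enn_root :: "real \<Rightarrow> ennreal \<Rightarrow> ennreal" where
  "enn_root p a = (if a = \<infinity> then \<infinity> else ennreal (enn2real a powr (1 / p)))"

definition Omega' :: "(real^'n::finite \<Rightarrow> real) \<Rightarrow> (real^'n) set \<Rightarrow> real \<Rightarrow> ('n \<Rightarrow> nat)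
    \<Rightarrow> 'n set \<Rightarrow> ('n \<Rightarrow> real) \<Rightarrow> ennreal" where
  "Omega' f G p l J t = enn_root p (ennreal (\<Prod>j\<in>J. 1 / (2 * t j)) * diff_int f G p l J t)"

definition Lp_norm :: "(real^'n::finite) set \<Rightarrow> real \<Rightarrow> (real^'n \<Rightarrow> real) \<Rightarrow> ennreal" where
  "Lp_norm G p f = enn_root p (\<integral>\<^sup>+ x \<in> G. ennreal (\<bar>f x\<bar> powr p) \<partial>lebesgue)"

definition Lq_norm :: "(real^'n::finite) set \<Rightarrow> ennreal \<Rightarrow> (real^'n \<Rightarrow> real) \<Rightarrow> ennreal" where
  "Lq_norm G q f = (if q = \<infinity> then esssup (lebesgue_on G) (\<lambda>x. ennreal \<bar>f x\<bar>)
                    else Lp_norm G (enn2real q) f)"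

definition inv_exp :: "ennreal \<Rightarrow> real" where
  "inv_exp q = (if q = \<infinity> then 0 else 1 / enn2real q)"

definition in_Lp :: "(real^'n::finite) set \<Rightarrow> real \<Rightarrow> (real^'n \<Rightarrow> real) \<Rightarrow> bool" where
  "in_Lp G p f \<longleftrightarrow> f \<in> borel_measurable (lebesgue_on G) \<and>
     (\<integral>\<^sup>+ x \<in> G. ennreal (\<bar>f x\<bar> powr p) \<partial>lebesgue) < \<infinity>"

definition SH' :: "('n::finite \<Rightarrow> real) \<Rightarrow> real \<Rightarrow> (real^'n) set \<Rightarrow> (real^'n \<Rightarrow> real) set" where
  "SH' \<alpha> p G = {f. in_Lp G p f \<and>
     (\<forall>J. J \<noteq> {} \<longrightarrow> (\<exists>C::real. \<forall>t. (\<forall>j\<in>J. 0 < t j) \<longrightarrow>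
        ennreal (\<Prod>j\<in>J. t j powr (- \<alpha> j)) * Omega' f G p (lvec \<alpha>) J t \<le> ennreal C))}"

definition poly_space :: "('n::finite \<Rightarrow> nat) \<Rightarrow> (real^'n \<Rightarrow> real) set" where
  "poly_space k = {g. \<exists>a::('n \<Rightarrow> nat) \<Rightarrow> real.
      g = (\<lambda>x. \<Sum>m\<in>{m. \<forall>j. m j \<le> k j}. a m * (\<Prod>j\<in>UNIV. (x $ j) ^ m j))}"

definition cube :: "('n::finite \<Rightarrow> real) \<Rightarrow> real^'n \<Rightarrow> (real^'n) set" where
  "cube \<delta> x0 = box x0 (x0 + (\<chi> j. \<delta> j))"

definition poly_proj :: "('n::finite \<Rightarrow> nat) \<Rightarrow> ('n \<Rightarrow> real) \<Rightarrow> real^'n \<Rightarrow> (real^'n \<Rightarrow> real)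
    \<Rightarrow> (real^'n \<Rightarrow> real)" where
  "poly_proj k \<delta> x0 f = (THE g. g \<in> poly_space k \<and>
      (\<forall>h\<in>poly_space k. (\<integral>x. (f x - g x) * h x \<partial>(lebesgue_on (cube \<delta> x0))) = 0))"

text \<open>classical partial derivatives, used only for test functions\<close>
definition partial :: "'n::finite \<Rightarrow> (real^'n \<Rightarrow> real) \<Rightarrow> (real^'n \<Rightarrow> real)" where
  "partial j \<phi> = (\<lambda>x. deriv (\<lambda>s. \<phi> (x + s *\<^sub>R axis j 1)) 0)"

fun partial_list :: "'n::finite list \<Rightarrow> (real^'n \<Rightarrow> real) \<Rightarrow> (real^'n \<Rightarrow> real)" where
  "partial_list [] \<phi> = \<phi>"
| "partial_list (j # js) \<phi> = partial j (partial_list js \<phi>)"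

definition partial_mi :: "('n::finite \<Rightarrow> nat) \<Rightarrow> (real^'n \<Rightarrow> real) \<Rightarrow> (real^'n \<Rightarrow> real)" where
  "partial_mi lam \<phi> = partial_list (SOME js. \<forall>j. count_list js j = lam j) \<phi>"

definition test_fun :: "(real^'n::finite) set \<Rightarrow> (real^'n \<Rightarrow> real) \<Rightarrow> bool" where
  "test_fun G \<phi> \<longleftrightarrow>
     (\<forall>js. continuous_on UNIV (partial_list js \<phi>) \<and>
        (\<forall>j x. (\<lambda>s. partial_list js \<phi> (x + s *\<^sub>R axis j 1)) differentiable (at 0))) \<and>
     compact (closure {x. \<phi> x \<noteq> 0}) \<and> closure {x. \<phi> x \<noteq> 0} \<subseteq> G"

definition weak_deriv :: "(real^'n::finite) set \<Rightarrow> ('n \<Rightarrow> nat) \<Rightarrow> (real^'n \<Rightarrow> real)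
    \<Rightarrow> (real^'n \<Rightarrow> real) \<Rightarrow> bool" where
  "weak_deriv G lam f g \<longleftrightarrow>
     (\<forall>K. compact K \<and> K \<subseteq> G \<longrightarrow> integrable (lebesgue_on K) g) \<and>
     (\<forall>\<phi>. test_fun G \<phi> \<longrightarrow>
        (\<integral>x. f x * partial_mi lam \<phi> x \<partial>(lebesgue_on G)) =
        (-1) ^ (\<Sum>j\<in>UNIV. lam j) * (\<integral>x. g x * \<phi> x \<partial>(lebesgue_on G)))"

definition Wf :: "('n::finite \<Rightarrow> real) \<Rightarrow> real \<Rightarrow> ennreal \<Rightarrow> ('n \<Rightarrow> nat) \<Rightarrow> real
    \<Rightarrow> ('n \<Rightarrow> real) \<Rightarrow> real^'n \<Rightarrow> (real^'n \<Rightarrow> real) \<Rightarrow> ennreal" where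
  "Wf \<alpha> p q lam c1 \<delta> x0 f =
    (let s = max 0 (1 / p - inv_exp q) in
     \<Sum>J\<in>{J. J \<noteq> {}}.
       ennreal (\<Prod>j\<in>J. \<delta> j powr (real (lam j) + s)) *
       (\<integral>\<^sup>+ t. indicator (PiE J (\<lambda>j. {0 <..< c1 * \<delta> j})) t *
          ennreal (\<Prod>j\<in>J. t j powr (- real (lam j) - 1 / p - s - 1)) *
          enn_root p (diff_int f (cube \<delta> x0) p (lvec \<alpha>) J t)
        \<partial>(PiM J (\<lambda>_. lborel))))"

end

theory Submission imports Defs "HOL-Complex_Analysis.Great_Picard" begin

text \<open>On the unit cube, \<open>f\<close> is reproduced as a sum over \<open>J\<close> of integrals of the mixed differences of
  \<open>f\<close> against smooth kernels, obtained by telescoping tensor products of one-dimensional smoothing operators whose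
  supports stay inside the cube. Moving \<open>\<partial>\<^sup>\<lambda>\<close> onto the kernels gives the weak derivative, and
  Minkowski's inequality bounds every term with \<open>J \<noteq> {}\<close> by \<open>W(f)\<close> and the term \<open>J = {}\<close> by the
  \<open>L\<^sub>p\<close> norm. For \<open>f - P f\<close> that norm is again bounded by \<open>W(f)\<close>: a sequence violating this would
  converge, by Arzela-Ascoli, to a function all of whose differences vanish, hence to a polynomial orthogonal to
  all polynomials of the same degrees. The general cube follows by scaling.\<close>

text \<open>A convolution would leave the cube near its boundary. Here \<open>x\<close> is moved
  towards a point u of (0,1) instead: an average of f(x + k t (u - x)) only sees convex combinations
  of points of the cube. The price is a kernel that depends on \<open>x\<close>. Frozen at
  \<open>x\<close>, this kernel a is convolved with itself. The t-derivative of that square is twice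
  the convolution of a with da/dt, and da/dt is a sum of dilates by k = 1..l of one kernel of mean
  zero, with the coefficients \<open>ck\<close>. Mean zero supplies the missing term k = 0, and a
  difference of order \<open>l\<close> appears. Two successive steps have relative length at most 2
  l t, hence the bound \<open>c\<close> = 1/(2 S) on the scales, S being the sum of the
  \<open>l j\<close>. Each coordinate operator T_e is T_c plus an integral over scales in (e, c);
  expanding the product over the coordinates gives the sum over J. The limit e -> 0 is taken on the
  side of the test function, where the adjoint kernels act on a continuous function. The derivative
  of P f comes from the same representation, applied to the polynomial cut off to the cube.\<close>

abbreviation (input) BM where "BM \<equiv> borel_measurable"
abbreviation NN_lborel (binder "NN " 10) where "NN_lborel \<equiv> nn_integral lborel"
abbreviation LI_lborel (binder "LI " 10) where "LI_lborel \<equiv> integral\<^sup>L lborel"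
abbreviation LJ :: "'n set \<Rightarrow> ('n \<Rightarrow> real) measure" where "LJ J \<equiv> PiM J (\<lambda>_. lborel)"

lemmas BI_cong = Bochner_Integration.integral_cong

section \<open>Chains of derivatives and a compactly supported spline bump\<close>

text \<open>Derivatives are carried along as an explicit family, so that every derivative of a
  kernel is again a formula whose support and size can be read off.\<close>

definition smooth_chain :: "nat => (nat => real => real) => bool" where
 "smooth_chain N F \<longleftrightarrow> (\<forall>i<N. \<forall>x. (F i has_real_derivative F (Suc i) x) (at x)) \<and>
  (\<forall>i\<le>N. continuous_on UNIV (F i))"

definition leib :: "(nat => real => real) => (nat => real => real) => nat => real => real" where
 "leib F G i x = (\<Sum>r\<le>i. real (i choose r)*F r x*G (i - r) x)"

lemma smooth_chainD:
 assumes "smooth_chain N F"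
 shows "i < N ==> (F i has_real_derivative F (Suc i) x) (at x)"
  and "i <= N ==> continuous_on UNIV (F i)" using assms unfolding smooth_chain_def by auto

lemma smooth_chain_mono: "smooth_chain N F ==> M <= N ==> smooth_chain M F" unfolding smooth_chain_def by auto

text \<open>Pascal's rule: after shifting the index in the first half, equal products carry adjacent
  binomial coefficients.\<close>

lemma leibniz_sum_step:
 fixes a b :: "nat => real"
 shows "(\<Sum>r\<le>i. real (i choose r)*(a (Suc r)*b (i - r) + a r*b (Suc i - r))) =
   (\<Sum>r\<le>Suc i. real (Suc i choose r)*a r*b (Suc i - r))"
proof -
 have "(\<Sum>r\<le>Suc i. real (i choose r)*a r*b (Suc i - r)) =
   (\<Sum>r\<le>i. real (i choose r)*a r*b (Suc i - r))" by simp
 moreover have "(\<Sum>r\<le>Suc i. real (i choose r)*a r*b (Suc i - r)) =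
   a 0*b (Suc i) + (\<Sum>r\<le>i. real (i choose Suc r)*a (Suc r)*b (i - r))" by(subst sum.atMost_Suc_shift) simp
 moreover have "(\<Sum>r\<le>Suc i. real (Suc i choose r)*a r*b (Suc i - r)) =
   a 0*b (Suc i) + (\<Sum>r\<le>i. real (Suc i choose Suc r)*a (Suc r)*b (i - r))" by(subst sum.atMost_Suc_shift) simp
 ultimately show ?thesis by(simp only: distrib_left distrib_right sum.distrib binomial_Suc_Suc of_nat_add mult.assoc [symmetric])
qed

lemma leib_chain:
 assumes F: "smooth_chain N F" and G: "smooth_chain N G"
 shows "smooth_chain N (leib F G)" unfolding smooth_chain_def
proof (intro conjI allI impI)
 fix i x assume i: "i < N"
 have "(leib F G i has_real_derivative
  (\<Sum>r\<le>i. real (i choose r)*(F (Suc r) x*G (i - r) x + F r x*G (Suc i - r) x))) (at x)" unfolding leib_def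
 proof (rule DERIV_sum)
  fix r assume r: "r \<in> {..i}"
  then have r2: "r < N" "i - r < N" "Suc i - r = Suc (i - r)" using i by auto
  note d = smooth_chainD(1)[OF F r2(1), of x] smooth_chainD(1)[OF G r2(2), of x]
  show "((%x. real (i choose r)*F r x*G (i - r) x) has_real_derivative
   real (i choose r)*(F (Suc r) x*G (i - r) x + F r x*G (Suc i - r) x)) (at x)" unfolding r2(3) by(auto intro!: derivative_eq_intros d simp: algebra_simps)
 qed
 then show "(leib F G i has_real_derivative leib F G (Suc i) x) (at x)" unfolding leibniz_sum_step[of i "%r. F r x" "%r. G r x"] leib_def[of _ _ "Suc i"] .
next
 fix i assume i: "i <= N"
 show "continuous_on UNIV (leib F G i)" unfolding leib_def by(intro continuous_intros smooth_chainD(2)[OF F] smooth_chainD(2)[OF G]) (use i in auto)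
qed

lemma smooth_chain_affine:
 assumes "smooth_chain N F"
 shows "smooth_chain N (%i x. a^i*F i (x*a + b))" unfolding smooth_chain_def
proof (intro conjI allI impI)
 fix i x assume i: "i < N"
 show "((%x. a^i*F i (x*a + b)) has_real_derivative a^Suc i*F (Suc i) (x*a + b)) (at x)"
  by(rule DERIV_cong, rule DERIV_cmult, rule DERIV_chain2[OF smooth_chainD(1)[OF assms i]])
   (auto intro!: derivative_eq_intros)
next
 fix i assume i: "i <= N"
 show "continuous_on UNIV (%x. a^i*F i (x*a + b))" by(intro continuous_intros continuous_on_compose2[OF smooth_chainD(2)[OF assms i]]) auto
qed

lemma smooth_chain_cmult:
 "smooth_chain N F ==> smooth_chain N (%i x. a*F i x)" unfolding smooth_chain_def by(auto intro!: continuous_intros DERIV_cmult)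

lemma smooth_chain_add:
 "smooth_chain N F ==> smooth_chain N G ==> smooth_chain N (%i x. F i x + G i x)" unfolding smooth_chain_def by(auto intro!: continuous_intros DERIV_add)

lemma smooth_chain_sum:
 "(\<And>k. k \<in> S ==> smooth_chain N (F k)) ==> smooth_chain N (%i x. \<Sum>k\<in>S. F k i x)" unfolding smooth_chain_def by(auto intro!: continuous_intros DERIV_sum)

lemma smooth_chain_Suc:
 "smooth_chain (Suc N) F ==> smooth_chain N (%i. F (Suc i))" unfolding smooth_chain_def by auto

text \<open>The derivatives of the truncated power \<open>max 0 u ^ m\<close>. The chain stops at
  order m - 1, where the truncated first power is continuous but has a kink.\<close>

definition tpow :: "nat => nat => real => real" where
 "tpow m i u = (\<Prod>r<i. real (m - r))*max 0 u^(m - i)"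

lemma tpow_chain: "smooth_chain (m - 1) (tpow m)" unfolding smooth_chain_def
proof (intro conjI allI impI)
 fix i x assume i: "i < m - 1"
 define n where "n = m - i"
 have n: "2 <= n" "m - Suc i = n - 1" using i by(auto simp: n_def)
 have D: "((%u::real. max 0 u^n) has_real_derivative real n*max 0 x^(n - 1)) (at x)"
 proof -
  consider "x < 0" | "x > 0" | "x = 0" by linarith
  then show ?thesis
  proof cases
   case 1
   have "((%u::real. 0) has_real_derivative 0) (at x)" by simp
   then have "((%u::real. max 0 u^n) has_real_derivative 0) (at x)" by(rule has_field_derivative_transform_within_open[of _ _ _ "{..<0}"]) (use 1 n in auto)
   moreover have "max 0 x = 0" using 1 by simp
   ultimately show ?thesis using n by(simp add: zero_power)
  next
   case 2
   have "((%u::real. u^n) has_real_derivative real n*x^(n - 1)) (at x)" by(auto intro!: derivative_eq_intros)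
   then have "((%u::real. max 0 u^n) has_real_derivative real n*x^(n - 1)) (at x)" by(rule has_field_derivative_transform_within_open[of _ _ _ "{0<..}"]) (use 2 in auto)
   moreover have "max 0 x = x" using 2 by simp
   ultimately show ?thesis by simp
  next
   case 3
   \<comment> \<open>At the knot the difference quotient is bounded by |h|, because n is at least
     2.\<close>
   have "((%h::real. max 0 h^n/h) \<longlongrightarrow> 0) (at 0)"
   proof (rule Lim_null_comparison)
   show "eventually (%h::real. norm (max 0 h^n/h) <= \<bar>h\<bar>) (at 0)" unfolding eventually_at
   proof (intro exI[of _ 1] conjI ballI impI)
   fix h :: real assume h: "h ~= 0 \<and> dist h 0 < 1"
   have "max 0 h^n <= \<bar>h\<bar>^n" by(intro power_mono) auto
   also have "... <= \<bar>h\<bar>^2" using h n by(intro power_decreasing) auto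
   finally have "max 0 h^n <= \<bar>h\<bar>*\<bar>h\<bar>" by(simp add: power2_eq_square)
   then show "norm (max 0 h^n/h) <= \<bar>h\<bar>" using h by(simp add: abs_mult divide_le_eq)
   qed simp
   show "((%h::real. \<bar>h\<bar>) \<longlongrightarrow> 0) (at 0)" by(rule tendsto_eq_intros | simp)+
   qed
   moreover have "(0::real)^n = 0" "(0::real)^(n - 1) = 0" using n by(auto simp: zero_power)
   ultimately show ?thesis using 3 n unfolding has_field_derivative_iff by(simp add: power_0_left)
  qed
 qed
 show "(tpow m i has_real_derivative tpow m (Suc i) x) (at x)" unfolding tpow_def n_def[symmetric] n(2)
  using DERIV_cmult[OF D, of "\<Prod>r<i. real (m - r)"] by(simp add: n_def mult.assoc)
next
 fix i assume "i <= m - 1"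
 show "continuous_on UNIV (tpow m i)" unfolding tpow_def by(intro continuous_intros)
qed

lemma integrable_continuous_bounded_support:
 fixes f :: "real => real"
 assumes "continuous_on UNIV f" "\<And>x. x \<notin> {a..b} ==> f x = 0"
 shows "integrable lborel f"
proof -
 have "set_integrable lborel {a..b} f" by(rule borel_integrable_atLeastAtMost') (use assms continuous_on_subset in blast)
 moreover have "(%x. indicator {a..b} x *\<^sub>R f x) = f" using assms(2) by(auto simp: indicator_def fun_eq_iff)
 ultimately show ?thesis unfolding set_integrable_def by simp
qed

text \<open>Support, continuity and the bound hold for every index, also beyond \<open>N\<close>
  where the chain condition is silent, so later estimates carry no restriction on the order.\<close>

locale bump =
 fixes N :: nat and \<phi> :: "nat => real => real" and B :: real
 assumes phi_chain: "smooth_chain N \<phi>"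
  and phi_cont: "\<And>i. continuous_on UNIV (\<phi> i)"
  and phi_supp: "\<And>i x. \<phi> i x ~= 0 ==> 0 < x \<and> x < 1"
  and phi_int: "(LI x. \<phi> 0 x) = 1"
  and phi_bound: "\<And>i x. \<bar>\<phi> i x\<bar> <= B"

text \<open>The witness is the normalised product of the truncated powers of x and 1 - x with
  exponent N + 1; entries of order above \<open>N\<close> are set to 0.\<close>

lemma bump_exists: "\<exists>\<phi> B. bump N \<phi> B"
proof -
 define F where "F = tpow (N + 1)"
 define G where "G = (%i x. (-1)^i*tpow (N + 1) i (x*(-1) + 1))"
 have cF: "smooth_chain N F" using tpow_chain[of "N+1"] by(simp add: F_def)
 have cG: "smooth_chain N G" using smooth_chain_affine[OF tpow_chain[of "N+1"], of "-1" 1] by(simp add: G_def)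
 define H where "H = leib F G"
 have cH: "smooth_chain N H" unfolding H_def by(rule leib_chain[OF cF cG])
 have H0: "H i x = 0" if "i <= N" "\<not> (0 < x \<and> x < 1)" for i x unfolding H_def leib_def
 proof (rule sum.neutral, safe)
  fix r assume r: "r <= i"
  show "real (i choose r)*F r x*G (i - r) x = 0"
  proof (cases "x <= 0")
   case True
   then have "F r x = 0" using r that by(simp add: F_def tpow_def max_def)
   then show ?thesis by simp
  next
   case False
   then have "G (i - r) x = 0" using r that by(simp add: G_def tpow_def max_def)
   then show ?thesis by simp
  qed
 qed
 have contH: "continuous_on UNIV (H i)" if "i <= N" for i using smooth_chainD(2)[OF cH that] .
 have intH: "integrable lborel (H i)" if "i <= N" for i by(rule integrable_continuous_bounded_support[OF contH[OF that], of 0 1]) (use H0 that in auto)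
 have H00: "H 0 x = max 0 x^(N+1)*max 0 (1 - x)^(N+1)" for x by(simp add: H_def leib_def F_def G_def tpow_def)
 define Z where "Z = (LI x. H 0 x)"
 have "Z ~= 0"
 proof
  assume "Z = 0"
  then have "AE x in lborel. H 0 x = 0" unfolding Z_def by(subst (asm) integral_nonneg_eq_0_iff_AE) (use intH in \<open>auto simp: H00\<close>)
  then have "{x. H 0 x ~= 0} \<in> null_sets lborel" using borel_measurable_continuous_onI[OF contH[of 0]] by(subst (asm) AE_iff_null) auto
  moreover have "{x. H 0 x ~= 0} = {0<..<1}" by(auto simp: H00)
  ultimately show False by(simp add: null_sets_def)
 qed
 define \<phi> where "\<phi> = (%i x. if i <= N then (1/Z)*H i x else 0)"
 have cphi: "continuous_on UNIV (\<phi> i)" for i unfolding \<phi>_def using \<open>Z ~= 0\<close> by(cases "i <= N") (auto intro!: continuous_intros contH)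
 have chain: "smooth_chain N \<phi>" using smooth_chain_cmult[OF cH, of "1/Z"] unfolding smooth_chain_def \<phi>_def by(auto simp del: mult_eq_0_iff times_divide_eq_left)
 have supp: "\<phi> i x ~= 0 ==> 0 < x \<and> x < 1" for i x using H0[of i x] unfolding \<phi>_def by(auto split: if_splits)
 have "\<exists>b. \<forall>x. \<bar>\<phi> i x\<bar> <= b" for i
 proof -
  have "compact (\<phi> i ` {0..1})" by(intro compact_continuous_image continuous_on_subset[OF cphi]) auto
  then obtain b where b: "\<And>x. x \<in> {0..1} ==> norm (\<phi> i x) <= b" using compact_imp_bounded bounded_iff by(metis imageI)
  have "\<bar>\<phi> i x\<bar> <= max b 0" for x using b[of x] supp[of i x] by(cases "\<phi> i x = 0") auto
  then show ?thesis by blast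
 qed
 then obtain b where b: "\<And>i x. \<bar>\<phi> i x\<bar> <= b i" by metis
 define B where "B = (\<Sum>i\<le>N. b i)"
 have bpos: "b i \<ge> 0" for i using b[of i 0] by linarith
 have "\<bar>\<phi> i x\<bar> <= B" for i x
 proof (cases "i <= N")
  case True
  then have "b i <= B" unfolding B_def by(intro member_le_sum) (auto simp: bpos)
  then show ?thesis using b[of i x] by linarith
 next
  case False
  then show ?thesis by(simp add: \<phi>_def B_def sum_nonneg bpos)
 qed
 moreover have "(LI x. \<phi> 0 x) = 1" using \<open>Z ~= 0\<close> by(simp add: \<phi>_def Z_def[symmetric])
 ultimately have "bump N \<phi> B" by unfold_locales (use chain cphi supp in auto)
 then show ?thesis by blast
qed

section \<open>One-dimensional smoothing kernels: supports and bounds\<close>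

text \<open>Up to sign the coefficients of a difference of order \<open>l\<close> without its term k
  = 0. Their sum is 1, so the averages formed with them reproduce constants.\<close>

definition ck :: "nat => nat => real" where
 "ck l k = (-1)^(k + 1)*real (l choose k)"

lemma sum_ck: "1 <= l ==> (\<Sum>k=1..l. ck l k) = 1"
proof -
 assume "1 <= l"
 then have "(\<Sum>k\<le>l. (-1)^k*real (l choose k)) = 0" by(intro choose_alternating_sum) auto
 moreover have "(\<Sum>k\<le>l. (-1)^k*real (l choose k)) = 1 + (\<Sum>k=1..l. (-1)^k*real (l choose k))" by(simp add: atMost_atLeast0 sum.atLeast_Suc_atMost)
 ultimately show ?thesis by(simp add: ck_def sum_negf)
qed

lemma sum_abs_ck: "(\<Sum>k=1..l. \<bar>ck l k\<bar>) <= 2^l"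
proof -
 have "(\<Sum>k=1..l. \<bar>ck l k\<bar>) = (\<Sum>k=1..l. real (l choose k))" by(simp add: ck_def abs_mult power_abs)
 also have "... <= (\<Sum>k\<le>l. real (l choose k))" by(intro sum_mono2) auto
 also have "... = 2^l" using choose_row_sum[of l] by(metis of_nat_numeral of_nat_power of_nat_sum)
 finally show ?thesis .
qed

context bump
begin

lemma B_pos: "0 <= B" using phi_bound[of 0 0] by linarith

lemma phi_measurable [measurable]: "\<phi> i \<in> BM borel" by(rule borel_measurable_continuous_onI[OF phi_cont])

lemma phi_integrable: "integrable lborel (\<phi> i)" by(rule integrable_continuous_bounded_support[OF phi_cont, of 0 1]) (use phi_supp in force)

text \<open>The i-th derivative in \<open>x\<close>, at fixed \<open>z\<close>, of the sum of
  \<open>ck l k\<close> times phi(x + (z - x)/(k t))/(k t). This kernel averages f over the points x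
  + k t (u - x) with u distributed by phi; as u lies in (0,1), these points stay in (0,1) while k t
  is at most 1.\<close>

definition AZ :: "nat => nat => real => real => real => real" where
 "AZ l i t x z = (\<Sum>k=1..l. ck l k*(1/(real k*t)) *
   ((1 - 1/(real k*t))^i*\<phi> i (x*(1 - 1/(real k*t)) + z/(real k*t))))"

text \<open>The same kernel in terms of the displacement w = z - x, differentiated in
  \<open>x\<close> at fixed \<open>w\<close>. The factors \<open>1^i\<close> and \<open>x*1\<close>
  reproduce the shape of \<open>smooth_chain_affine\<close>.\<close>

definition AW :: "nat => nat => real => real => real => real" where
 "AW l i t x w = (\<Sum>k=1..l. ck l k*(1/(real k*t))*(1^i*\<phi> i (x*1 + w/(real k*t))))"

text \<open>For i = 0 this is the t-derivative of phi(x + xi/t)/t; the index \<open>i\<close> counts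
  derivatives in \<open>x\<close>.\<close>

definition bt :: "nat => real => real => real => real" where
 "bt i t x xi = - (1/t\<^sup>2)*(1^i*\<phi> i (x*1 + xi/t) + xi/t*(1^i*\<phi> (Suc i) (x*1 + xi/t)))"

text \<open>The kernel against which a difference of order \<open>l\<close> with base point
  \<open>z\<close> and step \<open>xi\<close> is integrated. The 2 comes from differentiating a
  convolution square, the sign from the order of the binomial terms.\<close>

definition kk :: "nat => nat => real => real => real => real => real" where
 "kk l i t x z xi = 2*(-1)^l*leib (%r x. AZ l r t x z) (%r x. bt r t x xi) i x"

text \<open>Two smoothing steps with the parameter frozen at \<open>x\<close>; \<open>z\<close> is
  the intermediate point. With the parameter frozen the two factors are translates of one function,
  and the product rule in \<open>t\<close> has two equal terms.\<close>

definition TI :: "nat => nat => real => real => real => real => real" where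
 "TI l i t x y z = leib (%r x. AZ l r t x z) (%r x. AW l r t x (y - z)) i x"

definition TT :: "nat => nat => real => real => real => real" where
 "TT l i t x y = integral {0..1} (TI l i t x y)"

lemma AZ_chain: "smooth_chain N (%i x. AZ l i t x z)" unfolding AZ_def by(intro smooth_chain_sum smooth_chain_cmult smooth_chain_affine phi_chain)

lemma AW_chain: "smooth_chain N (%i x. AW l i t x w)" unfolding AW_def by(intro smooth_chain_sum smooth_chain_cmult smooth_chain_affine phi_chain)

lemma bt_chain: "Suc M <= N ==> smooth_chain M (%i x. bt i t x xi)" unfolding bt_def by(intro smooth_chain_cmult smooth_chain_add smooth_chain_affine smooth_chain_Suc
  smooth_chain_mono[OF phi_chain]) auto

lemma kk_chain: "Suc M <= N ==> smooth_chain M (%i x. kk l i t x z xi)" unfolding kk_def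
 by(intro smooth_chain_cmult leib_chain smooth_chain_mono[OF AZ_chain] bt_chain) auto

lemma TI_chain: "smooth_chain N (%i x. TI l i t x y z)" unfolding TI_def by(intro leib_chain AZ_chain AW_chain)

lemma continuous_TI:
 "continuous_on (UNIV \<times> UNIV \<times> {0<..}) (%(x, z, t). TI l i t x y z)" unfolding TI_def leib_def AZ_def AW_def split_beta
 by(intro continuous_intros continuous_on_compose2[OF phi_cont] subset_UNIV) auto

lemma continuous_TI_xyz:
 assumes "0 < t"
 shows "continuous_on UNIV (%((x, y), z). TI l i t x y z)" unfolding TI_def leib_def AZ_def AW_def split_beta
 by(intro continuous_intros continuous_on_compose2[OF phi_cont] subset_UNIV) (use assms in auto)

lemma TT_continuous:
 assumes "0 < t"
 shows "continuous_on UNIV (%(x, y). TT l i t x y)"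
proof -
 have "continuous_on UNIV (%p. integral (cbox 0 1) (%z. TI l i t (fst p) (snd p) z))" by(rule integral_continuous_on_param)
   (use continuous_on_subset[OF continuous_TI_xyz[OF assms]] in \<open>auto simp: split_beta\<close>)
 then show ?thesis unfolding TT_def by(simp add: split_beta)
qed

lemma TT_chain:
 assumes t: "0 < t"
 shows "smooth_chain N (%i x. TT l i t x y)" unfolding smooth_chain_def
proof (intro conjI allI impI)
 fix i x assume i: "i < N"
 have c: "continuous_on UNIV (%(x, z). TI l i t x y z)" for i
 proof -
  have "continuous_on UNIV (%p::real\<times>real. (%((x, y), z). TI l i t x y z) ((fst p, y), snd p))"
   by(rule continuous_on_compose2[OF continuous_TI_xyz[OF t]]) (auto intro!: continuous_intros)
  then show ?thesis by(simp add: split_beta)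
 qed
 have "((%x. integral (cbox 0 1) (TI l i t x y)) has_real_derivative
   integral (cbox 0 1) (TI l (Suc i) t x y)) (at x within UNIV)"
 proof (rule leibniz_rule_field_derivative)
  show "continuous_on (UNIV \<times> cbox 0 1) (%(x, z). TI l (Suc i) t x y z)" by(rule continuous_on_subset[OF c]) auto
  show "(TI l i t x y) integrable_on cbox 0 1" for x
  proof (rule integrable_continuous)
   have "continuous_on (cbox 0 1) (%z. (%(x, z). TI l i t x y z) (x, z))" by(rule continuous_on_compose2[OF c]) (auto intro!: continuous_intros)
   then show "continuous_on (cbox 0 1) (TI l i t x y)" by simp
  qed
 qed (use smooth_chainD(1)[OF TI_chain i] in auto)
 then show "((%x. TT l i t x y) has_real_derivative TT l (Suc i) t x y) (at x)" unfolding TT_def by simp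
next
 fix i
 have "continuous_on UNIV (%x. (%(x, y). TT l i t x y) (x, y))" by(rule continuous_on_compose2[OF TT_continuous[OF t]]) (auto intro!: continuous_intros)
 then show "continuous_on UNIV (%x. TT l i t x y)" by simp
qed

lemma AZ_AW: "0 < t ==> AZ l 0 t x z = AW l 0 t x (z - x)" unfolding AZ_def AW_def by(intro sum.cong refl) (simp add: field_simps)

lemma AZ_supp:
 assumes "AZ l i t x z ~= 0"
 obtains k u where "1 <= k" "k <= l" "0 < u" "u < 1" "u = x*(1 - 1/(real k*t)) + z/(real k*t)"
proof -
 obtain k where k: "k \<in> {1..l}" "\<phi> i (x*(1 - 1/(real k*t)) + z/(real k*t)) ~= 0" using sum.not_neutral_contains_not_neutral[OF assms[unfolded AZ_def]] by force
 show ?thesis by(rule that[of k]) (use k phi_supp[OF k(2)] in auto)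
qed

lemma AW_supp:
 assumes "AW l i t x w ~= 0"
 obtains k u where "1 <= k" "k <= l" "0 < u" "u < 1" "u = x + w/(real k*t)"
proof -
 obtain k where k: "k \<in> {1..l}" "\<phi> i (x*1 + w/(real k*t)) ~= 0" using sum.not_neutral_contains_not_neutral[OF assms[unfolded AW_def]] by force
 show ?thesis by(rule that[of k]) (use k phi_supp[OF k(2)] in auto)
qed

lemma bt_supp: "bt i t x xi ~= 0 ==> 0 < x + xi/t \<and> x + xi/t < 1" using phi_supp[of i "x + xi/t"] phi_supp[of "Suc i" "x + xi/t"] unfolding bt_def by fastforce

lemma leib_nonzero: "leib F G i x ~= 0 ==> \<exists>r\<le>i. F r x ~= 0 \<and> G (i - r) x ~= 0" unfolding leib_def by(elim sum.not_neutral_contains_not_neutral) auto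

lemma AZ_supp2:
 assumes "AZ l i t x z ~= 0" "0 < t"
 obtains k u where "1 <= k" "k <= l" "0 < u" "u < 1" "z = x + real k*t*(u - x)"
proof -
 obtain k u where k: "1 <= k" "k <= l" "0 < u" "u < 1" "u = x*(1 - 1/(real k*t)) + z/(real k*t)" using AZ_supp[OF assms(1)] .
 have "z = x + real k*t*(u - x)" using k(1) assms(2) unfolding k(5) by(simp add: field_simps)
 then show ?thesis using k that by blast
qed

lemma AW_supp2:
 assumes "AW l i t x w ~= 0" "0 < t"
 obtains k u where "1 <= k" "k <= l" "0 < u" "u < 1" "w = real k*t*(u - x)"
proof -
 obtain k u where k: "1 <= k" "k <= l" "0 < u" "u < 1" "u = x + w/(real k*t)" using AW_supp[OF assms(1)] .
 have "w = real k*t*(u - x)" using k(1) assms(2) unfolding k(5) by(simp add: field_simps)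
 then show ?thesis using k that by blast
qed

text \<open>The point is a convex combination of x, u and v with weights 1 - a - b, a and b. With a
  and b at most l t this is the origin of the condition 2 l t <= 1.\<close>

lemma two_step:
 fixes x u v a b :: real
 assumes "0 < x" "x < 1" "0 < u" "u < 1" "0 < v" "v < 1" "0 < a" "0 <= b" "a + b <= 1"
 shows "0 < x + a*(u - x) + b*(v - x)" "x + a*(u - x) + b*(v - x) < 1"
proof -
 have "x + a*(u - x) + b*(v - x) = (1 - a - b)*x + a*u + b * v" by(simp add: algebra_simps)
 also have "... > 0" using assms by(intro add_nonneg_pos add_pos_nonneg mult_nonneg_nonneg mult_pos_pos) auto
 finally show "0 < x + a*(u - x) + b*(v - x)" .
 have "1 - (x + a*(u - x) + b*(v - x)) = (1 - a - b)*(1 - x) + a*(1 - u) + b*(1 - v)" by(simp add: algebra_simps)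
 also have "... > 0" using assms by(intro add_nonneg_pos add_pos_nonneg mult_nonneg_nonneg mult_pos_pos) auto
 finally show "x + a*(u - x) + b*(v - x) < 1" by simp
qed

lemma scale_le:
 assumes "k <= l" "m <= l" "0 < t" "2*real l*t <= 1"
 shows "real k*t + real m*t <= 1" "real k*t <= real l*t"
proof -
 have "real k*t <= real l*t" "real m*t <= real l*t" using assms by(auto intro!: mult_right_mono)
 then show "real k*t + real m*t <= 1" "real k*t <= real l*t" using assms by linarith+
qed

text \<open>Here z = x + k t (u - x) and xi = t (v - x), so z + l xi is reached from x by two steps
  of total relative length k t + l t <= 1. Both ends z and z + l xi lie in (0,1), which is
  membership in the shrunk set.\<close>

lemma kk_supp:
 assumes "kk l i t x z xi ~= 0" "0 < x" "x < 1" "0 < t" "2*real l*t <= 1"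
 shows "\<bar>xi\<bar> <= t" "\<bar>z - x\<bar> <= real l*t" "0 < z" "z < 1" "0 < z + real l*xi" "z + real l*xi < 1"
proof -
 obtain r where r: "AZ l r t x z ~= 0" "bt (i - r) t x xi ~= 0" using leib_nonzero[of "%r x. AZ l r t x z" "%r x. bt r t x xi" i x] assms(1) unfolding kk_def by auto
 obtain k u where k: "1 <= k" "k <= l" "0 < u" "u < 1" "z = x + real k*t*(u - x)" using AZ_supp2[OF r(1) assms(4)] .
 define v where "v = x + xi/t"
 have v: "0 < v" "v < 1" using bt_supp[OF r(2)] by(auto simp: v_def)
 have xi: "xi = t*(v - x)" using assms(4) by(simp add: v_def field_simps)
 have "\<bar>v - x\<bar> <= 1" "\<bar>u - x\<bar> <= 1" using v k assms by auto
 then show "\<bar>xi\<bar> <= t" using assms(4) mult_left_mono[of "\<bar>v - x\<bar>" 1 t] by(simp add: xi abs_mult)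
 have s: "real k*t <= real l*t" "real k*t <= 1" using scale_le[of k l l t] scale_le[of k l 0 t] assms k by auto
 have "real k*t*\<bar>u - x\<bar> <= real k*t*1" using \<open>\<bar>u - x\<bar> <= 1\<close> assms(4) by(intro mult_left_mono) auto
 moreover have "\<bar>z - x\<bar> = real k*t*\<bar>u - x\<bar>" using assms(4) by(simp add: k(5) abs_mult)
 ultimately show "\<bar>z - x\<bar> <= real l*t" using s by linarith
 show "0 < z" "z < 1" using two_step[of x u v "real k*t" 0] k v s assms by(auto simp: add_increasing2)
 have sl: "real k*t + real l*t <= 1" using scale_le(1)[of k l l t] assms k by auto
 have e: "z + real l*xi = x + real k*t*(u - x) + real l*t*(v - x)" by(simp add: k(5) xi)
 show "0 < z + real l*xi" "z + real l*xi < 1" unfolding e using two_step[of x u v "real k*t" "real l*t"] k(1,3,4) v sl assms by auto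
qed

lemma TI_supp:
 assumes "TI l i t x y z ~= 0" "0 < x" "x < 1" "0 < t" "2*real l*t <= 1"
 shows "0 < z" "z < 1" "0 < y" "y < 1" "\<bar>y - x\<bar> <= 2*real l*t" "\<bar>z - x\<bar> <= real l*t"
proof -
 obtain r where r: "AZ l r t x z ~= 0" "AW l (i - r) t x (y - z) ~= 0" using leib_nonzero[OF assms(1)[unfolded TI_def]] by blast
 obtain k u where k: "1 <= k" "k <= l" "0 < u" "u < 1" "z = x + real k*t*(u - x)" using AZ_supp2[OF r(1) assms(4)] .
 obtain m v where m: "1 <= m" "m <= l" "0 < v" "v < 1" "y - z = real m*t*(v - x)" using AW_supp2[OF r(2) assms(4)] .
 have v: "0 < v" "v < 1" using m by auto
 have e: "y = x + real k*t*(u - x) + real m*t*(v - x)" using k m by simp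
 have s: "real k*t + real m*t <= 1" "real k*t <= real l*t" "real m*t <= real l*t" using scale_le[of k l m t] scale_le[of m l m t] assms k m by auto
 have uv: "\<bar>v - x\<bar> <= 1" "\<bar>u - x\<bar> <= 1" using v k assms by auto
 show "0 < z" "z < 1" using two_step[of x u v "real k*t" 0] k v s assms by(auto simp: add_increasing2)
 show "0 < y" "y < 1" unfolding e using two_step[of x u v "real k*t" "real m*t"] k(1,3,4) v s m(1) assms by auto
 have "real k*t*\<bar>u - x\<bar> <= real k*t*1" using uv assms(4) by(intro mult_left_mono) auto
 moreover have "real m*t*\<bar>v - x\<bar> <= real m*t*1" using uv assms(4) by(intro mult_left_mono) auto
 moreover have "\<bar>real k*t*(u - x)\<bar> = real k*t*\<bar>u - x\<bar>"
  "\<bar>real m*t*(v - x)\<bar> = real m*t*\<bar>v - x\<bar>" using assms(4) by(auto simp: abs_mult)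
 ultimately have a: "\<bar>real k*t*(u - x)\<bar> <= real l*t" "\<bar>real m*t*(v - x)\<bar> <= real l*t" using s by linarith+
 show "\<bar>z - x\<bar> <= real l*t" using a(1) by(simp add: k(5))
 show "\<bar>y - x\<bar> <= 2*real l*t" using a unfolding e by linarith
qed

lemma TT_supp:
 assumes "TT l i t x y ~= 0" "0 < x" "x < 1" "0 < t" "2*real l*t <= 1"
 shows "0 < y" "y < 1" "\<bar>y - x\<bar> <= 2*real l*t"
proof -
 have "\<exists>z. TI l i t x y z ~= 0"
 proof (rule ccontr)
  assume "\<nexists>z. TI l i t x y z ~= 0"
  then have "TI l i t x y = (%_. 0)" by auto
  then show False using assms(1) by(simp add: TT_def)
 qed
 then obtain z where "TI l i t x y z ~= 0" by blast
 from TI_supp[OF this assms(2-)] show "0 < y" "y < 1" "\<bar>y - x\<bar> <= 2*real l*t" by auto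
qed

text \<open>One power of 1/t is the normalisation, the other \<open>i\<close> come from the chain
  rule, where t <= 1 gives |1 - 1/(k t)| <= 1/t.\<close>

lemma AZ_bound:
 assumes "0 < t" "t <= 1"
 shows "\<bar>AZ l i t x z\<bar> <= 2^l*B*(1/t)^(i + 1)"
proof -
 have "\<bar>AZ l i t x z\<bar> <= (\<Sum>k=1..l. \<bar>ck l k\<bar>*(B*(1/t)^(i + 1)))" unfolding AZ_def
 proof (rule order_trans[OF sum_abs], rule sum_mono)
  fix k assume "k \<in> {1..l}"
  then have k: "1 <= real k" by auto
  have a: "0 < 1/(real k*t)" "1/(real k*t) <= 1/t" using k assms by(auto simp: field_simps)
  have b: "1 <= 1/t" using assms by(simp add: field_simps)
  have c: "\<bar>1 - 1/(real k*t)\<bar> <= 1/t" using a b by linarith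
  let ?p = "\<phi> i (x*(1 - 1/(real k*t)) + z/(real k*t))"
  have "\<bar>ck l k*(1/(real k*t))*((1 - 1/(real k*t))^i*?p)\<bar>
   = \<bar>ck l k\<bar>*((1/(real k*t))*(\<bar>1 - 1/(real k*t)\<bar>^i*\<bar>?p\<bar>))" using k assms by(simp add: abs_mult power_abs)
  also have "... <= \<bar>ck l k\<bar>*((1/t)*((1/t)^i*B))" by(rule mult_left_mono[OF mult_mono[OF a(2) mult_mono[OF power_mono[OF c] phi_bound]]])
   (use assms k in \<open>auto intro!: mult_nonneg_nonneg\<close>)
  finally show "\<bar>ck l k*(1/(real k*t))*((1 - 1/(real k*t))^i*?p)\<bar>
   <= \<bar>ck l k\<bar>*(B*(1/t)^(i + 1))" by(simp add: mult_ac)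
 qed
 also have "... <= 2^l*(B*(1/t)^(i + 1))" unfolding sum_distrib_right[symmetric] by(rule mult_right_mono[OF sum_abs_ck]) (use assms B_pos in auto)
 finally show ?thesis by(simp add: mult_ac)
qed

lemma AW_bound:
 assumes "0 < t"
 shows "\<bar>AW l i t x w\<bar> <= 2^l*B*(1/t)"
proof -
 have "\<bar>AW l i t x w\<bar> <= (\<Sum>k=1..l. \<bar>ck l k\<bar>*(B*(1/t)))" unfolding AW_def
 proof (rule order_trans[OF sum_abs], rule sum_mono)
  fix k assume "k \<in> {1..l}"
  then have k: "1 <= real k" by auto
  have a: "0 < 1/(real k*t)" "1/(real k*t) <= 1/t" using k assms by(auto simp: field_simps)
  let ?p = "\<phi> i (x*1 + w/(real k*t))"
  have "\<bar>ck l k*(1/(real k*t))*(1^i*?p)\<bar> = \<bar>ck l k\<bar>*((1/(real k*t))*\<bar>?p\<bar>)" using k assms by(simp add: abs_mult power_abs)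
  also have "... <= \<bar>ck l k\<bar>*((1/t)*B)" by(rule mult_left_mono[OF mult_mono[OF a(2) phi_bound]]) (use assms k in auto)
  finally show "\<bar>ck l k*(1/(real k*t))*(1^i*?p)\<bar> <= \<bar>ck l k\<bar>*(B*(1/t))" by(simp add: mult_ac)
 qed
 also have "... <= 2^l*(B*(1/t))" unfolding sum_distrib_right[symmetric] by(rule mult_right_mono[OF sum_abs_ck]) (use assms B_pos in auto)
 finally show ?thesis by(simp add: mult_ac)
qed

lemma bt_bound:
 assumes "0 < t" "0 < x" "x < 1"
 shows "\<bar>bt i t x xi\<bar> <= 2*B*(1/t)^2"
proof (cases "bt i t x xi = 0")
 case True
 then show ?thesis using B_pos by simp
next
 case False
 have "\<bar>xi/t\<bar> <= 1" using bt_supp[OF False] assms by linarith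
 then have ub: "\<bar>xi/t*\<phi> (Suc i) (x + xi/t)\<bar> <= 1*B" unfolding abs_mult by(intro mult_mono phi_bound) auto
 have "\<bar>\<phi> i (x + xi/t) + xi/t*\<phi> (Suc i) (x + xi/t)\<bar> <= 2*B"
  using add_mono[OF phi_bound[of i "x + xi/t"] ub] by(intro order_trans[OF abs_triangle_ineq]) simp
 then have "(1/t\<^sup>2)*\<bar>\<phi> i (x + xi/t) + xi/t*\<phi> (Suc i) (x + xi/t)\<bar> <= (1/t\<^sup>2)*(2*B)" by(intro mult_left_mono) auto
 then show ?thesis unfolding bt_def by(simp add: abs_mult power_divide)
qed

lemma leib_bound:
 assumes "\<And>r. r <= i ==> \<bar>F r x\<bar>*\<bar>G (i - r) x\<bar> <= C"
 shows "\<bar>leib F G i x\<bar> <= 2^i*C"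
proof -
 have "\<bar>leib F G i x\<bar> <= (\<Sum>r\<le>i. real (i choose r)*C)" unfolding leib_def
 proof (rule order_trans[OF sum_abs], rule sum_mono)
  fix r assume "r \<in> {..i}"
  then show "\<bar>real (i choose r)*F r x*G (i - r) x\<bar> <= real (i choose r)*C"
   using mult_left_mono[OF assms[of r], of "real (i choose r)"] by(simp add: abs_mult mult.assoc)
 qed
 also have "... = 2^i*C" using choose_row_sum[of i] unfolding sum_distrib_right[symmetric] by(metis of_nat_numeral of_nat_power of_nat_sum)
 finally show ?thesis .
qed

text \<open>One constant for the bounds of both \<open>kk\<close> and \<open>TI\<close>; the summand
  1 keeps it positive.\<close>

definition kC :: "nat => nat => real" where "kC l i = 4*2^i*(2^l)\<^sup>2*(B\<^sup>2 + 1)"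

lemma kC_pos: "0 < kC l i" unfolding kC_def by(intro mult_pos_pos) (auto intro: add_nonneg_pos)

text \<open>The exponent i + 3 splits into i + 1 from \<open>AZ\<close> and 2 from
  \<open>bt\<close>. Integration over \<open>z\<close> and \<open>xi\<close>, each in a range of
  length proportional to \<open>t\<close>, later recovers part of it.\<close>

lemma kk_bound:
 assumes t: "0 < t" "t <= 1" and x: "0 < x" "x < 1"
 shows "\<bar>kk l i t x z xi\<bar> <= kC l i*(1/t)^(i + 3)"
proof -
 have "\<bar>leib (%r x. AZ l r t x z) (%r x. bt r t x xi) i x\<bar> <= 2^i*(2^l*(2*B\<^sup>2)*(1/t)^(i + 3))"
 proof (rule leib_bound)
  fix r assume r: "r <= i"
  have "\<bar>AZ l r t x z\<bar>*\<bar>bt (i - r) t x xi\<bar> <= (2^l*B*(1/t)^(r + 1))*(2*B*(1/t)^2)"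
   by(intro mult_mono AZ_bound bt_bound t x mult_nonneg_nonneg B_pos) (use t in auto)
  also have "... = 2^l*(2*B\<^sup>2)*(1/t)^(r + 3)" by(simp only: power_add power2_eq_square power3_eq_cube power_one_right mult_ac)
  also have "... <= 2^l*(2*B\<^sup>2)*(1/t)^(i + 3)" using t r by(intro mult_left_mono power_increasing) (auto simp: field_simps)
  finally show "\<bar>AZ l r t x z\<bar>*\<bar>bt (i - r) t x xi\<bar> <= 2^l*(2*B\<^sup>2)*(1/t)^(i + 3)" .
 qed
 then have "2*\<bar>leib (%r x. AZ l r t x z) (%r x. bt r t x xi) i x\<bar> <= 2*(2^i*(2^l*(2*B\<^sup>2)*(1/t)^(i + 3)))" by(rule mult_left_mono) simp
 moreover have "\<bar>kk l i t x z xi\<bar> = 2*\<bar>leib (%r x. AZ l r t x z) (%r x. bt r t x xi) i x\<bar>" unfolding kk_def by(simp add: abs_mult power_abs)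
 ultimately have "\<bar>kk l i t x z xi\<bar> <= 2*(2^i*(2^l*(2*B\<^sup>2)*(1/t)^(i + 3)))" by linarith
 also have "... = (4*2^i)*((2^l*B\<^sup>2)*(1/t)^(i + 3))" by simp
 also have "... <= (4*2^i)*(((2^l)\<^sup>2*(B\<^sup>2 + 1))*(1/t)^(i + 3))" using t by(intro mult_left_mono mult_right_mono mult_mono self_le_power) auto
 finally show ?thesis by(simp add: kC_def mult_ac)
qed

lemma TI_bound:
 assumes t: "0 < t" "t <= 1"
 shows "\<bar>TI l i t x y z\<bar> <= kC l i*(1/t)^(i + 2)"
proof -
 have b: "\<bar>TI l i t x y z\<bar> <= 2^i*((2^l)\<^sup>2*B\<^sup>2*(1/t)^(i + 2))" unfolding TI_def
 proof (rule leib_bound)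
  fix r assume r: "r <= i"
  have "\<bar>AZ l r t x z\<bar>*\<bar>AW l (i - r) t x (y - z)\<bar> <= (2^l*B*(1/t)^(r + 1))*(2^l*B*(1/t))"
   by(intro mult_mono AZ_bound AW_bound t mult_nonneg_nonneg B_pos) (use t in auto)
  also have "... = (2^l)\<^sup>2*B\<^sup>2*(1/t)^(r + 2)" by(simp only: power_add power2_eq_square power_one_right mult_ac)
  also have "... <= (2^l)\<^sup>2*B\<^sup>2*(1/t)^(i + 2)" using t r by(intro mult_left_mono power_increasing) (auto simp: field_simps)
  finally show "\<bar>AZ l r t x z\<bar>*\<bar>AW l (i - r) t x (y - z)\<bar> <= (2^l)\<^sup>2*B\<^sup>2*(1/t)^(i + 2)" .
 qed
 have "2^i*(((2^l)\<^sup>2*B\<^sup>2)*(1/t)^(i + 2)) <= (4*2^i)*(((2^l)\<^sup>2*(B\<^sup>2 + 1))*(1/t)^(i + 2))"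
 proof (rule mult_mono)
  show "(2^l)\<^sup>2*B\<^sup>2*(1/t)^(i + 2) <= (2^l)\<^sup>2*(B\<^sup>2 + 1)*(1/t)^(i + 2)" by(rule mult_right_mono, rule mult_left_mono) (use t in auto)
 qed (use t in auto)
 with b show ?thesis by(simp add: kC_def mult_ac)
qed

lemma TI_continuous_z:
 assumes "0 < t"
 shows "continuous_on S (TI l i t x y)"
proof -
 have "continuous_on S (%z. (%((x, y), z). TI l i t x y z) ((x, y), z))" by(rule continuous_on_compose2[OF continuous_TI_xyz[OF assms]]) (auto intro!: continuous_intros)
 then show ?thesis by simp
qed

lemma TT_bound:
 assumes t: "0 < t" "t <= 1"
 shows "\<bar>TT l i t x y\<bar> <= kC l i*(1/t)^(i + 2)"
proof -
 have "norm (integral {0..1} (TI l i t x y)) <= kC l i*(1/t)^(i + 2)*(1 - 0)"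
 proof (rule integral_bound)
  show "continuous_on {0..1} (TI l i t x y)" by(rule TI_continuous_z[OF t(1)])
  show "norm (TI l i t x y z) <= kC l i*(1/t)^(i + 2)" for z using TI_bound[OF t] by simp
 qed simp
 then show ?thesis unfolding TT_def by simp
qed

end

section \<open>The scale derivative of the smoothing kernel is a difference\<close>

lemma HK_eq_lborel:
 fixes f :: "real => real"
 assumes "continuous_on UNIV f" "\<And>x. x \<notin> {a..b} ==> f x = 0"
 shows "integral {a..b} f = (LI x. f x)"
proof -
 have e: "(%x. indicator {a..b} x *\<^sub>R f x) = f" using assms(2) by(auto simp: indicator_def fun_eq_iff)
 have "set_integrable lborel {a..b} f" by(rule borel_integrable_atLeastAtMost') (use assms continuous_on_subset in blast)
 from set_borel_integral_eq_integral(2)[OF this] show ?thesis unfolding set_lebesgue_integral_def e by simp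
qed

lemma integral_bound_support:
 fixes f :: "real => real"
 assumes "\<And>x. \<bar>f x\<bar> <= C" "\<And>x. f x ~= 0 ==> \<bar>x - a\<bar> <= r" "0 <= r" "0 <= C"
 shows "\<bar>\<integral>x. f x \<partial>lborel\<bar> <= 2*r*C"
proof -
 have "\<bar>\<integral>x. f x \<partial>lborel\<bar> <= (LI x. C*indicator {a-r..a+r} x)"
 proof (cases "integrable lborel f")
  case True
  have "norm (LI x. f x) <= (LI x. C*indicator {a-r..a+r} x)"
  proof (rule Bochner_Integration.integral_norm_bound_integral[OF True])
   show "norm (f x) <= C*indicator {a-r..a+r} x" for x using assms(1)[of x] assms(2)[of x] by(cases "f x = 0") (auto simp: indicator_def assms abs_le_iff)
   show "integrable lborel (%x. C*indicator {a-r..a+r} x)" by(intro integrable_mult_right integrable_real_indicator) (auto simp: emeasure_lborel_Icc_eq)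
  qed
  then show ?thesis by simp
 qed (auto simp: not_integrable_integral_eq assms)
 also have "... = 2*r*C" using assms(3) by simp
 finally show ?thesis .
qed

context bump
begin

text \<open>The t-derivative of \<open>AW l 0\<close>, written through \<open>bt\<close> at w/k: the
  substitution w = k xi then turns the sum over k into translates by multiples of one step
  xi.\<close>

definition AWt :: "nat => real => real => real => real" where
 "AWt l t x w = (\<Sum>k=1..l. ck l k*(1/real k)*bt 0 t x (w/real k))"

lemma AW_t_deriv:
 assumes "0 < t" "1 <= N"
 shows "((%t. AW l 0 t x w) has_real_derivative AWt l t x w) (at t)" unfolding AW_def AWt_def
proof (rule DERIV_sum)
 fix k assume "k \<in> {1..l}"
 then have k: "0 < real k" by auto
 have d: "(\<phi> 0 has_real_derivative \<phi> (Suc 0) y) (at y)" for y using smooth_chainD(1)[OF phi_chain] assms by auto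
 define K where "K = real k"
 have K: "K ~= 0" "t ~= 0" using k assms by(auto simp: K_def)
 have "((%t. ck l k*(1/(K*t))*(1^0*\<phi> 0 (x*1 + w/(K*t)))) has_real_derivative
  ck l k*(- K/(K*t)\<^sup>2)*(1*\<phi> 0 (x*1 + w/(K*t)))
   + ck l k*(1/(K*t))*(\<phi> (Suc 0) (x*1 + w/(K*t))*(- (w*K)/(K*t)\<^sup>2))) (at t)"
  using K by(auto intro!: derivative_eq_intros DERIV_chain2[OF d] simp: power2_eq_square field_simps)
 moreover have "ck l k*(- K/(K*t)\<^sup>2)*(1*\<phi> 0 (x*1 + w/(K*t)))
   + ck l k*(1/(K*t))*(\<phi> (Suc 0) (x*1 + w/(K*t))*(- (w*K)/(K*t)\<^sup>2))
   = ck l k*(1/K)*bt 0 t x (w/K)" unfolding bt_def using K by(simp add: field_simps power2_eq_square)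
 ultimately show "((%t. ck l k*(1/(real k*t))*(1^0*\<phi> 0 (x*1 + w/(real k*t)))) has_real_derivative
  ck l k*(1/real k)*bt 0 t x (w/real k)) (at t)" unfolding K_def by simp
qed

lemma continuous_AW: "continuous_on ({0<..} \<times> UNIV) (%(t, w). AW l i t x w)" unfolding AW_def split_beta
 by(intro continuous_intros continuous_on_compose2[OF phi_cont] subset_UNIV) auto

lemma continuous_bt: "continuous_on ({0<..} \<times> UNIV) (%(t, w). bt i t x w)" unfolding bt_def split_beta
 by(intro continuous_intros continuous_on_compose2[OF phi_cont] subset_UNIV) auto

lemma continuous_AWt: "continuous_on ({0<..} \<times> UNIV) (%(t, w). AWt l t x w)" unfolding AWt_def bt_def split_beta
 by(intro continuous_intros continuous_on_compose2[OF phi_cont] subset_UNIV) auto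

lemma AWt_supp:
 assumes "AWt l t x w ~= 0" "0 < t"
 obtains k u where "1 <= k" "k <= l" "0 < u" "u < 1" "w = real k*t*(u - x)"
proof -
 obtain k where k: "k \<in> {1..l}" "bt 0 t x (w/real k) ~= 0" using sum.not_neutral_contains_not_neutral[OF assms(1)[unfolded AWt_def]] by force
 show ?thesis by(rule that[of k "x + w/real k/t"]) (use k bt_supp[OF k(2)] assms in \<open>auto simp: field_simps\<close>)
qed

lemma z_range:
 assumes "0 < x" "x < 1" "0 < t" "2*real l*t <= 1" "k <= l" "1 <= k" "0 < u" "u < 1"
 shows "0 < x + real k*t*(u - x)" "x + real k*t*(u - x) < 1" "\<bar>real k*t*(u - x)\<bar> <= real l*t"
proof -
 have s: "real k*t <= real l*t" "real k*t <= 1" using scale_le[of k l l t] scale_le[of k l 0 t] assms by auto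
 show "0 < x + real k*t*(u - x)" "x + real k*t*(u - x) < 1" using two_step[of x u u "real k*t" 0] s assms by(auto simp: add_increasing2)
 have "\<bar>u - x\<bar> <= 1" using assms by auto
 then have "real k*t*\<bar>u - x\<bar> <= real k*t*1" using assms(3) by(intro mult_left_mono) auto
 moreover have "\<bar>real k*t*(u - x)\<bar> = real k*t*\<bar>u - x\<bar>" using assms(3) by(auto simp: abs_mult)
 ultimately show "\<bar>real k*t*(u - x)\<bar> <= real l*t" using s by linarith
qed

lemma AW_range:
 assumes "AW l i t x (z - x) ~= 0 \<or> AWt l t x (z - x) ~= 0" "0 < x" "x < 1" "0 < t" "2*real l*t <= 1"
 shows "0 < z" "z < 1" "\<bar>z - x\<bar> <= real l*t"
proof -
 have "\<exists>k u. 1 <= k \<and> k <= l \<and> 0 < u \<and> u < 1 \<and> z - x = real k*t*(u - x)" using assms(1)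
 proof
  assume "AW l i t x (z - x) ~= 0"
  from AW_supp2[OF this assms(4)] show ?thesis by blast
 next
  assume "AWt l t x (z - x) ~= 0"
  from AWt_supp[OF this assms(4)] show ?thesis by blast
 qed
 then obtain k u where k: "1 <= k" "k <= l" "0 < u" "u < 1" "z - x = real k*t*(u - x)" by blast
 have e: "z = x + real k*t*(u - x)" using k by simp
 show "0 < z" "z < 1" "\<bar>z - x\<bar> <= real l*t" unfolding e using z_range[OF assms(2-5) k(2,1,3,4)] by auto
qed

lemma AW_small: 
 assumes "AW l i t x w ~= 0" "0 < x" "x < 1" "0 < t" "2*real l*t <= 1"
 shows "\<bar>w\<bar> <= real l*t" using AW_range[of l i t x "w + x"] assms by auto

lemma continuous_AW_w: "0 < t ==> continuous_on S f ==> continuous_on S (%w. AW l i t x (f w))" unfolding AW_def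
 by(intro continuous_intros continuous_on_compose2[OF phi_cont] subset_UNIV) auto

lemma continuous_bt_w: "0 < t ==> continuous_on S f ==> continuous_on S (%w. bt i t x (f w))" unfolding bt_def
 by(intro continuous_intros continuous_on_compose2[OF phi_cont] subset_UNIV) auto

lemma continuous_AWt_w: "0 < t ==> continuous_on S f ==> continuous_on S (%w. AWt l t x (f w))" unfolding AWt_def by(intro continuous_intros continuous_bt_w) auto

lemma TI0: "0 < t ==> TI l 0 t x y z = AW l 0 t x (z - x)*AW l 0 t x (y - z)" unfolding TI_def leib_def by(simp add: AZ_AW)

lemma TT0:
 assumes "0 < x" "x < 1" "0 < t" "2*real l*t <= 1"
 shows "TT l 0 t x y = (LI z. AW l 0 t x (z - x)*AW l 0 t x (y - z))"
proof -
 have "TT l 0 t x y = (LI z. TI l 0 t x y z)" unfolding TT_def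
 proof (rule HK_eq_lborel[OF TI_continuous_z[OF assms(3)]], rule ccontr)
  fix z assume z: "z \<notin> {0..1}" "TI l 0 t x y z ~= 0"
  show False using TI_supp(1,2)[OF z(2) assms] z(1) by auto
 qed
 then show ?thesis by(simp add: TI0[OF assms(3)])
qed

lemma bt_range:
 assumes "bt i t x xi ~= 0" "0 < x" "x < 1" "0 < t"
 shows "\<bar>xi\<bar> <= t"
proof -
 define v where "v = x + xi/t"
 have v: "0 < v" "v < 1" using bt_supp[OF assms(1)] by(auto simp: v_def)
 have xi: "xi = t*(v - x)" using assms(4) by(simp add: v_def field_simps)
 have "\<bar>v - x\<bar> <= 1" using v assms by auto
 then show ?thesis using assms(4) mult_left_mono[of "\<bar>v - x\<bar>" 1 t] by(simp add: xi abs_mult)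
qed

text \<open>\<open>bt 0\<close> is the xi-derivative of -xi phi(x + xi/t)/t^2, which vanishes at xi
  = t and xi = -t since x + 1 and x - 1 lie outside (0,1).\<close>

lemma bt_integral0:
 assumes "0 < x" "x < 1" "0 < t" "1 <= N"
 shows "(LI xi. bt 0 t x xi) = 0"
proof -
 have d: "(\<phi> 0 has_real_derivative \<phi> (Suc 0) y) (at y)" for y using smooth_chainD(1)[OF phi_chain] assms by auto
 have z: "\<phi> i (x + 1) = 0" "\<phi> i (x - 1) = 0" for i using phi_supp assms by force+
 have "(bt 0 t x has_integral (- (1/t\<^sup>2)*(t*\<phi> 0 (x + t/t))) - (- (1/t\<^sup>2)*((- t)*\<phi> 0 (x + (-t)/t)))) {-t..t}"
 proof (rule fundamental_theorem_of_calculus)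
  fix xi
  have "((%xi. - (1/t\<^sup>2)*(xi*\<phi> 0 (x + xi/t))) has_real_derivative bt 0 t x xi) (at xi)" unfolding bt_def using assms(3)
   by(auto intro!: derivative_eq_intros DERIV_chain2[OF d] simp: field_simps)
  then show "((%xi. - (1/t\<^sup>2)*(xi*\<phi> 0 (x + xi/t))) has_vector_derivative bt 0 t x xi) (at xi within {-t..t})"
   by(meson has_real_derivative_iff_has_vector_derivative has_vector_derivative_at_within)
 qed (use assms in auto)
 then have "integral {-t..t} (bt 0 t x) = 0" using assms(3) z by(auto simp: integral_unique)
 moreover have "integral {-t..t} (bt 0 t x) = (LI xi. bt 0 t x xi)"
 proof (rule HK_eq_lborel)
  show "continuous_on UNIV (bt 0 t x)" using continuous_bt_w[OF assms(3) continuous_on_id] by simp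
  fix xi assume "xi \<notin> {-t..t}"
  then show "bt 0 t x xi = 0" using bt_range[OF _ assms(1-3), of 0 xi] by(cases "bt 0 t x xi = 0") (auto simp: abs_le_iff)
 qed
 ultimately show ?thesis by simp
qed

lemma AW_bt_integrable:
 assumes "0 < x" "x < 1" "0 < t"
 shows "integrable lborel (%xi. AW l 0 t x (y - real k*xi - x)*bt 0 t x xi)"
proof (rule integrable_continuous_bounded_support[of _ "-t" t])
 show "continuous_on UNIV (%xi. AW l 0 t x (y - real k*xi - x)*bt 0 t x xi)" by(intro continuous_intros continuous_AW_w continuous_bt_w assms)
 show "AW l 0 t x (y - real k*xi - x)*bt 0 t x xi = 0" if "xi \<notin> {-t..t}" for xi
  using bt_range[OF _ assms, of 0 xi] that by(cases "bt 0 t x xi = 0") (auto simp: abs_le_iff)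
qed

definition Dk :: "nat => real => real => real => real" where
 "Dk l t x y = (LI xi. (\<Sum>m\<le>l. (-1)^(l - m)*real (l choose m)*kk l 0 t x (y - real m*xi) xi))"

lemma kk0: "0 < t ==> kk l 0 t x z xi = 2*(-1)^l*(AW l 0 t x (z - x)*bt 0 t x xi)" unfolding kk_def leib_def by(simp add: AZ_AW)

lemma kk_integrable:
 assumes "0 < x" "x < 1" "0 < t"
 shows "integrable lborel (%xi. kk l 0 t x (y - real m*xi) xi)" unfolding kk0[OF assms(3)] by(intro integrable_mult_right AW_bt_integrable assms)

text \<open>Mean zero of \<open>bt\<close> removes the term m = 0 of the difference; the remaining
  binomial coefficients are those of \<open>ck\<close>.\<close>

lemma Dk_eq:
 assumes x: "0 < x" "x < 1" "0 < t" and l: "1 <= N"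
 shows "Dk l t x y = - 2*(\<Sum>k=1..l. ck l k*(LI xi. AW l 0 t x (y - real k*xi - x)*bt 0 t x xi))"
proof -
 let ?I = "%k. (LI xi. AW l 0 t x (y - real k*xi - x)*bt 0 t x xi)"
 have s: "(-1)^(l - m)*(2*(-1)^l*a) = 2*(-1)^m*(a::real)" if "m <= l" for m a
 proof -
  have "(-1::real)^(l - m)*(-1)^l = (-1)^(l - m)*((-1)^(l - m)*(-1)^m)" using that by(simp flip: power_add)
  also have "... = (-1)^m" by(simp flip: mult.assoc power_mult_distrib)
  finally show ?thesis by(metis mult.assoc mult.left_commute)
 qed
 have "Dk l t x y = (\<Sum>m\<le>l. (-1)^(l - m)*real (l choose m)*(LI xi. kk l 0 t x (y - real m*xi) xi))"
  unfolding Dk_def by(subst Bochner_Integration.integral_sum) (auto intro!: kk_integrable x)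
 also have "... = (\<Sum>m\<le>l. 2*((-1)^m*real (l choose m)*?I m))"
 proof (rule sum.cong)
  fix m assume "m \<in> {..l}"
  then have m: "m <= l" by simp
  have "(LI xi. kk l 0 t x (y - real m*xi) xi) = 2*(-1)^l*?I m" unfolding kk0[OF x(3)] by simp
  then show "(-1)^(l - m)*real (l choose m)*(LI xi. kk l 0 t x (y - real m*xi) xi)
   = 2*((-1)^m*real (l choose m)*?I m)" using s[OF m, of "real (l choose m)*?I m"] by(simp add: mult_ac)
 qed simp
 also have "... = 2*?I 0 + (\<Sum>m=1..l. 2*((-1)^m*real (l choose m)*?I m))" by(simp add: atMost_atLeast0 sum.atLeast_Suc_atMost)
 also have "?I 0 = 0" using bt_integral0[OF x l] by simp
 finally show ?thesis by(simp add: ck_def sum_negf sum_distrib_left mult_ac)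
qed

text \<open>The two terms of the product rule are equal. In one of them the substitution z = y - k
  xi brings the translates of \<open>Dk_eq\<close>, whose factor -2 accounts for the
  doubling.\<close>

lemma TT_t_deriv:
 assumes x: "0 < x" "x < 1" and t: "0 < t" "2*real l*t <= 1" and l: "1 <= N"
 shows "integral {0..1} (%z. AWt l t x (z - x)*AW l 0 t x (y - z) + AW l 0 t x (z - x)*AWt l t x (y - z))
  = - Dk l t x y"
proof -
 have c: "continuous_on UNIV (%z. AWt l t x (z - x)*AW l 0 t x (y - z))"
  "continuous_on UNIV (%z. AW l 0 t x (z - x)*AWt l t x (y - z))" by(intro continuous_intros continuous_AW_w continuous_AWt_w t)+
 have s: "z \<notin> {0..1} ==> AWt l t x (z - x)*AW l 0 t x (y - z) = 0"
  "z \<notin> {0..1} ==> AW l 0 t x (z - x)*AWt l t x (y - z) = 0" for z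
  using AW_range(1,2)[of l 0 t x z] x t by(cases "AWt l t x (z - x) = 0"; cases "AW l 0 t x (z - x) = 0"; auto)+
 note i = integrable_continuous_bounded_support[OF c(1) s(1)]
   integrable_continuous_bounded_support[OF c(2) s(2)]
 have "integral {0..1} (%z. AWt l t x (z - x)*AW l 0 t x (y - z) + AW l 0 t x (z - x)*AWt l t x (y - z))
  = (LI z. AWt l t x (z - x)*AW l 0 t x (y - z) + AW l 0 t x (z - x)*AWt l t x (y - z))"
 proof (rule HK_eq_lborel)
  show "AWt l t x (z - x)*AW l 0 t x (y - z) + AW l 0 t x (z - x)*AWt l t x (y - z) = 0" if "z \<notin> {0..1}" for z using s[OF that] by linarith
 qed (intro continuous_on_add c)
 also have "... = (LI z. AWt l t x (z - x)*AW l 0 t x (y - z)) + (LI z. AW l 0 t x (z - x)*AWt l t x (y - z))" by(rule Bochner_Integration.integral_add[OF i])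
 \<comment> \<open>The reflection of z to x + y - z exchanges the two displacements.\<close>
 also have "(LI z. AWt l t x (z - x)*AW l 0 t x (y - z)) = (LI z. AW l 0 t x (z - x)*AWt l t x (y - z))"
  by(subst lborel_integral_real_affine[where c="-1" and t="x + y"]) (auto simp: algebra_simps)
 also have "(LI z. AW l 0 t x (z - x)*AWt l t x (y - z))
   = (\<Sum>k=1..l. ck l k*(LI xi. AW l 0 t x (y - real k*xi - x)*bt 0 t x xi))"
 proof -
  have "(LI z. AW l 0 t x (z - x)*AWt l t x (y - z))
   = (LI z. (\<Sum>k=1..l. ck l k*(1/real k)*(AW l 0 t x (z - x)*bt 0 t x ((y - z)/real k))))" unfolding AWt_def by(simp add: sum_distrib_left mult_ac)
  also have "... = (\<Sum>k=1..l. ck l k*(1/real k)*(LI z. AW l 0 t x (z - x)*bt 0 t x ((y - z)/real k)))"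
  proof (subst Bochner_Integration.integral_sum)
   fix k assume k: "k \<in> {1..l}"
   show "integrable lborel (%z. ck l k*(1/real k)*(AW l 0 t x (z - x)*bt 0 t x ((y - z)/real k)))"
   proof (intro integrable_mult_right integrable_continuous_bounded_support[of _ 0 1])
   show "continuous_on UNIV (%z. AW l 0 t x (z - x)*bt 0 t x ((y - z)/real k))" using k by(auto intro!: continuous_intros continuous_AW_w continuous_bt_w t)
   show "AW l 0 t x (z - x)*bt 0 t x ((y - z)/real k) = 0" if "z \<notin> {0..1}" for z using AW_range(1,2)[of l 0 t x z] x t that by(cases "AW l 0 t x (z - x) = 0") auto
   qed
  qed simp
  also have "... = (\<Sum>k=1..l. ck l k*(LI xi. AW l 0 t x (y - real k*xi - x)*bt 0 t x xi))"
  proof (rule sum.cong)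
   fix k assume "k \<in> {1..l}"
   then have k: "0 < real k" by auto
   have "(LI z. AW l 0 t x (z - x)*bt 0 t x ((y - z)/real k))
   = real k*(LI xi. AW l 0 t x (y - real k*xi - x)*bt 0 t x xi)" using k by(subst lborel_integral_real_affine[where c="- real k" and t="y"]) auto
   then show "ck l k*(1/real k)*(LI z. AW l 0 t x (z - x)*bt 0 t x ((y - z)/real k))
   = ck l k*(LI xi. AW l 0 t x (y - real k*xi - x)*bt 0 t x xi)" using k by simp
  qed simp
  finally show ?thesis .
 qed
 finally show ?thesis unfolding Dk_eq[OF x t(1) l] by simp
qed

lemma Dk_continuous:
 assumes x: "0 < x" "x < 1" and c: "2*real l*c <= 1" and e: "0 < e" and l: "1 <= N"
 shows "continuous_on {e..c} (%t. Dk l t x y)"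
proof -
 have "continuous_on {e..c} (%t. integral (cbox 0 1) (%z. AWt l t x (z - x)*AW l 0 t x (y - z) + AW l 0 t x (z - x)*AWt l t x (y - z)))"
 proof (rule integral_continuous_on_param)
  have *: "continuous_on ({e..c} \<times> cbox 0 1) (%p. (%(t, w). AW l 0 t x w) (fst p, g (snd p)))"
   "continuous_on ({e..c} \<times> cbox 0 1) (%p. (%(t, w). AWt l t x w) (fst p, g (snd p)))"
   if "continuous_on UNIV g" for g by(rule continuous_on_compose2[OF continuous_AW] continuous_on_compose2[OF continuous_AWt];
   use e in \<open>auto intro!: continuous_intros continuous_on_compose2[OF that]\<close>)+
  show "continuous_on ({e..c} \<times> cbox 0 1) (%(t, z). AWt l t x (z - x)*AW l 0 t x (y - z) + AW l 0 t x (z - x)*AWt l t x (y - z))" unfolding split_beta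
   using *[of "%z. z - x"] *[of "%z. y - z"] by(auto intro!: continuous_intros simp: continuous_on_diff)
 qed
 then have "continuous_on {e..c} (%t. - Dk l t x y)"
 proof (rule continuous_on_eq)
  fix t assume t: "t \<in> {e..c}"
  then have "2*real l*t <= 2*real l*c" by(intro mult_left_mono) auto
  then show "integral (cbox 0 1) (%z. AWt l t x (z - x)*AW l 0 t x (y - z) + AW l 0 t x (z - x)*AWt l t x (y - z)) = - Dk l t x y"
   using TT_t_deriv[OF x _ _ l, of t] t c e by auto
 qed
 from continuous_on_minus[OF this] show ?thesis by simp
qed

text \<open>The fundamental theorem of calculus in the scale. The lower limit e stays positive
  because the kernels are singular at t = 0.\<close>

lemma TT_identity:
 assumes x: "0 < x" "x < 1" and c: "2*real l*c <= 1" and e: "0 < e" "e <= c" and l: "1 <= N"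
 shows "TT l 0 e x y = TT l 0 c x y + (LI t. indicator {e<..<c} t*Dk l t x y)"
  and "integrable lborel (%t. indicator {e<..<c} t*Dk l t x y)"
proof -
 have der: "((%t. TT l 0 t x y) has_real_derivative - Dk l t x y) (at t)" if t: "0 < t" "2*real l*t <= 1" for t
 proof -
  have "((%t. integral (cbox 0 1) (%z. AW l 0 t x (z - x)*AW l 0 t x (y - z))) has_real_derivative
   integral (cbox 0 1) (%z. AWt l t x (z - x)*AW l 0 t x (y - z) + AW l 0 t x (z - x)*AWt l t x (y - z))) (at t within {0<..})"
  proof (rule leibniz_rule_field_derivative)
   fix s z :: real assume "s \<in> {0<..}"
   then have s: "0 < s" by auto
   show "((%s. AW l 0 s x (z - x)*AW l 0 s x (y - z)) has_real_derivative
   AWt l s x (z - x)*AW l 0 s x (y - z) + AW l 0 s x (z - x)*AWt l s x (y - z)) (at s within {0<..})"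
   by(rule DERIV_subset[OF DERIV_cong[OF DERIV_mult[OF AW_t_deriv[OF s l] AW_t_deriv[OF s l]]]]) (auto simp: mult_ac)
   show "(%z. AW l 0 s x (z - x)*AW l 0 s x (y - z)) integrable_on cbox 0 1" by(intro integrable_continuous continuous_intros continuous_AW_w s)
  next
   have *: "continuous_on ({0<..} \<times> cbox 0 1) (%p. (%(t, w). AW l 0 t x w) (fst p, g (snd p)))"
   "continuous_on ({0<..} \<times> cbox 0 1) (%p. (%(t, w). AWt l t x w) (fst p, g (snd p)))"
   if "continuous_on UNIV g" for g by(rule continuous_on_compose2[OF continuous_AW] continuous_on_compose2[OF continuous_AWt];
   auto intro!: continuous_intros continuous_on_compose2[OF that])+
   show "continuous_on ({0<..} \<times> cbox 0 1) (%(t, z). AWt l t x (z - x)*AW l 0 t x (y - z) + AW l 0 t x (z - x)*AWt l t x (y - z))" unfolding split_beta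
   using *[of "%z. z - x"] *[of "%z. y - z"] by(auto intro!: continuous_intros simp: continuous_on_diff)
  qed (use t in auto)
  then have "((%t. integral {0..1} (%z. AW l 0 t x (z - x)*AW l 0 t x (y - z))) has_real_derivative - Dk l t x y) (at t)"
   using t TT_t_deriv[OF x t l, of y] by(simp add: at_within_open[of t "{0<..}"])
  then show ?thesis by(rule has_field_derivative_transform_within_open[of _ _ _ "{0<..}"])
   (use t in \<open>auto simp: TT_def TI0 intro!: integral_cong\<close>)
 qed
 have cont: "continuous_on {e..c} (%t. Dk l t x y)" by(rule Dk_continuous[OF x c e(1) l])
 have "((%t. - Dk l t x y) has_integral TT l 0 c x y - TT l 0 e x y) {e..c}"
 proof (rule fundamental_theorem_of_calculus[OF e(2)])
  fix t assume t: "t \<in> {e..c}"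
  then have "2*real l*t <= 2*real l*c" by(intro mult_left_mono) auto
  then have "((%t. TT l 0 t x y) has_real_derivative - Dk l t x y) (at t)" using der[of t] t e c by auto
  then show "((%t. TT l 0 t x y) has_vector_derivative - Dk l t x y) (at t within {e..c})"
   by(meson has_real_derivative_iff_has_vector_derivative has_vector_derivative_at_within)
 qed
 from has_integral_neg[OF this]
 have "((%t. Dk l t x y) has_integral TT l 0 e x y - TT l 0 c x y) {e..c}" by simp
 then have *: "integral {e..c} (%t. Dk l t x y) = TT l 0 e x y - TT l 0 c x y" by(rule integral_unique)
 have si: "set_integrable lborel {e..c} (%t. Dk l t x y)" by(rule borel_integrable_atLeastAtMost'[OF cont])
 \<comment> \<open>Only the two endpoints are lost. The open interval is the form in which scales
   are restricted later, from above by \<open>inbox\<close> and from below by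
   \<open>gate\<close>.\<close>
 have ae: "AE t in lborel. indicator {e..c} t *\<^sub>R Dk l t x y = indicator {e<..<c} t*Dk l t x y"
 proof -
  have "AE t in lborel. t ~= e" "AE t in lborel. t ~= c" by(rule AE_lborel_singleton)+
  then show ?thesis by eventually_elim (auto simp: indicator_def)
 qed
 have m1: "(%t. indicator {e..c} t *\<^sub>R Dk l t x y) \<in> BM lborel" using si unfolding set_integrable_def by auto
 have m2: "(%t. indicator {e<..<c} t*Dk l t x y) \<in> BM lborel"
 proof -
  have "(%t. indicator {e<..<c} t*(indicator {e..c} t *\<^sub>R Dk l t x y)) \<in> BM lborel" using m1 by measurable
  moreover have "(%t. indicator {e<..<c} t*(indicator {e..c} t *\<^sub>R Dk l t x y)) = (%t. indicator {e<..<c} t*Dk l t x y)" by(auto simp: indicator_def fun_eq_iff)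
  ultimately show ?thesis by simp
 qed
 show "integrable lborel (%t. indicator {e<..<c} t*Dk l t x y)" using integrable_cong_AE[OF m1 m2 ae] si unfolding set_integrable_def by simp
 have "(LI t. indicator {e<..<c} t*Dk l t x y) = integral {e..c} (%t. Dk l t x y)"
  using integral_cong_AE[OF m1 m2 ae] set_borel_integral_eq_integral(2)[OF si] unfolding set_lebesgue_integral_def by simp
 then show "TT l 0 e x y = TT l 0 c x y + (LI t. indicator {e<..<c} t*Dk l t x y)" using * by simp
qed

end

section \<open>Integration by parts against test functions\<close>

lemma integrable_compact_support:
 fixes f :: "'a::euclidean_space => real"
 assumes "continuous_on UNIV f" "compact S" "\<And>x. x \<notin> S ==> f x = 0"
 shows "integrable lborel f"
proof -
 have "integrable lborel (%x. indicator S x *\<^sub>R f x)" by(rule borel_integrable_compact[OF assms(2)]) (use assms continuous_on_subset in blast)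
 moreover have "(%x. indicator S x *\<^sub>R f x) = f" using assms(3) by(auto simp: indicator_def fun_eq_iff)
 ultimately show ?thesis by simp
qed

lemma lborel_integral_translate:
 fixes f :: "'a::euclidean_space => real"
 shows "(LI x. f (x + a)) = (LI x. f x)"
proof (cases "f \<in> BM borel")
 case True
 have "(LI x. f x) = (\<integral>x. f x \<partial>distr lborel borel ((+) a))" by(simp add: lborel_distr_plus)
 also have "... = (LI x. f (a + x))" by(rule integral_distr) (use True in auto)
 finally show ?thesis by(simp add: add.commute)
next
 case False
 have "(%x. f (x + a)) \<notin> BM borel"
 proof
  assume *: "(%x. f (x + a)) \<in> BM borel"
  have "(%x. f ((x - a) + a)) \<in> BM borel" by(rule measurable_compose[OF _ *]) simp
  then show False using False by simp
 qed
 then have "\<not> integrable lborel (%x. f (x + a))" "\<not> integrable lborel f" using False borel_measurable_integrable by fastforce+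
 then show ?thesis by(simp add: not_integrable_integral_eq)
qed

lemma lborel_integrable_translate:
 fixes f :: "'a::euclidean_space => real"
 assumes "integrable lborel f"
 shows "integrable lborel (%x. f (x + a))"
proof -
 have "integrable (distr lborel borel ((+) a)) f" using assms by(simp add: lborel_distr_plus)
 then have "integrable lborel (%x. f (a + x))" by(subst (asm) integrable_distr_eq) (use assms in auto)
 then show ?thesis by(simp add: add.commute)
qed

text \<open>Difference quotients have integral 0 by translation invariance. The mean value theorem
  turns them into values of \<open>u'\<close>, so they are uniformly bounded, and dominated
  convergence passes to the limit.\<close>

lemma integral_directional_derivative_zero:
 fixes u u' :: "'a::euclidean_space => real"
 assumes d: "\<And>x. ((%s. u (x + s *\<^sub>R e)) has_real_derivative u' x) (at 0)"
  and c: "continuous_on UNIV u" "continuous_on UNIV u'"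
  and S: "compact S" "\<And>x. x \<notin> S ==> u x = 0" "\<And>x. x \<notin> S ==> u' x = 0"
 shows "(LI x. u' x) = 0"
proof -
 have iu: "integrable lborel u" by(rule integrable_compact_support[OF c(1) S(1,2)])
 have d2: "((%s. u (x + s *\<^sub>R e)) has_real_derivative u' (x + s *\<^sub>R e)) (at s)" for x s
 proof -
  have "((%h. u ((x + s *\<^sub>R e) + (h - s) *\<^sub>R e)) has_real_derivative u' (x + s *\<^sub>R e)*1) (at s)"
   by(rule DERIV_chain2[where f = "%h. u ((x + s *\<^sub>R e) + h *\<^sub>R e)" and g = "%h. h - s"])
   (use d[of "x + s *\<^sub>R e"] in \<open>auto intro!: derivative_eq_intros\<close>)
  then show ?thesis by(simp add: algebra_simps)
 qed
 obtain B where B: "\<And>x. \<bar>u' x\<bar> <= B" "0 <= B"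
 proof -
  have "compact (u' ` S)" using S(1) c(2) compact_continuous_image continuous_on_subset by blast
  then obtain b where "\<And>x. x \<in> S ==> norm (u' x) <= b" using compact_imp_bounded bounded_iff by(metis imageI)
  then have "\<bar>u' x\<bar> <= max b 0" for x using S(3)[of x] by(cases "x \<in> S") fastforce+
  then show ?thesis using that[of "max b 0"] by auto
 qed
 define h where "h n = inverse (real (Suc n))" for n
 have h: "0 < h n" "h n <= 1" for n by(auto simp: h_def field_simps)
 have h0: "h \<longlonglongrightarrow> 0" unfolding h_def by(rule LIMSEQ_inverse_real_of_nat)
 define q where "q n x = (u (x + h n *\<^sub>R e) - u x)/h n" for n x
 \<comment> \<open>The set \<open>S\<close> swept backwards along \<open>e\<close> for parameters in
   [0,1]: it contains the supports of all the quotients, since their steps \<open>h n\<close> are at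
   most 1.\<close>
 define S2 where "S2 = (%p. fst p - snd p *\<^sub>R e) ` (S \<times> {0..1::real})"
 have S2: "compact S2" unfolding S2_def by(intro compact_continuous_image continuous_intros compact_Times S compact_Icc)
 have "(%n. \<integral>x. q n x \<partial>lborel) \<longlonglongrightarrow> (LI x. u' x)"
 proof (rule integral_dominated_convergence)
  show "u' \<in> BM lborel" using c borel_measurable_continuous_onI by auto
  show "q n \<in> BM lborel" for n unfolding q_def using borel_measurable_continuous_onI[OF c(1)] by measurable
  show "integrable lborel (%x. B*indicator S2 x)"
   using S2 emeasure_compact_finite[OF S2] compact_imp_closed[OF S2] by(intro integrable_mult_right) (auto intro: borel_closed)
  show "AE x in lborel. (%n. q n x) \<longlonglongrightarrow> u' x"
  proof (rule AE_I2)
   fix x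
   have "((%s. (u (x + s *\<^sub>R e) - u x)/s) \<longlongrightarrow> u' x) (at 0)" using d[of x] unfolding has_field_derivative_iff by simp
   moreover have "filterlim h (at 0) sequentially" unfolding filterlim_at using h0 h(1) by(simp add: less_imp_neq[symmetric])
   ultimately show "(%n. q n x) \<longlonglongrightarrow> u' x" unfolding q_def by(rule filterlim_compose)
  qed
  show "AE x in lborel. norm (q n x) <= B*indicator S2 x" for n
  proof (rule AE_I2)
   fix x
   obtain s where s: "0 < s" "s < h n" "u (x + h n *\<^sub>R e) - u (x + 0 *\<^sub>R e) = (h n - 0)*u' (x + s *\<^sub>R e)"
   using MVT2[of 0 "h n" "%s. u (x + s *\<^sub>R e)" "%s. u' (x + s *\<^sub>R e)"] d2 h by auto
   then have q: "q n x = u' (x + s *\<^sub>R e)" using h[of n] by(simp add: q_def)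
   show "norm (q n x) <= B*indicator S2 x"
   proof (cases "x \<in> S2")
   case True then show ?thesis using B by(simp add: q)
   next
   case False
   have "x + s *\<^sub>R e \<notin> S"
   proof
   assume "x + s *\<^sub>R e \<in> S"
   then have "(%p. fst p - snd p *\<^sub>R e) (x + s *\<^sub>R e, s) \<in> S2" unfolding S2_def by(intro imageI) (use s h[of n] in auto)
   then show False using False by simp
   qed
   then show ?thesis using S(3) B by(simp add: q)
   qed
  qed
 qed
 moreover have "(LI x. q n x) = 0" for n
 proof -
  have "(LI x. q n x) = ((LI x. u (x + h n *\<^sub>R e)) - (LI x. u x))/h n" unfolding q_def using iu lborel_integrable_translate[OF iu] by simp
  then show ?thesis by(simp add: lborel_integral_translate)
 qed
 ultimately show ?thesis by(simp add: LIMSEQ_const_iff)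
qed

lemma partial_zero_on_open:
 fixes g :: "real^'n::finite => real"
 assumes "open U" "\<And>x. x \<in> U ==> g x = 0" "x \<in> U"
 shows "partial j g x = 0"
proof -
 have "open ((%s::real. x + s *\<^sub>R axis j 1) -` U)" by(intro open_vimage assms continuous_intros)
 then have "((%s. g (x + s *\<^sub>R axis j 1)) has_real_derivative 0) (at 0)" by(rule has_field_derivative_transform_within_open[OF DERIV_const]) (use assms in auto)
 then show ?thesis unfolding partial_def by(rule DERIV_imp_deriv)
qed

lemma partial_list_support:
 fixes \<phi> :: "real^'n::finite => real"
 assumes "x \<notin> closure {x. \<phi> x ~= 0}"
 shows "partial_list js \<phi> x = 0" using assms
proof (induction js arbitrary: x)
 case Nil
 then show ?case using closure_subset[of "{x. \<phi> x ~= 0}"] by auto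
next
 case (Cons j js)
 have "open (- closure {x. \<phi> x ~= 0})" by auto
 then show ?case using partial_zero_on_open[of "- closure {x. \<phi> x ~= 0}" "partial_list js \<phi>" x j] Cons by auto
qed

lemma test_fun_deriv:
 assumes "test_fun G \<phi>"
 shows "((%s. partial_list js \<phi> (x + s *\<^sub>R axis j 1)) has_real_derivative partial_list (j # js) \<phi> x) (at 0)"
proof -
 have "(%s. partial_list js \<phi> (x + s *\<^sub>R axis j 1)) differentiable (at 0)" using assms unfolding test_fun_def by blast
 then have "(%s. partial_list js \<phi> (x + s *\<^sub>R axis j 1)) field_differentiable (at 0)" by(auto simp: field_differentiable_def elim: real_differentiableE)
 then show ?thesis by(simp add: partial_def field_differentiable_derivI)
qed

text \<open>The kernels have no compact support in \<open>x\<close>, but their product with a test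
  function does, and its directional derivative integrates to 0.\<close>

lemma IBP_step:
 fixes \<phi> :: "real^'n::finite => real"
 assumes t: "test_fun G \<phi>" and K: "\<And>i. smooth_chain M (K i)" and r: "\<And>i. r i <= M" "r j < M"
 shows "(LI x. partial_list (j # js) \<phi> x*(\<Prod>i\<in>UNIV. K i (r i) (x$i))) =
  - (LI x. partial_list js \<phi> x*(\<Prod>i\<in>UNIV. K i ((r(j := Suc (r j))) i) (x$i)))"
proof -
 define P where "P r x = (\<Prod>i\<in>UNIV. K i (r i) (x$i))" for r and x :: "real^'n"
 define S where "S = closure {x. \<phi> x ~= 0}"
 have S: "compact S" using t unfolding test_fun_def S_def by auto
 have cP: "continuous_on UNIV (P r)" if "\<And>i. r i <= M" for r unfolding P_def
 proof (rule continuous_on_prod)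
  fix i
  show "continuous_on UNIV (%x::real^'n. K i (r i) (x$i))" by(rule continuous_on_compose2[OF smooth_chainD(2)[OF K that[of i]]]) (auto intro!: continuous_intros)
 qed
 have cphi: "continuous_on UNIV (partial_list js \<phi>)" for js using t unfolding test_fun_def by blast
 have supp: "x \<notin> S ==> partial_list js \<phi> x = 0" for js x using partial_list_support unfolding S_def by blast
 let ?r = "r(j := Suc (r j))"
 have r2: "?r i <= M" for i using r by auto
 have dP: "((%s. P r (x + s *\<^sub>R axis j 1)) has_real_derivative P ?r x) (at 0)" for x
 proof -
  have *: "P r (x + s *\<^sub>R axis j 1) = K j (r j) (x$j + s)*(\<Prod>i\<in>UNIV-{j}. K i (r i) (x$i))" for s
   unfolding P_def by(subst prod.remove[of _ j]) (auto intro!: prod.cong simp: axis_def)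
  have **: "P ?r x = K j (Suc (r j)) (x$j + 0)*(\<Prod>i\<in>UNIV-{j}. K i (r i) (x$i))" unfolding P_def by(subst prod.remove[of _ j]) (auto intro!: prod.cong)
  have "((%s. K j (r j) (x$j + s)) has_real_derivative K j (Suc (r j)) (x$j + 0)*1) (at 0)"
   by(rule DERIV_chain2[OF smooth_chainD(1)[OF K r(2)]]) (auto intro!: derivative_eq_intros)
  then have "((%s. K j (r j) (x$j + s)) has_real_derivative K j (Suc (r j)) (x$j + 0)) (at 0)" by simp
  then show ?thesis unfolding * ** by(rule DERIV_cmult_right)
 qed
 have int: "integrable lborel (%x. partial_list js \<phi> x*P r x)" if "\<And>i. r i <= M" for js r
  by(rule integrable_compact_support[OF _ S]) (auto intro!: continuous_intros cphi cP that simp: supp)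
 have "(LI x. partial_list (j # js) \<phi> x*P r x + partial_list js \<phi> x*P ?r x) = 0"
 proof (rule integral_directional_derivative_zero[where u = "%x. partial_list js \<phi> x*P r x" and e = "axis j 1" and S = S])
  show "((%s. partial_list js \<phi> (x + s *\<^sub>R axis j 1)*P r (x + s *\<^sub>R axis j 1)) has_real_derivative
   partial_list (j # js) \<phi> x*P r x + partial_list js \<phi> x*P ?r x) (at 0)" for x
   by(rule DERIV_cong[OF DERIV_mult[OF test_fun_deriv[OF t] dP]]) (simp add: mult.commute)
 qed (auto intro!: continuous_on_add continuous_on_mult cphi cP r r2 S simp: supp simp del: partial_list.simps fun_upd_apply)
 moreover have "(LI x. partial_list (j # js) \<phi> x*P r x + partial_list js \<phi> x*P ?r x) =
   (LI x. partial_list (j # js) \<phi> x*P r x) + (LI x. partial_list js \<phi> x*P ?r x)" by(rule Bochner_Integration.integral_add[OF int[OF r(1)] int[OF r2]])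
 ultimately show ?thesis unfolding P_def by linarith
qed

lemma IBP_list:
 fixes \<phi> :: "real^'n::finite => real"
 assumes t: "test_fun G \<phi>" and K: "\<And>i. smooth_chain M (K i)" and r: "\<And>i. r i + count_list js i <= M"
 shows "(LI x. partial_list js \<phi> x*(\<Prod>i\<in>UNIV. K i (r i) (x$i))) =
  (-1)^length js*(LI x. \<phi> x*(\<Prod>i\<in>UNIV. K i (r i + count_list js i) (x$i)))" using r
proof (induction js arbitrary: r)
 case Nil
 then show ?case by simp
next
 case (Cons j js)
 have r: "r i <= M" "r j < M" for i using Cons.prems[of i] Cons.prems[of j] by auto
 let ?r = "r(j := Suc (r j))"
 have e: "?r i + count_list js i = r i + count_list (j # js) i" for i by simp
 have "?r i + count_list js i <= M" for i unfolding e by(rule Cons.prems)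
 from Cons.IH[OF this] show ?case unfolding IBP_step[where js = js and K = K and r = r, OF t K r] e by simp
qed

lemma integral_prod_vec:
 fixes g :: "'n::finite => real => real"
 assumes g: "\<And>i. integrable lborel (g i)"
 shows "(\<integral>x. (\<Prod>i\<in>UNIV. g i (x$i)) \<partial>(lborel::(real^'n) measure)) = (\<Prod>i\<in>UNIV. \<integral>x. g i x \<partial>lborel)"
proof -
 have inj: "inj (%i::'n. axis i (1::real))" by(auto simp: inj_def axis_eq_axis)
 have B: "(Basis :: (real^'n) set) = range (%i. axis i 1)" by(auto simp: Basis_vec_def)
 define h where "h b = g (SOME i. b = axis i (1::real))" for b :: "real^'n"
 have h: "h (axis i 1) = g i" for i unfolding h_def by(simp add: axis_eq_axis)
 have R: "(\<Prod>b\<in>Basis. F b) = (\<Prod>i\<in>UNIV. F (axis i 1))" for F :: "real^'n => real" unfolding B by(subst prod.reindex[OF inj]) simp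
 interpret product_sigma_finite "%b::real^'n. lborel::real measure" by standard
 have m[measurable]: "h b \<in> BM borel" if "b \<in> Basis" for b using that g unfolding B by(auto simp: h)
 have mg[measurable]: "g i \<in> BM borel" for i using g by auto
 have "(\<integral>x. (\<Prod>i\<in>UNIV. g i (x$i)) \<partial>(lborel::(real^'n) measure))
  = (\<integral>f. (\<Prod>i\<in>UNIV. g i ((\<Sum>b\<in>Basis. f b *\<^sub>R b)$i)) \<partial>(\<Pi>\<^sub>M b\<in>(Basis::(real^'n) set). lborel))"
  by(subst lborel_eq, subst integral_distr) auto
 also have "... = (\<integral>f. (\<Prod>b\<in>Basis. h b (f b)) \<partial>(\<Pi>\<^sub>M b\<in>(Basis::(real^'n) set). lborel))"
 proof (rule BI_cong[OF refl])
  fix f :: "real^'n => real"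
  have "(\<Sum>b\<in>Basis. f b *\<^sub>R b)$i = f (axis i 1)" for i
  proof -
   have "(\<Sum>b\<in>Basis. f b *\<^sub>R b)$i = (\<Sum>b\<in>Basis. f b *\<^sub>R b) \<bullet> axis i 1" by(simp add: inner_axis)
   also have "... = f (axis i 1)" by(rule inner_sum_left_Basis) simp
   finally show ?thesis .
  qed
  then show "(\<Prod>i\<in>UNIV. g i ((\<Sum>b\<in>Basis. f b *\<^sub>R b)$i)) = (\<Prod>b\<in>Basis. h b (f b))" by(simp add: R h)
 qed
 also have "... = (\<Prod>b\<in>Basis. \<integral>x. h b x \<partial>lborel)" by(rule product_integral_prod) (use g in \<open>auto simp: B h\<close>)
 also have "... = (\<Prod>i\<in>UNIV. \<integral>x. g i x \<partial>lborel)" by(simp add: R h)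
 finally show ?thesis .
qed

section \<open>The smoothing kernels as an approximate identity\<close>

context bump
begin

definition TC :: "nat => real" where "TC l = 2*real l*(2^l*B)\<^sup>2"

lemma TC_nonneg: "0 <= TC l" by(simp add: TC_def)

text \<open>\<open>TT_bound\<close> only yields t^-2. Integrating over the intermediate point,
  confined to an interval of length 2 l t, recovers one power; the result matches the width of the
  support, so the kernel stays bounded in L_1.\<close>

lemma TT0_bound:
 assumes "0 < x" "x < 1" "0 < t" "2*real l*t <= 1"
 shows "\<bar>TT l 0 t x y\<bar> <= TC l*(1/t)"
proof -
 have "\<bar>\<integral>z. AW l 0 t x (z - x)*AW l 0 t x (y - z) \<partial>lborel\<bar> <= 2*(real l*t)*((2^l*B*(1/t))*(2^l*B*(1/t)))"
 proof (rule integral_bound_support)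
  show "\<bar>AW l 0 t x (z - x)*AW l 0 t x (y - z)\<bar> <= (2^l*B*(1/t))*(2^l*B*(1/t))" for z
   unfolding abs_mult by(intro mult_mono AW_bound assms) (use assms B_pos in auto)
  show "AW l 0 t x (z - x)*AW l 0 t x (y - z) ~= 0 ==> \<bar>z - x\<bar> <= real l*t" for z using AW_range(3)[of l 0 t x z] assms by auto
 qed (use assms B_pos in auto)
 also have "... = TC l*(1/t)" using assms by(simp add: TC_def power2_eq_square field_simps)
 finally show ?thesis using TT0[OF assms] by simp
qed

lemma AW_lip:
 assumes "0 < t" "1 <= N"
 shows "\<bar>AW l 0 t x w - AW l 0 t y w\<bar> <= 2^l*B*(1/t)*\<bar>x - y\<bar>"
proof -
 have lip: "\<bar>\<phi> 0 a - \<phi> 0 b\<bar> <= B*\<bar>a - b\<bar>" for a b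
 proof -
  have "norm (\<phi> 0 a - \<phi> 0 b) <= B*norm (a - b)"
  proof (rule field_differentiable_bound[of UNIV])
   show "(\<phi> 0 has_field_derivative \<phi> (Suc 0) z) (at z within UNIV)" for z using smooth_chainD(1)[OF phi_chain] assms by auto
  qed (use phi_bound in auto)
  then show ?thesis by simp
 qed
 have "\<bar>AW l 0 t x w - AW l 0 t y w\<bar> <= (\<Sum>k=1..l. \<bar>ck l k\<bar>*(B*(1/t)*\<bar>x - y\<bar>))" unfolding AW_def sum_subtractf[symmetric]
 proof (rule order_trans[OF sum_abs], rule sum_mono)
  fix k assume "k \<in> {1..l}"
  then have k: "1 <= real k" by auto
  have a: "0 < 1/(real k*t)" "1/(real k*t) <= 1/t" using k assms by(auto simp: field_simps)
  let ?p = "%x. \<phi> 0 (x*1 + w/(real k*t))"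
  have "\<bar>ck l k*(1/(real k*t))*(1^0*?p x) - ck l k*(1/(real k*t))*(1^0*?p y)\<bar>
   = \<bar>ck l k\<bar>*((1/(real k*t))*\<bar>?p x - ?p y\<bar>)" using a(1) assms(1) by(simp add: abs_mult right_diff_distrib[symmetric] diff_divide_distrib[symmetric])
  also have "... <= \<bar>ck l k\<bar>*((1/t)*(B*\<bar>x - y\<bar>))"
   by(rule mult_left_mono[OF mult_mono[OF a(2)]]) (use lip[of "x + w/(real k*t)" "y + w/(real k*t)"] assms in auto)
  finally show "\<bar>ck l k*(1/(real k*t))*(1^0*?p x) - ck l k*(1/(real k*t))*(1^0*?p y)\<bar>
   <= \<bar>ck l k\<bar>*(B*(1/t)*\<bar>x - y\<bar>)" by(simp add: mult_ac)
 qed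
 also have "... <= 2^l*(B*(1/t)*\<bar>x - y\<bar>)" unfolding sum_distrib_right[symmetric] by(rule mult_right_mono[OF sum_abs_ck]) (use assms B_pos in auto)
 finally show ?thesis by(simp add: mult_ac)
qed

lemma AW_integrable: "0 < t ==> 0 < x ==> x < 1 ==> integrable lborel (AW l i t x)"
proof (rule integrable_continuous_bounded_support[of _ "- real l*t" "real l*t"])
 assume t: "0 < t" and x: "0 < x" "x < 1"
 show "continuous_on UNIV (AW l i t x)" using continuous_AW_w[OF t continuous_on_id] by simp
 show "AW l i t x w = 0" if "w \<notin> {- real l*t..real l*t}" for w
 proof (rule ccontr)
  assume "AW l i t x w ~= 0"
  from AW_supp2[OF this t] obtain k u where k: "1 <= k" "k <= l" "0 < u" "u < 1" "w = real k*t*(u - x)" .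
  have "\<bar>w\<bar> = real k*t*\<bar>u - x\<bar>" using k t by(simp add: abs_mult)
  also have "... <= real l*t*1" using k t x by(intro mult_mono) auto
  finally show False using that by auto
 qed
qed

lemma AW_int1:
 assumes "0 < t" "0 < x" "x < 1" "1 <= l"
 shows "(LI w. AW l 0 t x w) = 1"
proof -
 have i: "integrable lborel (%w. \<phi> 0 (x + (1/(real k*t))*w))" if "1 <= k" for k
  using lborel_integrable_real_affine[OF phi_integrable[of 0], of "1/(real k*t)" x] that assms by auto
 have s: "(LI w. \<phi> 0 (x + (1/(real k*t))*w)) = real k*t" if "1 <= k" for k
  using lborel_integral_real_affine[of "1/(real k*t)" "\<phi> 0" x] that assms phi_int by(simp add: field_simps)
 have "(LI w. AW l 0 t x w) = (LI w. (\<Sum>k=1..l. ck l k*(1/(real k*t))*\<phi> 0 (x + (1/(real k*t))*w)))" unfolding AW_def by simp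
 also have "... = (\<Sum>k=1..l. ck l k*(1/(real k*t))*(LI w. \<phi> 0 (x + (1/(real k*t))*w)))"
  by(subst Bochner_Integration.integral_sum) (auto intro!: integrable_mult_right i simp del: times_divide_eq_left times_divide_eq_right)
 also have "... = (\<Sum>k=1..l. ck l k)" by(intro sum.cong refl) (use assms in \<open>simp add: s del: times_divide_eq_left times_divide_eq_right\<close>, auto)
 finally show ?thesis using sum_ck[OF assms(4)] by simp
qed

lemma AW_measurable [measurable]: "AW l i t x \<in> BM borel" unfolding AW_def by measurable

text \<open>With the parameter frozen at \<open>y\<close> the order of integration can be exchanged,
  and the integral becomes a product of two integrals of \<open>AW\<close>, each equal to 1.\<close>

lemma frozen_int1:
 assumes "0 < t" "0 < y" "y < 1" "1 <= l"
 shows "(LI x. (LI z. AW l 0 t y (z - x)*AW l 0 t y (y - z))) = 1"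
  and "integrable lborel (%x. \<integral>z. AW l 0 t y (z - x)*AW l 0 t y (y - z) \<partial>lborel)"
proof -
 define a where "a = AW l 0 t y"
 have [measurable]: "a \<in> BM borel" unfolding a_def by measurable
 have a: "integrable lborel a" unfolding a_def by(rule AW_integrable[OF assms(1-3)])
 have a2: "integrable lborel (%x. a (z - x))" for z using lborel_integrable_real_affine[OF a, of "-1" z] by simp
 have a1: "(LI x. a (z - x)) = 1" for z using lborel_integral_real_affine[of "-1" a z] AW_int1[OF assms] by(simp add: a_def)
 have a3: "(LI x. \<bar>a (z - x)\<bar>) = (LI x. \<bar>a x\<bar>)" for z using lborel_integral_real_affine[of "-1" "%x. \<bar>a x\<bar>" z] by simp
 have I: "integrable (lborel \<Otimes>\<^sub>M lborel) (%(z, x). a (z - x)*a (y - z))"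
 proof (rule lborel_pair.Fubini_integrable)
  show "integrable lborel (%z. \<integral>x. norm (case (z, x) of (z, x) => a (z - x)*a (y - z)) \<partial>lborel)"
   using integrable_mult_left[OF integrable_abs[OF a2[of y]], of "\<integral>x. \<bar>a x\<bar> \<partial>lborel"] by(simp add: abs_mult a3 mult.commute)
  show "AE z in lborel. integrable lborel (%x. case (z, x) of (z, x) => a (z - x)*a (y - z))" by(simp add: integrable_mult_left a2)
 qed measurable
 show "integrable lborel (%x. \<integral>z. AW l 0 t y (z - x)*AW l 0 t y (y - z) \<partial>lborel)" using lborel_pair.integrable_snd[OF I] by(simp add: a_def)
 have "(LI x. (LI z. a (z - x)*a (y - z))) = (LI z. (LI x. a (z - x)*a (y - z)))" using lborel_pair.integral_snd[OF I] lborel_pair.integral_fst[OF I] by simp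
 also have "... = 1" by(simp add: a1)
 finally show "(LI x. (LI z. AW l 0 t y (z - x)*AW l 0 t y (y - z))) = 1" by(simp add: a_def)
qed

lemma TT_measurable [measurable]:
 assumes t: "0 < t" and [measurable]: "f \<in> BM M" "g \<in> BM M"
 shows "(%w. TT l i t (f w) (g w)) \<in> BM M"
proof -
 have "(%w. (f w, g w)) \<in> M \<rightarrow>\<^sub>M borel" by measurable
 from measurable_compose[OF this borel_measurable_continuous_onI[OF TT_continuous[OF t]]]
 show ?thesis by simp
qed

lemma kk_measurable [measurable (raw)]:
 assumes [measurable]: "f \<in> BM M" "g \<in> BM M" "h \<in> BM M" "k \<in> BM M"
 shows "(%w. kk l i (f w) (g w) (h w) (k w)) \<in> BM M" unfolding kk_def leib_def AZ_def bt_def by measurable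

lemma TT_slice_integrable:
 assumes "0 < t" "2*real l*t <= 1"
 shows "integrable lborel (%x. indicator {0<..<1} x*TT l 0 t x y)"
proof (rule Bochner_Integration.integrable_bound[of _ "%x. TC l*(1/t)*indicator {0<..<1::real} x"])
 show "integrable lborel (%x. TC l*(1/t)*indicator {0<..<1::real} x)" by(intro integrable_mult_right integrable_real_indicator) auto
 show "(%x. indicator {0<..<1} x*TT l 0 t x y) \<in> BM lborel" using assms(1) by measurable
 show "AE x in lborel. norm (indicator {0<..<1} x*TT l 0 t x y) <= norm (TC l*(1/t)*indicator {0<..<1} x)"
  using TT0_bound[OF _ _ assms] TC_nonneg[of l] assms(1) by(intro AE_I2) (auto simp: indicator_def abs_mult)
qed

text \<open>The integral runs over \<open>x\<close>, the variable in which the kernel is not a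
  convolution. Compared with the kernel frozen at \<open>y\<close>, the Lipschitz bound 1/t times |x
  - y| leaves a bounded error on an interval of length proportional to t, hence a total error of
  order t.\<close>

lemma TT_adjoint_one:
 assumes y: "0 < y" "y < 1" and l: "1 <= l" "1 <= N"
 shows "((%t. \<integral>x. indicator {0<..<1} x*TT l 0 t x y \<partial>lborel) \<longlongrightarrow> 1) (at_right 0)"
proof -
 define C where "C = 2^l*B"
 have C: "0 <= C" using B_pos by(simp add: C_def)
 \<comment> \<open>The range of z, of length 2 l t, times the bound 4 l C^2/t of the difference of
   the integrands.\<close>
 define M where "M = 8*(real l)\<^sup>2*C\<^sup>2"
 have M: "0 <= M" by(simp add: M_def)
 define t0 where "t0 = min y (1 - y)/(2*real l)"
 have t0: "0 < t0" using y l by(simp add: t0_def)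
 have main: "\<bar>(LI x. indicator {0<..<1} x*TT l 0 t x y) - 1\<bar> <= 4*real l*t*M" if t: "0 < t" "t < t0" for t
 proof -
  have lt: "2*real l*t < min y (1 - y)" using t l by(simp add: t0_def field_simps)
  then have lt1: "2*real l*t <= 1" using y by linarith
  define F where "F x = (LI z. AW l 0 t y (z - x)*AW l 0 t y (y - z))" for x
  have F1: "(LI x. F x) = 1" "integrable lborel F" using frozen_int1[OF t(1) y l(1)] by(auto simp: F_def[abs_def])
  have F0: "\<bar>x - y\<bar> <= 2*real l*t" if "F x ~= 0" for x
  proof (rule ccontr)
   assume *: "\<not> \<bar>x - y\<bar> <= 2*real l*t"
   have "AW l 0 t y (z - x)*AW l 0 t y (y - z) = 0" for z using AW_small[of l 0 t y "z - x"] AW_small[of l 0 t y "y - z"] y t lt1*by fastforce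
   then have "F x = 0" unfolding F_def by(simp only:) simp
   then show False using that by simp
  qed
  have D: "\<bar>TT l 0 t x y - F x\<bar> <= M" if x: "0 < x" "x < 1" for x
  proof -
   let ?D = "%z. AW l 0 t x (z - x)*AW l 0 t x (y - z) - AW l 0 t y (z - x)*AW l 0 t y (y - z)"
   have e: "TT l 0 t x y - F x = (LI z. ?D z)" unfolding TT0[OF x t(1) lt1] F_def
   proof (subst Bochner_Integration.integral_diff)
   have i: "integrable lborel (%z. AW l 0 t v (z - x)*AW l 0 t v (y - z))" if "0 < v" "v < 1" for v
   proof (rule integrable_continuous_bounded_support[of _ "x - real l*t" "x + real l*t"])
   show "continuous_on UNIV (%z. AW l 0 t v (z - x)*AW l 0 t v (y - z))" by(intro continuous_intros continuous_AW_w t)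
   show "AW l 0 t v (z - x)*AW l 0 t v (y - z) = 0" if z: "z \<notin> {x - real l*t..x + real l*t}" for z
   using AW_small[of l 0 t v "z - x"] \<open>0 < v\<close> \<open>v < 1\<close> t lt1 z by fastforce
   qed
   show "integrable lborel (%z. AW l 0 t x (z - x)*AW l 0 t x (y - z))" by(rule i[OF x])
   show "integrable lborel (%z. AW l 0 t y (z - x)*AW l 0 t y (y - z))" by(rule i[OF y])
   qed simp
   have s: "?D z ~= 0 ==> \<bar>z - y\<bar> <= real l*t \<and> \<bar>z - x\<bar> <= real l*t" for z
   using AW_small[of l 0 t x "z - x"] AW_small[of l 0 t x "y - z"] AW_small[of l 0 t y "z - x"] AW_small[of l 0 t y "y - z"] x y t lt1
   by(cases "AW l 0 t x (z - x)*AW l 0 t x (y - z) = 0") auto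
   have b: "\<bar>?D z\<bar> <= 4*real l*C\<^sup>2*(1/t)" for z
   proof (cases "?D z = 0")
   case True then show ?thesis using t C by simp
   next
   case False
   from s[OF this] have xy: "\<bar>x - y\<bar> <= 2*real l*t" by linarith
   have eq: "?D z = AW l 0 t x (z - x)*(AW l 0 t x (y - z) - AW l 0 t y (y - z))
   + (AW l 0 t x (z - x) - AW l 0 t y (z - x))*AW l 0 t y (y - z)" by(simp add: algebra_simps)
   have A: "\<bar>AW l 0 t v w\<bar> <= C*(1/t)" for v w using AW_bound[OF t(1)] by(simp add: C_def)
   have L: "\<bar>AW l 0 t x w - AW l 0 t y w\<bar> <= C*(2*real l)" for w
   proof -
   have "\<bar>AW l 0 t x w - AW l 0 t y w\<bar> <= C*(1/t)*\<bar>x - y\<bar>" using AW_lip[OF t(1) l(2)] by(simp add: C_def)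
   also have "... <= C*(1/t)*(2*real l*t)" using xy t C by(intro mult_left_mono) auto
   also have "... = C*(2*real l)" using t by simp
   finally show ?thesis .
   qed
   have "\<bar>?D z\<bar> <= \<bar>AW l 0 t x (z - x)\<bar>*\<bar>AW l 0 t x (y - z) - AW l 0 t y (y - z)\<bar>
   + \<bar>AW l 0 t x (z - x) - AW l 0 t y (z - x)\<bar>*\<bar>AW l 0 t y (y - z)\<bar>" unfolding eq by(rule order_trans[OF abs_triangle_ineq]) (simp add: abs_mult)
   also have "... <= C*(1/t)*(C*(2*real l)) + C*(2*real l)*(C*(1/t))" by(intro add_mono mult_mono A L) (use C t in auto)
   also have "... = 4*real l*C\<^sup>2*(1/t)" by(simp add: power2_eq_square)
   finally show ?thesis .
   qed
   have "\<bar>\<integral>z. ?D z \<partial>lborel\<bar> <= 2*(real l*t)*(4*real l*C\<^sup>2*(1/t))" by(rule integral_bound_support[where a = y]) (use b s C t in auto)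
   also have "... = M" using t by(simp add: M_def power2_eq_square)
   finally show ?thesis unfolding e .
  qed
  have "(LI x. indicator {0<..<1} x*TT l 0 t x y) - 1 = (LI x. indicator {0<..<1} x*TT l 0 t x y - F x)"
   by(subst Bochner_Integration.integral_diff[OF TT_slice_integrable[OF t(1) lt1] F1(2)]) (simp add: F1(1))
  also have "\<bar>...\<bar> <= 2*(2*real l*t)*M"
  proof (rule integral_bound_support[where a = y])
   have *: "indicator {0<..<1} x*TT l 0 t x y - F x = (if 0 < x \<and> x < 1 then TT l 0 t x y - F x else 0)" for x
   using F0[of x] lt by(cases "F x = 0") (auto simp: abs_le_iff)
   show "\<bar>indicator {0<..<1} x*TT l 0 t x y - F x\<bar> <= M" for x unfolding * using D M by auto
   show "indicator {0<..<1} x*TT l 0 t x y - F x ~= 0 ==> \<bar>x - y\<bar> <= 2*real l*t" for x unfolding * using F0[of x] TT_supp(3)[of l 0 t x y] t lt1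
   by(cases "F x = 0") (auto split: if_splits simp: abs_minus_commute)
  qed (use t M in auto)
  finally show ?thesis by simp
 qed
 show ?thesis
 proof (rule LIM_zero_cancel, rule Lim_null_comparison)
  show "\<forall>\<^sub>F t in at_right 0. norm ((LI x. indicator {0<..<1} x*TT l 0 t x y) - 1) <= 4*real l*t*M"
   using main t0 by(intro eventually_at_rightI[of 0 t0]) auto
  show "((%t. 4*real l*t*M) \<longlongrightarrow> 0) (at_right 0)" by(auto intro!: tendsto_eq_intros)
 qed
qed

end

section \<open>Powers of extended reals and Minkowski's integral inequality\<close>

text \<open>Infinity is kept for every exponent and 0 stays 0, since \<open>0 powr r = 0\<close>.
  The exponent 1/p gives \<open>enn_root p\<close>.\<close>

definition epow :: "ennreal => real => ennreal" where
 "epow a r = (if a = \<infinity> then \<infinity> else ennreal (enn2real a powr r))"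

lemma enn_root_epow: "enn_root p a = epow a (1/p)" by(simp add: enn_root_def epow_def)

lemma epow_ennreal: "0 <= x ==> epow (ennreal x) r = ennreal (x powr r)" by(simp add: epow_def)

lemma epow_top [simp]: "epow \<infinity> r = \<infinity>" "epow top r = top" by(simp_all add: epow_def)

lemma epow_0 [simp]: "epow 0 r = 0" by(simp add: epow_def)

lemma epow_1_left [simp]: "epow 1 r = 1" by(simp add: epow_def)

lemma epow_one [simp]: "epow a 1 = a" by(cases a) (auto simp: epow_def)

lemma epow_mono: "0 <= r ==> a <= b ==> epow a r <= epow b r" unfolding epow_def by(auto simp: top_unique less_top intro!: ennreal_leI powr_mono2 enn2real_mono)

lemma epow_mult: "0 < r ==> epow (a*b) r = epow a r*epow b r"
proof (cases a; cases b)
 assume r: "0 < r"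
 fix x y assume "a = ennreal x" "0 <= x" "b = ennreal y" "0 <= y"
 then show ?thesis by(simp add: epow_ennreal powr_mult flip: ennreal_mult)
next
 assume r: "0 < r"
 fix x assume "a = ennreal x" "0 <= x" "b = top"
 then show ?thesis by(cases "x = 0") (auto simp: epow_ennreal ennreal_mult_top)
next
 assume r: "0 < r"
 fix x assume "b = ennreal x" "0 <= x" "a = top"
 then show ?thesis by(cases "x = 0") (auto simp: epow_ennreal ennreal_top_mult)
qed simp

lemma epow_epow: "epow (epow a r) s = epow a (r * s)" by(cases a) (auto simp: epow_ennreal powr_powr)

lemma epow_add: "epow a (r + s) = epow a r*epow a s" by(cases a) (auto simp: epow_ennreal powr_add ennreal_mult ennreal_top_mult)

lemma epow_eq_0: "epow a r = 0 \<longleftrightarrow> a = 0" by(cases a) (auto simp: epow_ennreal)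

lemma epow_measurable [measurable]:
 assumes [measurable]: "f \<in> BM M"
 shows "(%x. epow (f x) r) \<in> BM M"
proof -
 have "(%x. if f x < top then ennreal (enn2real (f x) powr r) else top) \<in> BM M" by measurable
 moreover have "(%x. if f x < top then ennreal (enn2real (f x) powr r) else top) = (%x. epow (f x) r)" by(auto simp: epow_def fun_eq_iff less_top)
 ultimately show ?thesis by simp
qed

lemma young_unit:
 assumes "1 <= p" "0 <= (u::real)"
 shows "u <= u powr p/p + (1 - 1/p)"
proof (cases "p = 1")
 case True then show ?thesis using assms by simp
next
 case False
 then have p: "1 < p" using assms by simp
 define q where "q = p/(p - 1)"
 have q: "1 < q" "1/p + 1/q = 1" using p by(auto simp: q_def field_simps)
 have "u*1 <= u powr p/p + 1 powr q/q" by(rule Youngs_inequality) (use p q assms in auto)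
 moreover have "1/q = 1 - 1/p" using q by linarith
 ultimately show ?thesis by simp
qed

text \<open>Jensen's inequality for a weight of total mass at most Y. It follows from Young's
  inequality with a free scale s, applied pointwise and integrated.\<close>

lemma power_mean:
 fixes F a :: "'a => ennreal"
 assumes p: "1 <= p" and [measurable]: "F \<in> BM M" "a \<in> BM M"
  and Y: "(nn_integral M (%x. a x)) <= ennreal Y" "0 < Y"
 shows "epow (nn_integral M (%x. a x*F x)) p <= ennreal (Y powr (p - 1))*(nn_integral M (%x. a x*epow (F x) p))"
proof -
 define X where "X = (nn_integral M (%x. a x*epow (F x) p))"
 show ?thesis
 proof (cases X)
  case top
  then show ?thesis using Y by(simp add: X_def[symmetric] ennreal_mult_top)
 next
  case (real x)
  show ?thesis
  proof (cases "x = 0")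
   case True
   then have "AE z in M. a z*epow (F z) p = 0" using real by(simp add: X_def nn_integral_0_iff_AE)
   then have "AE z in M. a z*F z = 0" by eventually_elim (auto simp: epow_eq_0)
   then have "(nn_integral M (%x. a x*F x)) = 0" by(simp add: nn_integral_0_iff_AE)
   then show ?thesis by simp
  next
   case False
   then have x: "0 < x" using real by simp
   \<comment> \<open>The scale at which the two terms of Young's inequality combine to the sharp
     product.\<close>
   define s where "s = (x/Y) powr (1/p)"
   have s: "0 < s" using x Y by(simp add: s_def)
   define c1 where "c1 = s powr (1 - p)/p"
   define c2 where "c2 = s*(1 - 1/p)"
   have c: "0 <= c1" "0 <= c2" using s p by(auto simp: c1_def c2_def)
   have "F z <= ennreal c1*epow (F z) p + ennreal c2" for z
   proof (cases "F z")
   case (real f)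
   have "f/s <= (f/s) powr p/p + (1 - 1/p)" by(rule young_unit[OF p]) (use real s in auto)
   then have "s*(f/s) <= s*((f/s) powr p/p + (1 - 1/p))" using s by(intro mult_left_mono) auto
   also have "... = c1*f powr p + c2" using s real by(simp add: c1_def c2_def powr_divide powr_diff distrib_left)
   finally have "f <= c1*f powr p + c2" using s by simp
   then show ?thesis using real c by(simp add: epow_ennreal flip: ennreal_mult ennreal_plus)
   next
   case top
   have "0 < c1" using s p by(simp add: c1_def)
   then show ?thesis using top by(simp add: ennreal_mult_top)
   qed
   then have "(nn_integral M (%z. a z*F z)) <= (nn_integral M (%z. a z*(ennreal c1*epow (F z) p + ennreal c2)))" by(intro nn_integral_mono mult_left_mono) auto
   also have "... = (nn_integral M (%z. ennreal c1*(a z*epow (F z) p) + ennreal c2*a z))" by(intro nn_integral_cong) (simp add: distrib_left mult_ac)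
   also have "... = ennreal c1*X + ennreal c2*(nn_integral M (%x. a x))" by(simp add: nn_integral_add nn_integral_cmult X_def)
   also have "... <= ennreal c1*X + ennreal c2*ennreal Y" using Y by(intro add_left_mono mult_left_mono) auto
   also have "... = ennreal (c1*x + c2*Y)" using real c Y x by(simp flip: ennreal_mult ennreal_plus)
   also have "c1*x + c2*Y = x powr (1/p)*Y powr (1 - 1/p)"
   proof -
   have e: "s powr (1 - p) = (x/Y) powr (1/p - 1)" using p by(simp add: s_def powr_powr diff_divide_distrib left_diff_distrib)
   have "c1*x = x powr (1/p)*Y powr (1 - 1/p)/p" unfolding c1_def e using x Y by(simp add: powr_diff powr_divide field_simps)
   moreover have "c2*Y = x powr (1/p)*Y powr (1 - 1/p)*(1 - 1/p)" unfolding c2_def s_def using x Y by(simp add: powr_diff powr_divide field_simps)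
   ultimately show ?thesis by(simp add: algebra_simps)
   qed
   finally have "epow (nn_integral M (%z. a z*F z)) p <= epow (ennreal (x powr (1/p)*Y powr (1 - 1/p))) p" using p by(intro epow_mono) auto
   also have "... = ennreal (Y powr (p - 1))*ennreal x" using p x Y by(simp add: epow_ennreal powr_mult powr_powr left_diff_distrib flip: ennreal_mult)
   finally show ?thesis using real by(simp add: X_def)
  qed
 qed
qed

lemma ennreal_powr_limit:
 assumes "\<And>Y. y < Y ==> A <= ennreal (Y powr q)" "0 <= y" "0 < q"
 shows "A <= ennreal (y powr q)"
proof -
 have "((%Y. ennreal (Y powr q)) \<longlongrightarrow> ennreal (y powr q)) (at_right y)"
  by(intro tendsto_ennrealI tendsto_powr2 tendsto_intros) (use assms in \<open>auto simp: eventually_at_right_less eventually_at_filter\<close>)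
 moreover have "eventually (%Y. A <= ennreal (Y powr q)) (at_right y)" using assms(1) by(auto simp: eventually_at_filter)
 ultimately show ?thesis by(rule tendsto_lowerbound) simp
qed

text \<open>Writing G as beta times G/beta and applying \<open>power_mean\<close> with weight beta,
  Fubini and the bound on the norm of \<open>G t\<close> cancel beta. As \<open>b\<close> may
  vanish, beta is \<open>b\<close> plus a small constant on \<open>S\<close>; this costs eta times
  the measure of \<open>S\<close>, absorbed in some Y > w that finally decreases to w.\<close>

lemma minkowski_nn:
 fixes G :: "'a => 'b => ennreal"
 assumes "sigma_finite_measure M" "sigma_finite_measure N"
  and G[measurable]: "case_prod G \<in> BM (M \<Otimes>\<^sub>M N)"
  and b[measurable]: "b \<in> BM M" and S[measurable]: "S \<in> sets M" and fin: "emeasure M S < \<infinity>"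
  and q: "1 <= q"
  and Gb: "\<And>t. t \<in> S ==> (nn_integral N (%x. epow (G t x) q)) <= epow (b t) q"
  and b_fin: "\<And>t. t \<in> S ==> b t < \<infinity>"
  and off: "\<And>t x. t \<in> space M ==> t \<notin> S ==> G t x = 0"
  and W: "(nn_integral M (%t. b t)) <= ennreal w" "0 <= w"
 shows "(nn_integral N (%x. epow (nn_integral M (%t. G t x)) q)) <= ennreal (w powr q)"
proof (rule ennreal_powr_limit)
 interpret M: sigma_finite_measure M by fact
 interpret N: sigma_finite_measure N by fact
 interpret MN: pair_sigma_finite M N ..
 fix Y assume Y: "w < Y"
 then have Y0: "0 < Y" using W by simp
 define \<mu> where "\<mu> = measure M S"
 have mu: "emeasure M S = ennreal \<mu>" "0 <= \<mu>" using fin by(auto simp: \<mu>_def emeasure_eq_ennreal_measure)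
 define \<eta> where "\<eta> = (Y - w)/(\<mu> + 1)"
 have eta: "0 < \<eta>" "w + \<eta>*\<mu> <= Y" using Y mu by(auto simp: \<eta>_def field_simps)
 define \<beta> where "\<beta> t = (b t + ennreal \<eta>)*indicator S t" for t
 have [measurable]: "\<beta> \<in> BM M" unfolding \<beta>_def by measurable
 have beta: "(nn_integral M (%t. \<beta> t)) <= ennreal Y"
 proof -
  have "(nn_integral M (%t. \<beta> t)) <= (nn_integral M (%t. b t + ennreal \<eta>*indicator S t))" by(intro nn_integral_mono) (auto simp: \<beta>_def indicator_def)
  also have "... = (nn_integral M (%t. b t)) + ennreal \<eta>*ennreal \<mu>" by(simp add: nn_integral_add nn_integral_cmult mu)
  also have "... <= ennreal w + ennreal \<eta>*ennreal \<mu>" using W by(intro add_right_mono)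
  also have "... = ennreal (w + \<eta>*\<mu>)" using eta mu W by(simp flip: ennreal_mult ennreal_plus)
  also have "... <= ennreal Y" using eta by(intro ennreal_leI)
  finally show ?thesis .
 qed
 have pos: "\<beta> t ~= 0" "\<beta> t ~= \<infinity>" if "t \<in> S" for t using that b_fin[OF that] eta by(auto simp: \<beta>_def ennreal_add_eq_top)
 have cancel: "\<beta> t*(G t x*inverse (\<beta> t)) = G t x" if "t \<in> space M" for t x
 proof (cases "t \<in> S")
  case True
  then have "\<beta> t*inverse (\<beta> t) = 1" using pos[OF True] by(metis divide_ennreal_def ennreal_divide_self infinity_ennreal_def less_top)
  then show ?thesis by(metis mult.left_commute mult.right_neutral)
 qed (use off that in simp)
 have s1: "(nn_integral N (%x. epow (nn_integral M (%t. G t x)) q)) \<le>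
  (nn_integral N (%x. ennreal (Y powr (q - 1))*(nn_integral M (%t. \<beta> t*epow (G t x*inverse (\<beta> t)) q))))"
 proof (rule nn_integral_mono)
  fix x assume x: "x \<in> space N"
  have [measurable]: "(%t. G t x) \<in> BM M" using x by measurable
  have "(nn_integral M (%t. G t x)) = (nn_integral M (%t. \<beta> t*(G t x*inverse (\<beta> t))))" by(intro nn_integral_cong) (simp add: cancel)
  then show "epow (nn_integral M (%t. G t x)) q <= ennreal (Y powr (q - 1))*(nn_integral M (%t. \<beta> t*epow (G t x*inverse (\<beta> t)) q))"
   using power_mean[OF q, of "%t. G t x*inverse (\<beta> t)" M \<beta> Y] beta Y0 by simp
 qed
 have s2: "... = ennreal (Y powr (q - 1))*(nn_integral N (%x. (nn_integral M (%t. \<beta> t*epow (G t x*inverse (\<beta> t)) q))))" by(rule nn_integral_cmult) measurable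
 have "(nn_integral N (%x. (nn_integral M (%t. \<beta> t*epow (G t x*inverse (\<beta> t)) q)))) =
  (nn_integral M (%t. (nn_integral N (%x. \<beta> t*epow (G t x*inverse (\<beta> t)) q))))" by(rule MN.Fubini') measurable
 also have "... <= (nn_integral M (%t. \<beta> t))"
 proof (rule nn_integral_mono)
  fix t assume t: "t \<in> space M"
  have [measurable]: "(%x. G t x) \<in> BM N" using t by measurable
  show "(nn_integral N (%x. \<beta> t*epow (G t x*inverse (\<beta> t)) q)) <= \<beta> t"
  proof (cases "t \<in> S")
   case True
   have "(nn_integral N (%x. \<beta> t*epow (G t x*inverse (\<beta> t)) q)) = \<beta> t*(epow (inverse (\<beta> t)) q*(nn_integral N (%x. epow (G t x) q)))"
   using q by(simp add: epow_mult nn_integral_cmult mult.commute[of _ "epow (inverse (\<beta> t)) q"])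
   also have "... <= \<beta> t*(epow (inverse (\<beta> t)) q*epow (\<beta> t) q)" using Gb[OF True] epow_mono[of q "b t" "\<beta> t"] q True
   by(intro mult_left_mono) (auto simp: \<beta>_def elim!: order_trans)
   also have "... = \<beta> t*epow (inverse (\<beta> t)*\<beta> t) q" using q by(simp add: epow_mult)
   also have "inverse (\<beta> t)*\<beta> t = 1" using pos[OF True] by(metis divide_ennreal_def ennreal_divide_self infinity_ennreal_def less_top mult.commute)
   finally show ?thesis by simp
  next
   case False
   then show ?thesis by(simp add: \<beta>_def)
  qed
 qed
 also have "... <= ennreal Y" by(rule beta)
 finally have "ennreal (Y powr (q - 1))*(nn_integral N (%x. (nn_integral M (%t. \<beta> t*epow (G t x*inverse (\<beta> t)) q))))
  <= ennreal (Y powr (q - 1))*ennreal Y" by(rule mult_left_mono) simp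
 with s1 s2 have "(nn_integral N (%x. epow (nn_integral M (%t. G t x)) q)) <= ennreal (Y powr (q - 1))*ennreal Y" by simp
 also have "... = ennreal (Y powr q)" using Y0 by(simp add: powr_diff flip: ennreal_mult)
 finally show "(nn_integral N (%x. epow (nn_integral M (%t. G t x)) q)) <= ennreal (Y powr q)" .
qed (use W q in auto)

section \<open>Mixed differences on the unit cube: domains and measurability\<close>

lemma mem_cube: "x \<in> cube \<delta> x0 \<longleftrightarrow> (\<forall>j. x0$j < x$j \<and> x$j < x0$j + \<delta> j)" unfolding cube_def by(simp add: mem_box_cart)

lemma prod_Basis_vec:
 fixes F :: "real^'n::finite => 'a::comm_monoid_mult"
 shows "(\<Prod>b\<in>Basis. F b) = (\<Prod>i\<in>UNIV. F (axis i 1))"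
proof -
 have inj: "inj (%i::'n. axis i (1::real))" by(auto simp: inj_def axis_eq_axis)
 have B: "(Basis :: (real^'n) set) = range (%i. axis i 1)" by(auto simp: Basis_vec_def)
 show ?thesis unfolding B by(subst prod.reindex[OF inj]) simp
qed

text \<open>In each coordinate the segment from z to z + l xi stays in an interval as soon as its
  ends do, so only t = 0 and t = 1 have to be tested.\<close>

lemma shrunk_cube:
 fixes z :: "real^'n::finite"
 shows "z \<in> shrunk (cube \<delta> x0) (chiJ J l) (restr_vec J xi) \<longleftrightarrow>
  z \<in> cube \<delta> x0 \<and> (\<forall>j\<in>J. x0$j < z$j + real (l j)*xi j \<and> z$j + real (l j)*xi j < x0$j + \<delta> j)"
proof
 assume *: "z \<in> shrunk (cube \<delta> x0) (chiJ J l) (restr_vec J xi)"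
 have "z + (\<chi> j. (%_. 1) j*real (chiJ J l j)*restr_vec J xi$j) \<in> cube \<delta> x0"
  using * unfolding shrunk_def mem_Collect_eq by(elim conjE allE[of _ "%_. 1"]) simp
 then have "\<forall>j\<in>J. x0$j < z$j + real (l j)*xi j \<and> z$j + real (l j)*xi j < x0$j + \<delta> j"
  unfolding mem_cube by(auto simp: chiJ_def restr_vec_def split: if_splits dest!: spec)
 then show "z \<in> cube \<delta> x0 \<and> (\<forall>j\<in>J. x0$j < z$j + real (l j)*xi j \<and> z$j + real (l j)*xi j < x0$j + \<delta> j)"
  using * by(auto simp: shrunk_def)
next
 assume *: "z \<in> cube \<delta> x0 \<and> (\<forall>j\<in>J. x0$j < z$j + real (l j)*xi j \<and> z$j + real (l j)*xi j < x0$j + \<delta> j)"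
 show "z \<in> shrunk (cube \<delta> x0) (chiJ J l) (restr_vec J xi)" unfolding shrunk_def mem_Collect_eq
 proof (intro conjI allI impI)
  show "z \<in> cube \<delta> x0" using * by simp
  fix t :: "'n => real" assume t: "\<forall>j. 0 <= t j \<and> t j <= 1"
  show "z + (\<chi> j. t j*real (chiJ J l j)*restr_vec J xi$j) \<in> cube \<delta> x0" unfolding mem_cube
  proof (intro allI)
   fix j
   have z: "x0$j < z$j" "z$j < x0$j + \<delta> j" using * by(auto simp: mem_cube)
   show "x0$j < (z + (\<chi> j. t j*real (chiJ J l j)*restr_vec J xi$j))$j \<and>
   (z + (\<chi> j. t j*real (chiJ J l j)*restr_vec J xi$j))$j < x0$j + \<delta> j"
   proof (cases "j \<in> J")
   case True
   define w where "w = z$j + real (l j)*xi j"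
   have w: "x0$j < w" "w < x0$j + \<delta> j" using * True by(auto simp: w_def)
   have tj: "0 <= t j" "t j <= 1" using t by auto
   have e: "(z + (\<chi> j. t j*real (chiJ J l j)*restr_vec J xi$j))$j = (1 - t j)*z$j + t j*w" using True by(simp add: chiJ_def restr_vec_def w_def algebra_simps)
   have "(1 - t j)*z$j + t j*w \<in> {x0$j <..< x0$j + \<delta> j}"
   using convexD[OF convex_real_interval(8)[of "x0$j" "x0$j + \<delta> j"], of "z$j" w "1 - t j" "t j"] z w tj by simp
   then show ?thesis unfolding e by simp
   next
   case False
   then show ?thesis using z by(simp add: chiJ_def)
   qed
  qed
 qed
qed

lemma finite_multi: "finite {k::'n::finite => nat. \<forall>j. k j <= m j}"
proof -
 have "{k::'n => nat. \<forall>j. k j <= m j} = (\<Pi>\<^sub>E j\<in>UNIV. {..m j})" by(auto simp: PiE_def)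
 then show ?thesis by(simp add: finite_PiE)
qed

lemma measurable_vec_nth [measurable (raw)]:
 fixes z :: "'a => real^'n::finite"
 assumes [measurable]: "z \<in> BM M"
 shows "(%w. z w$j) \<in> BM M" unfolding cart_eq_inner_axis by measurable

lemma pred_ball_fin:
 assumes "\<And>j. j \<in> (J::'n::finite set) ==> Measurable.pred M (%w. P j w)"
 shows "Measurable.pred M (%w. \<forall>j\<in>J. P j w)" by(rule pred_intros_finite(3)) (use assms in auto)

lemma measurable_PiM_component:
 "xi \<in> M \<rightarrow>\<^sub>M LJ J ==> j \<in> J ==> (%w. xi w j) \<in> BM M"
 using measurable_compose[OF _ measurable_component_singleton[of j J "%_. lborel"]] by simp

lemma measurable_vec_lambda:
 fixes g :: "'n::finite => 'a => real"
 assumes [measurable]: "\<And>j. g j \<in> BM M"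
 shows "(%w. \<chi> j. g j w) \<in> BM M" by(subst borel_measurable_euclidean_space) (auto simp: Basis_vec_def inner_axis)

lemma measurable_restr_vec:
 "(%xi. restr_vec J xi) \<in> LJ J \<rightarrow>\<^sub>M (borel :: (real^'n::finite) measure)" unfolding restr_vec_def
proof (rule measurable_vec_lambda)
 fix j :: 'n
 show "(%xi. if j \<in> J then xi j else 0) \<in> BM (LJ J)" by(cases "j \<in> J") (auto intro: measurable_component_singleton[of j J "%_. lborel", simplified])
qed

lemma measurable_mdiff:
 assumes [measurable]: "f \<in> BM borel"
 shows "(%(h, x). mdiff m h f x) \<in> BM (borel \<Otimes>\<^sub>M (borel :: (real^'n::finite) measure))"
proof -
 have "(%w. \<chi> j. real (k j)*fst w$j) \<in> BM (borel \<Otimes>\<^sub>M (borel :: (real^'n) measure))" for k :: "'n => nat" by(rule measurable_vec_lambda) measurable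
 note [measurable] = this
 show ?thesis unfolding mdiff_def split_beta by measurable
qed

lemma measurable_mdiff' [measurable (raw)]:
 fixes f :: "real^'n::finite => real"
 assumes f: "f \<in> BM borel" and [measurable]: "xi \<in> M \<rightarrow>\<^sub>M LJ J" "z \<in> BM M"
 shows "(%w. mdiff m (restr_vec J (xi w)) f (z w)) \<in> BM M"
proof -
 have [measurable]: "(%w. restr_vec J (xi w)) \<in> BM M" by(rule measurable_compose[OF _ measurable_restr_vec]) measurable
 have "(%w. (restr_vec J (xi w), z w)) \<in> M \<rightarrow>\<^sub>M borel \<Otimes>\<^sub>M borel" by measurable
 from measurable_compose[OF this measurable_mdiff[OF f]] show ?thesis by simp
qed

lemma pred_cube [measurable (raw)]:
 fixes z :: "'a => real^'n::finite"
 assumes [measurable]: "z \<in> BM M"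
 shows "Measurable.pred M (%w. z w \<in> cube \<delta> x0)" unfolding mem_cube by measurable

lemma pred_shrunk [measurable (raw)]:
 fixes z :: "'a => real^'n::finite"
 assumes [measurable]: "xi \<in> M \<rightarrow>\<^sub>M LJ J" "z \<in> BM M"
 shows "Measurable.pred M (%w. z w \<in> shrunk (cube \<delta> x0) (chiJ J l) (restr_vec J (xi w)))"
proof -
 have "Measurable.pred M (%w. \<forall>j\<in>J. x0$j < z w$j + real (l j)*xi w j \<and> z w$j + real (l j)*xi w j < x0$j + \<delta> j)"
 proof (rule pred_ball_fin)
  fix j assume "j \<in> J"
  note [measurable] = measurable_PiM_component[OF assms(1) this]
  show "Measurable.pred M (%w. x0$j < z w$j + real (l j)*xi w j \<and> z w$j + real (l j)*xi w j < x0$j + \<delta> j)" by measurable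
 qed
 then show ?thesis unfolding shrunk_cube by measurable
qed

abbreviation Q1 :: "(real^'n::finite) set" where "Q1 \<equiv> cube (%_. 1) 0"

text \<open>The absolute mixed difference extended by 0 from its natural domain; including the range
  of \<open>xi\<close> here leaves plain integrals over the whole space.\<close>

definition dd :: "(real^'n::finite => real) => ('n => nat) => 'n set => ('n => real) => ('n => real) => real^'n => ennreal" where
 "dd f l J t xi z = (if (\<forall>j\<in>J. \<bar>xi j\<bar> <= t j) \<and> z \<in> shrunk Q1 (chiJ J l) (restr_vec J xi)
  then ennreal \<bar>mdiff (chiJ J l) (restr_vec J xi) f z\<bar> else 0)"

text \<open>The localisation of \<open>z\<close> near \<open>x\<close> that \<open>kk_supp\<close>
  grants on the support of the kernel.\<close>

definition nearJ :: "('n::finite => nat) => 'n set => ('n => real) => real^'n => real^'n => bool" where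
 "nearJ l J t x z \<longleftrightarrow> (\<forall>j\<in>J. \<bar>z$j - x$j\<bar> <= real (l j)*t j)"

definition UU :: "(real^'n::finite => real) => ('n => nat) => 'n set => ('n => real) => real^'n => ennreal" where
 "UU f l J t x = (nn_integral (LJ J) (%xi. (NN z. (if nearJ l J t x z then dd f l J t xi z else 0))))"

definition inbox :: "real => 'n set => ('n => real) => bool" where
 "inbox c J t \<longleftrightarrow> (\<forall>j\<in>J. 0 < t j \<and> t j < c)"

text \<open>Up to a constant, a majorant of the term \<open>J\<close> of the representation at
  \<open>x\<close>: the weight is the bound of \<open>kk\<close> at order \<open>lam j\<close>, and
  \<open>UU\<close> integrates the difference over the support of the kernel.\<close>

definition HH :: "(real^'n::finite => real) => ('n => nat) => ('n => nat) => real => 'n set => real^'n => ennreal" where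
 "HH f l lam c J x = (nn_integral (LJ J) (%t. (if inbox c J t then ennreal (\<Prod>j\<in>J. t j powr (- real (lam j) - 3))*UU f l J t x else 0)
  ))"

lemma measurable_dd [measurable (raw)]:
 fixes z :: "'a => real^'n::finite"
 assumes [measurable]: "f \<in> BM borel" "t \<in> M \<rightarrow>\<^sub>M LJ J"
  "xi \<in> M \<rightarrow>\<^sub>M LJ J" "z \<in> BM M"
 shows "(%w. dd f l J (t w) (xi w) (z w)) \<in> BM M"
proof -
 have "Measurable.pred M (%w. \<forall>j\<in>J. \<bar>xi w j\<bar> <= t w j)"
 proof (rule pred_ball_fin)
  fix j assume j: "j \<in> J"
  note [measurable] = measurable_PiM_component[OF assms(2) j] measurable_PiM_component[OF assms(3) j]
  show "Measurable.pred M (%w. \<bar>xi w j\<bar> <= t w j)" by measurable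
 qed
 note [measurable] = this
 show ?thesis unfolding dd_def by measurable
qed

lemma pred_nearJ [measurable (raw)]:
 fixes z :: "'a => real^'n::finite"
 assumes [measurable]: "t \<in> M \<rightarrow>\<^sub>M LJ J" "x \<in> BM M" "z \<in> BM M"
 shows "Measurable.pred M (%w. nearJ l J (t w) (x w) (z w))"
proof -
 show ?thesis unfolding nearJ_def
 proof (rule pred_ball_fin)
  fix j assume j: "j \<in> J"
  note [measurable] = measurable_PiM_component[OF assms(1) j]
  show "Measurable.pred M (%w. \<bar>z w$j - x w$j\<bar> <= real (l j)*t w j)" by measurable
 qed
qed

lemma pred_inbox [measurable (raw)]:
 fixes J :: "'n::finite set"
 assumes [measurable]: "t \<in> M \<rightarrow>\<^sub>M LJ J"
 shows "Measurable.pred M (%w. inbox c J (t w))"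
proof -
 show ?thesis unfolding inbox_def
 proof (rule pred_ball_fin)
  fix j assume j: "j \<in> J"
  note [measurable] = measurable_PiM_component[OF assms(1) j]
  show "Measurable.pred M (%w. 0 < t w j \<and> t w j < c)" by measurable
 qed
qed

lemma sigma_finite_PiM_lborel: "sigma_finite_measure (LJ (J::'n::finite set))"
proof -
 interpret product_sigma_finite "%_::'n. lborel::real measure" by standard
 show ?thesis by(rule sigma_finite) simp
qed

lemma measurable_UU [measurable (raw)]:
 fixes x :: "'a => real^'n::finite"
 assumes [measurable]: "f \<in> BM borel" "t \<in> M \<rightarrow>\<^sub>M LJ J" "x \<in> BM M"
 shows "(%w. UU f l J (t w) (x w)) \<in> BM M"
proof -
 interpret P: sigma_finite_measure "LJ J" by(rule sigma_finite_PiM_lborel)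
 show ?thesis unfolding UU_def by measurable
qed

lemma measurable_prod_powr:
 fixes J :: "'n::finite set"
 assumes [measurable]: "t \<in> M \<rightarrow>\<^sub>M LJ J"
 shows "(%w. \<Prod>j\<in>J. t w j powr a j) \<in> BM M"
proof -
 show ?thesis
 proof (rule borel_measurable_prod)
  fix j assume j: "j \<in> J"
  note [measurable] = measurable_PiM_component[OF assms(1) j]
  show "(%w. t w j powr a j) \<in> BM M" by measurable
 qed
qed

lemma measurable_HH [measurable (raw)]:
 fixes x :: "'a => real^'n::finite"
 assumes [measurable]: "f \<in> BM borel" "x \<in> BM M"
 shows "(%w. HH f l lam c J (x w)) \<in> BM M"
proof -
 interpret P: sigma_finite_measure "LJ J" by(rule sigma_finite_PiM_lborel)
 have [measurable]: "(%w. \<Prod>j\<in>J. snd w j powr (- real (lam j) - 3)) \<in> BM (M \<Otimes>\<^sub>M LJ J)" by(rule measurable_prod_powr) measurable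
 show ?thesis unfolding HH_def by measurable
qed

section \<open>Hoelder and Minkowski estimates of the majorants\<close>

lemma vol_near:
 fixes x :: "real^'n::finite"
 assumes r: "\<And>j. j \<in> J ==> 0 <= r j"
 shows "(NN z. indicator {z \<in> Q1. \<forall>j\<in>J. \<bar>z$j - x$j\<bar> <= r j} z) <= ennreal (\<Prod>j\<in>J. 2*r j)"
proof -
 define a b where "a = (\<chi> j. if j \<in> J then x$j - r j else 0)" and "b = (\<chi> j. if j \<in> J then x$j + r j else 1)"
 have le: "\<forall>c\<in>Basis. a \<bullet> c <= b \<bullet> c" using r by(auto simp: Basis_vec_def inner_axis a_def b_def)
 have "(NN z. indicator {z \<in> Q1. \<forall>j\<in>J. \<bar>z$j - x$j\<bar> <= r j} z) <= (NN z. indicator (cbox a b) z)"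
  by(intro nn_integral_mono indicator_leI) (auto simp: mem_box_cart mem_cube a_def b_def abs_le_iff less_imp_le)
 also have "... = ennreal (\<Prod>c\<in>Basis. (b - a) \<bullet> c)" using le by(simp add: emeasure_lborel_cbox_eq)
 also have "(\<Prod>c\<in>Basis. (b - a) \<bullet> c) = (\<Prod>j\<in>UNIV. if j \<in> J then 2*r j else 1)"
  unfolding prod_Basis_vec by(intro prod.cong) (auto simp: inner_axis a_def b_def)
 also have "... = (\<Prod>j\<in>J. 2*r j)" by(simp add: prod.If_cases)
 finally show ?thesis .
qed

text \<open>Jensen over the pairs (xi, z). The number \<open>m\<close> bounds the measure of their
  range: each j in J contributes 2 t_j for xi and 2 l_j t_j for z.\<close>

lemma UU_mean:
 fixes f :: "real^'n::finite => real"
 assumes [measurable]: "f \<in> BM borel" and p: "1 <= p" and l: "\<And>j. 1 <= l j"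
  and t: "t \<in> space (LJ J)" "\<And>j. j \<in> J ==> 0 < t j"
 defines "m \<equiv> (\<Prod>j\<in>J. 4*real (l j))*(\<Prod>j\<in>J. t j)\<^sup>2"
 shows "epow (UU f l J t x) p <= ennreal (m powr (p - 1)) *
  (nn_integral (LJ J) (%xi. (NN z. (if nearJ l J t x z then epow (dd f l J t xi z) p else 0))))"
proof -
 let ?P = "LJ J"
 interpret P: sigma_finite_measure ?P by(rule sigma_finite_PiM_lborel)
 interpret PP: product_sigma_finite "%_::'n. lborel::real measure" by standard
 interpret pair_sigma_finite ?P "lborel :: (real^'n) measure" ..
 have [measurable]: "(%z. t) \<in> M \<rightarrow>\<^sub>M ?P" for M :: "'b measure" using t by auto
 define a where "a w = (if (\<forall>j\<in>J. \<bar>fst w j\<bar> <= t j) \<and> snd w \<in> Q1 \<and> nearJ l J t x (snd w) then 1 else 0::ennreal)" for w :: "('n => real) \<times> (real^'n)"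
 have "Measurable.pred (?P \<Otimes>\<^sub>M (borel :: (real^'n) measure)) (%w. \<forall>j\<in>J. \<bar>fst w j\<bar> <= t j)"
 proof (rule pred_ball_fin)
  fix j assume j: "j \<in> J"
  have [measurable]: "(%w. fst w j) \<in> BM (?P \<Otimes>\<^sub>M (borel :: (real^'n) measure))" by(rule measurable_PiM_component[OF _ j]) measurable
  show "Measurable.pred (?P \<Otimes>\<^sub>M (borel :: (real^'n) measure)) (%w. \<bar>fst w j\<bar> <= t j)" by measurable
 qed
 note [measurable] = this
 have [measurable]: "a \<in> BM (?P \<Otimes>\<^sub>M borel)" unfolding a_def by measurable
 have tpos: "0 < (\<Prod>j\<in>J. t j)" using t by(intro prod_pos) auto
 have lpos: "0 < (\<Prod>j\<in>J. 4*real (l j))" using l by(intro prod_pos) (auto simp: Suc_le_eq)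
 have m: "0 < m" unfolding m_def by(intro mult_pos_pos zero_less_power tpos lpos)
 have "(\<integral>\<^sup>+w. a w \<partial>(?P \<Otimes>\<^sub>M lborel)) = (nn_integral ?P (%xi. (NN z. a (xi, z))))"
  by(rule lborel.nn_integral_fst[symmetric]) measurable
 also have "... <= (nn_integral ?P (%xi. ennreal (\<Prod>j\<in>J. 2*(real (l j)*t j))*indicator (PiE J (%j. {- t j..t j})) xi))"
 proof (rule nn_integral_mono)
  fix xi assume xi: "xi \<in> space ?P"
  have box: "xi \<in> PiE J (%j. {- t j..t j}) \<longleftrightarrow> (\<forall>j\<in>J. \<bar>xi j\<bar> <= t j)"
   using xi by(auto simp: PiE_def Pi_def space_PiM abs_le_iff)
  have "(NN z. a (xi, z)) = (NN z. indicator (PiE J (%j. {- t j..t j})) xi*indicator {z \<in> Q1. \<forall>j\<in>J. \<bar>z$j - x$j\<bar> <= real (l j)*t j} z)"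
   by(intro nn_integral_cong) (use box in \<open>auto simp: a_def nearJ_def indicator_def\<close>)
  also have "... <= ennreal (\<Prod>j\<in>J. 2*(real (l j)*t j))*indicator (PiE J (%j. {- t j..t j})) xi" using vol_near[of J "%j. real (l j)*t j" x] t
   by(cases "xi \<in> PiE J (%j. {- t j..t j})") (auto simp: less_imp_le)
  finally show "(NN z. a (xi, z)) <= ..." .
 qed
 also have "... = ennreal (\<Prod>j\<in>J. 2*(real (l j)*t j))*emeasure ?P (PiE J (%j. {- t j..t j}))"
  by(subst nn_integral_cmult_indicator) (auto intro!: sets_PiM_I_finite)
 also have "emeasure ?P (PiE J (%j. {- t j..t j})) = ennreal (\<Prod>j\<in>J. 2*t j)"
  by(subst PP.emeasure_PiM) (auto simp: t less_imp_le prod_ennreal intro!: prod.cong arg_cong[of _ _ ennreal] simp flip: mult_2)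
 also have "ennreal (\<Prod>j\<in>J. 2*(real (l j)*t j))*ennreal (\<Prod>j\<in>J. 2*t j) = ennreal m"
 proof -
  have "(\<Prod>j\<in>J. 2*(real (l j)*t j))*(\<Prod>j\<in>J. 2*t j) = m" unfolding m_def power2_eq_square prod.distrib[symmetric] by(intro prod.cong) auto
  then show ?thesis by(subst ennreal_mult[symmetric]) (auto intro!: prod_nonneg mult_nonneg_nonneg simp: t less_imp_le)
 qed
 finally have mass: "(\<integral>\<^sup>+w. a w \<partial>(?P \<Otimes>\<^sub>M lborel)) <= ennreal m" .
 have ad: "a (xi, z)*(if True then dd f l J t xi z else 0) = (if nearJ l J t x z then dd f l J t xi z else 0)"
  "a (xi, z)*epow (dd f l J t xi z) p = (if nearJ l J t x z then epow (dd f l J t xi z) p else 0)" for xi z by(auto simp: a_def dd_def shrunk_cube)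
 have "epow (\<integral>\<^sup>+w. a w*dd f l J t (fst w) (snd w) \<partial>(?P \<Otimes>\<^sub>M lborel)) p \<le>
  ennreal (m powr (p - 1))*(\<integral>\<^sup>+w. a w*epow (dd f l J t (fst w) (snd w)) p \<partial>(?P \<Otimes>\<^sub>M lborel))"
  by(rule power_mean[OF p _ _ mass m]) measurable
 also have "(\<integral>\<^sup>+w. a w*dd f l J t (fst w) (snd w) \<partial>(?P \<Otimes>\<^sub>M lborel)) = UU f l J t x"
  unfolding UU_def by(subst lborel.nn_integral_fst[symmetric]) (use ad(1) in \<open>auto cong: if_cong\<close>)
 also have "(\<integral>\<^sup>+w. a w*epow (dd f l J t (fst w) (snd w)) p \<partial>(?P \<Otimes>\<^sub>M lborel)) =
  (nn_integral ?P (%xi. (NN z. (if nearJ l J t x z then epow (dd f l J t xi z) p else 0))))"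
  by(subst lborel.nn_integral_fst[symmetric]) (use ad(2) in \<open>auto cong: if_cong\<close>)
 finally show ?thesis .
qed

definition CJ :: "('n::finite => nat) => 'n set => real" where "CJ l J = (\<Prod>j\<in>J. 4*real (l j))"

definition Dt :: "(real^'n::finite => real) => real => ('n => nat) => 'n set => ('n => real) => ennreal" where
 "Dt f p l J t = (nn_integral (LJ J) (%xi. (NN z. epow (dd f l J t xi z) p)))"

lemma measurable_Dt [measurable (raw)]:
 assumes [measurable]: "f \<in> BM borel" "t \<in> M \<rightarrow>\<^sub>M LJ J"
 shows "(%w. Dt f p l J (t w)) \<in> BM M"
proof -
 interpret P: sigma_finite_measure "LJ J" by(rule sigma_finite_PiM_lborel)
 show ?thesis unfolding Dt_def by measurable
qed

lemma CJ_ge1: "(\<And>j. 1 <= l j) ==> 1 <= CJ l J" unfolding CJ_def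
proof (rule prod_ge_1)
 fix j assume l: "\<And>j. 1 <= l j"
 then have "1 <= real (l j)" by simp
 then show "1 <= 4*real (l j)" by linarith
qed

text \<open>The case q = infinity: the localisation of z is simply dropped after
  \<open>UU_mean\<close>, which leaves the power 2 - 2/p of the product of the scales.\<close>

lemma UU_sup:
 fixes f :: "real^'n::finite => real"
 assumes f: "f \<in> BM borel" and p: "1 <= p" and l: "\<And>j. 1 <= l j"
  and t: "t \<in> space (LJ J)" "\<And>j. j \<in> J ==> 0 < t j"
 shows "UU f l J t x <= ennreal (CJ l J*(\<Prod>j\<in>J. t j) powr (2 - 2/p))*epow (Dt f p l J t) (1/p)"
proof -
 define \<tau> where "\<tau> = (\<Prod>j\<in>J. t j)"
 have tau: "0 < \<tau>" unfolding \<tau>_def using t by(intro prod_pos) auto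
 have C: "1 <= CJ l J" by(rule CJ_ge1[OF l])
 define m where "m = CJ l J*\<tau>\<^sup>2"
 have m: "0 < m" using C tau by(simp add: m_def)
 have mp: "m powr a = CJ l J powr a*\<tau> powr (2*a)" for a
 proof -
  have "m = CJ l J*\<tau> powr 2" using tau by(simp add: m_def)
  then show ?thesis using tau C by(simp add: powr_mult powr_powr del: powr_numeral)
 qed
 have "epow (UU f l J t x) p <= ennreal (m powr (p - 1)) *
  (nn_integral (LJ J) (%xi. (NN z. (if nearJ l J t x z then epow (dd f l J t xi z) p else 0))))" using UU_mean[OF f p l t] by(simp add: m_def \<tau>_def CJ_def)
 also have "... <= ennreal (m powr (p - 1))*Dt f p l J t" unfolding Dt_def by(intro mult_left_mono nn_integral_mono) auto
 finally have "epow (epow (UU f l J t x) p) (1/p) <= epow (ennreal (m powr (p - 1))*Dt f p l J t) (1/p)" using p by(intro epow_mono) auto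
 also have "... = ennreal (m powr (1 - 1/p))*epow (Dt f p l J t) (1/p)" using p by(simp add: epow_mult epow_ennreal powr_powr diff_divide_distrib)
 also have "ennreal (m powr (1 - 1/p)) <= ennreal (CJ l J*\<tau> powr (2 - 2/p))"
 proof (rule ennreal_leI)
  have "m powr (1 - 1/p) = CJ l J powr (1 - 1/p)*\<tau> powr (2 - 2/p)" by(simp add: mp right_diff_distrib)
  also have "... <= CJ l J powr 1*\<tau> powr (2 - 2/p)" using C p by(intro mult_right_mono powr_mono) auto
  finally show "m powr (1 - 1/p) <= CJ l J*\<tau> powr (2 - 2/p)" using C by simp
 qed
 finally show ?thesis using p by(simp add: epow_epow \<tau>_def mult_right_mono)
qed

text \<open>Of the power q/p of the local integral \<open>Dx\<close>, the surplus q/p - 1 is bounded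
  by the global \<open>D\<close> and a single factor is integrated in \<open>x\<close>. Fubini then
  gains one more power of the product of the scales, which is the summand 1/q in the
  exponent.\<close>

lemma UU_Lq:
 fixes f :: "real^'n::finite => real"
 assumes f[measurable]: "f \<in> BM borel" and p: "1 <= p" "p <= q" and l: "\<And>j. 1 <= l j"
  and t: "t \<in> space (LJ J)" "\<And>j. j \<in> J ==> 0 < t j"
 shows "(NN x. (if x \<in> Q1 then epow (UU f l J t x) q else 0)) \<le>
  epow (ennreal (CJ l J*(\<Prod>j\<in>J. t j) powr (2 - 2/p + 1/q))*epow (Dt f p l J t) (1/p)) q"
proof -
 let ?P = "LJ J"
 interpret P: sigma_finite_measure ?P by(rule sigma_finite_PiM_lborel)
 interpret PL: pair_sigma_finite ?P "lborel :: (real^'n) measure" ..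
 interpret LP: pair_sigma_finite "lborel :: (real^'n) measure" "?P \<Otimes>\<^sub>M (lborel :: (real^'n) measure)"
  by(intro pair_sigma_finite.intro sigma_finite_lborel PL.sigma_finite_measure_axioms)
 define \<tau> where "\<tau> = (\<Prod>j\<in>J. t j)"
 have tau: "0 < \<tau>" unfolding \<tau>_def using t by(intro prod_pos) auto
 define C where "C = CJ l J"
 have C: "1 <= C" unfolding C_def by(rule CJ_ge1[OF l])
 define m where "m = C*\<tau>\<^sup>2"
 have m: "0 < m" using C tau by(simp add: m_def)
 have mp: "m powr a = C powr a*\<tau> powr (2*a)" for a
 proof -
  have "m = C*\<tau> powr 2" using tau by(simp add: m_def)
  then show ?thesis using tau C by(simp add: powr_mult powr_powr del: powr_numeral)
 qed
 define D where "D = Dt f p l J t"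
 define Dx where "Dx x = (nn_integral ?P (%xi. (NN z. (if nearJ l J t x z then epow (dd f l J t xi z) p else 0))))" for x
 have tm[measurable]: "(%z. t) \<in> M \<rightarrow>\<^sub>M ?P" for M :: "'b measure" using t by auto
 have Dx_le: "Dx x <= D" for x unfolding D_def Dx_def Dt_def by(intro nn_integral_mono) auto
 have [measurable]: "Dx \<in> BM borel" unfolding Dx_def by measurable
 \<comment> \<open>For fixed z the points x near z fill a box whose volume is at most C times the
   product of the scales.\<close>
 have intD: "(NN x. (if x \<in> Q1 then Dx x else 0)) <= ennreal (C*\<tau>)*D"
 proof -
  have "(NN x. (if x \<in> Q1 then Dx x else 0)) =
   (NN x. (\<integral>\<^sup>+w. (if x \<in> Q1 \<and> nearJ l J t x (snd w) then epow (dd f l J t (fst w) (snd w)) p else 0) \<partial>(?P \<Otimes>\<^sub>M lborel)))"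
  proof (rule nn_integral_cong)
   fix x :: "real^'n"
   have "Dx x = (\<integral>\<^sup>+w. (if nearJ l J t x (snd w) then epow (dd f l J t (fst w) (snd w)) p else 0) \<partial>(?P \<Otimes>\<^sub>M lborel))"
   unfolding Dx_def by(subst lborel.nn_integral_fst[symmetric]) (measurable, simp cong: if_cong)
   then show "(if x \<in> Q1 then Dx x else 0) = (\<integral>\<^sup>+w. (if x \<in> Q1 \<and> nearJ l J t x (snd w) then epow (dd f l J t (fst w) (snd w)) p else 0) \<partial>(?P \<Otimes>\<^sub>M lborel))"
   by simp
  qed
  also have "... = (\<integral>\<^sup>+w. (NN x. (if x \<in> Q1 \<and> nearJ l J t x (snd w) then epow (dd f l J t (fst w) (snd w)) p else 0)) \<partial>(?P \<Otimes>\<^sub>M lborel))"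
   by(rule LP.Fubini'[symmetric]) measurable
  also have "... <= (\<integral>\<^sup>+w. ennreal (C*\<tau>)*epow (dd f l J t (fst w) (snd w)) p \<partial>(?P \<Otimes>\<^sub>M lborel))"
  proof (rule nn_integral_mono)
   fix w :: "('n => real) \<times> (real^'n)"
   let ?e = "epow (dd f l J t (fst w) (snd w)) p"
   have "(NN x. (if x \<in> Q1 \<and> nearJ l J t x (snd w) then ?e else 0)) =
   (NN x. ?e*indicator {x \<in> Q1. \<forall>j\<in>J. \<bar>x$j - snd w$j\<bar> <= real (l j)*t j} x)"
   by(intro nn_integral_cong) (auto simp: nearJ_def indicator_def abs_minus_commute)
   also have "... = ?e*(NN x. indicator {x \<in> Q1. \<forall>j\<in>J. \<bar>x$j - snd w$j\<bar> <= real (l j)*t j} x)"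
   proof (rule nn_integral_cmult)
   have [measurable]: "Measurable.pred borel (%x. \<forall>j\<in>J. \<bar>x$j - snd w$j\<bar> <= real (l j)*t j)" by(rule pred_ball_fin) measurable
   show "indicator {x \<in> Q1. \<forall>j\<in>J. \<bar>x$j - snd w$j\<bar> <= real (l j)*t j} \<in> BM lborel" unfolding indicator_def mem_Collect_eq by measurable
   qed
   also have "... <= ?e*ennreal (\<Prod>j\<in>J. 2*(real (l j)*t j))" by(intro mult_left_mono vol_near) (use t in \<open>auto simp: less_imp_le\<close>)
   also have "... <= ?e*ennreal (C*\<tau>)"
   proof (intro mult_left_mono ennreal_leI)
   have "(\<Prod>j\<in>J. 2*(real (l j)*t j)) <= (\<Prod>j\<in>J. 4*real (l j)*t j)" by(intro prod_mono conjI) (use t in \<open>auto simp: less_imp_le\<close>)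
   then show "(\<Prod>j\<in>J. 2*(real (l j)*t j)) <= C*\<tau>" by(simp add: C_def CJ_def \<tau>_def prod.distrib)
   qed simp
   finally show "(NN x. (if x \<in> Q1 \<and> nearJ l J t x (snd w) then ?e else 0)) <= ennreal (C*\<tau>)*?e" by(simp add: mult.commute)
  qed
  also have "... = ennreal (C*\<tau>)*(\<integral>\<^sup>+w. epow (dd f l J t (fst w) (snd w)) p \<partial>(?P \<Otimes>\<^sub>M lborel))"
   by(rule nn_integral_cmult) measurable
  also have "(\<integral>\<^sup>+w. epow (dd f l J t (fst w) (snd w)) p \<partial>(?P \<Otimes>\<^sub>M lborel)) = D"
   unfolding D_def Dt_def by(subst lborel.nn_integral_fst[symmetric]) auto
  finally show ?thesis .
 qed
 \<comment> \<open>The exponent (p - 1) q/p that \<open>m\<close> acquires when the Jensen bound is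
   raised to the power q/p.\<close>
 define e where "e = q - q/p"
 have e: "0 <= e" "e + 1 <= q" using p by(auto simp: e_def field_simps mult_right_mono) 
 have pw: "epow (UU f l J t x) q <= ennreal (m powr e)*epow D (q/p - 1)*Dx x" for x
 proof -
  have "epow (UU f l J t x) p <= ennreal (m powr (p - 1))*Dx x" using UU_mean[OF f p(1) l t] by(simp add: m_def \<tau>_def CJ_def C_def Dx_def)
  then have "epow (epow (UU f l J t x) p) (q/p) <= epow (ennreal (m powr (p - 1))*Dx x) (q/p)" using p by(intro epow_mono) auto
  also have "... = ennreal (m powr e)*epow (Dx x) (q/p - 1 + 1)"
  proof -
   have "(p - 1)*(q/p) = e" using p by(simp add: e_def field_simps)
   then show ?thesis using p by(simp add: epow_mult epow_ennreal powr_powr del: times_divide_eq_right)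
  qed
  also have "... = ennreal (m powr e)*(epow (Dx x) (q/p - 1)*Dx x)" unfolding epow_add epow_one ..
  also have "... <= ennreal (m powr e)*(epow D (q/p - 1)*Dx x)" using p by(intro mult_left_mono mult_right_mono epow_mono Dx_le) auto
  finally show ?thesis using p by(simp add: epow_epow mult.assoc)
 qed
 have "(NN x. (if x \<in> Q1 then epow (UU f l J t x) q else 0)) \<le>
  (NN x. ennreal (m powr e)*epow D (q/p - 1)*(if x \<in> Q1 then Dx x else 0))" by(intro nn_integral_mono) (use pw in auto)
 also have "... = ennreal (m powr e)*epow D (q/p - 1)*(NN x. (if x \<in> Q1 then Dx x else 0))" by(rule nn_integral_cmult) measurable
 also have "... <= ennreal (m powr e)*epow D (q/p - 1)*(ennreal (C*\<tau>)*D)" by(intro mult_left_mono intD) simp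
 also have "... = ennreal (m powr e*(C*\<tau>))*epow D (q/p - 1 + 1)" unfolding epow_add epow_one using C tau by(simp add: ennreal_mult mult_ac)
 also have "... <= ennreal ((C*\<tau> powr (2 - 2/p + 1/q)) powr q)*epow D (q/p - 1 + 1)"
 proof (intro mult_right_mono ennreal_leI)
  have "m powr e*(C*\<tau>) = C powr (e + 1)*\<tau> powr (2*e + 1)" using C tau by(simp add: mp powr_add)
  also have "... <= C powr q*\<tau> powr (2*e + 1)" using C e by(intro mult_right_mono powr_mono) auto
  also have "2*e + 1 = (2 - 2/p + 1/q)*q" using p by(simp add: e_def field_simps)
  also have "C powr q*\<tau> powr ((2 - 2/p + 1/q)*q) = (C*\<tau> powr (2 - 2/p + 1/q)) powr q" using C tau by(simp add: powr_mult powr_powr)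
  finally show "m powr e*(C*\<tau>) <= (C*\<tau> powr (2 - 2/p + 1/q)) powr q" .
 qed simp
 also have "... = epow (ennreal (C*\<tau> powr (2 - 2/p + 1/q))*epow D (1/p)) q" using p C by(simp add: epow_mult epow_epow epow_ennreal)
 finally show ?thesis by(simp add: C_def \<tau>_def D_def)
qed

text \<open>The integral belonging to \<open>J\<close> in \<open>Wf\<close> on the unit cube, with a
  free parameter \<open>s\<close> in place of (1/p - 1/q)_+.\<close>

definition WJ :: "(real^'n::finite => real) => real => ('n => nat) => ('n => nat) => real => real => 'n set => ennreal" where
 "WJ f p l lam s c J = (nn_integral (LJ J) (%t. (if inbox c J t then ennreal (\<Prod>j\<in>J. t j powr (- real (lam j) - 1/p - s - 1))*epow (Dt f p l J t) (1/p) else 0)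
  ))"

text \<open>The balance of exponents: the kernel bound -lam - 3 and the Hoelder gain 2 - 2/p + r
  combine to the weight of W with s = 1/p - r. It is used with r = 1/q, and with r = 0 for q =
  infinity.\<close>

lemma inbox_weight:
 fixes t :: "'n::finite => real"
 assumes "inbox c J t"
 shows "(\<Prod>j\<in>J. t j powr (- real (lam j) - 3))*(\<Prod>j\<in>J. t j) powr (2 - 2/p + r)
  = (\<Prod>j\<in>J. t j powr (- real (lam j) - 1/p - (1/p - r) - 1))"
proof -
 have "(\<Prod>j\<in>J. t j) powr (2 - 2/p + r) = (\<Prod>j\<in>J. t j powr (2 - 2/p + r))"
  using assms by(induction J rule: infinite_finite_induct) (auto simp: inbox_def powr_mult prod_nonneg less_imp_le)
 then show ?thesis by(simp add: prod.distrib[symmetric] powr_add[symmetric]) (intro prod.cong refl arg_cong2[of _ _ _ _ "(powr)"], simp add: field_simps)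
qed

lemma HH_sup:
 fixes f :: "real^'n::finite => real"
 assumes f[measurable]: "f \<in> BM borel" and p: "1 <= p" and l: "\<And>j. 1 <= l j"
  and W: "WJ f p l lam (1/p) c J <= ennreal w" "0 <= w"
 shows "HH f l lam c J x <= ennreal (CJ l J*w)"
proof -
 have C: "1 <= CJ l J" by(rule CJ_ge1[OF l])
 have "HH f l lam c J x <= (nn_integral (LJ J) (%t. ennreal (CJ l J)*(if inbox c J t then ennreal (\<Prod>j\<in>J. t j powr (- real (lam j) - 1/p - 1/p - 1))*epow (Dt f p l J t) (1/p) else 0)))"
  unfolding HH_def
 proof (rule nn_integral_mono)
  fix t assume t: "t \<in> space (LJ J)"
  show "(if inbox c J t then ennreal (\<Prod>j\<in>J. t j powr (- real (lam j) - 3))*UU f l J t x else 0)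
   <= ennreal (CJ l J)*(if inbox c J t then ennreal (\<Prod>j\<in>J. t j powr (- real (lam j) - 1/p - 1/p - 1))*epow (Dt f p l J t) (1/p) else 0)"
  proof (cases "inbox c J t")
   case True
   have "ennreal (\<Prod>j\<in>J. t j powr (- real (lam j) - 3))*UU f l J t x \<le>
   ennreal (\<Prod>j\<in>J. t j powr (- real (lam j) - 3))*(ennreal (CJ l J*(\<Prod>j\<in>J. t j) powr (2 - 2/p))*epow (Dt f p l J t) (1/p))"
   by(intro mult_left_mono UU_sup f p l t) (use True in \<open>auto simp: inbox_def\<close>)
   also have "... = ennreal (CJ l J)*(ennreal ((\<Prod>j\<in>J. t j powr (- real (lam j) - 3))*(\<Prod>j\<in>J. t j) powr (2 - 2/p + 0))*epow (Dt f p l J t) (1/p))"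
   using C by(simp add: ennreal_mult prod_nonneg mult_ac)
   also have "... = ennreal (CJ l J)*(ennreal (\<Prod>j\<in>J. t j powr (- real (lam j) - 1/p - 1/p - 1))*epow (Dt f p l J t) (1/p))"
   unfolding inbox_weight[OF True] by simp
   finally show ?thesis using True by simp
  qed simp
 qed
 also have "... = ennreal (CJ l J)*WJ f p l lam (1/p) c J" unfolding WJ_def
 proof (rule nn_integral_cmult)
  have [measurable]: "(%t. \<Prod>j\<in>J. t j powr (- real (lam j) - 1/p - 1/p - 1)) \<in> BM (LJ J)" by(rule measurable_prod_powr) measurable
  show "(%t. if inbox c J t then ennreal (\<Prod>j\<in>J. t j powr (- real (lam j) - 1/p - 1/p - 1))*epow (Dt f p l J t) (1/p) else 0)
   \<in> BM (LJ J)" by measurable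
 qed
 also have "... <= ennreal (CJ l J)*ennreal w" by(intro mult_left_mono W) simp
 finally show ?thesis using C W by(simp add: ennreal_mult)
qed

text \<open>Minkowski over the scales \<open>t\<close>, with \<open>UU_Lq\<close> at each fixed
  \<open>t\<close>. The set of admissible scales is a bounded box, hence of finite measure as
  \<open>minkowski_nn\<close> requires.\<close>

lemma HH_Lq:
 fixes f :: "real^'n::finite => real"
 assumes f[measurable]: "f \<in> BM borel" and p: "1 <= p" "p <= q" and l: "\<And>j. 1 <= l j"
  and W: "WJ f p l lam (1/p - 1/q) c J <= ennreal w" "0 <= w"
  and fin: "\<And>t. t \<in> space (LJ J) ==> inbox c J t ==> Dt f p l J t < \<infinity>"
 shows "(NN x. (if x \<in> Q1 then epow (HH f l lam c J x) q else 0)) <= ennreal ((CJ l J*w) powr q)"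
proof -
 let ?P = "LJ J"
 interpret P: sigma_finite_measure ?P by(rule sigma_finite_PiM_lborel)
 interpret PP: product_sigma_finite "%_::'n. lborel::real measure" by standard
 have C: "1 <= CJ l J" by(rule CJ_ge1[OF l])
 define G where "G t x = (if inbox c J t \<and> x \<in> Q1 then ennreal (\<Prod>j\<in>J. t j powr (- real (lam j) - 3))*UU f l J t x else 0)" for t x
 define b where "b t = ennreal (CJ l J)*(if inbox c J t then ennreal (\<Prod>j\<in>J. t j powr (- real (lam j) - 1/p - (1/p - 1/q) - 1))*epow (Dt f p l J t) (1/p) else 0)" for t
 have [measurable]: "(%t. \<Prod>j\<in>J. t j powr (- real (lam j) - 1/p - (1/p - 1/q) - 1)) \<in> borel_measurable ?P" by(rule measurable_prod_powr) measurable
 have [measurable]: "(%w. \<Prod>j\<in>J. fst w j powr (- real (lam j) - 3)) \<in> BM (?P \<Otimes>\<^sub>M (borel::(real^'n) measure))"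
  by(rule measurable_prod_powr) measurable
 have "(NN x. epow (nn_integral ?P (%t. G t x)) q) <= ennreal ((CJ l J*w) powr q)"
 proof (rule minkowski_nn[where b = b and S = "{t \<in> space ?P. inbox c J t}"])
  show "sigma_finite_measure ?P" by(rule sigma_finite_PiM_lborel)
  show "sigma_finite_measure (lborel :: (real^'n) measure)" by(rule sigma_finite_lborel)
  show "case_prod G \<in> BM (?P \<Otimes>\<^sub>M lborel)" unfolding G_def split_beta by measurable
  show "b \<in> borel_measurable ?P" unfolding b_def by measurable
  show S: "{t \<in> space ?P. inbox c J t} \<in> sets ?P" by measurable
  show "emeasure ?P {t \<in> space ?P. inbox c J t} < \<infinity>"
  proof -
   have "{t \<in> space ?P. inbox c J t} = PiE J (%_. {0<..<c})" by(auto simp: space_PiM inbox_def PiE_def Pi_def)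
   then have "emeasure ?P {t \<in> space ?P. inbox c J t} = (\<Prod>j\<in>J. emeasure lborel {0<..<c})" by(simp add: PP.emeasure_PiM)
   also have "... ~= top" by(cases "0 <= c") (auto simp: ennreal_power power_0_left)
   finally show ?thesis by(simp add: less_top)
  qed
  show "1 <= q" using p by simp
  show "b t < \<infinity>" if "t \<in> {t \<in> space ?P. inbox c J t}" for t using fin[of t] that by(auto simp: b_def epow_def ennreal_mult_less_top)
  show "G t x = 0" if "t \<in> space ?P" "t \<notin> {t \<in> space ?P. inbox c J t}" for t x using that by(simp add: G_def)
  show "(nn_integral ?P (%t. b t)) <= ennreal (CJ l J*w)"
  proof -
   have "(nn_integral ?P (%t. b t)) = ennreal (CJ l J)*WJ f p l lam (1/p - 1/q) c J" unfolding WJ_def b_def by(rule nn_integral_cmult) measurable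
   also have "... <= ennreal (CJ l J)*ennreal w" by(intro mult_left_mono W) simp
   finally show ?thesis using C W by(simp add: ennreal_mult)
  qed
  show "0 <= CJ l J*w" using C W by simp
  show "(NN x. epow (G t x) q) <= epow (b t) q" if t: "t \<in> {t \<in> space ?P. inbox c J t}" for t
  proof -
   have tm[measurable]: "(%z. t) \<in> M \<rightarrow>\<^sub>M ?P" for M :: "'b measure" using t by auto
   have i: "inbox c J t" using t by simp
   let ?w = "ennreal (\<Prod>j\<in>J. t j powr (- real (lam j) - 3))"
   have "(NN x. epow (G t x) q) = (NN x. epow ?w q*(if x \<in> Q1 then epow (UU f l J t x) q else 0))" using i p by(intro nn_integral_cong) (simp add: G_def epow_mult)
   also have "... = epow ?w q*(NN x. (if x \<in> Q1 then epow (UU f l J t x) q else 0))" by(rule nn_integral_cmult) measurable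
   also have "... <= epow ?w q*epow (ennreal (CJ l J*(\<Prod>j\<in>J. t j) powr (2 - 2/p + 1/q))*epow (Dt f p l J t) (1/p)) q"
   by(intro mult_left_mono UU_Lq f p l) (use t in \<open>auto simp: inbox_def\<close>)
   also have "... = epow (ennreal (CJ l J)*(ennreal ((\<Prod>j\<in>J. t j powr (- real (lam j) - 3))*(\<Prod>j\<in>J. t j) powr (2 - 2/p + 1/q))*epow (Dt f p l J t) (1/p))) q"
   using C p by(simp add: epow_mult[symmetric] ennreal_mult prod_nonneg mult_ac)
   also have "... = epow (b t) q" unfolding inbox_weight[OF i] using i by(simp add: b_def)
   finally show ?thesis .
  qed
 qed
 moreover have "(nn_integral ?P (%t. G t x)) = (if x \<in> Q1 then HH f l lam c J x else 0)" for x by(simp add: G_def HH_def cong: if_cong)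
 ultimately show ?thesis by(simp add: if_distrib[of "%a. epow a q"] cong: if_cong)
qed

section \<open>Tensor product kernels and their action on test functions\<close>

context bump
begin

text \<open>The kernel of the term \<open>J\<close>: difference kernels at their own scales in the
  coordinates of \<open>J\<close>, and the fixed smoothing at scale \<open>c\<close> in all others.
  \<open>i\<close> is the order of the derivatives in \<open>x\<close>.\<close>

definition EE :: "('n::finite => nat) => real => 'n set => ('n => nat) => ('n => real) => ('n => real) => real^'n => real^'n => real" where
 "EE l c J i t xi x z = (\<Prod>j\<in>UNIV. if j \<in> J then kk (l j) (i j) (t j) (x$j) (z$j) (xi j) else TT (l j) (i j) c (x$j) (z$j))"

text \<open>Every coordinate receives the factor (1/c)^(lam j + 2), which only those outside
  \<open>J\<close> produce; since c <= 1 it is at least 1, and the constant no longer depends on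
  \<open>J\<close>.\<close>

definition CE :: "('n::finite => nat) => real => ('n => nat) => real" where
 "CE l c lam = (\<Prod>j\<in>UNIV. kC (l j) (lam j)*(1/c)^(lam j + 2))"

lemma kC_mono: "i <= i' ==> kC l i <= kC l i'" unfolding kC_def by(intro mult_right_mono mult_left_mono power_increasing) auto

lemma CE_pos: "0 < c ==> 0 < CE l c lam" unfolding CE_def by(intro prod_pos ballI mult_pos_pos kC_pos zero_less_power) simp

lemma EE_bound:
 fixes x z :: "real^'n::finite"
 assumes c: "0 < c" "c <= 1" and x: "x \<in> Q1" and t: "inbox c J t" and i: "\<And>j. i j <= lam j"
 shows "\<bar>EE l c J i t xi x z\<bar> <= CE l c lam*(\<Prod>j\<in>J. t j powr (- real (lam j) - 3))"
proof -
 have x': "0 < x$j" "x$j < 1" for j using x by(auto simp: mem_cube)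
 have c1: "1 <= 1/c" using c by(simp add: field_simps)
 have "\<bar>EE l c J i t xi x z\<bar> = (\<Prod>j\<in>UNIV. \<bar>if j \<in> J then kk (l j) (i j) (t j) (x$j) (z$j) (xi j) else TT (l j) (i j) c (x$j) (z$j)\<bar>)"
  unfolding EE_def by(rule abs_prod)
 also have "... <= (\<Prod>j\<in>UNIV. (kC (l j) (lam j)*(1/c)^(lam j + 2))*(if j \<in> J then t j powr (- real (lam j) - 3) else 1))"
 proof (intro prod_mono conjI)
  fix j
  have kc: "kC (l j) (i j) <= kC (l j) (lam j)" by(rule kC_mono[OF i])
  have k0: "0 <= kC (l j) (i j)" "0 <= kC (l j) (lam j)" using kC_pos[of "l j" "i j"] kC_pos[of "l j" "lam j"] by auto
  show "\<bar>if j \<in> J then kk (l j) (i j) (t j) (x$j) (z$j) (xi j) else TT (l j) (i j) c (x$j) (z$j)\<bar>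
   <= (kC (l j) (lam j)*(1/c)^(lam j + 2))*(if j \<in> J then t j powr (- real (lam j) - 3) else 1)"
  proof (cases "j \<in> J")
   case True
   then have tj: "0 < t j" "t j < c" using t by(auto simp: inbox_def)
   have "\<bar>kk (l j) (i j) (t j) (x$j) (z$j) (xi j)\<bar> <= kC (l j) (i j)*(1/t j)^(i j + 3)" by(rule kk_bound) (use tj c x' in auto)
   also have "... <= kC (l j) (lam j)*(1/t j)^(lam j + 3)" using tj c i k0 by(intro mult_mono kc power_increasing) (auto simp: field_simps)
   also have "(1/t j)^(lam j + 3) = t j powr (- real (lam j) - 3)"
   proof -
   have "(1/t j)^n = t j powr (- real n)" for n using tj by(simp add: powr_minus powr_realpow power_one_over inverse_eq_divide)
   from this[of "lam j + 3"] show ?thesis by(simp add: add.commute)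
   qed
   also have "kC (l j) (lam j)*t j powr (- real (lam j) - 3) <= (kC (l j) (lam j)*(1/c)^(lam j + 2))*t j powr (- real (lam j) - 3)"
   using mult_left_mono[OF one_le_power[OF c1, of "lam j + 2"] k0(2)] by(intro mult_right_mono) simp_all
   finally show ?thesis using True by simp
  next
   case False
   have "\<bar>TT (l j) (i j) c (x$j) (z$j)\<bar> <= kC (l j) (i j)*(1/c)^(i j + 2)" by(rule TT_bound[OF c])
   also have "... <= kC (l j) (lam j)*(1/c)^(lam j + 2)" using c c1 i k0 by(intro mult_mono kc power_increasing) auto
   finally show ?thesis using False by simp
  qed
 qed auto
 also have "... = CE l c lam*(\<Prod>j\<in>J. t j powr (- real (lam j) - 3))" unfolding CE_def
  by(subst prod.distrib, rule arg_cong2[of _ _ _ _ "(*)"]) (simp_all add: prod.If_cases)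
 finally show ?thesis .
qed

lemma EE_supp:
 fixes x z :: "real^'n::finite"
 assumes nz: "EE l c J i t xi x z ~= 0" and c: "0 < c" "\<And>j. 2*real (l j)*c <= 1" and x: "x \<in> Q1" and t: "inbox c J t"
 shows "nearJ l J t x z" "\<forall>j\<in>J. \<bar>xi j\<bar> <= t j" "z \<in> shrunk Q1 (chiJ J l) (restr_vec J xi)"
proof -
 have x': "0 < x$j" "x$j < 1" for j using x by(auto simp: mem_cube)
 have f: "(if j \<in> J then kk (l j) (i j) (t j) (x$j) (z$j) (xi j) else TT (l j) (i j) c (x$j) (z$j)) ~= 0" for j using nz unfolding EE_def by(simp add: prod_zero_iff)
 have a: "\<bar>xi j\<bar> <= t j \<and> \<bar>z$j - x$j\<bar> <= real (l j)*t j \<and> 0 < z$j \<and> z$j < 1 \<and> 0 < z$j + real (l j)*xi j \<and> z$j + real (l j)*xi j < 1" if j: "j \<in> J" for j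
 proof -
  have tj: "0 < t j" "t j < c" using t j by(auto simp: inbox_def)
  have "2*real (l j)*t j <= 2*real (l j)*c" using tj by(intro mult_left_mono) auto
  then have "2*real (l j)*t j <= 1" using c(2)[of j] by linarith
  then show ?thesis using kk_supp[of "l j" "i j" "t j" "x$j" "z$j" "xi j"] f[of j] j x' tj by auto
 qed
 have b: "0 < z$j \<and> z$j < 1" for j using a[of j] f[of j] TT_supp(1,2)[of "l j" "i j" c "x$j" "z$j"] x' c by(cases "j \<in> J") auto
 show "nearJ l J t x z" "\<forall>j\<in>J. \<bar>xi j\<bar> <= t j" "z \<in> shrunk Q1 (chiJ J l) (restr_vec J xi)"
  using a b by(auto simp: nearJ_def shrunk_cube mem_cube)
qed

lemma measurable_EE:
 fixes x z :: "'a => real^'n::finite"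
 assumes c: "0 < c" and t: "t \<in> M \<rightarrow>\<^sub>M LJ J"
  and xi: "xi \<in> M \<rightarrow>\<^sub>M LJ J"
  and [measurable]: "x \<in> BM M" "z \<in> BM M"
 shows "(%w. EE l c J i (t w) (xi w) (x w) (z w)) \<in> BM M" unfolding EE_def
proof (rule borel_measurable_prod)
 fix j
 show "(%w. if j \<in> J then kk (l j) (i j) (t w j) (x w$j) (z w$j) (xi w j) else TT (l j) (i j) c (x w$j) (z w$j)) \<in> BM M"
 proof (cases "j \<in> J")
  case True
  note [measurable] = measurable_PiM_component[OF t True] measurable_PiM_component[OF xi True]
  show ?thesis using True by simp
 next
  case False
  have "(%w. TT (l j) (i j) c (x w$j) (z w$j)) \<in> BM M" by(rule TT_measurable[OF c]) measurable
  then show ?thesis using False by simp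
 qed
qed

definition PT :: "('n::finite => nat) => real => real^'n => real^'n => real" where
 "PT l e x y = (\<Prod>j\<in>UNIV. TT (l j) 0 e (x$j) (y$j))"

lemma measurable_PT:
 fixes x y :: "'a => real^'n::finite"
 assumes e: "0 < e" and [measurable]: "x \<in> BM M" "y \<in> BM M"
 shows "(%w. PT l e (x w) (y w)) \<in> BM M" unfolding PT_def by(intro borel_measurable_prod TT_measurable[OF e]) measurable

text \<open>Each coordinate gives the length 4 l e of the interval |x - y| <= 2 l e times the kernel
  bound \<open>TC\<close>/e; the scale e cancels.\<close>

definition CA :: "('n::finite => nat) => real" where "CA l = (\<Prod>j\<in>UNIV. 4*real (l j)*TC (l j))"

lemma CA_nonneg: "0 <= CA l" unfolding CA_def by(intro prod_nonneg) (auto simp: TC_nonneg)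

lemma PT_bound:
 fixes x y :: "real^'n::finite"
 assumes x: "x \<in> Q1" and e: "0 < e" "\<And>j. 2*real (l j)*e <= 1"
 shows "\<bar>PT l e x y\<bar> <= (\<Prod>j\<in>UNIV. TC (l j)*(1/e))"
  and "PT l e x y ~= 0 ==> y \<in> Q1"
  and "PT l e x y ~= 0 ==> \<bar>x$j - y$j\<bar> <= 2*real (l j)*e"
proof -
 have x': "0 < x$j" "x$j < 1" for j using x by(auto simp: mem_cube)
 show "\<bar>PT l e x y\<bar> <= (\<Prod>j\<in>UNIV. TC (l j)*(1/e))" unfolding PT_def abs_prod by(intro prod_mono conjI TT0_bound x' e) auto
 have "PT l e x y ~= 0 ==> TT (l j) 0 e (x$j) (y$j) ~= 0" for j unfolding PT_def by(simp add: prod_zero_iff)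
 from TT_supp[OF this x' e(1) e(2)] 
 show "PT l e x y ~= 0 ==> y \<in> Q1" "PT l e x y ~= 0 ==> \<bar>x$j - y$j\<bar> <= 2*real (l j)*e" by(auto simp: mem_cube abs_minus_commute)
qed

text \<open>The bound does not depend on \<open>e\<close>, because the size of the kernel and the
  volume of its support compensate. With \<open>\<eta>\<close> a small local bound it yields
  convergence, with a global bound the dominating function.\<close>

lemma PT_slice:
 fixes y :: "real^'n::finite" and \<psi> :: "real^'n => real"
 assumes [measurable]: "\<psi> \<in> BM borel" and e: "0 < e" "\<And>j. 2*real (l j)*e <= 1"
  and psi: "\<And>x. \<bar>\<psi> x\<bar> <= \<Psi>" "\<And>x. x \<notin> Q1 ==> \<psi> x = 0" and loc: "\<And>x. x \<in> Q1 ==> PT l e x y ~= 0 ==> \<bar>\<psi> x\<bar> <= \<eta>" "0 <= \<eta>"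
 shows "integrable lborel (%x. \<psi> x*PT l e x y)" "\<bar>\<integral>x. \<psi> x*PT l e x y \<partial>lborel\<bar> <= \<eta>*CA l"
proof -
 define A where "A = {x \<in> Q1. \<forall>j\<in>UNIV. \<bar>x$j - y$j\<bar> <= 2*real (l j)*e}"
 define K where "K = (\<Prod>j\<in>(UNIV::'n set). TC (l j)*(1/e))"
 have [measurable]: "(%x. PT l e x y) \<in> BM borel" by(rule measurable_PT[OF e(1)]) measurable
 have K: "0 <= K" unfolding K_def by(intro prod_nonneg) (use e TC_nonneg in auto)
 have b: "\<bar>\<psi> x*PT l e x y\<bar> <= \<eta>*K*indicator A x" for x
 proof (cases "x \<in> Q1 \<and> PT l e x y ~= 0")
  case True
  then have "x \<in> A" using PT_bound(3)[of x e l y] e by(auto simp: A_def)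
  moreover have "\<bar>\<psi> x*PT l e x y\<bar> <= \<eta>*K" unfolding abs_mult
  proof (rule mult_mono)
   show "\<bar>\<psi> x\<bar> <= \<eta>" using loc(1)[of x] True by blast
   show "\<bar>PT l e x y\<bar> <= K" unfolding K_def by(rule PT_bound(1)[OF _ e]) (use True in blast)
  qed (use loc(2) in simp_all)
  ultimately show ?thesis by simp
 next
  case False
  then have "\<psi> x*PT l e x y = 0" using psi(2) by auto
  then show ?thesis using K loc(2) by(simp only: abs_zero) simp
 qed
 have le: "ennreal (norm (\<psi> x*PT l e x y)) <= ennreal (\<eta>*K)*indicator A x" for x
 proof -
  have "ennreal (norm (\<psi> x*PT l e x y)) <= ennreal (\<eta>*K*indicator A x)" using b[of x] by(intro ennreal_leI) simp
  also have "... = ennreal (\<eta>*K)*indicator A x" by(cases "x \<in> A") simp_all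
  finally show ?thesis .
 qed
 have Am[measurable]: "A \<in> sets borel"
 proof -
  have "Measurable.pred borel (%x. \<forall>j\<in>UNIV. \<bar>x$j - y$j\<bar> <= 2*real (l j)*e)" by(rule pred_ball_fin) measurable
  note [measurable] = this
  have "Measurable.pred borel (%x. x \<in> Q1 \<and> (\<forall>j\<in>UNIV. \<bar>x$j - y$j\<bar> <= 2*real (l j)*e))" by measurable
  then show ?thesis by(simp add: pred_def A_def)
 qed
 have "(NN x. ennreal (norm (\<psi> x*PT l e x y))) <= (NN x. ennreal (\<eta>*K)*indicator A x)" by(intro nn_integral_mono le)
 also have "... = ennreal (\<eta>*K)*(NN x. indicator A x)" by(rule nn_integral_cmult) measurable
 also have "... <= ennreal (\<eta>*K)*ennreal (\<Prod>j\<in>UNIV. 2*(2*real (l j)*e))" unfolding A_def by(intro mult_left_mono vol_near) (use e in auto)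
 also have "... = ennreal (\<eta>*CA l)"
 proof -
  have "K*(\<Prod>j\<in>(UNIV::'n set). 2*(2*real (l j)*e)) = CA l" unfolding CA_def K_def prod.distrib[symmetric] using e by(intro prod.cong) auto
  then have eq: "\<eta>*K*(\<Prod>j\<in>(UNIV::'n set). 2*(2*real (l j)*e)) = \<eta>*CA l" by(simp only: mult.assoc)
  have V: "0 <= (\<Prod>j\<in>(UNIV::'n set). 2*(2*real (l j)*e))" by(intro prod_nonneg) (use e in auto)
  show ?thesis unfolding eq[symmetric] by(rule ennreal_mult[symmetric, OF mult_nonneg_nonneg[OF loc(2) K] V])
 qed
 finally have *: "(NN x. ennreal (norm (\<psi> x*PT l e x y))) <= ennreal (\<eta>*CA l)" .
 show i: "integrable lborel (%x. \<psi> x*PT l e x y)" by(rule integrableI_bounded) (use*in \<open>auto simp: top_unique less_top intro: le_less_trans\<close>)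
 have "ennreal (norm (LI x. \<psi> x*PT l e x y)) <= ennreal (\<eta>*CA l)" using integral_norm_bound_ennreal[OF i]*by(rule order_trans)
 then show "\<bar>\<integral>x. \<psi> x*PT l e x y \<partial>lborel\<bar> <= \<eta>*CA l" using loc(2) CA_nonneg[of l] by(simp add: ennreal_le_iff)
qed

text \<open>The integral over the cube factors into the one-dimensional adjoint integrals, each of
  which tends to 1.\<close>

lemma PT_one:
 fixes y :: "real^'n::finite"
 assumes y: "y \<in> Q1" and l: "\<And>j. 1 <= l j" "1 <= N" and c: "0 < c" "\<And>j. 2*real (l j)*c <= 1"
 shows "((%e. \<integral>x. indicator Q1 x*PT l e x y \<partial>lborel) \<longlongrightarrow> 1) (at_right 0)"
proof (rule Lim_transform_eventually)
 have "((%e. \<Prod>j\<in>UNIV. \<integral>x. indicator {0<..<1} x*TT (l j) 0 e x (y$j) \<partial>lborel) \<longlongrightarrow> (\<Prod>j\<in>(UNIV::'n set). 1)) (at_right 0)"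
  by(intro tendsto_prod TT_adjoint_one) (use y l in \<open>auto simp: mem_cube\<close>)
 then show "((%e. \<Prod>j\<in>UNIV. \<integral>x. indicator {0<..<1} x*TT (l j) 0 e x (y$j) \<partial>lborel) \<longlongrightarrow> 1) (at_right 0)" by simp
 have "(\<Prod>j\<in>UNIV. \<integral>x. indicator {0<..<1} x*TT (l j) 0 e x (y$j) \<partial>lborel) = (LI x. indicator Q1 x*PT l e x y)" if e: "0 < e" "e < c" for e
 proof -
  have el: "2*real (l j)*e <= 1" for j
  proof -
   have "2*real (l j)*e <= 2*real (l j)*c" using e by(intro mult_left_mono) auto
   then show ?thesis using c(2)[of j] by linarith
  qed
  have "(\<Prod>j\<in>UNIV. \<integral>x. indicator {0<..<1} x*TT (l j) 0 e x (y$j) \<partial>lborel)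
   = (\<integral>x. (\<Prod>j\<in>UNIV. indicator {0<..<1} (x$j)*TT (l j) 0 e (x$j) (y$j)) \<partial>(lborel::(real^'n) measure))"
   by(rule integral_prod_vec[symmetric]) (rule TT_slice_integrable[OF e(1) el])
  also have "(%x::real^'n. \<Prod>j\<in>UNIV. indicator {0<..<1} (x$j)*TT (l j) 0 e (x$j) (y$j)) = (%x. indicator Q1 x*PT l e x y)"
  proof
   fix x :: "real^'n"
   have "(\<Prod>j\<in>UNIV. indicat_real {0<..<1} (x$j)) = indicator Q1 x"
   proof (cases "x \<in> Q1")
   case True then show ?thesis by(auto simp: mem_cube intro!: prod.neutral)
   next
   case False
   then obtain j where "x$j \<notin> {0<..<1}" by(auto simp: mem_cube)
   then have "(\<Prod>j\<in>UNIV. indicat_real {0<..<1} (x$j)) = 0" by(intro prod_zero bexI[of _ j]) auto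
   then show ?thesis using False by simp
   qed
   then show "(\<Prod>j\<in>UNIV. indicator {0<..<1} (x$j)*TT (l j) 0 e (x$j) (y$j)) = indicator Q1 x*PT l e x y" by(simp add: prod.distrib PT_def)
  qed
  finally show ?thesis .
 qed
 then show "\<forall>\<^sub>F e in at_right 0. (\<Prod>j\<in>UNIV. \<integral>x. indicator {0<..<1} x*TT (l j) 0 e x (y$j) \<partial>lborel) = (LI x. indicator Q1 x*PT l e x y)"
  using c by(intro eventually_at_rightI[of 0 c]) auto
qed

text \<open>Subtracting the constant \<open>\<psi> y\<close> on the cube leaves a function that is
  small on the support of the kernel; the constant itself is handled by
  \<open>PT_one\<close>.\<close>

lemma PT_limit:
 fixes y :: "real^'n::finite" and \<psi> :: "real^'n => real"
 assumes m[measurable]: "\<psi> \<in> BM borel" and l: "\<And>j. 1 <= l j" "1 <= N" and c: "0 < c" "\<And>j. 2*real (l j)*c <= 1"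
  and psi: "\<And>x. \<bar>\<psi> x\<bar> <= \<Psi>" "\<And>x. x \<notin> Q1 ==> \<psi> x = 0" and y: "y \<in> Q1" and cont: "isCont \<psi> y"
 shows "((%e. \<integral>x. \<psi> x*PT l e x y \<partial>lborel) \<longlongrightarrow> \<psi> y) (at_right 0)"
proof (rule Lim_transform_eventually)
 have PT1: "((%e. \<integral>x. indicator Q1 x*PT l e x y \<partial>lborel) \<longlongrightarrow> 1) (at_right 0)" by(rule PT_one[OF y l c])
 have d0: "((%e. (LI x. (\<psi> x - \<psi> y*indicator Q1 x)*PT l e x y)) \<longlongrightarrow> 0) (at_right 0)"
 proof (rule tendstoI)
  fix \<eta>' :: real assume "0 < \<eta>'"
  define \<eta> where "\<eta> = \<eta>'/(CA l + 1)"
  have eta: "0 < \<eta>" "\<eta>*CA l < \<eta>'" using \<open>0 < \<eta>'\<close> CA_nonneg[of l] by(auto simp: \<eta>_def field_simps add_pos_nonneg)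
  obtain d where d: "0 < d" "\<And>x. dist x y < d ==> \<bar>\<psi> x - \<psi> y\<bar> < \<eta>"
   using cont eta(1) unfolding continuous_at_eps_delta dist_real_def by blast
  define S where "S = (\<Sum>j\<in>UNIV. 2*real (l j))"
  have S: "0 <= S" by(simp add: S_def sum_nonneg)
  define e0 where "e0 = min c (d/(S + 1))"
  have e0: "0 < e0" using c d S by(simp add: e0_def)
  have "\<bar>\<integral>x. (\<psi> x - \<psi> y*indicator Q1 x)*PT l e x y \<partial>lborel\<bar> < \<eta>'" if e: "0 < e" "e < e0" for e
  proof -
   have el: "2*real (l j)*e <= 1" for j
   proof -
   have "2*real (l j)*e <= 2*real (l j)*c" using e by(intro mult_left_mono) (auto simp: e0_def)
   then show ?thesis using c(2)[of j] by linarith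
   qed
   have eS: "e*S < d"
   proof -
   have "e*(S + 1) < d" using e S by(simp add: e0_def field_simps)
   moreover have "e*S <= e*(S + 1)" using e by(intro mult_left_mono) auto
   ultimately show ?thesis by linarith
   qed
   have "\<bar>\<integral>x. (\<psi> x - \<psi> y*indicator Q1 x)*PT l e x y \<partial>lborel\<bar> <= \<eta>*CA l"
   proof (rule PT_slice(2)[where \<Psi> = "2*\<Psi>"])
   show "(%x. \<psi> x - \<psi> y*indicator Q1 x) \<in> BM borel" unfolding indicator_def by measurable
   show "\<bar>\<psi> x - \<psi> y*indicator Q1 x\<bar> <= 2*\<Psi>" for x using psi(1)[of x] psi(1)[of y] by(auto simp: indicator_def)
   show "\<bar>\<psi> x - \<psi> y*indicator Q1 x\<bar> <= \<eta>" if x: "x \<in> Q1" "PT l e x y ~= 0" for x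
   proof -
   have "dist x y <= (\<Sum>j\<in>UNIV. \<bar>x$j - y$j\<bar>)" unfolding dist_norm using norm_le_l1_cart[of "x - y"] by simp
   also have "... <= (\<Sum>j\<in>UNIV. 2*real (l j)*e)" by(intro sum_mono PT_bound(3)[OF x(1) e(1) el x(2)])
   also have "... = e*S" by(simp add: S_def sum_distrib_left mult_ac)
   finally have "dist x y < d" using eS by linarith
   from d(2)[OF this] show ?thesis using x by simp
   qed
   qed (use e el psi eta in auto)
   then show ?thesis using eta by linarith
  qed
  then show "\<forall>\<^sub>F e in at_right 0. dist (LI x. (\<psi> x - \<psi> y*indicator Q1 x)*PT l e x y) 0 < \<eta>'"
   using e0 by(intro eventually_at_rightI[of 0 e0]) auto
 qed
 from tendsto_add[OF d0 tendsto_mult_left[OF PT1, of "\<psi> y"]]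
 show "((%e. (LI x. (\<psi> x - \<psi> y*indicator Q1 x)*PT l e x y) + \<psi> y*(LI x. indicator Q1 x*PT l e x y)) \<longlongrightarrow> \<psi> y) (at_right 0)" by simp
 have "(LI x. (\<psi> x - \<psi> y*indicator Q1 x)*PT l e x y) + \<psi> y*(LI x. indicator Q1 x*PT l e x y) = (LI x. \<psi> x*PT l e x y)" if e: "0 < e" "e < c" for e
 proof -
  have el: "2*real (l j)*e <= 1" for j
  proof -
   have "2*real (l j)*e <= 2*real (l j)*c" using e by(intro mult_left_mono) auto
   then show ?thesis using c(2)[of j] by linarith
  qed
  have P0: "0 <= \<Psi>" using psi(1)[of 0] by linarith
  have i1: "integrable lborel (%x. \<psi> x*PT l e x y)" by(rule PT_slice(1)[where \<Psi> = \<Psi> and \<eta> = \<Psi>]) (use e el psi P0 in auto)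
  have i2: "integrable lborel (%x. indicator Q1 x*PT l e x y)" by(rule PT_slice(1)[where \<Psi> = 1 and \<eta> = 1]) (use e el in \<open>auto simp: indicator_def\<close>)
  have "(LI x. (\<psi> x - \<psi> y*indicator Q1 x)*PT l e x y) = (LI x. \<psi> x*PT l e x y - \<psi> y*(indicator Q1 x*PT l e x y))" by(simp add: algebra_simps)
  also have "... = (LI x. \<psi> x*PT l e x y) - (LI x. \<psi> y*(indicator Q1 x*PT l e x y))"
   by(rule Bochner_Integration.integral_diff[OF i1 integrable_mult_right[OF i2]])
  finally show ?thesis by simp
 qed
 then show "\<forall>\<^sub>F e in at_right 0. (LI x. (\<psi> x - \<psi> y*indicator Q1 x)*PT l e x y) + \<psi> y*(LI x. indicator Q1 x*PT l e x y) = (LI x. \<psi> x*PT l e x y)"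
  using c by(intro eventually_at_rightI[of 0 c]) auto
qed

end

section \<open>The representation formula\<close>

locale rep = bump N \<phi> B for N \<phi> B +
 fixes l :: "'n::finite => nat" and c :: real
 assumes l1: "\<And>j. 1 <= l j" and N1: "1 <= N" and c0: "0 < c" and c1: "c <= 1" and lc: "\<And>j. 2*real (l j)*c <= 1"
begin

abbreviation T :: "'n set => ('n => real) measure" where "T J \<equiv> LJ J"
abbreviation V :: "'n set => (('n => real) \<times> ('n => real)) measure" where "V J \<equiv> T J \<Otimes>\<^sub>M T J"
abbreviation R :: "'n set => ((('n => real) \<times> ('n => real)) \<times> (real^'n)) measure" where "R J \<equiv> V J \<Otimes>\<^sub>M lborel"

lemma sf_T: "sigma_finite_measure (T J)" by(rule sigma_finite_PiM_lborel)

lemma pair_T: "pair_sigma_finite (T J) (T J)" by(intro pair_sigma_finite.intro sf_T)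

lemma sf_V: "sigma_finite_measure (V J)"
proof -
 interpret pair_sigma_finite "T J" "T J" by(rule pair_T)
 show ?thesis by(rule sigma_finite_measure_axioms)
qed

lemma pair_R: "pair_sigma_finite (V J) (lborel :: (real^'n) measure)" by(intro pair_sigma_finite.intro sf_V sigma_finite_lborel)

lemma sf_R: "sigma_finite_measure (R J)"
proof -
 interpret pair_sigma_finite "V J" "lborel :: (real^'n) measure" by(rule pair_R)
 show ?thesis by(rule sigma_finite_measure_axioms)
qed

text \<open>The integrand of the term \<open>J\<close> at the point \<open>x\<close>; the variable
  \<open>w\<close> is ((t, xi), z).\<close>

definition IN :: "('n => nat) => 'n set => (real^'n => real) => real^'n => (('n => real) \<times> ('n => real)) \<times> (real^'n) => real" where
 "IN i J f x w = (if inbox c J (fst (fst w)) then mdiff (chiJ J l) (restr_vec J (snd (fst w))) f (snd w) *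
  EE l c J i (fst (fst w)) (snd (fst w)) x (snd w) else 0)"

definition HD :: "('n => nat) => 'n set => (real^'n => real) => real^'n => (('n => real) \<times> ('n => real)) \<times> (real^'n) => ennreal" where
 "HD lam J f x w = (if inbox c J (fst (fst w)) then ennreal (\<Prod>j\<in>J. fst (fst w) j powr (- real (lam j) - 3)) *
  (if nearJ l J (fst (fst w)) x (snd w) then dd f l J (fst (fst w)) (snd (fst w)) (snd w) else 0) else 0)"

lemma IN_le_HD:
 assumes x: "x \<in> Q1" and i: "\<And>j. i j <= lam j"
 shows "ennreal \<bar>IN i J f x w\<bar> <= ennreal (CE l c lam)*HD lam J f x w"
proof (cases "IN i J f x w = 0")
 case False
 obtain t xi z where w: "w = ((t, xi), z)" by(metis prod.collapse)
 have t: "inbox c J t" and e: "EE l c J i t xi x z ~= 0" using False by(auto simp: IN_def w split: if_splits)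
 note s = EE_supp[OF e c0 lc x t]
 have "\<bar>IN i J f x w\<bar> = \<bar>EE l c J i t xi x z\<bar>*\<bar>mdiff (chiJ J l) (restr_vec J xi) f z\<bar>" using t by(simp add: IN_def w abs_mult)
 also have "... <= (CE l c lam*(\<Prod>j\<in>J. t j powr (- real (lam j) - 3)))*\<bar>mdiff (chiJ J l) (restr_vec J xi) f z\<bar>"
  by(intro mult_right_mono EE_bound c0 c1 x t i) simp
 finally have "ennreal \<bar>IN i J f x w\<bar> <= ennreal ((CE l c lam*(\<Prod>j\<in>J. t j powr (- real (lam j) - 3)))*\<bar>mdiff (chiJ J l) (restr_vec J xi) f z\<bar>)"
  by(rule ennreal_leI)
 also have "... = ennreal (CE l c lam)*HD lam J f x w" using t s CE_pos[OF c0, of l lam] by(simp add: HD_def w dd_def ennreal_mult[symmetric] prod_nonneg mult.assoc)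
 finally show ?thesis .
qed simp

lemma R_comps:
 assumes "w \<in> M \<rightarrow>\<^sub>M R J"
 shows "(%v. fst (fst (w v))) \<in> M \<rightarrow>\<^sub>M T J" "(%v. snd (fst (w v))) \<in> M \<rightarrow>\<^sub>M T J" "(%v. snd (w v)) \<in> BM M"
 using measurable_compose[OF measurable_compose[OF assms measurable_fst] measurable_fst]
  measurable_compose[OF measurable_compose[OF assms measurable_fst] measurable_snd]
  measurable_compose[OF assms measurable_snd] by simp_all

lemma V_comps:
 assumes "v \<in> M \<rightarrow>\<^sub>M V J"
 shows "(%w. fst (v w)) \<in> M \<rightarrow>\<^sub>M T J" "(%w. snd (v w)) \<in> M \<rightarrow>\<^sub>M T J"
 using measurable_compose[OF assms measurable_fst] measurable_compose[OF assms measurable_snd] by simp_all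

lemma measurable_IN:
 assumes f[measurable]: "f \<in> BM borel" and x: "x \<in> BM M" and w: "w \<in> M \<rightarrow>\<^sub>M R J"
 shows "(%v. IN i J f (x v) (w v)) \<in> BM M"
proof -
 note [measurable] = x R_comps[OF w]
 have [measurable]: "(%v. EE l c J i (fst (fst (w v))) (snd (fst (w v))) (x v) (snd (w v))) \<in> BM M" by(rule measurable_EE[OF c0]) measurable
 show ?thesis unfolding IN_def by measurable
qed

lemma measurable_HD:
 assumes f[measurable]: "f \<in> BM borel" and x: "x \<in> BM M" and w: "w \<in> M \<rightarrow>\<^sub>M R J"
 shows "(%v. HD lam J f (x v) (w v)) \<in> BM M"
proof -
 note [measurable] = x R_comps[OF w]
 have [measurable]: "(%v. \<Prod>j\<in>J. fst (fst (w v)) j powr (- real (lam j) - 3)) \<in> BM M" by(rule measurable_prod_powr[OF R_comps(1)[OF w]])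
 show ?thesis unfolding HD_def by measurable
qed

lemma HD_integral:
 assumes f[measurable]: "f \<in> BM borel"
 shows "(nn_integral (R J) (%w. HD lam J f x w)) = HH f l lam c J x"
proof -
 interpret T: sigma_finite_measure "T J" by(rule sf_T)
 interpret VR: pair_sigma_finite "V J" "lborel :: (real^'n) measure" by(rule pair_R)
 have m[measurable]: "(%w. HD lam J f x w) \<in> BM (R J)" by(rule measurable_HD) measurable
 have "(nn_integral (R J) (%w. HD lam J f x w)) = (nn_integral (V J) (%v. (NN z. HD lam J f x (v, z))))" by(rule lborel.nn_integral_fst[symmetric]) measurable
 also have "... = (nn_integral (T J) (%t. (nn_integral (T J) (%xi. (NN z. HD lam J f x ((t, xi), z))))))" by(rule T.nn_integral_fst[symmetric]) measurable
 also have "... = HH f l lam c J x" unfolding HH_def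
 proof (rule nn_integral_cong)
  fix t assume t: "t \<in> space (T J)"
  have [measurable]: "(%z. t) \<in> M \<rightarrow>\<^sub>M T J" for M :: "'b measure" using t by auto
  show "(nn_integral (T J) (%xi. (NN z. HD lam J f x ((t, xi), z)))) =
   (if inbox c J t then ennreal (\<Prod>j\<in>J. t j powr (- real (lam j) - 3))*UU f l J t x else 0)"
  proof (cases "inbox c J t")
   case True
   have "(nn_integral (T J) (%xi. (NN z. HD lam J f x ((t, xi), z)))) =
   (nn_integral (T J) (%xi. ennreal (\<Prod>j\<in>J. t j powr (- real (lam j) - 3))*(NN z. (if nearJ l J t x z then dd f l J t xi z else 0))))"
   proof (rule nn_integral_cong)
   fix xi assume xi: "xi \<in> space (T J)"
   have [measurable]: "(%z. xi) \<in> M \<rightarrow>\<^sub>M T J" for M :: "'b measure" using xi by auto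
   have "(NN z. HD lam J f x ((t, xi), z)) = (NN z. ennreal (\<Prod>j\<in>J. t j powr (- real (lam j) - 3))*(if nearJ l J t x z then dd f l J t xi z else 0))"
   using True by(simp add: HD_def cong: if_cong)
   also have "... = ennreal (\<Prod>j\<in>J. t j powr (- real (lam j) - 3))*(NN z. (if nearJ l J t x z then dd f l J t xi z else 0))"
   by(rule nn_integral_cmult) measurable
   finally show "(NN z. HD lam J f x ((t, xi), z)) = ..." .
   qed
   also have "... = ennreal (\<Prod>j\<in>J. t j powr (- real (lam j) - 3))*UU f l J t x" unfolding UU_def by(rule nn_integral_cmult) measurable
   finally show ?thesis using True by simp
  qed (simp add: HD_def)
 qed
 finally show ?thesis .
qed

text \<open>The truncation of the scales from below that a smoothing at scale e > 0 leaves behind;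
  it opens as e tends to 0.\<close>

definition gate :: "real => 'n set => ('n => real) => bool" where
 "gate e J t \<longleftrightarrow> (\<forall>j\<in>J. e < t j)"

lemma pred_gate [measurable (raw)]:
 assumes [measurable]: "t \<in> M \<rightarrow>\<^sub>M T J"
 shows "Measurable.pred M (%w. gate e J (t w))" unfolding gate_def
proof (rule pred_ball_fin)
 fix j assume j: "j \<in> J"
 note [measurable] = measurable_PiM_component[OF assms(1) j]
 show "Measurable.pred M (%w. e < t w j)" by measurable
qed

text \<open>The difference acts on the kernel here, as it comes out of \<open>Dk\<close>;
  translating the integration variable moves it to f.\<close>

definition sj :: "'n => real => real => real => real => real" where
 "sj j t xi x y = (\<Sum>m\<le>l j. (-1)^(l j - m)*real (l j choose m)*kk (l j) 0 t x (y - real m*xi) xi)"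

lemma Dk_sj: "Dk (l j) t x y = (LI xi. sj j t xi x y)" unfolding Dk_def sj_def ..

lemma sj_bound:
 assumes e: "0 < e" "e < t" "t < c" and x: "0 < x" "x < 1"
 shows "\<bar>sj j t xi x y\<bar> <= 2^l j*(kC (l j) 0*(1/e)^3)" "sj j t xi x y ~= 0 ==> \<bar>xi\<bar> <= c"
proof -
 have k: "\<bar>kk (l j) 0 t x z xi\<bar> <= kC (l j) 0*(1/e)^3" for z
 proof -
  have "\<bar>kk (l j) 0 t x z xi\<bar> <= kC (l j) 0*(1/t)^(0 + 3)" by(rule kk_bound) (use e x c1 in auto)
  also have "... <= kC (l j) 0*(1/e)^3" using e kC_pos[of "l j" 0] by(intro mult_mono power_mono) (auto simp: field_simps)
  finally show ?thesis .
 qed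
 have "\<bar>sj j t xi x y\<bar> <= (\<Sum>m\<le>l j. real (l j choose m)*(kC (l j) 0*(1/e)^3))" unfolding sj_def
  by(rule order_trans[OF sum_abs], rule sum_mono) (use k in \<open>simp add: abs_mult power_abs mult_left_mono\<close>)
 also have "... = 2^l j*(kC (l j) 0*(1/e)^3)" unfolding sum_distrib_right[symmetric] using choose_row_sum[of "l j"] by(metis of_nat_numeral of_nat_power of_nat_sum)
 finally show "\<bar>sj j t xi x y\<bar> <= 2^l j*(kC (l j) 0*(1/e)^3)" .
 assume "sj j t xi x y ~= 0"
 then obtain m where "kk (l j) 0 t x (y - real m*xi) xi ~= 0" unfolding sj_def by(elim sum.not_neutral_contains_not_neutral) auto
 from kk_supp(1)[OF this x] have "2*real (l j)*t <= 1 ==> \<bar>xi\<bar> <= t" using e by auto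
 moreover have "2*real (l j)*t <= 2*real (l j)*c" using e by(intro mult_left_mono) auto
 ultimately show "\<bar>xi\<bar> <= c" using lc[of j] e by linarith
qed

lemma sj_integrable: "0 < x ==> x < 1 ==> 0 < t ==> integrable lborel (%xi. sj j t xi x y)"
 unfolding sj_def by(intro Bochner_Integration.integrable_sum integrable_mult_right kk_integrable)

definition SJ :: "real => 'n set => real^'n => real^'n => ('n => real) \<times> ('n => real) => real" where
 "SJ e J x y v = (if inbox c J (fst v) \<and> gate e J (fst v)
  then (\<Prod>j\<in>J. sj j (fst v j) (snd v j) (x$j) (y$j)) else 0)"

definition V0 :: "'n set => (('n => real) \<times> ('n => real)) set" where
 "V0 J = PiE J (%_. {0..c}) \<times> PiE J (%_. {-c..c})"

lemma V0: "V0 J \<in> sets (V J)" "emeasure (V J) (V0 J) < \<infinity>"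
proof -
 interpret PP: product_sigma_finite "%_::'n. lborel::real measure" by standard
 interpret T: sigma_finite_measure "T J" by(rule sf_T)
 show "V0 J \<in> sets (V J)" unfolding V0_def by(intro pair_measureI sets_PiM_I_finite) auto
 have "emeasure (V J) (V0 J) = emeasure (T J) (PiE J (%_. {0..c}))*emeasure (T J) (PiE J (%_. {-c..c}))"
  unfolding V0_def by(intro T.emeasure_pair_measure_Times sets_PiM_I_finite) auto
 also have "... = (\<Prod>j\<in>J. ennreal c)*(\<Prod>j\<in>J. ennreal (c + c))" using c0 by(subst (1 2) PP.emeasure_PiM) auto
 also have "... < \<infinity>" using c0 by(simp add: ennreal_power ennreal_mult_less_top)
 finally show "emeasure (V J) (V0 J) < \<infinity>" .
qed

definition KS :: "real => 'n set => real" where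
 "KS e J = (\<Prod>j\<in>J. 2^l j*(kC (l j) 0*(1/e)^3))"

lemma SJ_bound:
 assumes e: "0 < e" and x: "x \<in> Q1" and v: "v \<in> space (V J)"
 shows "\<bar>SJ e J x y v\<bar> <= KS e J*indicator (V0 J) v"
proof (cases "SJ e J x y v = 0")
 case True
 have "0 <= KS e J" unfolding KS_def using e kC_pos by(intro prod_nonneg) (auto intro!: mult_nonneg_nonneg less_imp_le)
 then show ?thesis using True by simp
next
 case False
 have x': "0 < x$j" "x$j < 1" for j using x by(auto simp: mem_cube)
 have t: "inbox c J (fst v)" "gate e J (fst v)" using False by(auto simp: SJ_def split: if_splits)
 then have tj: "e < fst v j" "fst v j < c" if "j \<in> J" for j using that by(auto simp: inbox_def gate_def)
 have nz: "sj j (fst v j) (snd v j) (x$j) (y$j) ~= 0" if "j \<in> J" for j using False t that by(auto simp: SJ_def prod_zero_iff)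
 have "v \<in> V0 J" using v tj e sj_bound(2)[OF e tj x' nz] by(cases v) (auto simp: V0_def space_pair_measure space_PiM PiE_def Pi_def abs_le_iff less_imp_le; fastforce)
 moreover have "\<bar>SJ e J x y v\<bar> <= KS e J" using t by(simp add: SJ_def KS_def abs_prod) (intro prod_mono conjI sj_bound(1) e tj x'; simp)
 ultimately show ?thesis by simp
qed

lemma measurable_SJ:
 assumes y: "y \<in> BM M" and v: "v \<in> M \<rightarrow>\<^sub>M V J"
 shows "(%w. SJ e J x (y w) (v w)) \<in> BM M"
proof -
 note [measurable] = y V_comps[OF v]
 have "(%w. \<Prod>j\<in>J. sj j (fst (v w) j) (snd (v w) j) (x$j) (y w$j)) \<in> BM M"
 proof (rule borel_measurable_prod)
  fix j assume j: "j \<in> J"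
  have [measurable]: "(%w. fst (v w) j) \<in> BM M" "(%w. snd (v w) j) \<in> BM M"
   by(rule measurable_PiM_component[OF V_comps(1)[OF v] j], rule measurable_PiM_component[OF V_comps(2)[OF v] j])
  show "(%w. sj j (fst (v w) j) (snd (v w) j) (x$j) (y w$j)) \<in> BM M" unfolding sj_def by measurable
 qed
 note [measurable] = this
 show ?thesis unfolding SJ_def by measurable
qed

lemma SJ_integrable:
 assumes e: "0 < e" and x: "x \<in> Q1"
 shows "integrable (V J) (SJ e J x y)"
proof (rule integrableI_bounded_set[where A = "V0 J" and B = "KS e J"])
 show "SJ e J x y \<in> BM (V J)" by(rule measurable_SJ) auto
 show "AE v in V J. v \<in> V0 J --> norm (SJ e J x y v) <= KS e J"
 proof (intro AE_I2 impI)
  fix v assume "v \<in> space (V J)" "v \<in> V0 J"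
  then show "norm (SJ e J x y v) <= KS e J" using SJ_bound[OF e x, of v J y] by simp
 qed
 show "AE v in V J. v \<notin> V0 J --> SJ e J x y v = 0"
 proof (intro AE_I2 impI)
  fix v assume "v \<in> space (V J)" "v \<notin> V0 J"
  then show "SJ e J x y v = 0" using SJ_bound[OF e x, of v J y] by simp
 qed
qed (use V0 in auto)

text \<open>By \<open>TT_identity\<close> each coordinate factor is a sum of two terms. Expanding
  the product over the coordinates, \<open>J\<close> collects those where the integral over scales
  is chosen.\<close>

lemma PT_expand:
 assumes e: "0 < e" "e < c" and x: "x \<in> Q1"
 shows "PT l e x y = (\<Sum>J\<in>UNIV. (\<integral>v. SJ e J x y v \<partial>V J)*(\<Prod>j\<in>UNIV-J. TT (l j) 0 c (x$j) (y$j)))"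
proof -
 interpret PP: product_sigma_finite "%_::'n. lborel::real measure" by standard
 have x': "0 < x$j" "x$j < 1" for j using x by(auto simp: mem_cube)
 define I where "I j = (LI t. indicator {e<..<c} t*Dk (l j) t (x$j) (y$j))" for j
 note id = TT_identity[OF x' lc e(1) less_imp_le[OF e(2)] N1]
 have "PT l e x y = (\<Prod>j\<in>UNIV. I j + TT (l j) 0 c (x$j) (y$j))" unfolding PT_def I_def by(intro prod.cong refl) (simp add: id(1) add.commute)
 also have "... = (\<Sum>J\<in>Pow UNIV. (\<Prod>j\<in>J. I j)*(\<Prod>j\<in>UNIV-J. TT (l j) 0 c (x$j) (y$j)))" by(rule prod_add) simp
 also have "... = (\<Sum>J\<in>UNIV. (\<integral>v. SJ e J x y v \<partial>V J)*(\<Prod>j\<in>UNIV-J. TT (l j) 0 c (x$j) (y$j)))"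
 proof (rule sum.cong)
  fix J :: "'n set"
  interpret TT: pair_sigma_finite "T J" "T J" by(rule pair_T)
  have "(\<Prod>j\<in>J. I j) = (\<integral>t. (\<Prod>j\<in>J. indicator {e<..<c} (t j)*Dk (l j) (t j) (x$j) (y$j)) \<partial>T J)"
   unfolding I_def by(rule PP.product_integral_prod[symmetric]) (auto simp: id(2))
  also have "... = (\<integral>t. (\<integral>xi. SJ e J x y (t, xi) \<partial>T J) \<partial>T J)"
  proof (rule BI_cong[OF refl])
   fix t
   show "(\<Prod>j\<in>J. indicator {e<..<c} (t j)*Dk (l j) (t j) (x$j) (y$j)) = (\<integral>xi. SJ e J x y (t, xi) \<partial>T J)"
   proof (cases "inbox c J t \<and> gate e J t")
   case True
   then have tj: "e < t j" "t j < c" if "j \<in> J" for j using that by(auto simp: inbox_def gate_def)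
   have "(\<Prod>j\<in>J. indicator {e<..<c} (t j)*Dk (l j) (t j) (x$j) (y$j)) = (\<Prod>j\<in>J. \<integral>xi. sj j (t j) xi (x$j) (y$j) \<partial>lborel)"
   by(intro prod.cong refl) (simp add: Dk_sj tj)
   also have "... = (\<integral>xi. (\<Prod>j\<in>J. sj j (t j) (xi j) (x$j) (y$j)) \<partial>T J)"
   by(rule PP.product_integral_prod[symmetric]) (auto intro!: sj_integrable[OF x' less_trans[OF e(1) tj(1)]])
   finally show ?thesis using True by(simp add: SJ_def)
   next
   case False
   then obtain j where j: "j \<in> J" "t j \<notin> {e<..<c}" using e by(auto simp: inbox_def gate_def)
   then have "(\<Prod>j\<in>J. indicator {e<..<c} (t j)*Dk (l j) (t j) (x$j) (y$j)) = 0" by(intro prod_zero bexI[of _ j]) auto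
   then show ?thesis using False by(auto simp: SJ_def)
   qed
  qed
  also have "... = (\<integral>v. SJ e J x y v \<partial>V J)" by(rule TT.integral_fst'[OF SJ_integrable[OF e(1) x]])
  finally show "(\<Prod>j\<in>J. I j)*(\<Prod>j\<in>UNIV-J. TT (l j) 0 c (x$j) (y$j)) =
   (\<integral>v. SJ e J x y v \<partial>V J)*(\<Prod>j\<in>UNIV-J. TT (l j) 0 c (x$j) (y$j))" by simp
 qed simp
 finally show ?thesis .
qed

text \<open>The product of the one-dimensional alternating sums expands to the multi-index sum in
  \<open>mdiff\<close>. The kernel translated by k xi is paired with f, and translation invariance
  shifts f instead.\<close>

lemma SJ_mdiff:
 assumes f[measurable]: "f \<in> BM borel" and fi: "integrable lborel f" and x: "x \<in> Q1" and v: "v \<in> space (V J)"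
 shows "(LI y. f y*(SJ e J x y v * (\<Prod>j\<in>UNIV-J. TT (l j) 0 c (x$j) (y$j)))) =
  (LI z. (if gate e J (fst v) then IN (%_. 0) J f x (v, z) else 0))"
proof (cases "inbox c J (fst v) \<and> gate e J (fst v)")
 case False
 then show ?thesis by(cases "gate e J (fst v)") (auto simp: SJ_def IN_def)
next
 case True
 obtain t xi where v': "v = (t, xi)" by(cases v)
 have sp: "t \<in> space (T J)" "xi \<in> space (T J)" using v by(auto simp: v' space_pair_measure)
 have [measurable]: "(%z. t) \<in> M \<rightarrow>\<^sub>M T J" "(%z. xi) \<in> M \<rightarrow>\<^sub>M T J" for M :: "'b measure" using sp by auto
 have t: "inbox c J t" "gate e J t" using True by(auto simp: v')
 define L where "L = chiJ J l"
 define K where "K = {k::'n => nat. \<forall>j. k j <= L j}"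
 define co where "co k = (-1::real)^(\<Sum>j\<in>UNIV. L j - k j)*(\<Prod>j\<in>UNIV. real (L j choose k j))" for k
 define a where "a k = (\<chi> j. real (k j)*restr_vec J xi$j)" for k
 let ?E = "%z. EE l c J (%_. 0) t xi x z"
 have Em[measurable]: "?E \<in> BM borel" by(rule measurable_EE[OF c0]) measurable
 have PiE: "(\<Pi>\<^sub>E j\<in>UNIV. {..L j}) = K" by(auto simp: K_def PiE_def)
 have exp: "SJ e J x y v * (\<Prod>j\<in>UNIV-J. TT (l j) 0 c (x$j) (y$j)) = (\<Sum>k\<in>K. co k*?E (y - a k))" for y
 proof -
  let ?h = "%j m. (-1)^(L j - m)*real (L j choose m)*(if j \<in> J then kk (l j) 0 (t j) (x$j) (y$j - real m*xi j) (xi j) else TT (l j) 0 c (x$j) (y$j))"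
  have "SJ e J x y v * (\<Prod>j\<in>UNIV-J. TT (l j) 0 c (x$j) (y$j)) = (\<Prod>j\<in>UNIV. if j \<in> J then sj j (t j) (xi j) (x$j) (y$j) else TT (l j) 0 c (x$j) (y$j))"
   using t by(simp add: SJ_def v' prod.If_cases Compl_eq_Diff_UNIV)
  also have "... = (\<Prod>j\<in>UNIV. \<Sum>m\<le>L j. ?h j m)" by(intro prod.cong refl) (auto simp: sj_def L_def chiJ_def)
  also have "... = (\<Sum>k\<in>K. \<Prod>j\<in>UNIV. ?h j (k j))" by(subst prod_sum_PiE) (auto simp: PiE)
  also have "... = (\<Sum>k\<in>K. co k*?E (y - a k))"
  proof (rule sum.cong)
   fix k
   have "?E (y - a k) = (\<Prod>j\<in>UNIV. (if j \<in> J then kk (l j) 0 (t j) (x$j) (y$j - real (k j)*xi j) (xi j) else TT (l j) 0 c (x$j) (y$j)))"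
   unfolding EE_def by(intro prod.cong refl) (auto simp: a_def restr_vec_def)
   then show "(\<Prod>j\<in>UNIV. ?h j (k j)) = co k*?E (y - a k)" by(simp add: co_def prod.distrib power_sum)
  qed simp
  finally show ?thesis .
 qed
 obtain b where b: "\<And>z. \<bar>?E z\<bar> <= b" using EE_bound[OF c0 c1 x t(1), of "%_. 0" "%_. 0" l xi] by blast
 have i1: "integrable lborel (%z. f (z + a k)*?E z)" for k
 proof (rule Bochner_Integration.integrable_bound[OF integrable_mult_left[OF lborel_integrable_translate[OF fi, of "a k"], of b]])
  show "AE z in lborel. norm (f (z + a k)*?E z) <= norm (f (z + a k)*b)"
   using b by(intro AE_I2) (auto simp: abs_mult intro!: mult_left_mono order_trans[OF b abs_ge_self])
 qed measurable
 have i2: "integrable lborel (%y. f y*?E (y - a k))" for k using lborel_integrable_translate[OF i1[of k], of "- a k"] by simp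
 have tr: "(LI y. f y*?E (y - a k)) = (LI z. f (z + a k)*?E z)" for k using lborel_integral_translate[of "%z. f (z + a k)*?E z" "- a k"] by simp
 have "(LI y. f y*(SJ e J x y v * (\<Prod>j\<in>UNIV-J. TT (l j) 0 c (x$j) (y$j)))) =
  (LI y. (\<Sum>k\<in>K. co k*(f y*?E (y - a k))))" unfolding exp by(simp add: sum_distrib_left mult_ac)
 also have "... = (\<Sum>k\<in>K. co k*(LI y. f y*?E (y - a k)))" by(subst Bochner_Integration.integral_sum) (auto intro!: integrable_mult_right i2)
 also have "... = (\<Sum>k\<in>K. co k*(LI z. f (z + a k)*?E z))" by(simp add: tr)
 also have "... = (LI z. (\<Sum>k\<in>K. co k*(f (z + a k)*?E z)))" by(subst Bochner_Integration.integral_sum) (auto intro!: integrable_mult_right i1)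
 also have "... = (LI z. (if gate e J (fst v) then IN (%_. 0) J f x (v, z) else 0))"
  using t by(simp add: v' IN_def mdiff_def co_def a_def K_def L_def sum_distrib_right sum_distrib_left mult_ac)
 finally show ?thesis .
qed

lemma IN_norm_integral:
 assumes f: "f \<in> BM borel" and x: "x \<in> Q1" and i: "\<And>j. i j <= lam j"
 shows "(nn_integral (R J) (%w. ennreal \<bar>IN i J f x w\<bar>)) <= ennreal (CE l c lam)*HH f l lam c J x"
proof -
 have [measurable]: "(%w. HD lam J f x w) \<in> BM (R J)" by(rule measurable_HD[OF f]) auto
 have "(nn_integral (R J) (%w. ennreal \<bar>IN i J f x w\<bar>)) <= (nn_integral (R J) (%w. ennreal (CE l c lam)*HD lam J f x w))"
  by(intro nn_integral_mono IN_le_HD x i)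
 also have "... = ennreal (CE l c lam)*HH f l lam c J x" by(subst nn_integral_cmult) (auto simp: HD_integral[OF f])
 finally show ?thesis .
qed

lemma measurable_IN_R: "f \<in> BM borel ==> IN i J f x \<in> BM (R J)" by(rule measurable_IN[where x = "%_. x" and w = "%w. w"]) auto

lemma IN_integrable:
 assumes f: "f \<in> BM borel" and x: "x \<in> Q1" and i: "\<And>j. i j <= lam j" and fin: "HH f l lam c J x < \<infinity>"
 shows "integrable (R J) (IN i J f x)"
proof (rule integrableI_bounded)
 show "IN i J f x \<in> BM (R J)" by(rule measurable_IN_R[OF f])
 have "(nn_integral (R J) (%w. ennreal (norm (IN i J f x w)))) <= ennreal (CE l c lam)*HH f l lam c J x" using IN_norm_integral[OF f x i] by simp
 also have "... < \<infinity>" using fin by(simp add: ennreal_mult_less_top)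
 finally show "(nn_integral (R J) (%w. ennreal (norm (IN i J f x w)))) < \<infinity>" .
qed

lemma integrable_gated:
 fixes F :: "'b => real"
 assumes "integrable M F" and [measurable]: "Measurable.pred M g"
 shows "integrable M (%w. if g w then F w else 0)" by(rule Bochner_Integration.integrable_bound[OF assms(1)]) (use assms(1) in auto)

lemma pred_gate_R: "Measurable.pred (R J) (%w. gate e J (fst (fst w)))" by(rule pred_gate[OF R_comps(1)]) simp

lemma TT_prod_bound:
 shows "\<exists>b\<ge>0. \<forall>y::real^'n. \<bar>\<Prod>j\<in>A. TT (l j) 0 c (x$j) (y$j)\<bar> <= b"
proof (intro exI[of _ "\<Prod>j\<in>A. kC (l j) 0*(1/c)^(0 + 2)"] conjI allI)
 show "0 <= (\<Prod>j\<in>A. kC (l j) 0*(1/c)^(0 + 2))" using c0 kC_pos by(intro prod_nonneg mult_nonneg_nonneg) (auto simp: less_imp_le)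
 show "\<bar>\<Prod>j\<in>A. TT (l j) 0 c (x$j) (y$j)\<bar> <= (\<Prod>j\<in>A. kC (l j) 0*(1/c)^(0 + 2))" for y
  unfolding abs_prod by(intro prod_mono conjI TT_bound c0 c1) simp
qed

text \<open>For fixed e > 0 the truncated kernels are bounded with scales in a set of finite
  measure, so integrability of f suffices for Fubini. Once the difference sits on f, finiteness of
  \<open>HH\<close> at \<open>x\<close> provides the integrability.\<close>

lemma PT_IN:
 assumes f[measurable]: "f \<in> BM borel" and fi: "integrable lborel f" and x: "x \<in> Q1"
  and e: "0 < e" "e < c" and fin: "\<And>J. HH f l lam c J x < \<infinity>"
 shows "(LI y. f y*PT l e x y) = (\<Sum>J\<in>UNIV. \<integral>w. (if gate e J (fst (fst w)) then IN (%_. 0) J f x w else 0) \<partial>R J)"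
proof -
 define P where "P J y = (\<Prod>j\<in>UNIV-J. TT (l j) 0 c (x$j) (y$j))" for J and y :: "real^'n"
 have Pm[measurable]: "P J \<in> BM borel" for J unfolding P_def by(intro borel_measurable_prod TT_measurable[OF c0]) measurable
 define F where "F J v y = f y*(SJ e J x y v * P J y)" for J v y
 have KS0: "0 <= KS e J" for J unfolding KS_def using e kC_pos by(intro prod_nonneg) (auto intro!: mult_nonneg_nonneg less_imp_le)
 have FI: "integrable (R J) (%(v, y). F J v y)" for J
 proof -
  interpret VR: pair_sigma_finite "V J" "lborel :: (real^'n) measure" by(rule pair_R)
  obtain b where b: "0 <= b" "\<And>y. \<bar>P J y\<bar> <= b" using TT_prod_bound[where A = "UNIV - J" and x = x] by(auto simp: P_def)
  have [measurable]: "(%p. SJ e J x (snd p) (fst p)) \<in> BM (R J)" by(rule measurable_SJ) auto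
  have V0m[measurable]: "V0 J \<in> sets (V J)" by(rule V0)
  define H where "H = (%(v, y). KS e J*indicator (V0 J) v * (b*\<bar>f y\<bar>))"
  have "integrable (R J) H"
  proof (rule VR.Fubini_integrable)
   show "H \<in> BM (R J)" unfolding H_def split_beta by measurable
   have "(%v. \<integral>y. norm (H (v, y)) \<partial>lborel) = (%v. (KS e J*(b*(LI y. \<bar>f y\<bar>)))*indicator (V0 J) v)"
   using b KS0[of J] by(auto simp: H_def fun_eq_iff abs_mult mult_ac)
   then show "integrable (V J) (%v. \<integral>y. norm (H (v, y)) \<partial>lborel)" using V0[of J] by simp
   show "AE v in V J. integrable lborel (%y. H (v, y))" unfolding H_def using fi by(auto intro!: integrable_mult_right integrable_abs)
  qed
  then show ?thesis
  proof (rule Bochner_Integration.integrable_bound)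
   show "(%(v, y). F J v y) \<in> BM (R J)" unfolding F_def split_beta by measurable
   show "AE p in R J. norm (case p of (v, y) => F J v y) <= norm (H p)"
   proof (rule AE_I2)
   fix p assume "p \<in> space (R J)"
   then obtain v y where p: "p = (v, y)" "v \<in> space (V J)" by(auto simp: space_pair_measure)
   have "\<bar>f y*(SJ e J x y v * P J y)\<bar> <= \<bar>f y\<bar>*((KS e J*indicator (V0 J) v)*b)"
   unfolding abs_mult by(intro mult_left_mono mult_mono SJ_bound e x p b) (auto intro!: mult_nonneg_nonneg KS0)
   also have "... = norm (H p)" using b KS0[of J] by(simp add: H_def p abs_mult mult_ac)
   finally show "norm (case p of (v, y) => F J v y) <= norm (H p)" by(simp add: p F_def)
   qed
  qed
 qed
 have main: "integrable lborel (%y. \<integral>v. F J v y \<partial>V J)"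
  "(LI y. (\<integral>v. F J v y \<partial>V J)) = (\<integral>w. (if gate e J (fst (fst w)) then IN (%_. 0) J f x w else 0) \<partial>R J)" for J
 proof -
  interpret VR: pair_sigma_finite "V J" "lborel :: (real^'n) measure" by(rule pair_R)
  show "integrable lborel (%y. \<integral>v. F J v y \<partial>V J)" by(rule VR.integrable_snd[OF FI])
  have "(LI y. (\<integral>v. F J v y \<partial>V J)) = (\<integral>v. (LI y. F J v y) \<partial>V J)" using VR.integral_snd[OF FI] VR.integral_fst[OF FI] by simp
  also have "... = (\<integral>v. (LI z. (if gate e J (fst v) then IN (%_. 0) J f x (v, z) else 0)) \<partial>V J)"
   unfolding F_def P_def by(intro BI_cong refl SJ_mdiff f fi x)
  also have "... = (\<integral>w. (if gate e J (fst (fst w)) then IN (%_. 0) J f x w else 0) \<partial>R J)"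
  proof -
   have "integrable (R J) (%w. if gate e J (fst (fst w)) then IN (%_. 0) J f x w else 0)" by(intro integrable_gated IN_integrable[OF f x _ fin] pred_gate_R) simp
   from VR.integral_fst'[OF this] show ?thesis by simp
  qed
  finally show "(LI y. (\<integral>v. F J v y \<partial>V J)) = (\<integral>w. (if gate e J (fst (fst w)) then IN (%_. 0) J f x w else 0) \<partial>R J)" .
 qed
 have "f y*PT l e x y = (\<Sum>J\<in>UNIV. \<integral>v. F J v y \<partial>V J)" for y unfolding PT_expand[OF e x] F_def P_def by(simp add: sum_distrib_left)
 then show ?thesis by(simp add: Bochner_Integration.integral_sum main)
qed

lemma IN2_integrable:
 assumes f[measurable]: "f \<in> BM borel" and i: "\<And>j. i j <= lam j"
  and psi[measurable]: "\<psi> \<in> BM borel" "\<And>x. \<bar>\<psi> x\<bar> <= \<Psi>" "\<And>x. x \<notin> Q1 ==> \<psi> x = 0"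
  and fin: "(NN x. (if x \<in> Q1 then HH f l lam c J x else 0)) < \<infinity>"
  and g[measurable]: "Measurable.pred (R J) g"
 shows "integrable (lborel \<Otimes>\<^sub>M R J) (%(x, w). \<psi> x*(if g w then IN i J f x w else 0))"
proof (rule integrableI_bounded)
 interpret RR: sigma_finite_measure "R J" by(rule sf_R)
 have [measurable]: "(%p. IN i J f (fst p) (snd p)) \<in> BM (lborel \<Otimes>\<^sub>M R J)" by(rule measurable_IN[OF f]) auto
 show m: "(%(x, w). \<psi> x*(if g w then IN i J f x w else 0)) \<in> BM (lborel \<Otimes>\<^sub>M R J)" unfolding split_beta by measurable
 have P0: "0 <= \<Psi>" using psi(2)[of 0] by linarith
 have "(\<integral>\<^sup>+p. ennreal (norm (case p of (x, w) => \<psi> x*(if g w then IN i J f x w else 0))) \<partial>(lborel \<Otimes>\<^sub>M R J))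
  = (NN x. (nn_integral (R J) (%w. ennreal (norm (\<psi> x*(if g w then IN i J f x w else 0))))))" using m by(subst RR.nn_integral_fst[symmetric]) auto
 also have "... <= (NN x. ennreal (\<Psi>*CE l c lam)*(if x \<in> Q1 then HH f l lam c J x else 0))"
 proof (rule nn_integral_mono)
  fix x :: "real^'n"
  show "(nn_integral (R J) (%w. ennreal (norm (\<psi> x*(if g w then IN i J f x w else 0))))) <= ennreal (\<Psi>*CE l c lam)*(if x \<in> Q1 then HH f l lam c J x else 0)"
  proof (cases "x \<in> Q1")
   case True
   have [measurable]: "IN i J f x \<in> BM (R J)" by(rule measurable_IN_R[OF f])
   have "(nn_integral (R J) (%w. ennreal (norm (\<psi> x*(if g w then IN i J f x w else 0))))) <= (nn_integral (R J) (%w. ennreal \<Psi>*ennreal \<bar>IN i J f x w\<bar>))"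
   by(intro nn_integral_mono) (use P0 psi(2)[of x] in \<open>auto simp: abs_mult ennreal_mult[symmetric] intro!: ennreal_leI mult_right_mono\<close>)
   also have "... = ennreal \<Psi>*(nn_integral (R J) (%w. ennreal \<bar>IN i J f x w\<bar>))" by(rule nn_integral_cmult) measurable
   also have "... <= ennreal \<Psi>*(ennreal (CE l c lam)*HH f l lam c J x)" by(intro mult_left_mono IN_norm_integral f True i) simp
   finally show ?thesis using True P0 CE_pos[OF c0, of l lam] by(simp add: ennreal_mult mult.assoc)
  qed (simp add: psi)
 qed
 also have "... = ennreal (\<Psi>*CE l c lam)*(NN x. (if x \<in> Q1 then HH f l lam c J x else 0))" by(rule nn_integral_cmult) measurable
 also have "... < \<infinity>" using fin by(simp add: ennreal_mult_less_top)
 finally show "(\<integral>\<^sup>+p. ennreal (norm (case p of (x, w) => \<psi> x*(if g w then IN i J f x w else 0))) \<partial>(lborel \<Otimes>\<^sub>M R J)) < \<infinity>" .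
qed

lemma integral_pull_factor:
 fixes a b :: "'b => real"
 shows "(\<integral>x. a x*(m*b x) \<partial>M) = m*(\<integral>x. a x*b x \<partial>M)" unfolding mult.left_commute[of "a x" m "b x" for x] by simp

definition GJ :: "('n => nat) => 'n set => (real^'n => real) => real^'n => real" where
 "GJ lam J f x = (\<integral>w. IN lam J f x w \<partial>R J)"

lemma PT_Fubini:
 assumes f[measurable]: "f \<in> BM borel" and fi: "integrable lborel f"
  and psi[measurable]: "\<psi> \<in> BM borel" "\<And>x. \<bar>\<psi> x\<bar> <= \<Psi>" "\<And>x. x \<notin> Q1 ==> \<psi> x = 0"
  and e: "0 < e" "e < c"
 shows "(LI x. \<psi> x*(LI y. f y*PT l e x y)) = (LI y. f y*(LI x. \<psi> x*PT l e x y))"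
proof -
 have le: "2*real (l j)*e <= 1" for j
 proof -
  have "2*real (l j)*e <= 2*real (l j)*c" using e by(intro mult_left_mono) auto
  then show ?thesis using lc[of j] by linarith
 qed
 have P0: "0 <= \<Psi>" using psi(2)[of 0] by linarith
 let ?K = "(\<Prod>j\<in>(UNIV::'n set). TC (l j)*(1/e))"
 have K: "0 <= ?K" by(intro prod_nonneg mult_nonneg_nonneg) (use e TC_nonneg in auto)
 have [measurable]: "(%p. PT l e (fst p) (snd p)) \<in> BM (lborel \<Otimes>\<^sub>M lborel)" by(rule measurable_PT[OF e(1)]) auto
 have Q1m[measurable]: "(Q1 :: (real^'n) set) \<in> sets borel" by(simp add: cube_def)
 have Q1f: "emeasure lborel (Q1 :: (real^'n) set) < \<infinity>" unfolding cube_def by(rule emeasure_bounded_finite) simp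
 define H where "H = (%(x::real^'n, y). (\<Psi>*?K)*indicator Q1 x*\<bar>f y\<bar>)"
 have HI: "integrable (lborel \<Otimes>\<^sub>M lborel) H"
 proof (rule lborel_pair.Fubini_integrable)
  show "H \<in> BM (lborel \<Otimes>\<^sub>M lborel)" unfolding H_def split_beta by measurable
  have "(%x. \<integral>y. norm (H (x, y)) \<partial>lborel) = (%x. ((\<Psi>*?K)*(LI y. \<bar>f y\<bar>))*indicator Q1 x)"
   using P0 K by(auto simp: H_def fun_eq_iff abs_mult mult_ac)
  then show "integrable lborel (%x. \<integral>y. norm (H (x, y)) \<partial>lborel)" using Q1f by simp
  show "AE x in lborel. integrable lborel (%y. H (x, y))" unfolding H_def using fi by(auto intro!: integrable_mult_right integrable_abs)
 qed
 have I: "integrable (lborel \<Otimes>\<^sub>M lborel) (%(x, y). \<psi> x*(f y*PT l e x y))"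
 proof (rule Bochner_Integration.integrable_bound[OF HI])
  show "(%(x, y). \<psi> x*(f y*PT l e x y)) \<in> BM (lborel \<Otimes>\<^sub>M lborel)" unfolding split_beta by measurable
  show "AE p in lborel \<Otimes>\<^sub>M lborel. norm (case p of (x, y) => \<psi> x*(f y*PT l e x y)) <= norm (H p)"
  proof (rule AE_I2)
   fix p :: "(real^'n) \<times> (real^'n)"
   obtain x y where p: "p = (x, y)" by(cases p)
   show "norm (case p of (x, y) => \<psi> x*(f y*PT l e x y)) <= norm (H p)"
   proof (cases "x \<in> Q1")
   case True
   have "\<bar>\<psi> x*(f y*PT l e x y)\<bar> <= \<Psi>*(\<bar>f y\<bar>*?K)" unfolding abs_mult using PT_bound(1)[where l = l, OF True e(1) le, of y] P0 psi(2)[of x]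
   by(intro mult_mono mult_left_mono) auto
   then show ?thesis using True P0 K by(simp add: p H_def abs_mult mult_ac)
   qed (simp add: p psi)
  qed
 qed
 have "(LI x. \<psi> x*(LI y. f y*PT l e x y)) = (LI x. (LI y. \<psi> x*(f y*PT l e x y)))" by simp
 also have "... = (LI y. (LI x. \<psi> x*(f y*PT l e x y)))" using lborel_pair.integral_snd[OF I] lborel_pair.integral_fst[OF I] by simp
 also have "... = (LI y. f y*(LI x. \<psi> x*PT l e x y))" unfolding mult.left_commute[of "\<psi> x" "f y" for x y] by simp
 finally show ?thesis .
qed

text \<open>The functions \<open>\<psi>\<close> and \<open>\<phi>'\<close> are tied only by
  \<open>ibp\<close>, so that one proof serves twice: a derivative of a test function and the signed
  test function give the weak derivative, and the indicator of a box in both roles gives the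
  identity almost everywhere. For the indicator, continuity is asked only at almost every
  point.\<close>

theorem representation:
 assumes f[measurable]: "f \<in> BM borel" and fi: "integrable lborel f" and f0: "\<And>x. x \<notin> Q1 ==> f x = 0"
  and fin: "\<And>J. (NN x. (if x \<in> Q1 then HH f l lam c J x else 0)) < \<infinity>"
  and psi[measurable]: "\<psi> \<in> BM borel" and psib: "\<And>x. \<bar>\<psi> x\<bar> <= \<Psi>" and psi0: "\<And>x. x \<notin> Q1 ==> \<psi> x = 0"
  and cont: "AE y in lborel. y \<in> Q1 --> isCont \<psi> y"
  and phi[measurable]: "\<phi>' \<in> BM borel" and phib: "\<And>x. \<bar>\<phi>' x\<bar> <= \<Psi>" and phi0: "\<And>x. x \<notin> Q1 ==> \<phi>' x = 0"
  and ibp: "\<And>J t xi z. inbox c J t ==> (LI x. \<psi> x*EE l c J (%_. 0) t xi x z) = (LI x. \<phi>' x*EE l c J lam t xi x z)"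
 shows "(LI x. f x*\<psi> x) = (\<Sum>J\<in>UNIV. \<integral>x. \<phi>' x*GJ lam J f x \<partial>lborel)"
proof -
 \<comment> \<open>The denominator n + 2 keeps every term strictly below c.\<close>
 define \<epsilon> where "\<epsilon> n = c/real (n + 2)" for n
 have eps: "0 < \<epsilon> n" "\<epsilon> n < c" for n using c0 by(auto simp: \<epsilon>_def field_simps add_pos_nonneg)
 have eps0: "\<epsilon> \<longlonglongrightarrow> 0" unfolding \<epsilon>_def using LIMSEQ_ignore_initial_segment[OF lim_const_over_n[of c], of 2] by simp
 have epsr: "filterlim \<epsilon> (at_right 0) sequentially"
  unfolding filterlim_at using eps0 eps by(auto simp: eventually_sequentially less_imp_neq[symmetric] intro!: exI[of _ 0] always_eventually) 
 have P0: "0 <= \<Psi>" using psib[of 0] by linarith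
 define A where "A n = (LI x. \<psi> x*(LI y. f y*PT l (\<epsilon> n) x y))" for n
 \<comment> \<open>Fubini moves the smoothing to \<open>\<psi>\<close>, where it converges almost
   everywhere on the cube with a uniform bound.\<close>
 have lim1: "A \<longlonglongrightarrow> (LI x. f x*\<psi> x)"
 proof -
  have "(%n. \<integral>y. f y*(LI x. \<psi> x*PT l (\<epsilon> n) x y) \<partial>lborel) \<longlonglongrightarrow> (LI y. f y*\<psi> y)"
  proof (rule integral_dominated_convergence[where w = "%y. \<bar>f y\<bar>*(\<Psi>*CA l)"])
   show "(%y. f y*(LI x. \<psi> x*PT l (\<epsilon> n) x y)) \<in> BM lborel" for n
   proof -
   have [measurable]: "(%p. PT l (\<epsilon> n) (snd p) (fst p)) \<in> BM (lborel \<Otimes>\<^sub>M lborel)" by(rule measurable_PT[OF eps(1)]) auto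
   show ?thesis by measurable
   qed
   show "integrable lborel (%y. \<bar>f y\<bar>*(\<Psi>*CA l))" using fi by(intro integrable_mult_left integrable_abs)
   show "AE y in lborel. (%n. f y*(LI x. \<psi> x*PT l (\<epsilon> n) x y)) \<longlonglongrightarrow> f y*\<psi> y" using cont
   proof eventually_elim
   case (elim y)
   show ?case
   proof (cases "y \<in> Q1")
   case True
   have "((%e. \<integral>x. \<psi> x*PT l e x y \<partial>lborel) \<longlongrightarrow> \<psi> y) (at_right 0)"
   by(rule PT_limit[OF psi l1 N1 c0 lc psib psi0 True]) (use elim True in auto)
   from filterlim_compose[OF this epsr] show ?thesis by(intro tendsto_mult_left)
   qed (simp add: f0)
   qed
   show "AE y in lborel. norm (f y*(LI x. \<psi> x*PT l (\<epsilon> n) x y)) <= \<bar>f y\<bar>*(\<Psi>*CA l)" for n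
   proof (rule AE_I2)
   fix y
   have le: "2*real (l j)*\<epsilon> n <= 1" for j
   proof -
   have "2*real (l j)*\<epsilon> n <= 2*real (l j)*c" using eps[of n] by(intro mult_left_mono) auto
   then show ?thesis using lc[of j] by linarith
   qed
   have "\<bar>\<integral>x. \<psi> x*PT l (\<epsilon> n) x y \<partial>lborel\<bar> <= \<Psi>*CA l"
   by(rule PT_slice(2)[where \<Psi> = \<Psi>]) (use eps le psib psi0 P0 in auto)
   then show "norm (f y*(LI x. \<psi> x*PT l (\<epsilon> n) x y)) <= \<bar>f y\<bar>*(\<Psi>*CA l)" by(simp add: abs_mult mult_left_mono)
   qed
  qed measurable
  moreover have "A = (%n. \<integral>y. f y*(LI x. \<psi> x*PT l (\<epsilon> n) x y) \<partial>lborel)" unfolding A_def by(intro ext PT_Fubini[OF f fi psi psib psi0 eps])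
  ultimately show ?thesis by simp
 qed
 define D where "D n J = (\<integral>p. (case p of (x, w) => \<phi>' x*(if gate (\<epsilon> n) J (fst (fst w)) then IN lam J f x w else 0)) \<partial>(lborel \<Otimes>\<^sub>M R J))" for n J
 \<comment> \<open>At a fixed truncation the derivatives pass to the kernel by \<open>ibp\<close>,
   after the integral over \<open>x\<close> has been taken innermost.\<close>
 have AD: "A n = (\<Sum>J\<in>UNIV. D n J)" for n
 proof -
  let ?I = "%i J x w. (if gate (\<epsilon> n) J (fst (fst w)) then IN i J f x w else 0)"
  have HHm: "(%x. if x \<in> Q1 then HH f l lam c J x else 0) \<in> BM lborel" for J by measurable
  have "AE x in lborel. \<forall>J\<in>UNIV. (if x \<in> Q1 then HH f l lam c J x else 0) ~= \<infinity>"
  proof (rule AE_finite_allI)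
   show "AE x in lborel. (if x \<in> Q1 then HH f l lam c J x else 0) ~= \<infinity>" for J by(rule nn_integral_PInf_AE[OF HHm]) (use fin[of J] in simp)
  qed simp
  then have ae: "AE x in lborel. \<psi> x*(LI y. f y*PT l (\<epsilon> n) x y) = (\<Sum>J\<in>UNIV. \<integral>w. \<psi> x*?I (%_. 0) J x w \<partial>R J)"
  proof eventually_elim
   case (elim x)
   show ?case
   proof (cases "x \<in> Q1")
   case True
   have "(LI y. f y*PT l (\<epsilon> n) x y) = (\<Sum>J\<in>UNIV. \<integral>w. ?I (%_. 0) J x w \<partial>R J)"
   by(rule PT_IN[OF f fi True eps]) (use elim True in \<open>auto simp: less_top\<close>)
   then show ?thesis by(simp add: sum_distrib_left)
   qed (simp add: psi0)
  qed
  have i0: "integrable (lborel \<Otimes>\<^sub>M R J) (%(x, w). \<psi> x*?I (%_. 0) J x w)" for J by(rule IN2_integrable[OF f _ psi psib psi0 fin pred_gate_R]) simp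
  have i1: "integrable (lborel \<Otimes>\<^sub>M R J) (%(x, w). \<phi>' x*?I lam J x w)" for J by(rule IN2_integrable[OF f _ phi phib phi0 fin pred_gate_R]) simp
  have i0': "integrable lborel (%x. \<integral>w. \<psi> x*?I (%_. 0) J x w \<partial>R J)" for J
  proof -
   interpret LR: pair_sigma_finite "lborel :: (real^'n) measure" "R J" by(intro pair_sigma_finite.intro sf_R sigma_finite_lborel)
   show ?thesis by(rule LR.integrable_fst[OF i0])
  qed
  have "A n = (LI x. (\<Sum>J\<in>UNIV. \<integral>w. \<psi> x*?I (%_. 0) J x w \<partial>R J))" unfolding A_def
  proof (rule integral_cong_AE[OF _ _ ae])
   have [measurable]: "(%p. PT l (\<epsilon> n) (fst p) (snd p)) \<in> BM (lborel \<Otimes>\<^sub>M lborel)" by(rule measurable_PT[OF eps(1)]) auto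
   show "(%x. \<psi> x*(LI y. f y*PT l (\<epsilon> n) x y)) \<in> BM lborel" by measurable
   show "(%x. \<Sum>J\<in>UNIV. \<integral>w. \<psi> x*?I (%_. 0) J x w \<partial>R J) \<in> BM lborel" by(intro borel_measurable_sum borel_measurable_integrable i0')
  qed
  also have "... = (\<Sum>J\<in>UNIV. \<integral>x. (\<integral>w. \<psi> x*?I (%_. 0) J x w \<partial>R J) \<partial>lborel)"
   by(rule Bochner_Integration.integral_sum[OF i0'])
  also have "... = (\<Sum>J\<in>UNIV. D n J)"
  proof (rule sum.cong)
   fix J
   interpret LR: pair_sigma_finite "lborel :: (real^'n) measure" "R J" by(intro pair_sigma_finite.intro sf_R sigma_finite_lborel)
   have "(LI x. (\<integral>w. \<psi> x*?I (%_. 0) J x w \<partial>R J)) = (\<integral>w. (LI x. \<psi> x*?I (%_. 0) J x w) \<partial>R J)"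
   using LR.integral_fst[OF i0] LR.integral_snd[OF i0] by simp
   also have "... = (\<integral>w. (LI x. \<phi>' x*?I lam J x w) \<partial>R J)"
   proof (rule BI_cong[OF refl])
   fix w
   show "(LI x. \<psi> x*?I (%_. 0) J x w) = (LI x. \<phi>' x*?I lam J x w)"
   proof (cases "gate (\<epsilon> n) J (fst (fst w)) \<and> inbox c J (fst (fst w))")
   case True
   let ?m = "mdiff (chiJ J l) (restr_vec J (snd (fst w))) f (snd w)"
   have "(LI x. \<psi> x*?I (%_. 0) J x w) = ?m*(LI x. \<psi> x*EE l c J (%_. 0) (fst (fst w)) (snd (fst w)) x (snd w))"
   using True by(simp add: IN_def integral_pull_factor)
   also have "... = ?m*(LI x. \<phi>' x*EE l c J lam (fst (fst w)) (snd (fst w)) x (snd w))" using ibp True by simp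
   also have "... = (LI x. \<phi>' x*?I lam J x w)" using True by(simp add: IN_def integral_pull_factor)
   finally show ?thesis .
   qed (cases "gate (\<epsilon> n) J (fst (fst w))"; auto simp: IN_def)
   qed
   also have "... = D n J" unfolding D_def using LR.integral_snd[OF i1] by simp
   finally show "(LI x. (\<integral>w. \<psi> x*?I (%_. 0) J x w \<partial>R J)) = D n J" .
  qed simp
  finally show ?thesis .
 qed
 \<comment> \<open>Each point with positive scales passes the gate for all large n, and the
   integrand without the gate dominates.\<close>
 have lim2: "(%n. D n J) \<longlonglongrightarrow> (LI x. \<phi>' x*GJ lam J f x)" for J
 proof -
  interpret LR: pair_sigma_finite "lborel :: (real^'n) measure" "R J" by(intro pair_sigma_finite.intro sf_R sigma_finite_lborel)
  have i: "integrable (lborel \<Otimes>\<^sub>M R J) (%(x, w). \<phi>' x*(if True then IN lam J f x w else 0))" by(rule IN2_integrable[OF f _ phi phib phi0 fin]) simp_all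
  have i': "integrable (lborel \<Otimes>\<^sub>M R J) (%(x, w). \<phi>' x*IN lam J f x w)" using i by simp
  have im: "integrable (lborel \<Otimes>\<^sub>M R J) (%(x, w). \<phi>' x*(if gate (\<epsilon> n) J (fst (fst w)) then IN lam J f x w else 0))" for n
   by(rule IN2_integrable[OF f _ phi phib phi0 fin pred_gate_R]) simp
  have "(%n. D n J) \<longlonglongrightarrow> (\<integral>p. (case p of (x, w) => \<phi>' x*IN lam J f x w) \<partial>(lborel \<Otimes>\<^sub>M R J))" unfolding D_def
  proof (rule integral_dominated_convergence[where w = "%p. \<bar>case p of (x, w) => \<phi>' x*IN lam J f x w\<bar>"])
   show "integrable (lborel \<Otimes>\<^sub>M R J) (%p. \<bar>case p of (x, w) => \<phi>' x*IN lam J f x w\<bar>)" by(rule integrable_abs[OF i'])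
   show "AE p in lborel \<Otimes>\<^sub>M R J. (%n. case p of (x, w) => \<phi>' x*(if gate (\<epsilon> n) J (fst (fst w)) then IN lam J f x w else 0))
   \<longlonglongrightarrow> (case p of (x, w) => \<phi>' x*IN lam J f x w)"
   proof (rule AE_I2, clarify)
   fix x t xi z
   show "(%n. \<phi>' x*(if gate (\<epsilon> n) J (fst (fst ((t, xi), z))) then IN lam J f x ((t, xi), z) else 0)) \<longlonglongrightarrow> \<phi>' x*IN lam J f x ((t, xi), z)"
   proof (cases "inbox c J t")
   case True
   have "eventually (%n. \<epsilon> n < t j) sequentially" if "j \<in> J" for j using True that by(intro order_tendstoD(2)[OF eps0]) (auto simp: inbox_def)
   then have "eventually (%n. \<forall>j\<in>J. \<epsilon> n < t j) sequentially" by(intro eventually_ball_finite) auto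
   then have "eventually (%n. \<phi>' x*(if gate (\<epsilon> n) J (fst (fst ((t, xi), z))) then IN lam J f x ((t, xi), z) else 0) = \<phi>' x*IN lam J f x ((t, xi), z)) sequentially"
   by eventually_elim (simp add: gate_def)
   then show ?thesis by(rule tendsto_eventually)
   qed (simp add: IN_def cong: if_cong)
   qed
   show "AE p in lborel \<Otimes>\<^sub>M R J. norm (case p of (x, w) => \<phi>' x*(if gate (\<epsilon> n) J (fst (fst w)) then IN lam J f x w else 0))
   <= \<bar>case p of (x, w) => \<phi>' x*IN lam J f x w\<bar>" for n by(intro AE_I2) (auto split: prod.split)
  qed (use i' im in \<open>auto intro: borel_measurable_integrable\<close>)
  also have "(\<integral>p. (case p of (x, w) => \<phi>' x*IN lam J f x w) \<partial>(lborel \<Otimes>\<^sub>M R J)) = (LI x. \<phi>' x*GJ lam J f x)"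
   using LR.integral_fst[OF i'] by(simp add: GJ_def)
  finally show ?thesis .
 qed
 have "A = (%n. \<Sum>J\<in>UNIV. D n J)" by(intro ext AD)
 then have "A \<longlonglongrightarrow> (\<Sum>J\<in>UNIV. \<integral>x. \<phi>' x*GJ lam J f x \<partial>lborel)" by(simp add: tendsto_sum lim2)
 with lim1 show ?thesis by(rule LIMSEQ_unique)
qed

end

section \<open>Weak derivatives and their norms\<close>

lemma exists_list_counts: "\<exists>js. \<forall>j::'n::finite. count_list js j = lam j"
proof -
 have *: "finite A ==> \<exists>js. \<forall>j::'n. count_list js j = (if j \<in> A then lam j else 0)" for A
 proof (induction A rule: finite_induct)
  case empty
  show ?case by(rule exI[of _ "[]"]) simp
 next
  case (insert a A)
  then obtain js where js: "\<forall>j. count_list js j = (if j \<in> A then lam j else 0)" by blast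
  have r: "count_list (replicate n a) j = (if j = a then n else 0)" for n j by(induction n) auto
  show ?case by(rule exI[of _ "replicate (lam a) a @ js"]) (use js insert r in auto)
 qed
 from *[of UNIV] show ?thesis by simp
qed

lemma length_count_list: "length js = (\<Sum>j\<in>UNIV. count_list js (j::'n::finite))" by(rule sum_count_set[symmetric]) auto

lemma partial_mi_list:
 obtains js where "\<And>j::'n::finite. count_list js j = lam j" "partial_mi lam \<phi> = partial_list js \<phi>"
  "length js = (\<Sum>j\<in>UNIV. lam j)"
proof -
 define js where "js = (SOME js. \<forall>j::'n. count_list js j = lam j)"
 have "\<forall>j. count_list js j = lam j" unfolding js_def by(rule someI_ex[OF exists_list_counts])
 moreover have "partial_mi lam \<phi> = partial_list js \<phi>" unfolding partial_mi_def js_def ..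
 ultimately show ?thesis using that[of js] length_count_list[of js] by simp
qed

lemma continuous_compact_bounded:
 fixes g :: "'a::euclidean_space => real"
 assumes "continuous_on UNIV g" "compact S" "\<And>x. x \<notin> S ==> g x = 0"
 shows "\<exists>b\<ge>0. \<forall>x. \<bar>g x\<bar> <= b"
proof -
 have "compact (g ` S)" using assms compact_continuous_image continuous_on_subset by blast
 then obtain b where b: "\<And>x. x \<in> S ==> norm (g x) <= b" using compact_imp_bounded bounded_iff by(metis imageI)
 have "\<bar>g x\<bar> <= max b 0" for x using b[of x] assms(3)[of x] by(cases "x \<in> S") auto
 then show ?thesis by(intro exI[of _ "max b 0"]) auto
qed

lemma test_fun_facts:
 assumes t: "test_fun G \<phi>"
 shows "continuous_on UNIV (partial_list js \<phi>)" "x \<notin> G ==> partial_list js \<phi> x = 0" "\<exists>b\<ge>0. \<forall>x. \<bar>partial_list js \<phi> x\<bar> <= b"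
  "partial_list js \<phi> \<in> BM borel"
proof -
 show c: "continuous_on UNIV (partial_list js \<phi>)" using t unfolding test_fun_def by blast
 have sub: "closure {x. \<phi> x ~= 0} \<subseteq> G" "compact (closure {x. \<phi> x ~= 0})" using t unfolding test_fun_def by auto
 show "x \<notin> G ==> partial_list js \<phi> x = 0" using partial_list_support sub by blast
 show "\<exists>b\<ge>0. \<forall>x. \<bar>partial_list js \<phi> x\<bar> <= b" by(rule continuous_compact_bounded[OF c sub(2)]) (rule partial_list_support)
 show "partial_list js \<phi> \<in> BM borel" by(rule borel_measurable_continuous_onI[OF c])
qed

text \<open>A sum is at most its number of terms times the largest one.\<close>

lemma epow_sum_le:
 assumes "finite S" "0 <= q"
 shows "epow (\<Sum>J\<in>S. a J) q <= ennreal (real (card S) powr q)*(\<Sum>J\<in>S. epow (a J) q)"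
proof (cases "S = {}")
 case False
 then obtain J0 where J0: "J0 \<in> S" "\<And>J. J \<in> S ==> a J <= a J0"
  using finite_imageI[OF assms(1), of a] Max_in[of "a ` S"] Max_ge[of "a ` S"] by(metis (no_types, lifting) image_iff image_is_empty imageI)
 have "(\<Sum>J\<in>S. a J) <= (\<Sum>J\<in>S. a J0)" by(intro sum_mono J0)
 also have "... = ennreal (real (card S))*a J0" by(simp add: ennreal_of_nat_eq_real_of_nat)
 finally have "epow (\<Sum>J\<in>S. a J) q <= epow (ennreal (real (card S))*a J0) q" by(intro epow_mono assms)
 also have "... <= ennreal (real (card S) powr q)*epow (a J0) q"
 proof (cases "q = 0")
  case True
  then show ?thesis using False assms(1)
   by(cases "a J0 = 0"; cases "a J0 = top"; auto simp: epow_def ennreal_mult_top ennreal_mult_eq_top_iff enn2real_eq_0_iff card_gt_0_iff)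
 next
  case False
  then show ?thesis using assms by(simp add: epow_mult epow_ennreal)
 qed
 also have "... <= ennreal (real (card S) powr q)*(\<Sum>J\<in>S. epow (a J) q)" by(intro mult_left_mono member_le_sum J0 assms) auto
 finally show ?thesis .
qed simp

context rep
begin

lemma GJ_bound:
 assumes f: "f \<in> BM borel" and x: "x \<in> Q1" and i: "\<And>j. i j <= lam j"
 shows "ennreal \<bar>GJ i J f x\<bar> <= ennreal (CE l c lam)*HH f l lam c J x"
proof (cases "integrable (R J) (IN i J f x)")
 case True
 have "ennreal (norm (GJ i J f x)) <= (nn_integral (R J) (%w. ennreal (norm (IN i J f x w))))" unfolding GJ_def by(rule integral_norm_bound_ennreal[OF True])
 also have "... <= ennreal (CE l c lam)*HH f l lam c J x" using IN_norm_integral[OF f x i] by simp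
 finally show ?thesis by simp
qed (simp add: GJ_def not_integrable_integral_eq)

lemma measurable_GJ [measurable]:
 assumes f[measurable]: "f \<in> BM borel"
 shows "GJ i J f \<in> BM borel"
proof -
 interpret RR: sigma_finite_measure "R J" by(rule sf_R)
 have [measurable]: "(%p. IN i J f (fst p) (snd p)) \<in> BM (borel \<Otimes>\<^sub>M R J)" by(rule measurable_IN[OF f]) auto
 have "(%x. \<integral>w. IN i J f x w \<partial>R J) \<in> BM borel" by measurable
 then show ?thesis unfolding GJ_def .
qed

text \<open>For the full index set this is the weak derivative of order \<open>lam\<close>. A
  general index set allows the term of the empty \<open>J\<close> to be split off.\<close>

definition gg :: "'n set set => ('n => nat) => (real^'n => real) => real^'n => real" where
 "gg S lam f x = (if x \<in> Q1 then (\<Sum>J\<in>S. GJ lam J f x) else 0)"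

lemma measurable_gg [measurable]:
 assumes f[measurable]: "f \<in> BM borel"
 shows "gg S lam f \<in> BM borel" unfolding gg_def by measurable

text \<open>The chain of kernels has length N - 1 only, since \<open>bt\<close> already spends one
  derivative of the bump; hence lam j < N.\<close>

lemma EE_ibp:
 assumes t: "test_fun Q1 \<phi>'" and i: "inbox c J t" and lam: "\<And>j. lam j < N" and js: "\<And>j. count_list js j = lam j"
 shows "(LI x. partial_list js \<phi>' x*EE l c J (%_. 0) t xi x z) =
  (-1)^length js*(LI x. \<phi>' x*EE l c J lam t xi x z)"
proof -
 define K where "K j = (%r x. if j \<in> J then kk (l j) r (t j) x (z$j) (xi j) else TT (l j) r c x (z$j))" for j
 have ch: "smooth_chain (N - 1) (K j)" for j
 proof (cases "j \<in> J")
  case True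
  then show ?thesis unfolding K_def using N1 kk_chain[of "N - 1" "l j" "t j" "z$j" "xi j"] by simp
 next
  case False
  then show ?thesis unfolding K_def using smooth_chain_mono[OF TT_chain[OF c0], of "N - 1" "l j" "z$j"] by simp
 qed
 have "(LI x. partial_list js \<phi>' x*(\<Prod>i\<in>UNIV. K i ((%_. 0) i) (x$i))) =
  (-1)^length js*(LI x. \<phi>' x*(\<Prod>i\<in>UNIV. K i ((%_. 0) i + count_list js i) (x$i)))"
 proof (rule IBP_list[OF t ch])
  show "(%_. 0) i + count_list js i <= N - 1" for i using lam[of i] js[of i] by simp
 qed
 then show ?thesis unfolding EE_def K_def js by(simp add: if_distrib if_distribR cong: if_cong)
qed

lemma weak_deriv_gg:
 assumes f[measurable]: "f \<in> BM borel" and fi: "integrable lborel f" and f0: "\<And>x. x \<notin> Q1 ==> f x = 0"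
  and fin: "\<And>J. (NN x. (if x \<in> Q1 then HH f l lam c J x else 0)) < \<infinity>"
  and lam: "\<And>j. lam j < N" and t: "test_fun Q1 \<phi>'"
 shows "(LI x. f x*partial_mi lam \<phi>' x) = (-1)^(\<Sum>j\<in>UNIV. lam j)*(LI x. gg UNIV lam f x*\<phi>' x)"
  and "integrable lborel (gg UNIV lam f)"
proof -
 have gi: "integrable lborel (%x. if x \<in> Q1 then GJ lam J f x else 0)" for J
 proof (rule integrableI_bounded)
  have "(NN x. ennreal (norm (if x \<in> Q1 then GJ lam J f x else 0))) \<le>
   (NN x. ennreal (CE l c lam)*(if x \<in> Q1 then HH f l lam c J x else 0))" by(intro nn_integral_mono) (use GJ_bound[OF f, of _ lam lam J] in auto)
  also have "... = ennreal (CE l c lam)*(NN x. (if x \<in> Q1 then HH f l lam c J x else 0))" by(rule nn_integral_cmult) measurable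
  also have "... < \<infinity>" using fin by(simp add: ennreal_mult_less_top)
  finally show "(NN x. ennreal (norm (if x \<in> Q1 then GJ lam J f x else 0))) < \<infinity>" .
 qed measurable
 have gg_eq: "gg UNIV lam f x = (\<Sum>J\<in>UNIV. if x \<in> Q1 then GJ lam J f x else 0)" for x by(simp add: gg_def)
 show "integrable lborel (gg UNIV lam f)" unfolding gg_eq[abs_def] by(intro Bochner_Integration.integrable_sum gi)
 obtain js where js: "\<And>j. count_list js j = lam j" "partial_mi lam \<phi>' = partial_list js \<phi>'"
  "length js = (\<Sum>j\<in>UNIV. lam j)" using partial_mi_list[of lam "\<phi>'"] by blast
 obtain b1 where b1: "0 <= b1" "\<And>x. \<bar>partial_list js \<phi>' x\<bar> <= b1" using test_fun_facts(3)[OF t] by blast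
 obtain b2 where b2: "0 <= b2" "\<And>x. \<bar>\<phi>' x\<bar> <= b2" using test_fun_facts(3)[OF t, of "[]"] by auto
 have pm[measurable]: "\<phi>' \<in> BM borel" using test_fun_facts(4)[OF t, of "[]"] by simp
 have p0: "x \<notin> Q1 ==> \<phi>' x = 0" for x using test_fun_facts(2)[OF t, of x "[]"] by simp
 have "(LI x. f x*partial_list js \<phi>' x) = (\<Sum>J\<in>UNIV. \<integral>x. ((-1)^length js*\<phi>' x)*GJ lam J f x \<partial>lborel)"
 proof (rule representation[OF f fi f0 fin, where \<Psi> = "max b1 b2"])
  show "\<bar>partial_list js \<phi>' x\<bar> <= max b1 b2" for x using b1(2)[of x] by simp
  show "\<bar>(-1)^length js*\<phi>' x\<bar> <= max b1 b2" for x using b2(2)[of x] by(simp add: abs_mult power_abs)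
  show "AE y in lborel. y \<in> Q1 --> isCont (partial_list js \<phi>') y" using test_fun_facts(1)[OF t] by(auto simp: continuous_on_eq_continuous_at)
  show "(LI x. partial_list js \<phi>' x*EE l c J (%_. 0) t xi x z) = (LI x. (-1)^length js*\<phi>' x*EE l c J lam t xi x z)"
   if "inbox c J t" for J t xi z using EE_ibp[OF t that lam js(1)] by(simp add: mult.assoc)
 qed (use test_fun_facts[OF t] p0 in auto)
 also have "... = (-1)^length js*(\<Sum>J\<in>UNIV. \<integral>x. (if x \<in> Q1 then GJ lam J f x else 0)*\<phi>' x \<partial>lborel)" unfolding sum_distrib_left
 proof (rule sum.cong[OF refl])
  fix J
  have "(%x. ((-1)^length js*\<phi>' x)*GJ lam J f x) = (%x. (-1)^length js*((if x \<in> Q1 then GJ lam J f x else 0)*\<phi>' x))" using p0 by(auto simp: fun_eq_iff)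
  then show "(LI x. ((-1)^length js*\<phi>' x)*GJ lam J f x) = (-1)^length js*(LI x. (if x \<in> Q1 then GJ lam J f x else 0)*\<phi>' x)" by simp
 qed
 also have "(\<Sum>J\<in>UNIV. \<integral>x. (if x \<in> Q1 then GJ lam J f x else 0)*\<phi>' x \<partial>lborel) = (LI x. gg UNIV lam f x*\<phi>' x)"
 proof -
  have "integrable lborel (%x. (if x \<in> Q1 then GJ lam J f x else 0)*\<phi>' x)" for J
  proof (rule Bochner_Integration.integrable_bound[OF integrable_mult_left[OF gi[of J], of b2]])
   show "AE x in lborel. norm ((if x \<in> Q1 then GJ lam J f x else 0)*\<phi>' x) <= norm ((if x \<in> Q1 then GJ lam J f x else 0)*b2)"
   using b2 by(intro AE_I2) (auto simp: abs_mult intro!: mult_left_mono)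
  qed measurable
  then show ?thesis unfolding gg_eq by(subst Bochner_Integration.integral_sum[symmetric]) (auto simp: sum_distrib_right)
 qed
 finally show "(LI x. f x*partial_mi lam \<phi>' x) = (-1)^(\<Sum>j\<in>UNIV. lam j)*(LI x. gg UNIV lam f x*\<phi>' x)" by(simp add: js)
qed

definition WT :: "'n set set => (real^'n => real) => real => ('n => nat) => real => ennreal" where
 "WT S f p lam s = (\<Sum>J\<in>S. WJ f p l lam s c J)"

lemma WJ_le_WT: "J \<in> S ==> WJ f p l lam s c J <= WT S f p lam s" unfolding WT_def by(rule member_le_sum) auto

lemma CJ1: "1 <= CJ l J" by(rule CJ_ge1) (rule l1)

definition CM :: real where "CM = (\<Sum>J\<in>(UNIV::'n set set). CJ l J)"

lemma CJ_le_CM: "CJ l J <= CM" unfolding CM_def by(rule member_le_sum) (auto intro!: order_trans[OF zero_le_one CJ1])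

lemma CM_ge1: "1 <= CM" using CJ_le_CM[of "{}"] CJ1[of "{}"] by linarith

text \<open>The number of subsets enters squared: once for passing from a sum to its largest term,
  and once for adding up the terms, where n <= n^q is used.\<close>

definition CG :: "('n => nat) => real" where
 "CG lam = CE l c lam*CM*(real (card (UNIV :: 'n set set)))\<^sup>2"

lemma card_sets: "1 <= real (card (UNIV :: 'n set set))" by(simp add: Suc_le_eq card_gt_0_iff)

lemma gg_le: assumes f: "f \<in> BM borel" and x: "x \<in> Q1"
 shows "ennreal \<bar>gg S lam f x\<bar> <= ennreal (CE l c lam)*(\<Sum>J\<in>S. HH f l lam c J x)"
proof -
 have "ennreal \<bar>gg S lam f x\<bar> <= ennreal (\<Sum>J\<in>S. \<bar>GJ lam J f x\<bar>)" using x by(intro ennreal_leI) (simp add: gg_def sum_abs)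
 also have "... = (\<Sum>J\<in>S. ennreal \<bar>GJ lam J f x\<bar>)" by simp
 also have "... <= (\<Sum>J\<in>S. ennreal (CE l c lam)*HH f l lam c J x)" by(intro sum_mono GJ_bound f x) simp
 finally show ?thesis by(simp add: sum_distrib_left)
qed

lemma gg_sup:
 assumes f: "f \<in> BM borel" and p: "1 <= p"
  and W: "WT S f p lam (1/p) = ennreal w" "0 <= w"
 shows "\<bar>gg S lam f x\<bar> <= CG lam*w"
proof (cases "x \<in> Q1")
 case True
 have CE0: "0 < CE l c lam" by(rule CE_pos[OF c0])
 have "HH f l lam c J x <= ennreal (CM*w)" if "J \<in> S" for J
 proof -
  have "HH f l lam c J x <= ennreal (CJ l J*w)" by(rule HH_sup[OF f p l1]) (use WJ_le_WT[OF that, of f p lam "1/p"] W in auto)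
  also have "... <= ennreal (CM*w)" using CJ_le_CM W by(intro ennreal_leI mult_right_mono) auto
  finally show ?thesis .
 qed
 then have "(\<Sum>J\<in>S. HH f l lam c J x) <= (\<Sum>J\<in>S. ennreal (CM*w))" by(intro sum_mono)
 also have "... = ennreal (real (card S)*(CM*w))" using CM_ge1 W by(simp add: ennreal_of_nat_eq_real_of_nat ennreal_mult)
 also have "... <= ennreal (real (card (UNIV :: 'n set set))*(CM*w))" using CM_ge1 W by(intro ennreal_leI mult_right_mono of_nat_mono card_mono) auto
 also have "... <= ennreal ((real (card (UNIV :: 'n set set)))\<^sup>2*(CM*w))" using CM_ge1 W card_sets by(intro ennreal_leI mult_right_mono self_le_power) auto
 finally have "ennreal \<bar>gg S lam f x\<bar> <= ennreal (CE l c lam)*ennreal ((real (card (UNIV :: 'n set set)))\<^sup>2*(CM*w))"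
  using gg_le[OF f True, of S lam] by(meson mult_left_mono order_trans zero_le)
 also have "... = ennreal (CG lam*w)" using CE0 CM_ge1 W by(simp add: CG_def ennreal_mult[symmetric] mult_ac)
 finally show ?thesis using CE0 CM_ge1 W by(simp add: CG_def)
next
 case False
 then show ?thesis using CM_ge1 W CE_pos[OF c0, of l lam] by(simp add: gg_def CG_def)
qed

lemma gg_Lq:
 assumes f[measurable]: "f \<in> BM borel" and p: "1 <= p" "p <= q"
  and W: "WT S f p lam (1/p - 1/q) = ennreal w" "0 <= w"
  and fin: "\<And>J t. J \<in> S ==> t \<in> space (LJ J) ==> inbox c J t ==> Dt f p l J t < \<infinity>"
 shows "(NN x. ennreal (\<bar>gg S lam f x\<bar> powr q)) <= ennreal ((CG lam*w) powr q)"
proof -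
 let ?n = "real (card (UNIV :: 'n set set))"
 let ?C = "CE l c lam"
 have C: "0 < ?C" by(rule CE_pos[OF c0])
 have q: "0 < q" "1 <= q" using p by auto
 have pw: "ennreal (\<bar>gg S lam f x\<bar> powr q) <= ennreal (?C powr q*?n powr q)*(\<Sum>J\<in>S. (if x \<in> Q1 then epow (HH f l lam c J x) q else 0))" for x
 proof (cases "x \<in> Q1")
  case True
  have "ennreal (\<bar>gg S lam f x\<bar> powr q) = epow (ennreal \<bar>gg S lam f x\<bar>) q" by(simp add: epow_ennreal)
  also have "... <= epow (ennreal ?C*(\<Sum>J\<in>S. HH f l lam c J x)) q" by(intro epow_mono gg_le f True) (use q in auto)
  also have "... = ennreal (?C powr q)*epow (\<Sum>J\<in>S. HH f l lam c J x) q" using q C by(simp add: epow_mult epow_ennreal)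
  also have "... <= ennreal (?C powr q)*(ennreal (?n powr q)*(\<Sum>J\<in>S. epow (HH f l lam c J x) q))"
   by(intro mult_left_mono order_trans[OF epow_sum_le[OF finite]] mult_right_mono ennreal_leI powr_mono2 of_nat_mono card_mono) (use q in auto)
  finally show ?thesis using True by(simp add: ennreal_mult mult.assoc)
 qed (simp add: gg_def)
 have "(NN x. ennreal (\<bar>gg S lam f x\<bar> powr q)) \<le>
  (NN x. ennreal (?C powr q*?n powr q)*(\<Sum>J\<in>S. (if x \<in> Q1 then epow (HH f l lam c J x) q else 0)))" by(intro nn_integral_mono pw)
 also have "... = ennreal (?C powr q*?n powr q)*(\<Sum>J\<in>S. \<integral>\<^sup>+x. (if x \<in> Q1 then epow (HH f l lam c J x) q else 0) \<partial>lborel)"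
  by(subst nn_integral_cmult) (measurable, subst nn_integral_sum, measurable)
 also have "... <= ennreal (?C powr q*?n powr q)*(\<Sum>J\<in>S. ennreal ((CM*w) powr q))"
 proof (intro mult_left_mono sum_mono)
  fix J :: "'n set" assume J: "J \<in> S"
  have "(NN x. (if x \<in> Q1 then epow (HH f l lam c J x) q else 0)) <= ennreal ((CJ l J*w) powr q)"
   by(rule HH_Lq[OF f p l1]) (use WJ_le_WT[OF J, of f p lam "1/p - 1/q"] W fin[OF J] in auto)
  also have "... <= ennreal ((CM*w) powr q)" using CJ_le_CM W q order_trans[OF zero_le_one CJ1[of J]] by(intro ennreal_leI powr_mono2 mult_right_mono) auto
  finally show "(NN x. (if x \<in> Q1 then epow (HH f l lam c J x) q else 0)) <= ennreal ((CM*w) powr q)" .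
 qed simp
 also have "... = ennreal ((?C powr q*?n powr q)*(real (card S)*(CM*w) powr q))" by(simp add: ennreal_of_nat_eq_real_of_nat ennreal_mult)
 also have "... <= ennreal ((?C powr q*?n powr q)*(?n*(CM*w) powr q))" by(intro ennreal_leI mult_left_mono mult_right_mono of_nat_mono card_mono) auto
 also have "... <= ennreal ((CG lam*w) powr q)"
 proof (rule ennreal_leI)
  have "(?C powr q*?n powr q)*(?n*(CM*w) powr q) <= (?C powr q*?n powr q)*(?n powr q*(CM*w) powr q)"
   using powr_mono[OF q(2) card_sets] by(intro mult_left_mono mult_right_mono) auto
  also have "... = (CG lam*w) powr q" using C CM_ge1 W by(simp add: CG_def powr_mult power2_eq_square mult_ac)
  finally show "(?C powr q*?n powr q)*(?n*(CM*w) powr q) <= (CG lam*w) powr q" .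
 qed
 finally show ?thesis .
qed

end

section \<open>Representation almost everywhere and the empty index set\<close>

text \<open>The sets over which \<open>h\<close> integrates to 0 form a Dynkin system, once the
  whole space is seen to belong to it. Boxes are stable under intersection and generate the Borel
  sets, so the sets where \<open>h\<close> is positive or negative are included.\<close>

lemma AE_zero_from_boxes:
 fixes h :: "'a::euclidean_space => real"
 assumes h: "integrable lborel h" and box: "\<And>a b. (LI x. indicator (box a b) x*h x) = 0"
 shows "AE x in lborel. h x = 0"
proof -
 have [measurable]: "h \<in> BM borel" using h by auto
 have hi: "integrable lborel (%x. indicator A x*h x)" if "A \<in> sets borel" for A using integrable_mult_indicator[of A lborel h] h that by simp
 define G where "G = range (%(a, b). box a b :: 'a set)"
 have "Int_stable G" by(auto simp: Int_stable_def G_def box_Int_box image_iff)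
 have total: "(LI x. h x) = 0"
 proof -
  define b where "b n = real n *\<^sub>R (One :: 'a)" for n
  have "(%n. \<integral>x. indicator (box (- b n) (b n)) x*h x \<partial>lborel) \<longlonglongrightarrow> (LI x. h x)"
  proof (rule integral_dominated_convergence[where w = "%x. \<bar>h x\<bar>"])
   show "AE x in lborel. (%n. indicator (box (- b n) (b n)) x*h x) \<longlonglongrightarrow> h x"
   proof (rule AE_I2)
   fix x :: 'a
   obtain n0 where n0: "norm x < real n0" using reals_Archimedean2 by blast
   have "x \<in> box (- b n) (b n)" if "n0 <= n" for n
   proof -
   have "\<bar>x \<bullet> i\<bar> < real n" if "i \<in> Basis" for i using Basis_le_norm[OF that, of x] n0 \<open>n0 <= n\<close> by linarith
   then show ?thesis unfolding mem_box b_def by(auto simp: inner_Basis abs_less_iff) (metis minus_less_iff)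
   qed
   then show "(%n. indicator (box (- b n) (b n)) x*h x) \<longlonglongrightarrow> h x" by(intro tendsto_eventually eventually_sequentiallyI[of n0]) simp
   qed
   show "AE x in lborel. norm (indicator (box (- b n) (b n)) x*h x) <= \<bar>h x\<bar>" for n by(intro AE_I2) (auto simp: indicator_def)
  qed (use h in auto)
  then show ?thesis by(simp add: box LIMSEQ_const_iff)
 qed
 have zero: "(LI x. indicator A x*h x) = 0" if A: "A \<in> sets borel" for A
 proof -
  have A': "A \<in> sigma_sets UNIV G" using A unfolding G_def borel_eq_box by simp
  have sb: "sigma_sets UNIV G = sets borel" unfolding G_def borel_eq_box by simp
  show ?thesis using \<open>Int_stable G\<close> _ A'
  proof (rule sigma_sets_induct_disjoint)
   show "G \<subseteq> Pow UNIV" by simp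
   show "(LI x. indicator A x*h x) = 0" if "A \<in> G" for A using that box by(auto simp: G_def)
   show "(LI x. indicator {} x*h x) = 0" by simp
   show "(LI x. indicator (UNIV - A) x*h x) = 0"
   if "A \<in> sigma_sets UNIV G" "(LI x. indicator A x*h x) = 0" for A
   proof -
   have "(LI x. indicator (UNIV - A) x*h x) = (LI x. h x - indicator A x*h x)" by(intro BI_cong refl) (auto simp: indicator_def)
   also have "... = 0" using that hi h sb by(subst Bochner_Integration.integral_diff) (auto simp: total)
   finally show ?thesis .
   qed
   show "(LI x. indicator (\<Union>(range A)) x*h x) = 0"
   if "disjoint_family A" "range A \<subseteq> sigma_sets UNIV G" "\<And>i::nat. (LI x. indicator (A i) x*h x) = 0" for A
   proof -
   have Am: "A i \<in> sets lborel" for i using that(2) sb by auto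
   have "(LINT x:(\<Union>i. A i)|lborel. h x) = (\<Sum>i. (LINT x:(A i)|lborel. h x))"
   proof (rule lebesgue_integral_countable_add[OF Am])
   show "A i \<inter> A j = {}" if "i ~= j" for i j using \<open>disjoint_family A\<close> that by(auto simp: disjoint_family_on_def)
   show "set_integrable lborel (\<Union>(range A)) h" unfolding set_integrable_def using hi[of "\<Union>(range A)"] Am by auto
   qed
   then show ?thesis using that(3) by(simp add: set_lebesgue_integral_def)
   qed
  qed
 qed
 have "AE x in lborel. indicator {x. 0 < h x} x*h x = 0"
 proof (subst integral_nonneg_eq_0_iff_AE[symmetric])
  show "integrable lborel (%x. indicator {x. 0 < h x} x*h x)" by(rule hi) measurable
  show "(LI x. indicator {x. 0 < h x} x*h x) = 0" by(rule zero) measurable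
 qed (auto simp: indicator_def)
 moreover have "AE x in lborel. - (indicator {x. h x < 0} x*h x) = 0"
 proof (subst integral_nonneg_eq_0_iff_AE[symmetric])
  show "integrable lborel (%x. - (indicator {x. h x < 0} x*h x))" by(intro integrable_minus hi) measurable
  show "(LI x. - (indicator {x. h x < 0} x*h x)) = 0" by(subst integral_minus) (subst zero, measurable)
 qed (auto simp: indicator_def)
 ultimately show ?thesis by eventually_elim (auto simp: indicator_def split: if_splits)
qed

lemma AE_not_frontier:
 fixes S :: "'a::euclidean_space set"
 assumes "convex S"
 shows "AE x in lborel. x \<notin> frontier S"
proof (rule AE_not_in)
 show "frontier S \<in> null_sets lborel" using negligible_convex_frontier[OF assms] by(simp add: negligible_iff_null_sets null_sets_completion_iff)
qed

text \<open>The empty product measure is the unit mass at the only extensional function.\<close>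

lemma PiM_empty_nn_integral: "(\<integral>\<^sup>+t. F t \<partial>PiM ({}::'n::finite set) (%_. lborel::real measure)) = F (%_. undefined)"
proof -
 interpret product_sigma_finite "%_::'n. lborel::real measure" by standard
 show ?thesis by(rule nn_integral_empty) simp
qed

lemma mdiff_empty:
 fixes f :: "real^'n::finite => real"
 shows "mdiff (chiJ {} l) h f z = f z"
proof -
 have "{k::'n => nat. \<forall>j. k j <= chiJ {} l j} = {%_. 0}" by(auto simp: chiJ_def)
 moreover have "(\<chi> j. real 0*h$j) = 0" by(simp add: vec_eq_iff)
 ultimately show ?thesis by(simp add: mdiff_def chiJ_def)
qed

lemma Dt_empty:
 fixes f :: "real^'n::finite => real"
 assumes "\<And>x. x \<notin> Q1 ==> f x = 0" "0 < p"
 shows "Dt f p l {} t = (NN z. ennreal (\<bar>f z\<bar> powr p))" unfolding Dt_def PiM_empty_nn_integral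
 by(intro nn_integral_cong) (use assms in \<open>auto simp: dd_def shrunk_cube mdiff_empty epow_ennreal\<close>)

text \<open>No scale, weight or difference is left for the empty \<open>J\<close>, and its term of W
  is the L_p norm. The estimates proved for all \<open>J\<close> thus cover the smooth part as
  well.\<close>

lemma WJ_empty:
 fixes f :: "real^'n::finite => real"
 assumes "\<And>x. x \<notin> Q1 ==> f x = 0" "0 < p"
 shows "WJ f p l lam s c {} = epow (NN z. ennreal (\<bar>f z\<bar> powr p)) (1/p)" unfolding WJ_def PiM_empty_nn_integral by(simp add: inbox_def Dt_empty[OF assms])

context rep
begin

text \<open>Indicators of boxes cut with the cube serve as test functions. They are continuous off
  the frontier of a convex set, which is a null set.\<close>

lemma representation_ae:
 assumes f[measurable]: "f \<in> BM borel" and fi: "integrable lborel f" and f0: "\<And>x. x \<notin> Q1 ==> f x = 0"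
  and fin: "\<And>J. (NN x. (if x \<in> Q1 then HH f l (%_. 0) c J x else 0)) < \<infinity>"
 shows "AE x in lborel. f x = gg UNIV (%_. 0) f x"
proof -
 have gi: "integrable lborel (%x. if x \<in> Q1 then GJ (%_. 0) J f x else 0)" for J
 proof (rule integrableI_bounded)
  have "(NN x. ennreal (norm (if x \<in> Q1 then GJ (%_. 0) J f x else 0))) \<le>
   (NN x. ennreal (CE l c (%_. 0))*(if x \<in> Q1 then HH f l (%_. 0) c J x else 0))" by(intro nn_integral_mono) (use GJ_bound[OF f, of _ "%_. 0" "%_. 0" J] in auto)
  also have "... = ennreal (CE l c (%_. 0))*(NN x. (if x \<in> Q1 then HH f l (%_. 0) c J x else 0))" by(rule nn_integral_cmult) measurable
  also have "... < \<infinity>" using fin by(simp add: ennreal_mult_less_top)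
  finally show "(NN x. ennreal (norm (if x \<in> Q1 then GJ (%_. 0) J f x else 0))) < \<infinity>" .
 qed measurable
 have gg_eq: "gg UNIV (%_. 0) f x = (\<Sum>J\<in>UNIV. if x \<in> Q1 then GJ (%_. 0) J f x else 0)" for x by(simp add: gg_def)
 have ggi: "integrable lborel (gg UNIV (%_. 0) f)" unfolding gg_eq[abs_def] by(intro Bochner_Integration.integrable_sum gi)
 have Q1m[measurable]: "(Q1 :: (real^'n) set) \<in> sets borel" by(simp add: cube_def)
 have "AE x in lborel. f x - gg UNIV (%_. 0) f x = 0"
 proof (rule AE_zero_from_boxes)
  show "integrable lborel (%x. f x - gg UNIV (%_. 0) f x)" using fi ggi by simp
  fix a b :: "real^'n"
  define A where "A = box a b \<inter> Q1"
  have Am[measurable]: "A \<in> sets borel" by(simp add: A_def)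
  have cA: "convex A" unfolding A_def cube_def by(intro convex_Int convex_box)
  have "(LI x. f x*indicator A x) = (\<Sum>J\<in>UNIV. \<integral>x. indicator A x*GJ (%_. 0) J f x \<partial>lborel)"
  proof (rule representation[OF f fi f0 fin, where \<Psi> = 1])
   show "AE y in lborel. y \<in> Q1 --> isCont (indicat_real A) y" using AE_not_frontier[OF cA] by eventually_elim (simp add: isCont_indicator)
  qed (auto simp: A_def indicator_def)
  also have "... = (\<Sum>J\<in>UNIV. \<integral>x. indicator A x*(if x \<in> Q1 then GJ (%_. 0) J f x else 0) \<partial>lborel)"
   by(intro sum.cong refl BI_cong) (auto simp: A_def indicator_def)
  also have "... = (LI x. indicator A x*gg UNIV (%_. 0) f x)" unfolding gg_eq sum_distrib_left
   by(subst Bochner_Integration.integral_sum) (use integrable_mult_indicator[OF _ gi, of A] Am in auto)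
  finally have e: "(LI x. f x*indicator A x) = (LI x. indicator A x*gg UNIV (%_. 0) f x)" .
  have "(LI x. indicator (box a b) x*(f x - gg UNIV (%_. 0) f x)) = (LI x. indicator A x*f x - indicator A x*gg UNIV (%_. 0) f x)"
   by(intro BI_cong refl) (use f0 in \<open>auto simp: A_def gg_def indicator_def\<close>)
  also have "... = (LI x. indicator A x*f x) - (LI x. indicator A x*gg UNIV (%_. 0) f x)" by(rule Bochner_Integration.integral_diff)
   (use integrable_mult_indicator[OF _ fi, of A] integrable_mult_indicator[OF _ ggi, of A] Am in auto)
  finally show "(LI x. indicator (box a b) x*(f x - gg UNIV (%_. 0) f x)) = 0" using e by(simp add: mult.commute)
 qed
 then show ?thesis by eventually_elim simp
qed

text \<open>This identifies the part of f that is smoothed at the fixed scale \<open>c\<close>; its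
  kernel is continuous, which is what compactness uses.\<close>

lemma GJ_empty:
 assumes f[measurable]: "f \<in> BM borel" and f0: "\<And>x. x \<notin> Q1 ==> f x = 0" and fi: "integrable lborel f" and x: "x \<in> Q1"
 shows "GJ (%_. 0) {} f x = (LI z. f z*PT l c x z)"
proof -
 interpret T0: sigma_finite_measure "T {}" by(rule sf_T)
 interpret VR: pair_sigma_finite "V {}" "lborel :: (real^'n) measure" by(rule pair_R)
 interpret PS: product_sigma_finite "%_::'n. lborel::real measure" by standard
 have INe: "IN (%_. 0) {} f x w = f (snd w)*PT l c x (snd w)" for w by(simp add: IN_def inbox_def mdiff_empty EE_def PT_def)
 have HHe: "HH f l (%_. 0) c {} x = (NN z. ennreal \<bar>f z\<bar>)" unfolding HH_def UU_def PiM_empty_nn_integral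
  by(simp add: inbox_def) (intro nn_integral_cong, use f0 in \<open>auto simp: nearJ_def dd_def shrunk_cube mdiff_empty\<close>)
 have fin: "HH f l (%_. 0) c {} x < \<infinity>" unfolding HHe using fi by(simp add: integrable_iff_bounded)
 have i: "integrable (R {}) (IN (%_. 0) {} f x)" by(rule IN_integrable[OF f x _ fin]) simp
 have "GJ (%_. 0) {} f x = (\<integral>v. (LI z. IN (%_. 0) {} f x (v, z)) \<partial>V {})" unfolding GJ_def by(rule VR.integral_fst'[OF i, symmetric])
 also have "... = (\<integral>v. (LI z. f z*PT l c x z) \<partial>V {})" by(simp add: INe)
 also have "... = measure (V {}) (space (V {}))*(LI z. f z*PT l c x z)" by simp
 also have "measure (V {}) (space (V {})) = 1"
 proof -
  have "emeasure (V {}) (space (V {})) = (nn_integral (V {}) (%v. 1))" by simp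
  also have "... = (nn_integral (T {}) (%t. (nn_integral (T {}) (%xi. 1))))" by(rule T0.nn_integral_fst[symmetric]) simp
  also have "... = 1" unfolding PiM_empty_nn_integral ..
  finally show ?thesis by(simp add: measure_def)
 qed
 finally show ?thesis by simp
qed

end

section \<open>Differences annihilate polynomials; orthogonal projection\<close>

lemma alternating_binomial_Suc:
 fixes u :: "nat => real"
 shows "(\<Sum>k\<le>Suc l. (-1)^(Suc l - k)*real (Suc l choose k)*u k) =
  (\<Sum>k\<le>l. (-1)^(l - k)*real (l choose k)*(u (Suc k) - u k))"
proof -
 have "(\<Sum>k\<le>Suc l. (-1)^(Suc l - k)*real (Suc l choose k)*u k) =
  (-1)^Suc l*u 0 + (\<Sum>k\<le>l. (-1)^(l - k)*real (Suc l choose Suc k)*u (Suc k))" by(subst sum.atMost_Suc_shift) simp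
 also have "(\<Sum>k\<le>l. (-1)^(l - k)*real (Suc l choose Suc k)*u (Suc k)) =
  (\<Sum>k\<le>l. (-1)^(l - k)*real (l choose k)*u (Suc k)) + (\<Sum>k\<le>l. (-1)^(l - k)*real (l choose Suc k)*u (Suc k))"
  by(simp add: sum.distrib[symmetric] algebra_simps)
 also have "(\<Sum>k\<le>l. (-1)^(l - k)*real (l choose Suc k)*u (Suc k)) =
  (\<Sum>k\<le>Suc l. (-1)^(Suc l - k)*real (l choose k)*u k) - (-1)^Suc l*u 0" by(subst sum.atMost_Suc_shift) simp
 also have "(\<Sum>k\<le>Suc l. (-1)^(Suc l - k)*real (l choose k)*u k) = - (\<Sum>k\<le>l. (-1)^(l - k)*real (l choose k)*u k)" by(simp add: Suc_diff_le sum_negf)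
 finally show ?thesis by(simp add: right_diff_distrib sum_subtractf)
qed

text \<open>A first difference of the power m is a combination of powers below m, so each difference
  lowers the degree.\<close>

lemma alternating_binomial_power:
 fixes a b :: real
 shows "m < l ==> (\<Sum>k\<le>l. (-1)^(l - k)*real (l choose k)*(a + real k*b)^m) = 0"
proof (induction l arbitrary: m)
 case (Suc l)
 have e: "(a + real (Suc k)*b)^m - (a + real k*b)^m = (\<Sum>i<m. (real (m choose i)*b^(m - i))*(a + real k*b)^i)" for k
 proof -
  have "(a + real (Suc k)*b)^m = ((a + real k*b) + b)^m" by(simp add: algebra_simps)
  also have "... = (\<Sum>i\<le>m. real (m choose i)*(a + real k*b)^i*b^(m - i))" by(rule binomial_ring)
  also have "... = (\<Sum>i<m. real (m choose i)*(a + real k*b)^i*b^(m - i)) + (a + real k*b)^m" by(simp add: lessThan_Suc_atMost[symmetric])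
  finally show ?thesis by(simp add: mult_ac)
 qed
 have "(\<Sum>k\<le>Suc l. (-1)^(Suc l - k)*real (Suc l choose k)*(a + real k*b)^m) =
  (\<Sum>k\<le>l. \<Sum>i<m. (real (m choose i)*b^(m - i))*((-1)^(l - k)*real (l choose k)*(a + real k*b)^i))"
  unfolding alternating_binomial_Suc e by(simp add: sum_distrib_left mult_ac)
 also have "... = (\<Sum>i<m. \<Sum>k\<le>l. (real (m choose i)*b^(m - i))*((-1)^(l - k)*real (l choose k)*(a + real k*b)^i))" by(rule sum.swap)
 also have "... = (\<Sum>i<m. (real (m choose i)*b^(m - i))*(\<Sum>k\<le>l. (-1)^(l - k)*real (l choose k)*(a + real k*b)^i))" by(simp only: sum_distrib_left)
 also have "... = 0" using Suc by(intro sum.neutral) auto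
 finally show ?case .
qed simp

lemma alternating_binomial_poly:
 fixes q :: "real poly"
 assumes "degree q < l"
 shows "(\<Sum>k\<le>l. (-1)^(l - k)*real (l choose k)*poly q (a + real k*b)) = 0"
proof -
 have "(\<Sum>k\<le>l. (-1)^(l - k)*real (l choose k)*poly q (a + real k*b)) =
  (\<Sum>k\<le>l. \<Sum>i\<le>degree q. coeff q i*((-1)^(l - k)*real (l choose k)*(a + real k*b)^i))" unfolding poly_altdef by(simp add: sum_distrib_left mult_ac)
 also have "... = (\<Sum>i\<le>degree q. coeff q i*(\<Sum>k\<le>l. (-1)^(l - k)*real (l choose k)*(a + real k*b)^i))" by(subst sum.swap) (simp only: sum_distrib_left)
 also have "... = 0" using assms by(intro sum.neutral) (auto simp: alternating_binomial_power)
 finally show ?thesis .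
qed

lemma PiE_atMost: "{k::'n::finite => nat. \<forall>j. k j <= m j} = (\<Pi>\<^sub>E j\<in>UNIV. {..m j})" by(auto simp: PiE_def)

lemma mdiff_add: "mdiff m h (%x. f x + g x) z = mdiff m h f z + mdiff m h g z" unfolding mdiff_def by(simp add: sum.distrib[symmetric] algebra_simps)

lemma mdiff_cmult: "mdiff m h (%x. a*f x) z = a*mdiff m h f z" unfolding mdiff_def sum_distrib_left by(intro sum.cong refl) (simp add: mult_ac)

lemma mdiff_diff: "mdiff m h (%x. f x - g x) z = mdiff m h f z - mdiff m h g z" using mdiff_add[of m h f "%x. - 1*g x" z] mdiff_cmult[of m h "-1" g z] by simp

text \<open>On a monomial the mixed difference factors over the coordinates. At any coordinate of
  \<open>J\<close> the factor is a difference of order \<open>l j\<close> of a power at most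
  \<open>l j - 1\<close>.\<close>

lemma mdiff_poly_zero:
 fixes r :: "real^'n::finite => real"
 assumes r: "r \<in> poly_space (%j. l j - 1)" and l: "\<And>j. 1 <= l j" and J: "J ~= {}"
 shows "mdiff (chiJ J l) h r z = 0"
proof -
 obtain a where a: "r = (%x. \<Sum>m\<in>{m. \<forall>j. m j <= l j - 1}. a m*(\<Prod>j\<in>UNIV. (x$j)^m j))" using r by(auto simp: poly_space_def)
 obtain j0 where j0: "j0 \<in> J" using J by blast
 let ?L = "chiJ J l"
 have mono: "mdiff ?L h (%x. \<Prod>j\<in>UNIV. (x$j)^m j) z = 0" if m: "\<forall>j. m j <= l j - 1" for m
 proof -
  have "mdiff ?L h (%x. \<Prod>j\<in>UNIV. (x$j)^m j) z = (\<Sum>k\<in>(\<Pi>\<^sub>E j\<in>UNIV. {..?L j}). \<Prod>j\<in>UNIV. (-1)^(?L j - k j)*real (?L j choose k j)*(z$j + real (k j)*h$j)^m j)"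
   unfolding mdiff_def PiE_atMost by(simp add: prod.distrib power_sum)
  also have "... = (\<Prod>j\<in>UNIV. \<Sum>k\<le>?L j. (-1)^(?L j - k)*real (?L j choose k)*(z$j + real k*h$j)^m j)" by(rule prod_sum_PiE[symmetric]) auto
  also have "... = 0"
  proof (rule prod_zero)
   show "\<exists>j\<in>UNIV. (\<Sum>k\<le>?L j. (-1)^(?L j - k)*real (?L j choose k)*(z$j + real k*h$j)^m j) = 0"
   proof (rule bexI[of _ j0])
   have "m j0 < ?L j0" using m[rule_format, of j0] l[of j0] j0 by(simp add: chiJ_def)
   then show "(\<Sum>k\<le>?L j0. (-1)^(?L j0 - k)*real (?L j0 choose k)*(z$j0 + real k*h$j0)^m j0) = 0" by(rule alternating_binomial_power)
   qed simp
  qed simp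
  finally show ?thesis .
 qed
 have "mdiff ?L h r z = (\<Sum>m\<in>{m. \<forall>j. m j <= l j - 1}. a m*mdiff ?L h (%x. \<Prod>j\<in>UNIV. (x$j)^m j) z)"
  unfolding mdiff_def a by(simp add: sum_distrib_left mult_ac) (subst sum.swap, simp)
 also have "... = 0" by(intro sum.neutral) (simp add: mono)
 finally show ?thesis .
qed

lemma poly_space_add: "f \<in> poly_space k ==> g \<in> poly_space k ==> (%x. f x + g x) \<in> poly_space k"
proof -
 assume "f \<in> poly_space k" "g \<in> poly_space k"
 then obtain a b where "f = (%x. \<Sum>m\<in>{m. \<forall>j. m j <= k j}. a m*(\<Prod>j\<in>UNIV. (x$j)^m j))"
  "g = (%x. \<Sum>m\<in>{m. \<forall>j. m j <= k j}. b m*(\<Prod>j\<in>UNIV. (x$j)^m j))" by(auto simp: poly_space_def)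
 then have "(%x. f x + g x) = (%x. \<Sum>m\<in>{m. \<forall>j. m j <= k j}. (a m + b m)*(\<Prod>j\<in>UNIV. (x$j)^m j))" by(simp add: sum.distrib distrib_right)
 then show ?thesis unfolding poly_space_def mem_Collect_eq by(intro exI)
qed

lemma poly_space_cmult: "f \<in> poly_space k ==> (%x. c*f x) \<in> poly_space k"
proof -
 assume "f \<in> poly_space k"
 then obtain a where "f = (%x. \<Sum>m\<in>{m. \<forall>j. m j <= k j}. a m*(\<Prod>j\<in>UNIV. (x$j)^m j))" by(auto simp: poly_space_def)
 then have "(%x. c*f x) = (%x. \<Sum>m\<in>{m. \<forall>j. m j <= k j}. (c*a m)*(\<Prod>j\<in>UNIV. (x$j)^m j))" by(simp add: sum_distrib_left mult.assoc)
 then show ?thesis unfolding poly_space_def mem_Collect_eq by(intro exI)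
qed

lemma poly_space_diff: "f \<in> poly_space k ==> g \<in> poly_space k ==> (%x. f x - g x) \<in> poly_space k"
 using poly_space_add[of f k "%x. -1*g x"] poly_space_cmult[of g k "-1"] by simp

lemma poly_space_zero: "(%x. 0) \<in> poly_space k" unfolding poly_space_def mem_Collect_eq by(intro exI[of _ "%_. 0"]) simp

lemma poly_space_sum: "finite S ==> (\<And>i. i \<in> S ==> f i \<in> poly_space k) ==> (%x. \<Sum>i\<in>S. f i x) \<in> poly_space k"
 by(induction S rule: finite_induct) (auto intro: poly_space_zero poly_space_add)

lemma poly_space_continuous: "f \<in> poly_space k ==> continuous_on S f" unfolding poly_space_def by(auto intro!: continuous_intros)

lemma poly_space_measurable: "f \<in> poly_space k ==> f \<in> BM borel" by(intro borel_measurable_continuous_onI poly_space_continuous)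

lemma poly_space_prod:
 fixes p :: "'n::finite => real poly"
 assumes "\<And>j. degree (p j) <= k j"
 shows "(%x::real^'n. \<Prod>j\<in>UNIV. poly (p j) (x$j)) \<in> poly_space k"
proof -
 have "poly (p j) s = (\<Sum>m\<le>k j. coeff (p j) m * s^m)" for j s
  unfolding poly_altdef by(rule sum.mono_neutral_left) (use assms coeff_eq_0[of "p j"] in \<open>auto simp: not_le\<close>)
 then have "(%x::real^'n. \<Prod>j\<in>UNIV. poly (p j) (x$j)) = (%x. \<Sum>m\<in>{m. \<forall>j. m j <= k j}. (\<Prod>j\<in>UNIV. coeff (p j) (m j))*(\<Prod>j\<in>UNIV. (x$j)^m j))"
  by(simp add: prod_sum_PiE PiE_atMost prod.distrib)
 then show ?thesis unfolding poly_space_def mem_Collect_eq by(intro exI)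
qed

text \<open>Along the line from the centre of the cube to \<open>y\<close> a one-variable polynomial
  has infinitely many zeros, so it vanishes at the end of the segment too.\<close>

lemma poly_space_zero_on_cube:
 fixes r :: "real^'n::finite => real"
 assumes r: "r \<in> poly_space k" and d: "\<And>j. 0 < \<delta> j" and z: "\<And>x. x \<in> cube \<delta> x0 ==> r x = 0"
 shows "r y = 0"
proof -
 obtain a where a: "r = (%x. \<Sum>m\<in>{m. \<forall>j. m j <= k j}. a m*(\<Prod>j\<in>UNIV. (x$j)^m j))" using r by(auto simp: poly_space_def)
 define x where "x = x0 + (\<chi> j. \<delta> j/2)"
 have x: "x \<in> cube \<delta> x0" using d by(auto simp: x_def mem_cube field_simps)
 define u where "u s = r (x + s *\<^sub>R (y - x))" for s :: real
 have pf: "real_polynomial_function u"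
 proof -
  have lin: "real_polynomial_function (%s::real. (x + s *\<^sub>R (y - x))$j)" for j
  proof -
   have "(%s::real. (x + s *\<^sub>R (y - x))$j) = (%s. x$j + s*((y - x)$j))" by simp
   moreover have "real_polynomial_function (%s::real. x$j + s*((y - x)$j))" by(intro real_polynomial_function.intros bounded_linear_ident)
   ultimately show ?thesis by simp
  qed
  have pw: "real_polynomial_function (%s::real. ((x + s *\<^sub>R (y - x))$j)^n)" for j n using real_polynomial_function_power[OF lin] .
  have pr: "real_polynomial_function (%s::real. \<Prod>j\<in>S. ((x + s *\<^sub>R (y - x))$j)^m j)" if "finite S" for S m using that
  proof (induction S rule: finite_induct)
   case empty
   show ?case unfolding prod.empty by(rule real_polynomial_function.intros(2))
  next
   case (insert j F)
   show ?case unfolding prod.insert[OF insert.hyps] by(intro real_polynomial_function.intros(4) pw insert.IH)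
  qed
  show ?thesis unfolding u_def a by(intro real_polynomial_function_sum finite_multi real_polynomial_function.intros pr) auto
 qed
 obtain c n where u: "u = (%s. \<Sum>i\<le>n. c i * s^i)" using pf real_polynomial_function_iff_sum by metis
 have "open (cube \<delta> x0)" unfolding cube_def by(rule open_box)
 then have "open ((%s::real. x + s *\<^sub>R (y - x)) -` cube \<delta> x0)" by(intro open_vimage continuous_intros)
 moreover have "0 \<in> (%s::real. x + s *\<^sub>R (y - x)) -` cube \<delta> x0" using x by simp
 ultimately obtain e where e: "0 < e" "ball 0 e \<subseteq> (%s::real. x + s *\<^sub>R (y - x)) -` cube \<delta> x0" using open_contains_ball by blast
 have "ball 0 e \<subseteq> {s. (\<Sum>i\<le>n. c i * s^i) = 0}" using e(2) z unfolding u[symmetric, THEN fun_cong] u_def[symmetric]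
  by(auto simp: u[THEN fun_cong, symmetric] u_def)
 moreover have "infinite (ball (0::real) e)" using e(1) by(simp add: ball_eq_greaterThanLessThan infinite_Ioo)
 ultimately have "infinite {s. (\<Sum>i\<le>n. c i * s^i) = 0}" using finite_subset by blast
 then have "\<forall>i\<le>n. c i = 0" using polyfun_finite_roots by blast
 then have "u 1 = 0" unfolding u by simp
 then show ?thesis by(simp add: u_def)
qed

text \<open>Gram-Schmidt, adding one monomial at a time. As f is merely integrable, only pairings of
  f with continuous functions on the cube may be formed, never f with itself.\<close>

lemma projection_exists:
 fixes f :: "real^'n::finite => real"
 assumes fi: "integrable lborel f" and f0: "\<And>x. x \<notin> Q1 ==> f x = 0"
 shows "\<exists>g\<in>poly_space k. \<forall>h\<in>poly_space k. (LI x. indicator Q1 x*((f x - g x)*h x)) = 0"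
proof -
 define mono where "mono m = (%x::real^'n. \<Prod>j\<in>UNIV. (x$j)^m j)" for m
 define spn where "spn M = {g. \<exists>a. g = (%x. \<Sum>m\<in>M. a m*mono m x)}" for M
 have Q1m[measurable]: "(Q1 :: (real^'n) set) \<in> sets borel" by(simp add: cube_def)
 have mc: "continuous_on S (mono m)" for S m unfolding mono_def by(intro continuous_intros)
 have sc: "continuous_on S g" if "g \<in> spn M" for S g M using that unfolding spn_def by(auto intro!: continuous_intros mc)
 \<comment> \<open>The functions that can be paired with every continuous one; both f and the
   polynomials belong to this class.\<close>
 define Fn :: "(real^'n => real) set" where "Fn = {f. \<forall>v. continuous_on UNIV v --> integrable lborel (%x. indicator Q1 x*(f x * v x))}"
 have FnI: "integrable lborel (%x. indicator Q1 x*(f x * v x))" if "f \<in> Fn" "continuous_on UNIV v" for f v :: "real^'n => real" using that by(auto simp: Fn_def)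
 have Fn_L1: "f \<in> Fn" if "integrable lborel f" for f unfolding Fn_def mem_Collect_eq
 proof (intro allI impI)
  fix v :: "real^'n => real" assume v: "continuous_on UNIV v"
  have "compact (v ` cbox 0 1)" using v by(intro compact_continuous_image continuous_on_subset[OF v]) auto
  then obtain b where b: "\<And>x. x \<in> cbox 0 1 ==> norm (v x) <= b" using compact_imp_bounded bounded_iff by(metis imageI)
  have [measurable]: "v \<in> BM borel" by(rule borel_measurable_continuous_onI[OF v])
  have [measurable]: "f \<in> BM borel" using that by auto
  show "integrable lborel (%x. indicator Q1 x*(f x * v x))"
  proof (rule Bochner_Integration.integrable_bound[OF integrable_mult_left[OF that, of b]])
   show "AE x in lborel. norm (indicator Q1 x*(f x * v x)) <= norm (f x*b)"
   proof (rule AE_I2)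
   fix x :: "real^'n"
   show "norm (indicator Q1 x*(f x * v x)) <= norm (f x*b)"
   proof (cases "x \<in> Q1")
   case True
   then have "x \<in> cbox 0 1" by(auto simp: mem_cube mem_box_cart less_imp_le)
   then have "\<bar>v x\<bar> <= \<bar>b\<bar>" using b[of x] by simp
   then show ?thesis using True by(simp add: abs_mult mult_left_mono)
   qed simp
   qed
  qed measurable
 qed
 have Fn_cont: "g \<in> Fn" if g: "continuous_on UNIV g" for g unfolding Fn_def mem_Collect_eq
 proof (intro allI impI)
  fix v :: "real^'n => real" assume v: "continuous_on UNIV v"
  have "integrable lborel (%x. indicator (cbox 0 1) x *\<^sub>R (g x * v x))"
   by(rule borel_integrable_compact) (use g v continuous_on_subset in \<open>auto intro!: continuous_intros\<close>)
  then have i: "integrable lborel (%x. indicator Q1 x *\<^sub>R (indicator (cbox 0 1) x *\<^sub>R (g x * v x)))" by(rule integrable_mult_indicator[rotated]) auto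
  have eq: "(%x. indicator Q1 x *\<^sub>R (indicator (cbox 0 1) x *\<^sub>R (g x * v x))) = (%x. indicator Q1 x*(g x * v x))"
   by(auto simp: fun_eq_iff indicator_def mem_cube mem_box_cart less_imp_le)
  show "integrable lborel (%x. indicator Q1 x*(g x * v x))" using i unfolding eq .
 qed
 define ip where "ip u v = (LI x. indicator Q1 x*(u x * v x))" for u v :: "real^'n => real"
 have ip_diff: "ip (%x. u x - c*w x) v = ip u v - c*ip w v" if "u \<in> Fn" "w \<in> Fn" "continuous_on UNIV v" for u w v c
 proof -
  have "ip (%x. u x - c*w x) v = (LI x. indicator Q1 x*(u x * v x) - c*(indicator Q1 x*(w x * v x)))" unfolding ip_def by(intro BI_cong refl) (simp add: algebra_simps)
  also have "... = ip u v - c*ip w v" unfolding ip_def by(subst Bochner_Integration.integral_diff) (use FnI that in auto)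
  finally show ?thesis .
 qed
 have ip_add2: "ip u (%x. a * v x + w x) = a*ip u v + ip u w" if "u \<in> Fn" "continuous_on UNIV v" "continuous_on UNIV w" for u v w a
 proof -
  have "ip u (%x. a * v x + w x) = (LI x. a*(indicator Q1 x*(u x * v x)) + indicator Q1 x*(u x*w x))" unfolding ip_def by(intro BI_cong refl) (simp add: algebra_simps)
  also have "... = a*ip u v + ip u w" unfolding ip_def by(subst Bochner_Integration.integral_add) (use FnI that in auto)
  finally show ?thesis .
 qed
 have main: "\<forall>f\<in>Fn. \<exists>g\<in>spn M. \<forall>h\<in>spn M. ip (%x. f x - 1*g x) h = 0" if "finite M" for M using that
 proof (induction M rule: finite_induct)
  case empty
  have "spn {} = {%_. 0}" by(auto simp: spn_def)
  then show ?case by(auto simp: ip_def)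
 next
  case (insert m M)
  obtain pm where pm: "pm \<in> spn M" "\<And>h. h \<in> spn M ==> ip (%x. mono m x - 1*pm x) h = 0" using insert.IH Fn_cont[OF mc] by blast
  \<comment> \<open>The component of the new monomial orthogonal to the span of the previous
    ones.\<close>
  define q where "q x = mono m x - 1*pm x" for x
  have qc: "continuous_on UNIV q" unfolding q_def by(intro continuous_intros mc sc[OF pm(1)])
  show ?case
  proof
   fix f assume f: "f \<in> Fn"
   obtain g0 where g0: "g0 \<in> spn M" "\<And>h. h \<in> spn M ==> ip (%x. f x - 1*g0 x) h = 0" using insert.IH f by blast
   define c where "c = ip (%x. f x - 1*g0 x) q/ip q q"
   define g where "g x = g0 x + c*q x" for x
   have f0Fn: "(%x. f x - 1*g0 x) \<in> Fn" unfolding Fn_def mem_Collect_eq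
   proof (intro allI impI)
   fix v :: "real^'n => real" assume v: "continuous_on UNIV v"
   have "integrable lborel (%x. indicator Q1 x*(f x * v x) - indicator Q1 x*(g0 x * v x))" by(intro Bochner_Integration.integrable_diff FnI f Fn_cont sc[OF g0(1)] v)
   then show "integrable lborel (%x. indicator Q1 x*((f x - 1*g0 x) * v x))" by(simp add: algebra_simps)
   qed
   have qFn: "q \<in> Fn" by(rule Fn_cont[OF qc])
   have fg: "(%x. f x - 1*g x) = (%x. (f x - 1*g0 x) - c*q x)" by(auto simp: g_def)
   have gspn: "g \<in> spn (insert m M)"
   proof -
   obtain a b where ab: "g0 = (%x. \<Sum>m\<in>M. a m*mono m x)" "pm = (%x. \<Sum>m\<in>M. b m*mono m x)" using g0(1) pm(1) by(auto simp: spn_def)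
   have "g = (%x. \<Sum>i\<in>insert m M. (if i = m then c else a i - c*b i)*mono i x)"
   proof
   fix x
   have "(\<Sum>i\<in>insert m M. (if i = m then c else a i - c*b i)*mono i x) = c*mono m x + (\<Sum>i\<in>M. (a i - c*b i)*mono i x)"
   using insert.hyps by(simp, intro sum.cong) auto
   also have "... = g x" by(simp add: g_def q_def ab algebra_simps sum_subtractf sum_distrib_left)
   finally show "g x = (\<Sum>i\<in>insert m M. (if i = m then c else a i - c*b i)*mono i x)" by simp
   qed
   then show ?thesis unfolding spn_def mem_Collect_eq by(rule exI[of _ "%i. if i = m then c else a i - c*b i"])
   qed
   have ipq: "ip (%x. f x - 1*g x) q = 0"
   proof (cases "ip q q = 0")
   case False
   then show ?thesis unfolding fg by(subst ip_diff[OF f0Fn qFn qc]) (simp add: c_def)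
   next
   \<comment> \<open>A component of norm 0 vanishes almost everywhere on the cube, so every pairing
     with it is 0.\<close>
   case True
   then have "AE x in lborel. indicator Q1 x*(q x*q x) = 0" unfolding ip_def by(subst (asm) integral_nonneg_eq_0_iff_AE) (use FnI[OF qFn qc] in auto)
   then have "AE x in lborel. indicator Q1 x*(u x*q x) = 0" for u by eventually_elim (auto simp: indicator_def)
   then have "ip u q = 0" for u unfolding ip_def by(rule integral_eq_zero_AE)
   then show ?thesis .
   qed
   have ipM: "ip (%x. f x - 1*g x) h = 0" if "h \<in> spn M" for h
   proof -
   have qe: "q = (%x. mono m x - 1*pm x)" by(simp add: fun_eq_iff q_def)
   have "ip q h = 0" unfolding qe by(rule pm(2)[OF that])
   then show ?thesis unfolding fg by(subst ip_diff[OF f0Fn qFn sc[OF that]]) (simp only: g0(2)[OF that] mult_zero_right diff_self)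
   qed
   have fgFn: "(%x. f x - 1*g x) \<in> Fn" unfolding Fn_def mem_Collect_eq
   proof (intro allI impI)
   fix v :: "real^'n => real" assume v: "continuous_on UNIV v"
   have "integrable lborel (%x. indicator Q1 x*(f x * v x) - indicator Q1 x*(g x * v x))" by(intro Bochner_Integration.integrable_diff FnI f Fn_cont sc[OF gspn] v)
   then show "integrable lborel (%x. indicator Q1 x*((f x - 1*g x) * v x))" by(simp add: algebra_simps)
   qed
   have "ip (%x. f x - 1*g x) h = 0" if h: "h \<in> spn (insert m M)" for h
   proof -
   obtain a where a: "h = (%x. \<Sum>i\<in>insert m M. a i*mono i x)" using h by(auto simp: spn_def)
   obtain b where b: "pm = (%x. \<Sum>m\<in>M. b m*mono m x)" using pm(1) by(auto simp: spn_def)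
   define h0 where "h0 x = (\<Sum>i\<in>M. (a i + a m*b i)*mono i x)" for x
   have h0: "h0 \<in> spn M" unfolding spn_def mem_Collect_eq by(rule exI[of _ "%i. a i + a m*b i"]) (simp add: h0_def fun_eq_iff)
   have "h = (%x. a m*q x + h0 x)" using insert.hyps by(simp add: a q_def h0_def b fun_eq_iff algebra_simps sum.distrib sum_distrib_left)
   then show ?thesis using ip_add2[OF fgFn qc sc[OF h0], of "a m"] ipq ipM[OF h0] by simp
   qed
   with gspn show "\<exists>g\<in>spn (insert m M). \<forall>h\<in>spn (insert m M). ip (%x. f x - 1*g x) h = 0" by blast
  qed
 qed
 have "spn {m. \<forall>j. m j <= k j} = poly_space k" by(simp add: spn_def poly_space_def mono_def)
 then show ?thesis using main[OF finite_multi[of k]] Fn_L1[OF fi] by(auto simp: ip_def)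
qed

section \<open>Functions with vanishing differences are polynomials\<close>

lemma poly_zero_of_roots:
 fixes p :: "real poly"
 assumes "finite A" "degree p < card A" "\<And>a. a \<in> A ==> poly p a = 0"
 shows "p = 0"
proof (rule ccontr)
 assume p: "p ~= 0"
 have "card A <= card {x. poly p x = 0}" by(rule card_mono[OF poly_roots_finite[OF p]]) (use assms in auto)
 also have "... <= degree p" by(rule card_poly_roots_bound[OF p])
 finally show False using assms by simp
qed

lemma lagrange_basis:
 fixes A :: "real set"
 assumes A: "finite A" "a \<in> A"
 shows "\<exists>p. degree p < card A \<and> poly p a = 1 \<and> (\<forall>b\<in>A - {a}. poly p b = 0)"
proof (intro exI conjI ballI)
 let ?p = "\<Prod>b\<in>A - {a}. smult (1/(a - b)) [:- b, 1:]"
 have "degree ?p <= (\<Sum>b\<in>A - {a}. degree (smult (1/(a - b)) [:- b, 1:]))"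
  using degree_prod_sum_le[of "A - {a}" "%b. smult (1/(a - b)) [:- b, 1:]"] A by(simp add: o_def)
 also have "... <= (\<Sum>b\<in>A - {a}. 1)" by(intro sum_mono) auto
 also have "... < card A" using A card_Diff1_less[of A a] by simp
 finally show "degree ?p < card A" .
 show "poly ?p a = 1" unfolding poly_prod by(intro prod.neutral) (auto simp: diff_divide_distrib[symmetric])
 show "poly ?p b = 0" if "b \<in> A - {a}" for b unfolding poly_prod by(rule prod_zero) (use A that in \<open>auto intro!: bexI[of _ b]\<close>)
qed

lemma interpolation_exists:
 fixes A :: "real set" and v :: "real => real"
 assumes A: "finite A" "A ~= {}"
 shows "\<exists>q. degree q < card A \<and> (\<forall>a\<in>A. poly q a = v a)"
proof -
 obtain L where L: "\<And>a. a \<in> A ==> degree (L a) < card A \<and> poly (L a) a = 1 \<and> (\<forall>b\<in>A - {a}. poly (L a) b = 0)"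
  using lagrange_basis[OF A(1)] by metis
 let ?q = "\<Sum>a\<in>A. smult (v a) (L a)"
 have "degree ?q <= card A - 1" by(rule degree_sum_le[OF A(1)]) (use L in \<open>force intro: order_trans[OF degree_smult_le]\<close>)
 then have "degree ?q < card A" using A card_gt_0_iff[of A] by linarith
 moreover have "poly ?q a = v a" if "a \<in> A" for a
 proof -
  have "poly ?q a = (\<Sum>b\<in>A. if b = a then v a else 0)" unfolding poly_sum by(intro sum.cong) (use L that in auto)
  also have "... = v a" using A that by simp
  finally show ?thesis .
 qed
 ultimately show ?thesis by blast
qed

text \<open>The coefficient of the last term is 1, so each value is determined by the
  \<open>L\<close> preceding ones.\<close>

lemma recurrence_unique:
 fixes u w :: "nat => real"
 assumes init: "\<And>i. 1 <= i ==> i <= L ==> u i = w i"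
  and ru: "\<And>i. 1 <= i ==> i + L < M ==> (\<Sum>k\<le>L. (-1)^(L - k)*real (L choose k)*u (i + k)) = 0"
  and rw: "\<And>i. 1 <= i ==> i + L < M ==> (\<Sum>k\<le>L. (-1)^(L - k)*real (L choose k)*w (i + k)) = 0"
  and i: "1 <= i" "i < M"
 shows "u i = w i" using i
proof (induction i rule: less_induct)
 case (less i)
 show ?case
 proof (cases "i <= L")
  case True
  then show ?thesis using init less by simp
 next
  case False
  define i' where "i' = i - L"
  have i': "1 <= i'" "i' + L = i" using False by(auto simp: i'_def)
  have s: "(\<Sum>k\<le>L. (-1)^(L - k)*real (L choose k)*x (i' + k)) = x i + (\<Sum>k<L. (-1)^(L - k)*real (L choose k)*x (i' + k))" for x :: "nat => real"
   using i' by(simp add: lessThan_Suc_atMost[symmetric])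
  have "(\<Sum>k<L. (-1)^(L - k)*real (L choose k)*u (i' + k)) = (\<Sum>k<L. (-1)^(L - k)*real (L choose k)*w (i' + k))"
  proof (rule sum.cong)
   fix k assume "k \<in> {..<L}"
   then have "u (i' + k) = w (i' + k)" using less.IH[of "i' + k"] i' less.prems by auto
   then show "(-1)^(L - k)*real (L choose k)*u (i' + k) = (-1)^(L - k)*real (L choose k)*w (i' + k)" by simp
  qed simp
  then show ?thesis using ru[of i'] rw[of i'] i' less.prems s[of u] s[of w] by simp
 qed
qed

text \<open>A Frechet-type theorem: on each dyadic grid the difference equation is a linear recurrence, so the
 function agrees there with one polynomial, which does not depend on the grid.\<close>

lemma vanishing_differences_poly:
 fixes u :: "real => real"
 assumes cont: "continuous_on {0<..<1} u" and L: "1 <= L" and c: "0 < c"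
  and diff: "\<And>s h. 0 < h ==> h < c ==> 0 < s ==> s + real L*h < 1 ==>
   (\<Sum>k\<le>L. (-1)^(L - k)*real (L choose k)*u (s + real k*h)) = 0"
 shows "\<exists>q. degree q < L \<and> (\<forall>s\<in>{0<..<1}. u s = poly q s)"
proof -
 \<comment> \<open>A grid step below \<open>c\<close> makes the hypothesis on differences
   applicable, and more than \<open>L\<close> subdivisions keep the first \<open>L\<close> nodes
   inside (0,1).\<close>
 obtain M0 where M0: "1/c < real M0" "L < M0"
 proof -
  obtain M1 where "1/c < real M1" using reals_Archimedean2 by blast
  then show ?thesis using that[of "max M1 (Suc L)"] by auto
 qed
 define M where "M m = M0*2^m" for m
 have M_ge: "M0 <= M m" for m by(simp add: M_def)
 have Mpos: "0 < real (M m)" for m using M_ge[of m] M0 by auto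
 define A where "A m = (%i. real i/real (M m)) ` {1..L}" for m
 have inj: "inj_on (%i. real i/real (M m)) S" for m S using Mpos[of m] by(auto simp: inj_on_def)
 have cA: "card (A m) = L" "finite (A m)" "A m ~= {}" for m unfolding A_def using card_image[OF inj, of m "{1..L}"] L by auto
 have "\<exists>q. degree q < L \<and> (\<forall>a\<in>A m. poly q a = u a)" for m using interpolation_exists[OF cA(2,3), of m u] cA(1)[of m] by simp
 then obtain q where q: "\<And>m. degree (q m) < L" "\<And>m a. a \<in> A m ==> poly (q m) a = u a" by metis
 have agree: "u (real i/real (M m)) = poly (q m) (real i/real (M m))" if i: "1 <= i" "i < M m" for i m
 proof (rule recurrence_unique[where L = L and M = "M m" and i = i and u = "%i. u (real i/real (M m))" and w = "%i. poly (q m) (real i/real (M m))"])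
  show "u (real i/real (M m)) = poly (q m) (real i/real (M m))" if "1 <= i" "i <= L" for i
  proof -
   have "real i/real (M m) \<in> A m" unfolding A_def by(rule imageI) (use that in simp)
   from q(2)[OF this] show ?thesis by simp
  qed
  have h: "0 < 1/real (M m)" "1/real (M m) < c"
  proof -
   show "0 < 1/real (M m)" using Mpos by simp
   have "1/c < real (M m)" using M0(1) M_ge[of m] by linarith
   then show "1/real (M m) < c" using c Mpos[of m] by(simp add: field_simps)
  qed
  have e: "real (i + k)/real (M m) = real i/real (M m) + real k*(1/real (M m))" for i k by(simp add: add_divide_distrib)
  show "(\<Sum>k\<le>L. (-1)^(L - k)*real (L choose k)*u (real (i + k)/real (M m))) = 0" if "1 <= i" "i + L < M m" for i unfolding e
  proof (rule diff[OF h])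
   show "0 < real i/real (M m)" using that Mpos by simp
   have "real i + real L < real (M m)" using that by linarith
   then show "real i/real (M m) + real L*(1/real (M m)) < 1" using Mpos[of m] by(simp add: field_simps)
  qed
  show "(\<Sum>k\<le>L. (-1)^(L - k)*real (L choose k)*poly (q m) (real (i + k)/real (M m))) = 0" if "1 <= i" "i + L < M m" for i
   unfolding e by(rule alternating_binomial_poly[OF q(1)])
 qed (use i in auto)
 \<comment> \<open>The grids are nested: the \<open>L\<close> interpolation nodes of the coarsest
   one lie in every finer one and determine a polynomial of degree below \<open>L\<close>.\<close>
 have qq: "q m = q 0" for m
 proof -
  have "poly (q m - q 0) a = 0" if "a \<in> A 0" for a
  proof -
   obtain i where i: "1 <= i" "i <= L" "a = real i/real (M 0)" using \<open>a \<in> A 0\<close> by(auto simp: A_def)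
   have ae: "a = real (i*2^m)/real (M m)" using Mpos[of 0] by(simp add: i M_def)
   have b: "1 <= i*2^m" "i*2^m < M m" using i M0 by(auto simp: M_def Suc_le_eq)
   have "u a = poly (q m) a" unfolding ae by(rule agree[OF b])
   then show ?thesis using q(2)[OF that] by simp
  qed
  moreover have "degree (q m - q 0) < L" using degree_diff_le_max[of "q m" "q 0"] q(1)[of m] q(1)[of 0] by simp
  ultimately have "q m - q 0 = 0" using poly_zero_of_roots[OF cA(2), of "q m - q 0" 0] cA(1) by simp
  then show ?thesis by simp
 qed
 have "u s = poly (q 0) s" if s: "s \<in> {0<..<1}" for s
 proof -
  define i where "i m = nat \<lceil>s*real (M m)\<rceil>" for m
  define x where "x m = real (i m)/real (M m)" for m
  have ri: "real (i m) = of_int \<lceil>s*real (M m)\<rceil>" for m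
  proof -
   have "0 <= s*real (M m)" using s by simp
   then have "- 1 < s*real (M m)" by linarith
   then show ?thesis unfolding i_def by simp
  qed
  have xb: "s <= x m" "x m <= s + 1/real (M m)" for m
  proof -
   have "s*real (M m) <= real (i m)" "real (i m) <= s*real (M m) + 1" unfolding ri by linarith+
   then show "s <= x m" "x m <= s + 1/real (M m)" using Mpos[of m] by(auto simp: x_def field_simps)
  qed
  have M_inf: "(%m. 1/real (M m)) \<longlonglongrightarrow> 0"
  proof -
   have "(%m. (1/real M0)*(1/2)^m) \<longlonglongrightarrow> (1/real M0)*0" by(intro tendsto_mult_left LIMSEQ_power_zero) auto
   then show ?thesis by(simp add: M_def power_one_over field_simps)
  qed
  have xs: "x \<longlonglongrightarrow> s"
  proof (rule tendsto_sandwich[of "%_. s" _ _ "%m. s + 1/real (M m)"])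
   show "(%m. s + 1/real (M m)) \<longlonglongrightarrow> s" using tendsto_add[OF tendsto_const[of s] M_inf] by simp
  qed (use xb in auto)
  have ev: "eventually (%m. x m < 1) sequentially" using order_tendstoD(2)[OF xs, of 1] s by simp
  have E: "eventually (%m. u (x m) = poly (q 0) (x m)) sequentially" using ev
  proof eventually_elim
   case (elim m)
   have "0 < x m" using xb(1)[of m] s by simp
   then have "0 < i m" using Mpos[of m] by(auto simp: x_def zero_less_divide_iff)
   moreover have "i m < M m" using elim Mpos[of m] by(simp add: x_def)
   ultimately show ?case using agree[of "i m" m] unfolding x_def qq[of m] by simp
  qed
  have U: "(%m. u (x m)) \<longlonglongrightarrow> u s"
  proof -
   have "isCont u s" using cont s by(simp add: continuous_on_eq_continuous_at)
   then show ?thesis using xs isCont_tendsto_compose by blast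
  qed
  have "(%m. poly (q 0) (x m)) \<longlonglongrightarrow> poly (q 0) s" by(intro tendsto_poly xs)
  with Lim_transform_eventually[OF U E] show ?thesis by(rule LIMSEQ_unique)
 qed
 then show ?thesis using q(1) by blast
qed

text \<open>Lagrange interpolation at \<open>l j\<close> nodes reproduces g along every line in
  direction j. Applied in one coordinate after another, it writes g through its finitely many values
  on the grid of nodes, with products of one-variable polynomials as coefficients.\<close>

lemma coordinatewise_poly:
 fixes g :: "real^'n::finite => real"
 assumes l: "\<And>j. 1 <= l j"
  and H: "\<And>j x. x \<in> Q1 ==> \<exists>q. degree q < l j \<and> (\<forall>s\<in>{0<..<1}. g (\<chi> i. if i = j then s else x$i) = poly q s)"
 shows "\<exists>r\<in>poly_space (%j. l j - 1). \<forall>x\<in>Q1. g x = r x"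
proof -
 define A where "A j = (%i. real i/real (Suc (l j))) ` {1..l j}" for j
 have cA: "card (A j) = l j" "finite (A j)" "A j \<subseteq> {0<..<1}" for j
 proof -
  have "inj_on (%i. real i/real (Suc (l j))) {1..l j}" by(auto simp: inj_on_def)
  then show "card (A j) = l j" unfolding A_def by(simp add: card_image)
  show "finite (A j)" by(simp add: A_def)
  show "A j \<subseteq> {0<..<1}" by(auto simp: A_def field_simps)
 qed
 define P where "P j a = (SOME p. degree p < l j \<and> poly p a = 1 \<and> (\<forall>b\<in>A j - {a}. poly p b = 0))" for j a
 have P: "degree (P j a) < l j \<and> poly (P j a) a = 1 \<and> (\<forall>b\<in>A j - {a}. poly (P j a) b = 0)" if "a \<in> A j" for j a
  unfolding P_def by(rule someI_ex) (use lagrange_basis[OF cA(2) that] cA(1) in simp)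
 define upd where "upd S i x = (\<chi> j. if j \<in> S then i j else x$j)" for S i and x :: "real^'n"
 have one: "g x = (\<Sum>a\<in>A j. poly (P j a) (x$j)*g (\<chi> i. if i = j then a else x$i))" if x: "x \<in> Q1" for j x
 proof -
  obtain q where q: "degree q < l j" "\<And>s. s \<in> {0<..<1} ==> g (\<chi> i. if i = j then s else x$i) = poly q s" using H[OF x, of j] by blast
  define q' where "q' = (\<Sum>a\<in>A j. smult (poly q a) (P j a))"
  have "degree q' <= l j - 1" unfolding q'_def by(rule degree_sum_le[OF cA(2)]) (use P in \<open>force intro: order_trans[OF degree_smult_le]\<close>)
  then have "degree (q - q') < card (A j)" using degree_diff_le_max[of q q'] q(1) l[of j] cA(1)[of j] by simp
  moreover have "poly (q - q') a = 0" if a: "a \<in> A j" for a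
  proof -
   have "poly q' a = (\<Sum>b\<in>A j. if b = a then poly q a else 0)" unfolding q'_def poly_sum by(intro sum.cong) (use P a in auto)
   also have "... = poly q a" using cA a by simp
   finally show ?thesis by simp
  qed
  ultimately have "q - q' = 0" using poly_zero_of_roots[OF cA(2)] by blast
  then have qq: "q = q'" by simp
  have xx: "(\<chi> i. if i = j then x$j else x$i) = x" by(simp add: vec_eq_iff)
  have "g x = poly q (x$j)" using q(2)[of "x$j"] x xx by(auto simp: mem_cube)
  also have "... = (\<Sum>a\<in>A j. poly q a*poly (P j a) (x$j))" by(subst qq) (simp add: q'_def poly_sum)
  also have "... = (\<Sum>a\<in>A j. poly (P j a) (x$j)*g (\<chi> i. if i = j then a else x$i))" by(intro sum.cong refl) (use q(2) cA(3)[of j] in auto)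
  finally show ?thesis .
 qed
 have all: "g x = (\<Sum>i\<in>PiE S A. (\<Prod>j\<in>S. poly (P j (i j)) (x$j))*g (upd S i x))" if "finite S" "x \<in> Q1" for S x using that
 proof (induction S arbitrary: x rule: finite_induct)
  case empty
  then show ?case by(simp add: upd_def)
 next
  case (insert j S)
  have inQ: "upd S i x \<in> Q1" if "i \<in> PiE S A" for i unfolding mem_cube using that insert.prems cA(3) by(fastforce simp: upd_def mem_cube PiE_def Pi_def)
  have "g x = (\<Sum>i\<in>PiE S A. (\<Prod>j\<in>S. poly (P j (i j)) (x$j))*g (upd S i x))" using insert by simp
  also have "... = (\<Sum>i\<in>PiE S A. \<Sum>a\<in>A j. (\<Prod>j\<in>S. poly (P j (i j)) (x$j))*(poly (P j a) (x$j)*g (upd (insert j S) (i(j := a)) x)))"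
  proof (rule sum.cong[OF refl])
   fix i assume i: "i \<in> PiE S A"
   have "(\<chi> k. if k = j then a else upd S i x$k) = upd (insert j S) (i(j := a)) x" for a by(simp add: upd_def vec_eq_iff)
   moreover have "upd S i x$j = x$j" using insert.hyps by(simp add: upd_def)
   ultimately show "(\<Prod>j\<in>S. poly (P j (i j)) (x$j))*g (upd S i x) = (\<Sum>a\<in>A j. (\<Prod>j\<in>S. poly (P j (i j)) (x$j))*(poly (P j a) (x$j)*g (upd (insert j S) (i(j := a)) x)))"
   using one[OF inQ[OF i], of j] by(simp add: sum_distrib_left)
  qed
  also have "... = (\<Sum>(a, i)\<in>A j \<times> PiE S A. (\<Prod>j\<in>S. poly (P j (i j)) (x$j))*(poly (P j a) (x$j)*g (upd (insert j S) (i(j := a)) x)))"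
   by(subst sum.swap) (simp add: sum.cartesian_product)
  also have "... = (\<Sum>i\<in>PiE (insert j S) A. (\<Prod>j\<in>insert j S. poly (P j (i j)) (x$j))*g (upd (insert j S) i x))" unfolding PiE_insert_eq
  proof (subst sum.reindex)
   show "inj_on (%(y, g). g(j := y)) (A j \<times> PiE S A)" by(rule inj_combinator[OF insert.hyps(2)])
   show "(\<Sum>(a, i)\<in>A j \<times> PiE S A. (\<Prod>j\<in>S. poly (P j (i j)) (x$j))*(poly (P j a) (x$j)*g (upd (insert j S) (i(j := a)) x)))
   = sum ((%i. (\<Prod>j\<in>insert j S. poly (P j (i j)) (x$j))*g (upd (insert j S) i x)) \<circ> (%(y, g). g(j := y))) (A j \<times> PiE S A)"
   proof (intro sum.cong refl, clarify)
   fix a i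
   have "(\<Prod>k\<in>S. poly (P k ((i(j := a)) k)) (x$k)) = (\<Prod>k\<in>S. poly (P k (i k)) (x$k))" using insert.hyps by(intro prod.cong) auto
   then show "(\<Prod>j\<in>S. poly (P j (i j)) (x$j))*(poly (P j a) (x$j)*g (upd (insert j S) (i(j := a)) x))
   = ((%i. (\<Prod>j\<in>insert j S. poly (P j (i j)) (x$j))*g (upd (insert j S) i x)) \<circ> (%(y, g). g(j := y))) (a, i)" using insert.hyps by(simp add: mult_ac)
   qed
  qed
  finally show ?case .
 qed
 define r where "r x = (\<Sum>i\<in>PiE UNIV A. g (\<chi> j. i j)*(\<Prod>j\<in>UNIV. poly (P j (i j)) (x$j)))" for x
 have "r \<in> poly_space (%j. l j - 1)" unfolding r_def
 proof (intro poly_space_sum poly_space_cmult poly_space_prod)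
  show "finite (PiE UNIV A)" by(intro finite_PiE) (auto simp: cA)
  show "degree (P j (i j)) <= l j - 1" if "i \<in> PiE UNIV A" for i j using P[of "i j" j] that by force
 qed
 moreover have "g x = r x" if "x \<in> Q1" for x using all[of UNIV x] that by(simp add: r_def upd_def mult.commute)
 ultimately show ?thesis by blast
qed

section \<open>Differences in a single coordinate direction\<close>

definition d1 :: "(real^'n::finite => real) => nat => 'n => real => real => real^'n => real" where
 "d1 f L j \<tau> xi z = (if \<bar>xi\<bar> <= \<tau> \<and> z \<in> Q1 \<and> 0 < z$j + real L*xi \<and> z$j + real L*xi < 1
  then \<bar>\<Sum>m\<le>L. (-1)^(L - m)*real (L choose m)*f (z + (real m*xi) *\<^sub>R axis j 1)\<bar> else 0)"

text \<open>\<open>Dt\<close> for a one-element index set, with the product measure over one index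
  replaced by the line.\<close>

definition E1 :: "(real^'n::finite => real) => real => nat => 'n => real => ennreal" where
 "E1 f p L j \<tau> = (NN xi. (NN z. ennreal (d1 f L j \<tau> xi z powr p)))"

lemma measurable_d1 [measurable (raw)]:
 fixes f :: "real^'n::finite => real"
 assumes [measurable]: "f \<in> BM borel" "\<tau> \<in> BM M" "xi \<in> BM M" "z \<in> BM M"
 shows "(%w. d1 f L j (\<tau> w) (xi w) (z w)) \<in> BM M" unfolding d1_def by measurable

lemma measurable_E1 [measurable (raw)]:
 fixes f :: "real^'n::finite => real"
 assumes [measurable]: "f \<in> BM borel" "\<tau> \<in> BM M"
 shows "(%w. E1 f p L j (\<tau> w)) \<in> BM M" unfolding E1_def by measurable

lemma mdiff_single:
 fixes f :: "real^'n::finite => real"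
 shows "mdiff (chiJ {j} l) h f z =
  (\<Sum>m\<le>l j. (-1)^(l j - m)*real (l j choose m)*f (z + (real m*h$j) *\<^sub>R axis j 1))"
proof -
 let ?e = "%m i. if i = j then m else (0::nat)"
 have S: "{k. \<forall>i. k i <= chiJ {j} l i} = ?e ` {..l j}"
 proof
  show "{k. \<forall>i. k i <= chiJ {j} l i} \<subseteq> ?e ` {..l j}"
  proof
   fix k assume "k \<in> {k. \<forall>i. k i <= chiJ {j} l i}"
   then have k: "k i <= (if i = j then l j else 0)" for i by(auto simp: chiJ_def split: if_splits)
   have "k = ?e (k j)" using k by(auto simp: fun_eq_iff split: if_splits) (metis le_zero_eq)
   then show "k \<in> ?e ` {..l j}" using k[of j] by(intro image_eqI[of _ _ "k j"]) auto
  qed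
  show "?e ` {..l j} \<subseteq> {k. \<forall>i. k i <= chiJ {j} l i}" by(auto simp: chiJ_def)
 qed
 have inj: "inj_on ?e {..l j}" by(rule inj_onI) (metis)
 have s: "(\<Sum>i\<in>UNIV. chiJ {j} l i - ?e m i) = l j - m" for m
 proof -
  have "(\<Sum>i\<in>UNIV. chiJ {j} l i - ?e m i) = (\<Sum>i\<in>UNIV. if i = j then l j - m else 0)" by(intro sum.cong) (auto simp: chiJ_def)
  then show ?thesis by simp
 qed
 have p: "(\<Prod>i\<in>UNIV. real (chiJ {j} l i choose ?e m i)) = real (l j choose m)" for m
 proof -
  have "(\<Prod>i\<in>UNIV. real (chiJ {j} l i choose ?e m i)) = (\<Prod>i\<in>UNIV. if i = j then real (l j choose m) else 1)" by(intro prod.cong) (auto simp: chiJ_def)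
  then show ?thesis by simp
 qed
 have v: "(\<chi> i. real (?e m i)*h$i) = (real m*h$j) *\<^sub>R axis j 1" for m by(auto simp: vec_eq_iff axis_def)
 show ?thesis unfolding mdiff_def S by(subst sum.reindex[OF inj]) (simp add: s p v o_def)
qed

lemma dd_single: "dd f l {j} t xi z = ennreal (d1 f (l j) j (t j) (xi j) z)" unfolding dd_def d1_def mdiff_single shrunk_cube by(simp add: restr_vec_def conj_assoc)

lemma Dt_single:
 fixes f :: "real^'n::finite => real"
 assumes [measurable]: "f \<in> BM borel"
 shows "Dt f p l {j} t = E1 f p (l j) j (t j)"
proof -
 interpret PS: product_sigma_finite "%_::'n. lborel::real measure" by standard
 have d0: "0 <= d1 f (l j) j (t j) xi z" for xi z by(simp add: d1_def)
 have "(%xi. \<integral>\<^sup>+z. ennreal (d1 f (l j) j (t j) xi z powr p) \<partial>lborel) \<in> BM lborel" by measurable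
 from PS.product_nn_integral_singleton[OF this]
 show ?thesis unfolding Dt_def dd_single epow_ennreal[OF d0] E1_def .
qed

lemma E1_mono: 
 assumes "\<tau> <= \<tau>'" "0 <= p"
 shows "E1 f p L j \<tau> <= E1 f p L j \<tau>'" unfolding E1_def by(intro nn_integral_mono ennreal_leI powr_mono2) (use assms in \<open>auto simp: d1_def\<close>)

lemma powr_abs_add_le:
 fixes a b :: real
 assumes "0 <= p"
 shows "\<bar>a + b\<bar> powr p <= 2 powr p*(\<bar>a\<bar> powr p + \<bar>b\<bar> powr p)"
proof -
 have "\<bar>a + b\<bar> powr p <= (2*max \<bar>a\<bar> \<bar>b\<bar>) powr p" by(rule powr_mono2) (use assms in auto)
 also have "... = 2 powr p*max \<bar>a\<bar> \<bar>b\<bar> powr p" by(simp add: powr_mult)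
 also have "... <= 2 powr p*(\<bar>a\<bar> powr p + \<bar>b\<bar> powr p)" by(intro mult_left_mono) (auto simp: max_def)
 finally show ?thesis .
qed

lemma E1_triangle:
 fixes f :: "real^'n::finite => real"
 assumes [measurable]: "f \<in> BM borel" "g \<in> BM borel" and p: "0 <= p"
 shows "E1 (%x. f x + g x) p L j \<tau> <= ennreal (2 powr p)*(E1 f p L j \<tau> + E1 g p L j \<tau>)"
proof -
 have "ennreal (d1 (%x. f x + g x) L j \<tau> xi z powr p) <= ennreal (2 powr p)*(ennreal (d1 f L j \<tau> xi z powr p) + ennreal (d1 g L j \<tau> xi z powr p))" for xi z
  using powr_abs_add_le[OF p, of "\<Sum>m\<le>L. (-1)^(L - m)*real (L choose m)*f (z + (real m*xi) *\<^sub>R axis j 1)"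
   "\<Sum>m\<le>L. (-1)^(L - m)*real (L choose m)*g (z + (real m*xi) *\<^sub>R axis j 1)"]
  by(auto simp: d1_def ennreal_plus[symmetric] ennreal_mult[symmetric] sum.distrib[symmetric] distrib_left simp del: ennreal_plus intro!: ennreal_leI)
 then have "E1 (%x. f x + g x) p L j \<tau> <= (NN xi. (NN z. ennreal (2 powr p)*(ennreal (d1 f L j \<tau> xi z powr p) + ennreal (d1 g L j \<tau> xi z powr p))))"
  unfolding E1_def by(intro nn_integral_mono)
 also have "... = ennreal (2 powr p)*(E1 f p L j \<tau> + E1 g p L j \<tau>)" unfolding E1_def by(simp add: nn_integral_cmult nn_integral_add)
 finally show ?thesis .
qed

lemma nn_integral_translate:
 fixes F :: "'a::euclidean_space => ennreal"
 assumes [measurable]: "F \<in> BM borel"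
 shows "(NN x. F (x + a)) = (NN x. F x)"
proof -
 have "(NN x. F x) = (\<integral>\<^sup>+x. F x \<partial>distr lborel borel ((+) a))" by(simp add: lborel_distr_plus)
 also have "... = (NN x. F (a + x))" by(rule nn_integral_distr) measurable
 finally show ?thesis by(simp add: add.commute)
qed

text \<open>If z and z + L xi lie in the cube, so do all points of the difference; each translate is
  then bounded by the norm over the cube, and \<open>xi\<close> ranges over an interval of length 2
  tau.\<close>

lemma E1_le_Lp:
 fixes u :: "real^'n::finite => real"
 assumes [measurable]: "u \<in> BM borel" and p: "0 < p" and t: "0 <= \<tau>"
 shows "E1 u p L j \<tau> <= ennreal (2*\<tau>*(real (Suc L) powr p*real (Suc L)*(2^L) powr p))*(NN x. indicator Q1 x*ennreal (\<bar>u x\<bar> powr p))"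
proof -
 let ?I = "\<integral>\<^sup>+x. indicator Q1 x*ennreal (\<bar>u x\<bar> powr p) \<partial>lborel"
 let ?K = "ennreal (real (Suc L) powr p)*ennreal ((2^L) powr p)"
 have Q1m[measurable]: "(Q1 :: (real^'n) set) \<in> sets borel" by(simp add: cube_def)
 have inQ: "z + (real m*xi) *\<^sub>R axis j 1 \<in> Q1"
  if z: "z \<in> Q1" "0 < z$j + real L*xi" "z$j + real L*xi < 1" and m: "m <= L" for z :: "real^'n" and xi m
 proof -
  have zj: "0 < z$i" "z$i < 1" for i using z(1) by(auto simp: mem_cube)
  have "0 < z$j + real m*xi \<and> z$j + real m*xi < 1"
  proof (cases "0 <= xi")
   case True
   have "real m*xi <= real L*xi" "0 <= real m*xi" using True m by(auto intro: mult_right_mono)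
   then show ?thesis using zj[of j] z by linarith
  next
   case False
   have "real m*(- xi) <= real L*(- xi)" "0 <= real m*(- xi)" using False m by(intro mult_right_mono mult_nonneg_nonneg; simp)+
   then show ?thesis using zj[of j] z by simp
  qed
  then show ?thesis using zj by(auto simp: mem_cube axis_def)
 qed
 have pw: "ennreal (d1 u L j \<tau> xi z powr p) <= indicator {-\<tau>..\<tau>} xi*(?K*(\<Sum>m\<le>L. indicator Q1 (z + (real m*xi) *\<^sub>R axis j 1)*ennreal (\<bar>u (z + (real m*xi) *\<^sub>R axis j 1)\<bar> powr p)))" for xi z
 proof (cases "\<bar>xi\<bar> <= \<tau> \<and> z \<in> Q1 \<and> 0 < z$j + real L*xi \<and> z$j + real L*xi < 1")
  case True
  let ?u = "%m. u (z + (real m*xi) *\<^sub>R axis j 1)"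
  have "d1 u L j \<tau> xi z <= (\<Sum>m\<le>L. \<bar>(-1)^(L - m)*real (L choose m)*?u m\<bar>)"
   using True unfolding d1_def by(simp only: simp_thms if_True) (rule sum_abs)
  also have "... <= (\<Sum>m\<le>L. 2^L*\<bar>?u m\<bar>)"
  proof (intro sum_mono)
   fix m assume m: "m \<in> {..L}"
   have "real (L choose m) <= real (2^L)" by(rule of_nat_mono) (rule binomial_le_pow2)
   then show "\<bar>(-1)^(L - m)*real (L choose m)*?u m\<bar> <= 2^L*\<bar>?u m\<bar>" by(simp add: abs_mult power_abs mult_right_mono)
  qed
  finally have "ennreal (d1 u L j \<tau> xi z) <= ennreal (\<Sum>m\<le>L. 2^L*\<bar>?u m\<bar>)" by(rule ennreal_leI)
  also have "... = (\<Sum>m\<le>L. ennreal (2^L*\<bar>?u m\<bar>))" by(rule sum_ennreal[symmetric]) simp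
  finally have "epow (ennreal (d1 u L j \<tau> xi z)) p <= epow (\<Sum>m\<le>L. ennreal (2^L*\<bar>?u m\<bar>)) p" using p by(intro epow_mono) auto
  also have "... <= ennreal (real (card {..L}) powr p)*(\<Sum>m\<le>L. epow (ennreal (2^L*\<bar>?u m\<bar>)) p)" by(rule epow_sum_le) (use p in auto)
  also have "(\<Sum>m\<le>L. epow (ennreal (2^L*\<bar>?u m\<bar>)) p) = ennreal ((2^L) powr p)*(\<Sum>m\<le>L. ennreal (\<bar>?u m\<bar> powr p))"
   unfolding sum_distrib_left by(intro sum.cong refl) (simp only: ennreal_mult[OF zero_le_power[OF zero_le_numeral] abs_ge_zero] epow_mult[OF p] epow_ennreal[OF zero_le_power[OF zero_le_numeral]] epow_ennreal[OF abs_ge_zero])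
  also have "(\<Sum>m\<le>L. ennreal (\<bar>?u m\<bar> powr p)) = (\<Sum>m\<le>L. indicator Q1 (z + (real m*xi) *\<^sub>R axis j 1)*ennreal (\<bar>?u m\<bar> powr p))"
   using inQ[of z xi] True by(intro sum.cong refl) simp
  finally show ?thesis using True by(simp add: epow_ennreal d1_def abs_le_iff mult.assoc)
 qed (auto simp: d1_def)
 have "E1 u p L j \<tau> <= (NN xi. (NN z. indicator {-\<tau>..\<tau>} xi*(?K*(\<Sum>m\<le>L. indicator Q1 (z + (real m*xi) *\<^sub>R axis j 1)*ennreal (\<bar>u (z + (real m*xi) *\<^sub>R axis j 1)\<bar> powr p)))))"
  unfolding E1_def by(intro nn_integral_mono pw)
 also have "... = (NN xi. indicator {-\<tau>..\<tau>} xi*(?K*(\<Sum>m\<le>L. ?I)))"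
 proof (intro nn_integral_cong)
  fix xi :: real
  have tr: "(NN z. indicator Q1 (z + a)*ennreal (\<bar>u (z + a)\<bar> powr p)) = ?I" for a by(rule nn_integral_translate) measurable
  show "(NN z. indicator {-\<tau>..\<tau>} xi*(?K*(\<Sum>m\<le>L. indicator Q1 (z + (real m*xi) *\<^sub>R axis j 1)*ennreal (\<bar>u (z + (real m*xi) *\<^sub>R axis j 1)\<bar> powr p))))
   = indicator {-\<tau>..\<tau>} xi*(?K*(\<Sum>m\<le>L. ?I))"
   by(subst nn_integral_cmult, measurable, subst nn_integral_cmult, measurable, subst nn_integral_sum, measurable) (simp only: tr)
 qed
 also have "... = (?K*(\<Sum>m\<le>L. ?I))*emeasure lborel {-\<tau>..\<tau>}" by(subst mult.commute, subst nn_integral_cmult_indicator) simp_all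
 also have "... = ennreal (2*\<tau>*(real (Suc L) powr p*real (Suc L)*(2^L) powr p))*?I"
  using t by(simp add: ennreal_mult ennreal_of_nat_eq_real_of_nat mult_ac del: of_nat_Suc)
 finally show ?thesis .
qed

text \<open>For continuous g a nonzero difference would persist on an open set of pairs (xi, z), and
  nonempty open sets are not negligible.\<close>

lemma E1_zero_difference:
 fixes g :: "real^'n::finite => real"
 assumes [measurable]: "g \<in> BM borel" and g: "continuous_on Q1 g" and z: "E1 g p L j \<tau> = 0"
  and x: "\<bar>xi\<bar> < \<tau>" "x \<in> Q1" "0 < x$j + real L*xi" "x$j + real L*xi < 1"
 shows "(\<Sum>m\<le>L. (-1)^(L - m)*real (L choose m)*g (x + (real m*xi) *\<^sub>R axis j 1)) = 0"
proof (rule ccontr)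
 assume nz: "\<not> ?thesis"
 define Om where "Om = {w :: real \<times> (real^'n). \<bar>fst w\<bar> < \<tau> \<and> snd w \<in> Q1 \<and> 0 < snd w$j + real L*fst w \<and> snd w$j + real L*fst w < 1}"
 define F where "F w = (\<Sum>m\<le>L. (-1)^(L - m)*real (L choose m)*g (snd w + (real m*fst w) *\<^sub>R axis j 1))" for w :: "real \<times> (real^'n)"
 have oQ: "open {w :: real \<times> (real^'n). snd w \<in> Q1}"
 proof -
  have "{w :: real \<times> (real^'n). snd w \<in> Q1} = UNIV \<times> Q1" by auto
  then show ?thesis unfolding cube_def by(auto intro: open_Times)
 qed
 have oOm: "open Om" unfolding Om_def by(intro open_Collect_conj oQ open_Collect_less continuous_intros)
 have inQ: "snd w + (real m*fst w) *\<^sub>R axis j 1 \<in> Q1" if w: "w \<in> Om" and m: "m <= L" for w m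
 proof -
  have zj: "0 < snd w$i" "snd w$i < 1" "0 < snd w$j + real L*fst w" "snd w$j + real L*fst w < 1" for i using w by(auto simp: mem_cube Om_def)
  have "0 < snd w$j + real m*fst w \<and> snd w$j + real m*fst w < 1"
  proof (cases "0 <= fst w")
   case True
   have "real m*fst w <= real L*fst w" "0 <= real m*fst w" using True m by(auto intro: mult_right_mono)
   then show ?thesis using zj(1,2)[of j] zj(3,4) by linarith
  next
   case False
   have "real m*(- fst w) <= real L*(- fst w)" "0 <= real m*(- fst w)" using False m by(intro mult_right_mono mult_nonneg_nonneg; simp)+
   then show ?thesis using zj(1,2)[of j] zj(3,4) by simp
  qed
  then show ?thesis using zj by(auto simp: mem_cube axis_def)
 qed
 have cF: "continuous_on Om F" unfolding F_def by(intro continuous_intros continuous_on_compose2[OF g]) (use inQ in auto)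
 define A where "A = {w \<in> Om. F w ~= 0}"
 have oA: "open A"
 proof -
  have "A = Om \<inter> F -` (- {0})" by(auto simp: A_def)
  then show ?thesis using continuous_open_preimage[OF cF oOm, of "- {0}"] by(simp add: open_Compl)
 qed
 have wA: "(xi, x) \<in> A" using nz x by(simp add: A_def Om_def F_def)
 have "(\<integral>\<^sup>+w. ennreal (d1 g L j \<tau> (fst w) (snd w) powr p) \<partial>(lborel \<Otimes>\<^sub>M lborel)) = 0"
  using z unfolding E1_def by(subst lborel.nn_integral_fst[symmetric]) auto
 then have "(NN w. ennreal (d1 g L j \<tau> (fst w) (snd w) powr p)) = 0" by(simp only: lborel_prod)
 then have "AE w in lborel. ennreal (d1 g L j \<tau> (fst w) (snd w) powr p) = 0" by(subst (asm) nn_integral_0_iff_AE) (auto simp: borel_prod[symmetric])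
 then have "AE w in lborel. w \<notin> A"
 proof eventually_elim
  case (elim w)
  show ?case
  proof
   assume w: "w \<in> A"
   have "d1 g L j \<tau> (fst w) (snd w) = \<bar>F w\<bar>" using w by(auto simp: A_def Om_def d1_def F_def)
   then show False using elim w by(simp add: A_def)
  qed
 qed
 moreover have Am: "A \<in> sets lborel" using oA by simp
 ultimately have "A \<in> null_sets lborel" using AE_iff_null_sets[OF Am] by blast
 then have "negligible A" by(simp add: negligible_iff_null_sets null_sets_completionI)
 then show False using open_not_negligible[OF oA] wA by blast
qed

lemma E1_zero_poly:
 fixes g :: "real^'n::finite => real"
 assumes gm: "g \<in> BM borel" and g: "continuous_on Q1 g" and l: "\<And>j. 1 <= l j" and t: "0 < \<tau>"
  and z: "\<And>j. E1 g p (l j) j \<tau> = 0"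
 shows "\<exists>r\<in>poly_space (%j. l j - 1). \<forall>x\<in>Q1. g x = r x"
proof (rule coordinatewise_poly[OF l])
 fix j and x :: "real^'n" assume x: "x \<in> Q1"
 let ?v = "%s. \<chi> i. if i = j then s else x$i"
 have xi: "0 < x$i" "x$i < 1" for i using x by(auto simp: mem_cube)
 have vQ: "?v s \<in> Q1" if "0 < s" "s < 1" for s using that xi by(auto simp: mem_cube)
 show "\<exists>q. degree q < l j \<and> (\<forall>s\<in>{0<..<1}. g (?v s) = poly q s)"
 proof (rule vanishing_differences_poly[OF _ l t])
  have "continuous_on {0<..<1} ?v"
  proof (subst continuous_on_componentwise, intro ballI)
   fix b :: "real^'n" assume "b \<in> Basis"
   then obtain k where b: "b = axis k 1" by(auto simp: Basis_vec_def)
   show "continuous_on {0<..<1} (%s. ?v s \<bullet> b)" unfolding b inner_axis by(cases "k = j") (auto intro!: continuous_intros)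
  qed
  then show "continuous_on {0<..<1} (%s. g (?v s))" by(rule continuous_on_compose2[OF g]) (use vQ in auto)
  fix s h assume h: "0 < h" "h < \<tau>" and s: "0 < s" "s + real (l j)*h < 1"
  have "0 <= real (l j)*h" using h by simp
  then have s1: "s < 1" "0 < s + real (l j)*h" using s by linarith+
  have e: "?v s + (real m*h) *\<^sub>R axis j 1 = ?v (s + real m*h)" for m by(simp add: vec_eq_iff axis_def)
  have "(\<Sum>m\<le>l j. (-1)^(l j - m)*real (l j choose m)*g (?v s + (real m*h) *\<^sub>R axis j 1)) = 0"
  proof (rule E1_zero_difference[OF gm g z])
   show "0 < ?v s$j + real (l j)*h" "?v s$j + real (l j)*h < 1" using s1(2) s(2) by simp_all
  qed (use h s s1(1) vQ[of s] in auto)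
  then show "(\<Sum>k\<le>l j. (-1)^(l j - k)*real (l j choose k)*g (?v (s + real k*h))) = 0" unfolding e .
 qed
qed

lemma emeasure_Q1: "emeasure lborel (Q1 :: (real^'n::finite) set) = 1"
proof -
 have "emeasure lborel (box (0 :: real^'n) (\<chi> j. 1)) = ennreal (\<Prod>b\<in>Basis. ((\<chi> j. 1) - (0 :: real^'n)) \<bullet> b)"
  by(rule emeasure_lborel_box) (auto simp: Basis_vec_def inner_axis)
 also have "(\<Prod>b\<in>Basis. ((\<chi> j. 1) - (0 :: real^'n)) \<bullet> b) = 1" by(intro prod.neutral) (auto simp: Basis_vec_def inner_axis)
 finally show ?thesis by(simp add: cube_def)
qed

lemma L1_le_Lp:
 fixes F :: "real^'n::finite => ennreal"
 assumes [measurable]: "F \<in> BM borel" and p: "1 <= p"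
 shows "epow (NN x. indicator Q1 x*F x) p <= (NN x. indicator Q1 x*epow (F x) p)"
proof -
 have Q1m[measurable]: "(Q1 :: (real^'n) set) \<in> sets borel" by(simp add: cube_def)
 have i: "(NN x. indicator (Q1 :: (real^'n) set) x) <= ennreal 1" by(simp add: emeasure_Q1)
 have "epow (NN x. indicator Q1 x*F x) p <= ennreal (1 powr (p - 1))*(NN x. indicator Q1 x*epow (F x) p)" by(rule power_mean[OF p _ _ i]) auto
 then show ?thesis by simp
qed

lemma epow_le_root: "0 < p ==> epow X p <= ennreal (y powr p) ==> 0 <= y ==> X <= ennreal y"
 using epow_mono[of "1/p" "epow X p" "ennreal (y powr p)"] by(simp add: epow_epow epow_ennreal powr_powr)

section \<open>Compactness and the Whitney inequality\<close>

context rep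
begin

text \<open>Between c/2 and c the weight is at least 1, being a nonpositive power of a number below
  1, and \<open>E1\<close> increases with the scale.\<close>

lemma WJ_single_lower:
 fixes f :: "real^'n => real"
 assumes [measurable]: "f \<in> BM borel" and p: "1 <= p" and s: "0 <= s"
 shows "ennreal (c/2)*epow (E1 f p (l j) j (c/2)) (1/p) <= WJ f p l lam s c {j}"
proof -
 interpret PS: product_sigma_finite "%_::'n. lborel::real measure" by standard
 let ?F = "%\<tau>. if 0 < \<tau> \<and> \<tau> < c then ennreal (\<tau> powr (- real (lam j) - 1/p - s - 1))*epow (E1 f p (l j) j \<tau>) (1/p) else 0"
 have "?F \<in> BM lborel" by measurable
 from PS.product_nn_integral_singleton[OF this, of j]
 have e: "WJ f p l lam s c {j} = (NN \<tau>. ?F \<tau>)" by(simp add: WJ_def inbox_def Dt_single cong: if_cong)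
 have "(NN \<tau>. epow (E1 f p (l j) j (c/2)) (1/p)*indicator {c/2<..<c} \<tau>) <= (NN \<tau>. ?F \<tau>)"
 proof (intro nn_integral_mono)
  fix \<tau> :: real
  show "epow (E1 f p (l j) j (c/2)) (1/p)*indicator {c/2<..<c} \<tau> <= ?F \<tau>"
  proof (cases "\<tau> \<in> {c/2<..<c}")
   case True
   then have t: "0 < \<tau>" "\<tau> < 1" "\<tau> < c" "c/2 <= \<tau>" using c0 c1 by auto
   have "0 <= 1/p" using p by simp
   then have "- real (lam j) - 1/p - s - 1 <= 0" using s by linarith
   then have "\<tau> powr 0 <= \<tau> powr (- real (lam j) - 1/p - s - 1)" by(rule powr_mono') (use t in auto)
   then have "1 <= ennreal (\<tau> powr (- real (lam j) - 1/p - s - 1))" using t by simp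
   moreover have "epow (E1 f p (l j) j (c/2)) (1/p) <= epow (E1 f p (l j) j \<tau>) (1/p)" by(intro epow_mono E1_mono) (use t p in auto)
   ultimately have "1*epow (E1 f p (l j) j (c/2)) (1/p) <= ennreal (\<tau> powr (- real (lam j) - 1/p - s - 1))*epow (E1 f p (l j) j \<tau>) (1/p)"
   by(intro mult_mono) auto
   then show ?thesis using True t by simp
  qed simp
 qed
 also have "(NN \<tau>. epow (E1 f p (l j) j (c/2)) (1/p)*indicator {c/2<..<c} \<tau>) = epow (E1 f p (l j) j (c/2)) (1/p)*ennreal (c/2)"
  using c0 by(subst nn_integral_cmult_indicator) auto
 finally show ?thesis unfolding e by(simp add: mult.commute)
qed

lemma HH_integral_finite:
 fixes f :: "real^'n => real"
 assumes [measurable]: "f \<in> BM borel" and p: "1 <= p" "p <= q"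
  and W: "WJ f p l lam (1/p - 1/q) c J < \<infinity>"
  and fin: "\<And>t. t \<in> space (LJ J) ==> inbox c J t ==> Dt f p l J t < \<infinity>"
 shows "(NN x. (if x \<in> Q1 then HH f l lam c J x else 0)) < \<infinity>"
proof -
 obtain w where w: "WJ f p l lam (1/p - 1/q) c J = ennreal w" "0 <= w" using W by(cases "WJ f p l lam (1/p - 1/q) c J") auto
 have q: "1 <= q" using p by simp
 have "epow (NN x. indicator Q1 x*HH f l lam c J x) q <= (NN x. indicator Q1 x*epow (HH f l lam c J x) q)" by(rule L1_le_Lp[OF _ q]) measurable
 also have "... = (NN x. (if x \<in> Q1 then epow (HH f l lam c J x) q else 0))" by(intro nn_integral_cong) auto
 also have "... <= ennreal ((CJ l J*w) powr q)" by(rule HH_Lq[OF _ p l1 _ w(2) fin]) (use w in auto)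
 finally have "epow (NN x. indicator Q1 x*HH f l lam c J x) q < \<infinity>" using le_less_trans[OF _ ennreal_less_top] by simp
 then have "(NN x. indicator Q1 x*HH f l lam c J x) < \<infinity>" by(auto simp: epow_def split: if_splits simp: less_top)
 moreover have "(NN x. indicator Q1 x*HH f l lam c J x) = (NN x. (if x \<in> Q1 then HH f l lam c J x else 0))" by(intro nn_integral_cong) auto
 ultimately show ?thesis by simp
qed

lemma continuous_PT: "continuous_on UNIV (%w. PT l c (fst w) (snd w))"
proof -
 have "continuous_on UNIV (%w. TT (l j) 0 c (fst w$j) (snd w$j))" for j using continuous_on_compose2[OF TT_continuous[OF c0], of UNIV "%w. (fst w$j, snd w$j)" "l j" 0]
  by(simp add: continuous_intros)
 then show ?thesis unfolding PT_def by(intro continuous_on_prod)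
qed

text \<open>The representation splits \<open>r n\<close> into its smoothing at the fixed scale
  \<open>c\<close> and a remainder bounded by W. The first part is equicontinuous, the second tends
  to 0 in L_p. So the limit is continuous although the \<open>r n\<close> are only in L_p, and its
  differences can be tested pointwise.\<close>

lemma no_bad_sequence:
 fixes r :: "nat => real^'n => real"
 assumes rm[measurable]: "\<And>n. r n \<in> BM borel" and r0: "\<And>n x. x \<notin> Q1 ==> r n x = 0" and p: "1 <= p"
  and one: "\<And>n. (NN x. ennreal (\<bar>r n x\<bar> powr p)) = 1"
  and orth: "\<And>n h. h \<in> poly_space (%j. l j - 1) ==> (LI x. indicator Q1 x*(r n x*h x)) = 0"
  and fin: "\<And>n J t. J ~= {} ==> t \<in> space (LJ J) ==> inbox c J t ==> Dt (r n) p l J t < \<infinity>"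
  and W: "\<And>n. WT (- {{}}) (r n) p (%_. 0) 0 <= ennreal (1/real (Suc n))"
 shows False
proof -
 let ?S = "cbox 0 1 :: (real^'n) set"
 have p0: "0 < p" "0 <= p" using p by auto
 have Q1m[measurable]: "(Q1 :: (real^'n) set) \<in> sets borel" by(simp add: cube_def)
 have QS: "x \<in> Q1 ==> x \<in> ?S" for x :: "real^'n" by(auto simp: mem_cube mem_box_cart less_imp_le)
 define w where "w n = enn2real (WT (- {{}}) (r n) p (%_. 0) 0)" for n
 have w: "WT (- {{}}) (r n) p (%_. 0) 0 = ennreal (w n)" "0 <= w n" "w n <= 1/real (Suc n)" for n
 proof -
  show "0 <= w n" by(simp add: w_def)
  show "WT (- {{}}) (r n) p (%_. 0) 0 = ennreal (w n)" unfolding w_def by(rule ennreal_enn2real[symmetric]) (rule le_less_trans[OF W], simp)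
  then show "w n <= 1/real (Suc n)" using W[of n] by(simp add: ennreal_le_iff del: of_nat_Suc)
 qed
 have fin': "Dt (r n) p l J t < \<infinity>" if "t \<in> space (LJ J)" "inbox c J t" for n J t
  using fin[OF _ that] Dt_empty[where f = "r n", OF r0 p0(1)] one by(cases "J = {}") auto
 have WJfin: "WJ (r n) p l (%_. 0) (1/p - 1/p) c J < \<infinity>" for n J
 proof (cases "J = {}")
  case True
  then show ?thesis using WJ_empty[where f = "r n", OF r0 p0(1)] one by simp
 next
  case False
  then have "WJ (r n) p l (%_. 0) 0 c J <= ennreal (w n)" using WJ_le_WT[of J "- {{}}" "r n" p "%_. 0" 0] w by simp
  then show ?thesis using le_less_trans[of _ "ennreal (w n)" \<infinity>] by simp
 qed
 have HHfin: "(NN x. (if x \<in> Q1 then HH (r n) l (%_. 0) c J x else 0)) < \<infinity>" for n J by(rule HH_integral_finite[OF rm p order_refl WJfin fin'])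
 have L1: "(NN x. ennreal \<bar>r n x\<bar>) <= 1" for n
 proof -
  have "epow (NN x. indicator Q1 x*ennreal \<bar>r n x\<bar>) p <= (NN x. indicator Q1 x*epow (ennreal \<bar>r n x\<bar>) p)" by(rule L1_le_Lp[OF _ p]) measurable
  also have "... = (NN x. ennreal (\<bar>r n x\<bar> powr p))" by(intro nn_integral_cong) (use r0 in \<open>auto simp: indicator_def epow_ennreal\<close>)
  finally have "epow (NN x. indicator Q1 x*ennreal \<bar>r n x\<bar>) p <= ennreal (1 powr p)" using one by simp
  then have "(NN x. indicator Q1 x*ennreal \<bar>r n x\<bar>) <= ennreal 1" by(rule epow_le_root[OF p0(1)]) simp
  moreover have "(NN x. indicator Q1 x*ennreal \<bar>r n x\<bar>) = (NN x. ennreal \<bar>r n x\<bar>)"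
   by(intro nn_integral_cong) (use r0 in \<open>auto simp: indicator_def\<close>)
  ultimately show ?thesis by simp
 qed
 have ri: "integrable lborel (r n)" for n by(rule integrableI_bounded) (use le_less_trans[OF L1[of n], of \<infinity>] in auto)
 have ker: "integrable lborel (%z. r n z*k z)" "\<bar>\<integral>z. r n z*k z \<partial>lborel\<bar> <= M"
  if [measurable]: "k \<in> BM borel" and k: "\<And>z. z \<in> Q1 ==> \<bar>k z\<bar> <= M" and M: "0 <= M" for n k M
 proof -
  have b: "\<bar>r n z*k z\<bar> <= \<bar>M*r n z\<bar>" for z
   using k[of z] r0[of z n] M by(cases "z \<in> Q1") (auto simp: abs_mult mult.commute[of M] intro!: mult_left_mono)
  show i: "integrable lborel (%z. r n z*k z)" by(rule Bochner_Integration.integrable_bound[of _ "%z. M*r n z"]) (use ri b in auto)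
  have "ennreal (norm (LI z. r n z*k z)) <= (NN z. ennreal (norm (r n z*k z)))" by(rule integral_norm_bound_ennreal[OF i])
  also have "... <= (NN z. ennreal M*ennreal \<bar>r n z\<bar>)"
   by(intro nn_integral_mono) (use b M in \<open>auto simp: ennreal_mult[symmetric] abs_mult intro!: ennreal_leI\<close>)
  also have "... = ennreal M*(NN z. ennreal \<bar>r n z\<bar>)" by(rule nn_integral_cmult) measurable
  also have "... <= ennreal M*1" by(intro mult_left_mono L1) simp
  finally show "\<bar>\<integral>z. r n z*k z \<partial>lborel\<bar> <= M" using M by simp
 qed
 \<comment> \<open>The part of \<open>r n\<close> with a continuous kernel, by
   \<open>GJ_empty\<close>.\<close>
 define G where "G n x = (LI z. r n z*PT l c x z)" for n x
 have PTm[measurable]: "PT l c x \<in> BM borel" for x by(rule measurable_PT[OF c0]) measurable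
 have cS: "compact (?S \<times> ?S)" by(intro compact_Times compact_cbox)
 have PTc: "continuous_on (?S \<times> ?S) (%w. PT l c (fst w) (snd w))" by(rule continuous_on_subset[OF continuous_PT]) simp
 obtain M where M: "0 <= M" "\<And>x z. x \<in> ?S ==> z \<in> ?S ==> \<bar>PT l c x z\<bar> <= M"
 proof -
  have "bounded ((%w. PT l c (fst w) (snd w)) ` (?S \<times> ?S))" by(rule compact_imp_bounded[OF compact_continuous_image[OF PTc cS]])
  then obtain M where M: "\<And>y. y \<in> (%w. PT l c (fst w) (snd w)) ` (?S \<times> ?S) ==> norm y <= M" unfolding bounded_iff by blast
  show ?thesis
  proof (rule that[of "max M 0"])
   fix x z assume "x \<in> ?S" "z \<in> ?S"
   then have "norm (PT l c x z) <= M" by(intro M image_eqI[of _ _ "(x, z)"]) auto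
   then show "\<bar>PT l c x z\<bar> <= max M 0" by simp
  qed simp
 qed
 have UC: "uniformly_continuous_on (?S \<times> ?S) (%w. PT l c (fst w) (snd w))" by(rule compact_uniformly_continuous[OF PTc cS])
 have "\<exists>g k. continuous_on ?S g \<and> strict_mono (k :: nat => nat) \<and> (\<forall>e>0. \<exists>N. \<forall>n x. n \<ge> N \<and> x \<in> ?S --> norm (G (k n) x - g x) < e)"
 proof (rule Arzela_Ascoli[of ?S G M])
  show "norm (G n x) <= M" if "x \<in> ?S" for n x unfolding G_def real_norm_def by(rule ker(2)) (use M that QS in auto)
  fix x :: "real^'n" and e :: real assume x: "x \<in> ?S" and e: "0 < e"
  obtain d where d: "0 < d" "\<And>a b. a \<in> ?S \<times> ?S ==> b \<in> ?S \<times> ?S ==> dist b a < d ==> dist (PT l c (fst b) (snd b)) (PT l c (fst a) (snd a)) < e/2"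
   using uniformly_continuous_onE[OF UC, of "e/2"] e by(metis half_gt_zero)
  have "norm (G n x - G n y) < e" if y: "y \<in> ?S" "norm (x - y) < d" for n y
  proof -
   have "G n x - G n y = (LI z. r n z*(PT l c x z - PT l c y z))" unfolding G_def right_diff_distrib
   by(rule Bochner_Integration.integral_diff[symmetric]) (rule ker(1)[OF _ _ M(1)], use M x y QS in auto)+
   also have "\<bar>...\<bar> <= e/2"
   proof (rule ker(2))
   fix z assume "z \<in> (Q1 :: (real^'n) set)"
   then have "dist (PT l c (fst (x, z)) (snd (x, z))) (PT l c (fst (y, z)) (snd (y, z))) < e/2"
   by(intro d(2)) (use x y QS in \<open>auto simp: dist_Pair_Pair dist_norm\<close>)
   then show "\<bar>PT l c x z - PT l c y z\<bar> <= e/2" by(simp add: dist_real_def)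
   qed (use e in auto)
   finally show ?thesis using e by simp
  qed
  then show "\<exists>d>0. \<forall>n y. y \<in> ?S \<and> norm (x - y) < d --> norm (G n x - G n y) < e" using d(1) by blast
 next
  fix g' and k' :: "nat => nat"
  assume "continuous_on ?S g'" "strict_mono k'" "\<And>e. 0 < e ==> \<exists>N. \<forall>n x. n \<ge> N \<and> x \<in> ?S --> norm (G (k' n) x - g' x) < e"
  then show "\<exists>g k. continuous_on ?S g \<and> strict_mono (k :: nat => nat) \<and> (\<forall>e>0. \<exists>N. \<forall>n x. n \<ge> N \<and> x \<in> ?S --> norm (G (k n) x - g x) < e)"
   by(intro exI[of _ g'] exI[of _ k'] conjI allI impI)
 qed (rule compact_cbox)
 then obtain g and k :: "nat => nat" where g: "continuous_on ?S g" "strict_mono k"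
  and lim: "\<And>e. 0 < e ==> \<exists>N. \<forall>n x. n \<ge> N \<and> x \<in> ?S --> norm (G (k n) x - g x) < e" by blast
 have gQ: "continuous_on Q1 g" by(rule continuous_on_subset[OF g(1)]) (use QS in auto)
 define g' where "g' x = indicator Q1 x *\<^sub>R g x" for x
 have g'm[measurable]: "g' \<in> BM borel" unfolding g'_def by(rule borel_measurable_continuous_on_indicator[OF Q1m gQ])
 have g'c: "continuous_on Q1 g'" by(rule continuous_on_eq[OF gQ]) (simp add: g'_def)
 define u where "u n x = r (k n) x - g' x" for n x
 have um[measurable]: "u n \<in> BM borel" for n unfolding u_def by measurable
 \<comment> \<open>From |R + (G - g)|^p <= 2^p (|R|^p + |G - g|^p), where the remainder R is bounded
   by \<open>CG\<close> times W.\<close>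
 define C0 where "C0 = 2 powr p*((CG (%_. 0)) powr p + 1)"
 have CG0: "0 <= CG (%_. 0)" unfolding CG_def using CE_pos[OF c0, of l "%_. 0"] CM_ge1 by auto
 have C0: "0 < C0" unfolding C0_def by(intro mult_pos_pos add_nonneg_pos) auto
 have kge: "n <= k n" for n by(rule seq_suble[OF g(2)])
 have wev: "\<exists>N. \<forall>n\<ge>N. w (k n) <= e" if e: "0 < e" for e
 proof -
  obtain N where N: "1/e < real N" using reals_Archimedean2 by blast
  have "w (k n) <= e" if "n \<ge> N" for n
  proof -
   have a: "1/e < real (Suc (k n))" using N that kge[of n] by linarith
   have "w (k n) <= 1/real (Suc (k n))" by(rule w(3))
   also have "... <= e" using a e by(simp add: field_simps del: of_nat_Suc)
   finally show ?thesis .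
  qed
  then show ?thesis by blast
 qed
 have U0: "\<exists>N. \<forall>n\<ge>N. (NN x. ennreal (\<bar>u n x\<bar> powr p)) <= ennreal (C0*e powr p)" if e: "0 < e" for e
 proof -
  obtain N1 where N1: "\<And>n x. n \<ge> N1 ==> x \<in> ?S ==> norm (G (k n) x - g x) < e" using lim[OF e] by blast
  obtain N2 where N2: "\<And>n. n \<ge> N2 ==> w (k n) <= e" using wev[OF e] by blast
  have "(NN x. ennreal (\<bar>u n x\<bar> powr p)) <= ennreal (C0*e powr p)" if n: "n \<ge> max N1 N2" for n
  proof -
   let ?R = "gg (- {{}}) (%_. 0) (r (k n))"
   have ae: "AE x in lborel. r (k n) x = gg UNIV (%_. 0) (r (k n)) x" by(rule representation_ae[OF rm ri r0 HHfin])
   have gs: "gg UNIV (%_. 0) (r (k n)) x = G (k n) x + ?R x" if "x \<in> Q1" for x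
   proof -
   have U: "(UNIV :: 'n set set) = insert {} (- {{}})" by auto
   show ?thesis using that unfolding gg_def U G_def by(subst sum.insert) (auto simp: GJ_empty[OF rm r0 ri])
   qed
   have pw: "AE x in lborel. ennreal (\<bar>u n x\<bar> powr p) <= ennreal (2 powr p)*(ennreal (\<bar>?R x\<bar> powr p) + ennreal (e powr p)*indicator Q1 x)" using ae
   proof eventually_elim
   case (elim x)
   show ?case
   proof (cases "x \<in> Q1")
   case True
   have "u n x = ?R x + (G (k n) x - g x)" using elim gs[OF True] True by(simp add: u_def g'_def)
   then have "\<bar>u n x\<bar> powr p <= 2 powr p*(\<bar>?R x\<bar> powr p + \<bar>G (k n) x - g x\<bar> powr p)" by(simp add: powr_abs_add_le p0)
   also have "... <= 2 powr p*(\<bar>?R x\<bar> powr p + e powr p)" by(intro mult_left_mono add_left_mono powr_mono2) (use N1[of n x] n QS[OF True] p in auto)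
   finally show ?thesis using True by(simp add: ennreal_plus[symmetric] ennreal_mult[symmetric] del: ennreal_plus)
   next
   case False
   then show ?thesis by(simp add: u_def g'_def r0)
   qed
   qed
   have "(NN x. ennreal (\<bar>u n x\<bar> powr p)) <= (NN x. ennreal (2 powr p)*(ennreal (\<bar>?R x\<bar> powr p) + ennreal (e powr p)*indicator Q1 x))"
   by(rule nn_integral_mono_AE[OF pw])
   also have "... = ennreal (2 powr p)*((NN x. ennreal (\<bar>?R x\<bar> powr p)) + ennreal (e powr p))"
   by(subst nn_integral_cmult, measurable, subst nn_integral_add, measurable, subst nn_integral_cmult_indicator) (simp_all add: emeasure_Q1)
   also have "... <= ennreal (2 powr p)*(ennreal ((CG (%_. 0)*w (k n)) powr p) + ennreal (e powr p))"
   proof (intro mult_left_mono add_right_mono)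
   show "(NN x. ennreal (\<bar>?R x\<bar> powr p)) <= ennreal ((CG (%_. 0)*w (k n)) powr p)" by(rule gg_Lq[OF rm p order_refl]) (use w fin' in auto)
   qed simp
   also have "... <= ennreal (2 powr p)*(ennreal ((CG (%_. 0)*e) powr p) + ennreal (e powr p))"
   by(intro mult_left_mono add_right_mono ennreal_leI powr_mono2) (use N2[of n] n w CG0 p in auto)
   also have "... = ennreal (C0*e powr p)" using CG0 e by(simp add: C0_def powr_mult ennreal_plus[symmetric] ennreal_mult[symmetric] algebra_simps del: ennreal_plus)
   finally show ?thesis .
  qed
  then show ?thesis by blast
 qed
 have U: "\<exists>N. \<forall>n\<ge>N. (NN x. ennreal (\<bar>u n x\<bar> powr p)) <= ennreal e" if e: "0 < e" for e
 proof -
  have "C0*((e/C0) powr (1/p)) powr p = e" using e C0 p by(simp add: powr_powr)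
  then show ?thesis using U0[of "(e/C0) powr (1/p)"] e C0 by simp
 qed
 \<comment> \<open>The limit is \<open>r (k n)\<close> minus \<open>u n\<close>. The differences of
   the first are controlled by W through \<open>WJ_single_lower\<close>, those of the second by its
   L_p norm; both become arbitrarily small.\<close>
 have E0: "E1 g' p (l j) j (c/2) = 0" for j
 proof -
  define K where "K = 2*(c/2)*(real (Suc (l j)) powr p*real (Suc (l j))*(2^l j) powr p)"
  have K: "0 <= K" unfolding K_def using c0 by simp
  have E: "E1 g' p (l j) j (c/2) <= ennreal e" if e: "0 < e" for e
  proof -
   \<comment> \<open>Chosen so that the two contributions e' and K e', after the factor 2^p of
     \<open>E1_triangle\<close>, add up to e.\<close>
   define e' where "e' = e/(2 powr p*(1 + K))"
   have e': "0 < e'" "2 powr p*(e' + K*e') = e" 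
   proof -
   have D: "0 < 2 powr p*(1 + K)" using K by(intro mult_pos_pos) auto
   then show "0 < e'" unfolding e'_def using e by simp
   have "2 powr p*(e' + K*e') = e'*(2 powr p*(1 + K))" by(simp add: algebra_simps)
   also have "... = e" unfolding e'_def using D K by auto
   finally show "2 powr p*(e' + K*e') = e" .
   qed
   obtain N1 where N1: "\<And>n. n \<ge> N1 ==> (NN x. ennreal (\<bar>u n x\<bar> powr p)) <= ennreal e'" using U[OF e'(1)] by blast
   obtain N2 where N2: "\<And>n. n \<ge> N2 ==> w (k n) <= (c/2)*e' powr (1/p)" using wev[of "(c/2)*e' powr (1/p)"] c0 e' by auto
   define n where "n = max N1 N2"
   have "E1 g' p (l j) j (c/2) = E1 (%x. r (k n) x + (- u n x)) p (l j) j (c/2)" by(simp add: u_def)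
   also have "... <= ennreal (2 powr p)*(E1 (r (k n)) p (l j) j (c/2) + E1 (%x. - u n x) p (l j) j (c/2))" by(rule E1_triangle) (use p0 in auto)
   also have "... <= ennreal (2 powr p)*(ennreal e' + ennreal K*ennreal e')"
   proof (intro mult_left_mono add_mono)
   have "ennreal (c/2)*epow (E1 (r (k n)) p (l j) j (c/2)) (1/p) <= WJ (r (k n)) p l (%_. 0) 0 c {j}" by(rule WJ_single_lower[OF rm p]) simp
   also have "... <= ennreal (w (k n))" using WJ_le_WT[of "{j}" "- {{}}" "r (k n)" p "%_. 0" 0] w by simp
   also have "... <= ennreal ((c/2)*e' powr (1/p))" by(intro ennreal_leI N2) (simp add: n_def)
   also have "... = ennreal (c/2)*ennreal (e' powr (1/p))" using c0 by(intro ennreal_mult) auto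
   finally have a: "ennreal (c/2)*epow (E1 (r (k n)) p (l j) j (c/2)) (1/p) <= ennreal (c/2)*ennreal (e' powr (1/p))" .
   have "epow (E1 (r (k n)) p (l j) j (c/2)) (1/p) <= ennreal (e' powr (1/p))" using a c0 by(subst (asm) ennreal_mult_le_mult_iff) auto
   then show "E1 (r (k n)) p (l j) j (c/2) <= ennreal e'" by(rule epow_le_root[rotated]) (use p e' in auto)
   have "E1 (%x. - u n x) p (l j) j (c/2) <= ennreal K*(NN x. indicator Q1 x*ennreal (\<bar>- u n x\<bar> powr p))" unfolding K_def by(rule E1_le_Lp) (use p0 c0 in auto)
   also have "... <= ennreal K*(NN x. ennreal (\<bar>u n x\<bar> powr p))" by(intro mult_left_mono nn_integral_mono) (auto simp: indicator_def)
   also have "... <= ennreal K*ennreal e'" by(intro mult_left_mono N1) (auto simp: n_def)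
   finally show "E1 (%x. - u n x) p (l j) j (c/2) <= ennreal K*ennreal e'" .
   qed simp
   also have "... = ennreal e" unfolding e'(2)[symmetric] using e' K by(simp add: ennreal_plus[symmetric] ennreal_mult[symmetric] del: ennreal_plus)
   finally show ?thesis .
  qed
  have "E1 g' p (l j) j (c/2) <= 0"
  proof (rule ennreal_le_epsilon)
   fix e :: real assume "0 < e"
   from E[OF this] show "E1 g' p (l j) j (c/2) <= 0 + ennreal e" by simp
  qed
  then show ?thesis by simp
 qed
 obtain \<rho> where rho: "\<rho> \<in> poly_space (%j. l j - 1)" "\<And>x. x \<in> Q1 ==> g' x = \<rho> x"
  using E1_zero_poly[OF g'm g'c l1 half_gt_zero[OF c0] E0] by blast
 have rhom[measurable]: "\<rho> \<in> BM borel" by(rule poly_space_measurable[OF rho(1)])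
 obtain H where H: "0 <= H" "\<And>x. x \<in> ?S ==> \<bar>\<rho> x\<bar> <= H"
 proof -
  have "bounded (\<rho> ` ?S)" by(rule compact_imp_bounded[OF compact_continuous_image[OF poly_space_continuous[OF rho(1)] compact_cbox]])
  then obtain H where "\<And>y. y \<in> \<rho> ` ?S ==> norm y <= H" unfolding bounded_iff by blast
  then show ?thesis by(intro that[of "max H 0"]) (auto simp: le_max_iff_disj)
 qed
 have ind: "integrable lborel (%x. indicator Q1 x*f x)" if [measurable]: "f \<in> BM borel" and b: "\<And>x. x \<in> Q1 ==> \<bar>f x\<bar> <= B'" for f :: "real^'n => real" and B'
 proof (rule integrableI_bounded)
  have "(NN x. ennreal (norm (indicator Q1 x*f x))) <= (NN x. ennreal B'*indicator (Q1 :: (real^'n) set) x)"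
   by(intro nn_integral_mono) (use b in \<open>auto simp: indicator_def intro!: ennreal_leI\<close>)
  also have "... = ennreal B'" by(subst nn_integral_cmult_indicator) (simp_all add: emeasure_Q1)
  finally show "(NN x. ennreal (norm (indicator Q1 x*f x))) < \<infinity>" using le_less_trans[OF _ ennreal_less_top] by simp
 qed measurable
 have rr: "integrable lborel (%x. indicator Q1 x*(\<rho> x*\<rho> x))"
 proof (rule ind)
  show "\<bar>\<rho> x*\<rho> x\<bar> <= H*H" if "x \<in> Q1" for x unfolding abs_mult by(intro mult_mono H QS that) auto
 qed measurable
 \<comment> \<open>Orthogonality of \<open>r (k n)\<close> to the polynomial limit turns the square
   integral into a pairing with \<open>u n\<close>, which is small in L_1.\<close>
 have small: "\<bar>\<integral>x. indicator Q1 x*(\<rho> x*\<rho> x) \<partial>lborel\<bar> <= H*e" if e: "0 < e" for e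
 proof -
  obtain n where n: "(NN x. ennreal (\<bar>u n x\<bar> powr p)) <= ennreal (e powr p)" using U[of "e powr p"] e by auto
  have eq: "indicator Q1 x*(\<rho> x*\<rho> x) = indicator Q1 x*(r (k n) x*\<rho> x) - indicator Q1 x*(u n x*\<rho> x)" for x
   by(simp add: u_def rho(2) indicator_def left_diff_distrib)
  have i1: "integrable lborel (%x. indicator Q1 x*(r (k n) x*\<rho> x))"
  proof -
   have e: "indicator Q1 x*(r (k n) x*\<rho> x) = r (k n) x*\<rho> x" for x using r0 by(auto simp: indicator_def)
   show ?thesis unfolding e by(rule ker(1)[OF _ _ H(1)]) (use H QS in auto)
  qed
  have i2: "integrable lborel (%x. indicator Q1 x*(u n x*\<rho> x))"
  proof -
   have "(%x. indicator Q1 x*(u n x*\<rho> x)) = (%x. indicator Q1 x*(r (k n) x*\<rho> x) - indicator Q1 x*(\<rho> x*\<rho> x))" using eq by(auto simp: fun_eq_iff)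
   then show ?thesis using i1 rr by simp
  qed
  have "epow (NN x. indicator Q1 x*ennreal \<bar>u n x\<bar>) p <= (NN x. indicator Q1 x*epow (ennreal \<bar>u n x\<bar>) p)" by(rule L1_le_Lp[OF _ p]) measurable
  also have "... <= (NN x. ennreal (\<bar>u n x\<bar> powr p))" by(intro nn_integral_mono) (auto simp: indicator_def epow_ennreal)
  finally have "epow (NN x. indicator Q1 x*ennreal \<bar>u n x\<bar>) p <= ennreal (e powr p)" using n by simp
  then have u1: "(NN x. indicator Q1 x*ennreal \<bar>u n x\<bar>) <= ennreal e" by(rule epow_le_root[OF p0(1)]) (use e in simp)
  have "(LI x. indicator Q1 x*(\<rho> x*\<rho> x)) = - (LI x. indicator Q1 x*(u n x*\<rho> x))"
   unfolding eq using Bochner_Integration.integral_diff[OF i1 i2] orth[OF rho(1), of "k n"] by simp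
  moreover have "ennreal (norm (LI x. indicator Q1 x*(u n x*\<rho> x))) <= ennreal (H*e)"
  proof -
   have "ennreal (norm (LI x. indicator Q1 x*(u n x*\<rho> x))) <= (NN x. ennreal (norm (indicator Q1 x*(u n x*\<rho> x))))" by(rule integral_norm_bound_ennreal[OF i2])
   also have "... <= (NN x. ennreal H*(indicator Q1 x*ennreal \<bar>u n x\<bar>))"
   by(intro nn_integral_mono) (use H QS in \<open>auto simp: indicator_def abs_mult ennreal_mult[symmetric] mult.commute[of H] intro!: ennreal_leI mult_left_mono\<close>)
   also have "... = ennreal H*(NN x. indicator Q1 x*ennreal \<bar>u n x\<bar>)" by(rule nn_integral_cmult) measurable
   also have "... <= ennreal H*ennreal e" by(intro mult_left_mono u1) simp
   finally show ?thesis using H e by(simp add: ennreal_mult)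
  qed
  ultimately show ?thesis using H e by(simp add: ennreal_le_iff)
 qed
 have zero: "(LI x. indicator Q1 x*(\<rho> x*\<rho> x)) = 0"
 proof (rule ccontr)
  assume "(LI x. indicator Q1 x*(\<rho> x*\<rho> x)) ~= 0"
  then have "0 < \<bar>\<integral>x. indicator Q1 x*(\<rho> x*\<rho> x) \<partial>lborel\<bar>" by(simp only: zero_less_abs_iff not_False_eq_True)
  moreover define a where "a = \<bar>\<integral>x. indicator Q1 x*(\<rho> x*\<rho> x) \<partial>lborel\<bar>"
  ultimately have a: "0 < a" by(simp only:)
  have h: "0 < 2*(H + 1)" using H by simp
  have "a <= H*(a/(2*(H + 1)))" unfolding a_def by(rule small) (use a h in \<open>simp add: a_def[symmetric]\<close>)
  moreover have "H*(a/(2*(H + 1))) < a"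
  proof -
   have "H*a < a*(2*(H + 1))" using a mult_nonneg_nonneg[OF H(1) less_imp_le[OF a]] by(simp add: algebra_simps)
   then show ?thesis using h by(simp add: divide_less_eq)
  qed
  ultimately show False by simp
 qed
 have "AE x in lborel. indicator Q1 x*(\<rho> x*\<rho> x) = 0" using integral_nonneg_eq_0_iff_AE[OF rr] zero by(auto simp: indicator_def)
 then have g'0: "AE x in lborel. g' x = 0" by eventually_elim (use rho(2) in \<open>auto simp: g'_def indicator_def split: if_splits\<close>)
 \<comment> \<open>With limit 0 the functions \<open>u n\<close> and \<open>r (k n)\<close> agree
   almost everywhere, so the norm 1 contradicts convergence.\<close>
 obtain n where n: "(NN x. ennreal (\<bar>u n x\<bar> powr p)) <= ennreal (1/2)" using U[of "1/2"] by auto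
 have "(NN x. ennreal (\<bar>r (k n) x\<bar> powr p)) = (NN x. ennreal (\<bar>u n x\<bar> powr p))"
  by(rule nn_integral_cong_AE) (use g'0 in eventually_elim, simp add: u_def)
 then have "ennreal 1 <= ennreal (1/2)" using n one[of "k n"] by(simp only: ennreal_1)
 then show False by(subst (asm) ennreal_le_iff) auto
qed

end

lemma Dt_cmult:
 fixes f :: "real^'n::finite => real"
 assumes [measurable]: "f \<in> BM borel" and p: "0 < p" and t: "t \<in> space (LJ J)"
 shows "Dt (%x. a*f x) p l J t = ennreal (\<bar>a\<bar> powr p)*Dt f p l J t"
proof -
 let ?P = "LJ J"
 interpret P: sigma_finite_measure ?P by(rule sigma_finite_PiM_lborel)
 have t'[measurable]: "(%z. t) \<in> M \<rightarrow>\<^sub>M ?P" for M :: "'b measure" using t by auto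
 have dd: "dd (%x. a*f x) l J t xi z = ennreal \<bar>a\<bar>*dd f l J t xi z" for xi z by(simp add: dd_def mdiff_cmult abs_mult ennreal_mult)
 have "Dt (%x. a*f x) p l J t = (nn_integral ?P (%xi. ennreal (\<bar>a\<bar> powr p)*(NN z. epow (dd f l J t xi z) p)))" unfolding Dt_def
 proof (rule nn_integral_cong)
  fix xi assume "xi \<in> space ?P"
  then have [measurable]: "(%z. xi) \<in> M \<rightarrow>\<^sub>M ?P" for M :: "'b measure" by auto
  have "(NN z. epow (dd (%x. a*f x) l J t xi z) p) = (NN z. ennreal (\<bar>a\<bar> powr p)*epow (dd f l J t xi z) p)"
   unfolding dd using p by(simp add: epow_mult epow_ennreal)
  also have "... = ennreal (\<bar>a\<bar> powr p)*(NN z. epow (dd f l J t xi z) p)" by(rule nn_integral_cmult) measurable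
  finally show "(NN z. epow (dd (%x. a*f x) l J t xi z) p) = ennreal (\<bar>a\<bar> powr p)*(NN z. epow (dd f l J t xi z) p)" .
 qed
 also have "... = ennreal (\<bar>a\<bar> powr p)*Dt f p l J t" unfolding Dt_def by(rule nn_integral_cmult) measurable
 finally show ?thesis .
qed

lemma WJ_cmult:
 fixes f :: "real^'n::finite => real"
 assumes f[measurable]: "f \<in> BM borel" and p: "0 < p"
 shows "WJ (%x. a*f x) p l lam s c J = ennreal \<bar>a\<bar>*WJ f p l lam s c J"
proof -
 let ?P = "LJ J"
 have [measurable]: "(%t. \<Prod>j\<in>J. t j powr (- real (lam j) - 1/p - s - 1)) \<in> borel_measurable ?P" by(rule measurable_prod_powr) measurable
 have "WJ (%x. a*f x) p l lam s c J = (nn_integral ?P (%t. ennreal \<bar>a\<bar>*(if inbox c J t then ennreal (\<Prod>j\<in>J. t j powr (- real (lam j) - 1/p - s - 1))*epow (Dt f p l J t) (1/p) else 0)))"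
  unfolding WJ_def using p by(intro nn_integral_cong) (simp add: Dt_cmult[OF f p] epow_mult epow_ennreal powr_powr mult_ac)
 also have "... = ennreal \<bar>a\<bar>*WJ f p l lam s c J" unfolding WJ_def by(rule nn_integral_cmult) measurable
 finally show ?thesis .
qed

text \<open>All scales are below 1, where a smaller exponent gives a larger weight. The compactness
  argument can therefore be run once, for lam = 0 and s = 0.\<close>

lemma WJ_weight_mono:
 fixes f :: "real^'n::finite => real"
 assumes c: "c <= 1" and le: "s' <= s" "\<And>j. lam' j <= lam j"
 shows "WJ f p l lam' s' c J <= WJ f p l lam s c J" unfolding WJ_def
proof (rule nn_integral_mono)
 fix t :: "'n => real"
 have "ennreal (\<Prod>j\<in>J. t j powr (- real (lam' j) - 1/p - s' - 1)) <= ennreal (\<Prod>j\<in>J. t j powr (- real (lam j) - 1/p - s - 1))" if t: "inbox c J t"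
 proof (intro ennreal_leI prod_mono conjI)
  fix j assume j: "j \<in> J"
  have "0 < t j" "t j < c" using t j by(auto simp: inbox_def)
  moreover have "real (lam' j) <= real (lam j)" using le(2) by simp
  ultimately show "t j powr (- real (lam' j) - 1/p - s' - 1) <= t j powr (- real (lam j) - 1/p - s - 1)" by(intro powr_mono') (use c le(1) in auto)
 qed auto
 then show "(if inbox c J t then ennreal (\<Prod>j\<in>J. t j powr (- real (lam' j) - 1/p - s' - 1))*epow (Dt f p l J t) (1/p) else 0)
  <= (if inbox c J t then ennreal (\<Prod>j\<in>J. t j powr (- real (lam j) - 1/p - s - 1))*epow (Dt f p l J t) (1/p) else 0)" by(auto intro: mult_right_mono)
qed

context rep
begin

text \<open>If no constant works, each n + 1 fails for some function. Dividing it by its norm gives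
  a normalised sequence with W at most 1/(n + 1), which \<open>no_bad_sequence\<close> excludes. The
  constant is not explicit.\<close>

lemma whitney:
 assumes p: "1 <= p" and s: "0 <= s"
 obtains C where "0 <= C" "\<And>f w. \<lbrakk>f \<in> BM borel; \<And>x. x \<notin> Q1 ==> f x = 0;
   (NN x. ennreal (\<bar>f x\<bar> powr p)) < \<infinity>;
   \<And>h. h \<in> poly_space (%j. l j - 1) ==> (LI x. indicator Q1 x*(f x*h x)) = 0;
   \<And>J t. J ~= {} ==> t \<in> space (LJ J) ==> inbox c J t ==> Dt f p l J t < \<infinity>;
   WT (- {{}}) f p lam s <= ennreal w; 0 <= w\<rbrakk> \<Longrightarrow> (NN x. ennreal (\<bar>f x\<bar> powr p)) <= ennreal ((C*w) powr p)"
proof -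
 define I where "I f = (NN x. ennreal (\<bar>f x\<bar> powr p))" for f :: "real^'n => real"
 define A where "A f w \<longleftrightarrow> f \<in> BM borel \<and> (\<forall>x. x \<notin> Q1 --> f x = 0) \<and> I f < \<infinity> \<and>
   (\<forall>h\<in>poly_space (%j. l j - 1). (LI x. indicator Q1 x*(f x*h x)) = 0) \<and>
   (\<forall>J t. J ~= {} --> t \<in> space (LJ J) --> inbox c J t --> Dt f p l J t < \<infinity>) \<and>
   WT (- {{}}) f p lam s <= ennreal w \<and> 0 <= w" for f :: "real^'n => real" and w :: real
 have "\<exists>C\<ge>0. \<forall>f w. A f w --> I f <= ennreal ((C*w) powr p)"
 proof (rule ccontr)
  assume neg: "\<not> ?thesis"
  have p0: "0 < p" using p by simp
  have "\<exists>f w. A f w \<and> \<not> I f <= ennreal ((real (Suc n)*w) powr p)" for n using neg of_nat_0_le_iff[of "Suc n"] by blast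
  then obtain F w where Fw: "\<And>n. A (F n) (w n)" and big: "\<And>n. \<not> I (F n) <= ennreal ((real (Suc n)*w n) powr p)" by metis
  have Fm[measurable]: "F n \<in> BM borel" and F0: "x \<notin> Q1 ==> F n x = 0" and Ifin: "I (F n) < \<infinity>"
   and Forth: "h \<in> poly_space (%j. l j - 1) ==> (LI x. indicator Q1 x*(F n x*h x)) = 0"
   and Ffin: "J ~= {} ==> t \<in> space (LJ J) ==> inbox c J t ==> Dt (F n) p l J t < \<infinity>"
   and FW: "WT (- {{}}) (F n) p lam s <= ennreal (w n)" and w0: "0 <= w n" for n x h J t using Fw[of n] unfolding A_def by blast+
  define \<nu> where "\<nu> n = enn2real (I (F n)) powr (1/p)" for n
  have nu0: "0 <= \<nu> n" for n by(simp add: \<nu>_def)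
  have nu: "I (F n) = ennreal (\<nu> n powr p)" for n using Ifin[of n] p0 by(cases "I (F n)") (auto simp: \<nu>_def powr_powr)
  have bw: "real (Suc n)*w n < \<nu> n" for n
  proof (rule ccontr)
   assume "\<not> ?thesis"
   then have "I (F n) <= ennreal ((real (Suc n)*w n) powr p)" unfolding nu by(intro ennreal_leI powr_mono2) (use p0 nu0 in \<open>auto simp: not_less\<close>)
   then show False using big by blast
  qed
  have "0 <= real (Suc n)*w n" for n by(intro mult_nonneg_nonneg w0) simp
  then have nupos: "0 < \<nu> n" for n using bw[of n] by(meson le_less_trans)
  define r where "r n x = (1/\<nu> n)*F n x" for n x
  show False
  proof (rule no_bad_sequence[of r p])
   show "r n \<in> BM borel" for n unfolding r_def by measurable
   show "r n x = 0" if "x \<notin> Q1" for n x using F0[OF that] by(simp add: r_def)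
   show "1 <= p" by(rule p)
   show "(NN x. ennreal (\<bar>r n x\<bar> powr p)) = 1" for n
   proof -
   have "(NN x. ennreal (\<bar>r n x\<bar> powr p)) = (NN x. ennreal ((1/\<nu> n) powr p)*ennreal (\<bar>F n x\<bar> powr p))"
   using nu0[of n] by(intro nn_integral_cong) (simp add: r_def abs_mult powr_mult ennreal_mult[symmetric] powr_divide)
   also have "... = ennreal ((1/\<nu> n) powr p)*I (F n)" unfolding I_def by(rule nn_integral_cmult) measurable
   also have "... = 1" unfolding nu using nupos[of n] by(simp add: ennreal_mult[symmetric] powr_divide)
   finally show ?thesis .
   qed
   show "(LI x. indicator Q1 x*(r n x*h x)) = 0" if "h \<in> poly_space (%j. l j - 1)" for n h
   proof -
   have "(LI x. indicator Q1 x*(r n x*h x)) = (LI x. (1/\<nu> n)*(indicator Q1 x*(F n x*h x)))" by(intro BI_cong refl) (simp add: r_def)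
   then show ?thesis using Forth[OF that, of n] by(simp only: integral_mult_right_zero mult_zero_right)
   qed
   show "Dt (r n) p l J t < \<infinity>" if "J ~= {}" "t \<in> space (LJ J)" "inbox c J t" for n J t
   unfolding r_def Dt_cmult[OF Fm p0 that(2)] using Ffin[OF that, of n] by(simp add: ennreal_mult_less_top)
   show "WT (- {{}}) (r n) p (%_. 0) 0 <= ennreal (1/real (Suc n))" for n
   proof -
   have "WT (- {{}}) (r n) p (%_. 0) 0 = ennreal (1/\<nu> n)*WT (- {{}}) (F n) p (%_. 0) 0"
   using nu0[of n] unfolding WT_def r_def WJ_cmult[OF Fm p0] by(simp add: sum_distrib_left)
   also have "... <= ennreal (1/\<nu> n)*WT (- {{}}) (F n) p lam s" unfolding WT_def by(intro mult_left_mono sum_mono WJ_weight_mono c1 s) simp_all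
   also have "... <= ennreal (1/\<nu> n)*ennreal (w n)" by(intro mult_left_mono FW) simp
   also have "... <= ennreal (1/real (Suc n))" using bw[of n] nupos[of n] w0[of n] by(simp add: ennreal_mult[symmetric] field_simps del: of_nat_Suc)
   finally show ?thesis .
   qed
  qed
 qed
 then obtain C where C: "0 <= C" "\<And>f w. A f w ==> I f <= ennreal ((C*w) powr p)" by blast
 show ?thesis
 proof (rule that[OF C(1)])
  fix f :: "real^'n => real" and w :: real
  assume *: "f \<in> BM borel" "\<And>x. x \<notin> Q1 ==> f x = 0"
   "(NN x. ennreal (\<bar>f x\<bar> powr p)) < \<infinity>"
   "\<And>h. h \<in> poly_space (%j. l j - 1) ==> (LI x. indicator Q1 x*(f x*h x)) = 0"
   "\<And>J t. J ~= {} ==> t \<in> space (LJ J) ==> inbox c J t ==> Dt f p l J t < \<infinity>"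
   "WT (- {{}}) f p lam s <= ennreal w" "0 <= w"
  have "A f w" unfolding A_def I_def using * by blast
  from C(2)[OF this] show "(NN x. ennreal (\<bar>f x\<bar> powr p)) <= ennreal ((C*w) powr p)" unfolding I_def .
 qed
qed

end

section \<open>Both estimates on the unit cube\<close>

lemma shrunk_point:
 assumes z: "z \<in> shrunk G m h" and k: "\<And>j. k j <= m j"
 shows "z + (\<chi> j. real (k j)*h$j) \<in> G"
proof -
 let ?t = "%j. if m j = 0 then 0 else real (k j)/real (m j)"
 have "\<forall>t. (\<forall>j. 0 <= t j \<and> t j <= 1) --> z + (\<chi> j. t j*real (m j)*h$j) \<in> G" using z unfolding shrunk_def mem_Collect_eq by(rule conjunct2)
 from this[rule_format, of ?t] have "z + (\<chi> j. ?t j*real (m j)*h$j) \<in> G" using k by(auto simp: divide_le_eq)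
 moreover have "?t j*real (m j) = real (k j)" for j using k[of j] by auto
 ultimately show ?thesis by simp
qed

lemma mdiff_local:
 fixes f :: "real^'n::finite => real"
 assumes z: "z \<in> shrunk G m h" and eq: "\<And>x. x \<in> G ==> f x = g x"
 shows "mdiff m h f z = mdiff m h g z" unfolding mdiff_def by(intro sum.cong refl arg_cong2[of _ _ _ _ "(*)"] eq shrunk_point[OF z]) blast

definition Lbd :: "real => (real^'n::finite => real) => real => bool" where
 "Lbd r g b \<longleftrightarrow> (NN x. ennreal (\<bar>g x\<bar> powr r)) <= ennreal (b powr r)"

text \<open>For q = infinity the bound is demanded at every point. The functions \<open>gg\<close>
  satisfy it in this form, and it survives the change of variables without reference to null
  sets.\<close>

definition LB :: "ennreal => (real^'n::finite => real) => real => bool" where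
 "LB q g b \<longleftrightarrow> (if q = \<infinity> then \<forall>x. \<bar>g x\<bar> <= b else Lbd (enn2real q) g b)"

lemma integrable_of_Lbd:
 fixes F :: "real^'n::finite => real"
 assumes [measurable]: "F \<in> BM borel" and F0: "\<And>x. x \<notin> Q1 ==> F x = 0" and v: "Lbd p F v" "0 <= v" and p: "1 <= p"
 shows "integrable lborel F"
proof (rule integrableI_bounded)
 have p0: "0 < p" using p by simp
 have "epow (NN x. indicator Q1 x*ennreal \<bar>F x\<bar>) p <= (NN x. indicator Q1 x*epow (ennreal \<bar>F x\<bar>) p)" by(rule L1_le_Lp[OF _ p]) measurable
 also have "... <= (NN x. ennreal (\<bar>F x\<bar> powr p))" by(intro nn_integral_mono) (auto simp: indicator_def epow_ennreal)
 also have "... <= ennreal (v powr p)" using v by(simp add: Lbd_def)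
 finally have "(NN x. indicator Q1 x*ennreal \<bar>F x\<bar>) <= ennreal v" by(rule epow_le_root[OF p0]) (rule v)
 moreover have "(NN x. indicator Q1 x*ennreal \<bar>F x\<bar>) = (NN x. ennreal (norm (F x)))"
  by(intro nn_integral_cong) (use F0 in \<open>auto simp: indicator_def\<close>)
 ultimately show "(NN x. ennreal (norm (F x))) < \<infinity>" using le_less_trans[OF _ ennreal_less_top] by simp
qed measurable

text \<open>A crude triangle inequality: one factor 2 comes from \<open>powr_abs_add_le\<close>, the
  other from absorbing 2 into 2^r.\<close>

lemma Lbd_add:
 fixes f :: "real^'n::finite => real"
 assumes [measurable]: "f \<in> BM borel" "g \<in> BM borel" and r: "1 <= r"
  and ab: "Lbd r f a" "Lbd r g b" "0 <= a" "0 <= b"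
 shows "Lbd r (%x. f x + g x) (4*(a + b))"
proof -
 have "(NN x. ennreal (\<bar>f x + g x\<bar> powr r)) <= (NN x. ennreal (2 powr r)*(ennreal (\<bar>f x\<bar> powr r) + ennreal (\<bar>g x\<bar> powr r)))"
  by(intro nn_integral_mono) (use powr_abs_add_le[of r] r in \<open>auto simp: ennreal_plus[symmetric] ennreal_mult[symmetric] simp del: ennreal_plus intro!: ennreal_leI\<close>)
 also have "... = ennreal (2 powr r)*((NN x. ennreal (\<bar>f x\<bar> powr r)) + (NN x. ennreal (\<bar>g x\<bar> powr r)))"
  by(simp add: nn_integral_cmult nn_integral_add)
 also have "... <= ennreal (2 powr r)*(ennreal (a powr r) + ennreal (b powr r))" by(intro mult_left_mono add_mono) (use ab in \<open>auto simp: Lbd_def\<close>)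
 also have "... = ennreal (2 powr r*(a powr r + b powr r))" by(simp add: ennreal_plus[symmetric] ennreal_mult[symmetric] del: ennreal_plus)
 also have "... <= ennreal ((4*(a + b)) powr r)"
 proof (rule ennreal_leI)
  have m: "a powr r <= (a + b) powr r" "b powr r <= (a + b) powr r" using ab r by(intro powr_mono2; simp)+
  have two: "2 <= 2 powr r" using powr_mono[of 1 r 2] r by simp
  have "2 powr r*(a powr r + b powr r) <= 2 powr r*(2*(a + b) powr r)" using m by(intro mult_left_mono) auto
  also have "... <= 2 powr r*(2 powr r*(a + b) powr r)" by(intro mult_left_mono mult_right_mono two) auto
  also have "... = (4*(a + b)) powr r" using ab by(simp add: powr_mult[symmetric])
  finally show "2 powr r*(a powr r + b powr r) <= (4*(a + b)) powr r" .
 qed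
 finally show ?thesis unfolding Lbd_def .
qed

lemma Lbd_mono: "Lbd r f a ==> 0 <= a ==> a <= b ==> 0 <= r ==> Lbd r f b" unfolding Lbd_def by(erule order_trans) (intro ennreal_leI powr_mono2)

lemma LB_mono: "LB q f a ==> 0 <= a ==> a <= b ==> LB q f b" unfolding LB_def by(auto intro: Lbd_mono order_trans split: if_splits)

lemma enn2real_ge1: "1 <= q ==> q ~= \<infinity> ==> 1 <= enn2real q" by(cases q) (auto simp: ennreal_ge_1)

lemma LB_add:
 fixes f :: "real^'n::finite => real"
 assumes m: "f \<in> BM borel" "g \<in> BM borel" and q: "1 <= q"
  and ab: "LB q f a" "LB q g b" "0 <= a" "0 <= b"
 shows "LB q (%x. f x + g x) (4*(a + b))"
proof (cases "q = \<infinity>")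
 case True
 have "\<bar>f x + g x\<bar> <= 4*(a + b)" for x
 proof -
  have "\<bar>f x\<bar> <= a" "\<bar>g x\<bar> <= b" using ab True by(auto simp: LB_def)
  from add_mono[OF this] have "\<bar>f x + g x\<bar> <= a + b" by(rule order_trans[OF abs_triangle_ineq])
  also have "... <= 4*(a + b)" using ab(3,4) by simp
  finally show ?thesis .
 qed
 then show ?thesis using True by(simp add: LB_def)
next
 case False
 then show ?thesis using Lbd_add[OF m enn2real_ge1[OF q False]] ab by(simp add: LB_def)
qed

definition sobgap :: "real => ennreal => real" where "sobgap p q = max 0 (1/p - inv_exp q)"

text \<open>\<open>P\<close> is the projection of \<open>F\<close>; \<open>g\<close> and
  \<open>h\<close> are the weak derivatives of \<open>F\<close> and of \<open>P\<close> cut off to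
  the cube. Integrals over the whole space make the change of variables uniform.\<close>

definition unit_estimate :: "('n::finite => nat) => ennreal => ('n => nat) => (real^'n => real) => real => real => bool" where
 "unit_estimate k q lam F a b \<longleftrightarrow> (\<exists>P g h. P \<in> poly_space k \<and> (\<forall>hh\<in>poly_space k. (LI x. indicator Q1 x*((F x - P x)*hh x)) = 0) \<and>
   integrable lborel g \<and> integrable lborel h \<and>
   (\<forall>\<phi>. test_fun Q1 \<phi> --> (LI x. F x*partial_mi lam \<phi> x) = (-1)^(\<Sum>j\<in>UNIV. lam j)*(LI x. g x*\<phi> x)) \<and>
   (\<forall>\<phi>. test_fun Q1 \<phi> --> (LI x. (indicator Q1 x*P x)*partial_mi lam \<phi> x) = (-1)^(\<Sum>j\<in>UNIV. lam j)*(LI x. h x*\<phi> x)) \<and>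
   LB q (%x. g x - h x) a \<and> LB q g b)"

context rep
begin

lemma Dt_dd_cong:
 assumes "\<And>t xi z. dd f l J t xi z = dd g l J t xi z"
 shows "Dt f p l J t = Dt g p l J t" "WJ f p l lam s c J = WJ g p l lam s c J" unfolding WJ_def Dt_def assms by(rule refl)+

lemma CG_nonneg: "0 <= CG lam" unfolding CG_def using CE_pos[OF c0, of l lam] CM_ge1 by auto

text \<open>For q < p the number \<open>sobgap p q\<close> is 0. The bound is then proved in L_p and
  passes to L_q because the cube has volume 1.\<close>

lemma gg_LB:
 fixes f :: "real^'n => real"
 assumes f[measurable]: "f \<in> BM borel" and p: "1 <= p" and q: "1 <= q"
  and W: "WT S f p lam (sobgap p q) <= ennreal w" "0 <= w"
  and fin: "\<And>J t. J \<in> S ==> t \<in> space (LJ J) ==> inbox c J t ==> Dt f p l J t < \<infinity>"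
 shows "LB q (gg S lam f) (CG lam*w)"
proof -
 define w' where "w' = enn2real (WT S f p lam (sobgap p q))"
 have w': "WT S f p lam (sobgap p q) = ennreal w'" "0 <= w'" "w' <= w"
 proof -
  show e: "WT S f p lam (sobgap p q) = ennreal w'" unfolding w'_def by(rule ennreal_enn2real[symmetric]) (rule le_less_trans[OF W(1)], simp)
  show "0 <= w'" by(simp add: w'_def)
  show "w' <= w" using W e by(simp add: ennreal_le_iff)
 qed
 have cw: "0 <= CG lam*w'" "CG lam*w' <= CG lam*w" using CG_nonneg w' by(auto intro: mult_left_mono)
 have "LB q (gg S lam f) (CG lam*w')"
 proof (cases "q = \<infinity>")
  case True
  have "sobgap p q = 1/p" using p True by(simp add: sobgap_def inv_exp_def)
  then show ?thesis using gg_sup[OF f p, of S lam w'] w' True by(simp add: LB_def)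
 next
  case False
  define r where "r = enn2real q"
  have r: "1 <= r" unfolding r_def by(rule enn2real_ge1[OF q False])
  have ie: "inv_exp q = 1/r" using False by(simp add: inv_exp_def r_def)
  show ?thesis
  proof (cases "p <= r")
   case True
   then have "sobgap p q = 1/p - 1/r" using p r by(simp add: sobgap_def ie frac_le)
   then show ?thesis using gg_Lq[OF f p True, of S lam w'] w' fin False by(simp add: LB_def Lbd_def r_def)
  next
   case pr: False
   then have "sobgap p q = 1/p - 1/p" using p r by(simp add: sobgap_def ie frac_le)
   then have I: "(NN x. ennreal (\<bar>gg S lam f x\<bar> powr p)) <= ennreal ((CG lam*w') powr p)" using gg_Lq[OF f p order_refl, of S lam w'] w' fin by simp
   have pr': "1 <= p/r" "0 < p/r" using pr r by auto
   have g0: "x \<notin> Q1 ==> gg S lam f x = 0" for x by(simp add: gg_def)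
   have "epow (NN x. indicator Q1 x*ennreal (\<bar>gg S lam f x\<bar> powr r)) (p/r) <= (NN x. indicator Q1 x*epow (ennreal (\<bar>gg S lam f x\<bar> powr r)) (p/r))"
   by(rule L1_le_Lp[OF _ pr'(1)]) measurable
   also have "... = (NN x. ennreal (\<bar>gg S lam f x\<bar> powr p))"
   using r by(intro nn_integral_cong) (use g0 in \<open>auto simp: indicator_def epow_ennreal powr_powr\<close>)
   also have "... <= ennreal (((CG lam*w') powr r) powr (p/r))" using I r by(simp add: powr_powr)
   finally have "(NN x. indicator Q1 x*ennreal (\<bar>gg S lam f x\<bar> powr r)) <= ennreal ((CG lam*w') powr r)" by(rule epow_le_root[OF pr'(2)]) simp
   moreover have "(NN x. indicator Q1 x*ennreal (\<bar>gg S lam f x\<bar> powr r)) = (NN x. ennreal (\<bar>gg S lam f x\<bar> powr r))"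
   using r by(intro nn_integral_cong) (use g0 in \<open>auto simp: indicator_def\<close>)
   ultimately show ?thesis using False by(simp add: LB_def Lbd_def r_def)
  qed
 qed
 then show ?thesis by(rule LB_mono) (use cw in auto)
qed

lemma HH_finite:
 fixes f :: "real^'n => real"
 assumes f: "f \<in> BM borel" and p: "1 <= p"
  and W: "WJ f p l lam s c J < \<infinity>" and s: "0 <= s"
  and fin: "\<And>t. t \<in> space (LJ J) ==> inbox c J t ==> Dt f p l J t < \<infinity>"
 shows "(NN x. (if x \<in> Q1 then HH f l lam c J x else 0)) < \<infinity>"
proof (rule HH_integral_finite[OF f p order_refl _ fin])
 show "WJ f p l lam (1/p - 1/p) c J < \<infinity>" by(rule le_less_trans[OF WJ_weight_mono W]) (use c1 s in auto)
qed

text \<open>Differences with nonempty \<open>J\<close> do not see polynomials, so the remainder f1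
  has the same W as F while the polynomial part f2 has W = 0. The inequality \<open>whitney\<close>
  bounds the norm of f1 by W, hence that of f2 by the norm of F and W. Applying the representation
  to both parts also produces the weak derivative of the polynomial.\<close>

lemma unit_cube:
 assumes p: "1 <= p" and q: "1 <= q" and lam: "\<And>j. lam j < N"
 obtains K where "0 < K" "\<And>F w v. \<lbrakk>F \<in> BM borel; \<And>x. x \<notin> Q1 ==> F x = 0; Lbd p F v; 0 <= v;
   \<And>J t. J ~= {} ==> t \<in> space (LJ J) ==> inbox c J t ==> Dt F p l J t < \<infinity>;
   WT (- {{}}) F p lam (sobgap p q) <= ennreal w; 0 <= w\<rbrakk> \<Longrightarrow>
   unit_estimate (%j. l j - 1) q lam F (K*w) (K*(v + w))"
proof -
 let ?s = "sobgap p q"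
 have s: "0 <= ?s" by(simp add: sobgap_def)
 have p0: "0 < p" "0 <= p" using p by auto
 obtain C where C: "0 <= C" "\<And>f w. \<lbrakk>f \<in> BM borel; \<And>x. x \<notin> Q1 ==> f x = 0;
   (NN x. ennreal (\<bar>f x\<bar> powr p)) < \<infinity>;
   \<And>h. h \<in> poly_space (%j. l j - 1) ==> (LI x. indicator Q1 x*(f x*h x)) = 0;
   \<And>J t. J ~= {} ==> t \<in> space (LJ J) ==> inbox c J t ==> Dt f p l J t < \<infinity>;
   WT (- {{}}) f p lam ?s <= ennreal w; 0 <= w\<rbrakk> \<Longrightarrow> (NN x. ennreal (\<bar>f x\<bar> powr p)) <= ennreal ((C*w) powr p)"
  using whitney[OF p s, of lam] by blast
 \<comment> \<open>The 20 is 4 (1 + 4), from two applications of the triangle inequality with factor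
   4: one bounds f2 = F - f1, the other adds the two derivatives.\<close>
 define K where "K = 20*(CG lam + 1)*(C + 1)"
 have K: "0 < K" unfolding K_def using C(1) CG_nonneg[of lam] by(intro mult_pos_pos) auto
 show ?thesis
 proof (rule that[OF K])
  fix F :: "real^'n => real" and w v :: real
  assume Fm[measurable]: "F \<in> BM borel" and F0: "\<And>x. x \<notin> Q1 ==> F x = 0" and Fv: "Lbd p F v" "0 <= v"
   and fin: "\<And>J t. J ~= {} ==> t \<in> space (LJ J) ==> inbox c J t ==> Dt F p l J t < \<infinity>"
   and W: "WT (- {{}}) F p lam ?s <= ennreal w" "0 <= w"
  have Q1m[measurable]: "(Q1 :: (real^'n) set) \<in> sets borel" by(simp add: cube_def)
  have Fi: "integrable lborel F" by(rule integrable_of_Lbd[OF Fm F0 Fv p])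
  obtain P where P: "P \<in> poly_space (%j. l j - 1)" and orth: "\<And>hh. hh \<in> poly_space (%j. l j - 1) ==> (LI x. indicator Q1 x*((F x - P x)*hh x)) = 0"
   using projection_exists[OF Fi F0] by blast
  have Pm[measurable]: "P \<in> BM borel" by(rule poly_space_measurable[OF P])
  define f1 f2 where "f1 x = F x - indicator Q1 x*P x" and "f2 x = indicator Q1 x*P x" for x
  have f1m[measurable]: "f1 \<in> BM borel" and f2m[measurable]: "f2 \<in> BM borel" unfolding f1_def f2_def by measurable
  have f10: "x \<notin> Q1 ==> f1 x = 0" and f20: "x \<notin> Q1 ==> f2 x = 0" for x using F0 by(auto simp: f1_def f2_def)
  obtain H where H: "0 <= H" "\<And>x. \<bar>f2 x\<bar> <= H"
  proof -
   have "bounded (P ` cbox 0 1)" by(rule compact_imp_bounded[OF compact_continuous_image[OF poly_space_continuous[OF P] compact_cbox]])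
   then obtain H where H: "\<And>y. y \<in> P ` cbox 0 1 ==> norm y <= H" unfolding bounded_iff by blast
   have "\<bar>f2 x\<bar> <= max H 0" for x
   proof (cases "x \<in> Q1")
   case True
   then have "x \<in> cbox 0 1" by(auto simp: mem_cube mem_box_cart less_imp_le)
   then show ?thesis using H[of "P x"] True by(auto simp: f2_def)
   qed (simp add: f2_def)
   then show ?thesis using that[of "max H 0"] by simp
  qed
  have Q1b: "(NN x. ennreal B'*indicator (Q1 :: (real^'n) set) x) = ennreal B'" for B' by(subst nn_integral_cmult_indicator) (simp_all add: emeasure_Q1)
  have f2H: "Lbd p f2 H"
  proof -
   have "(NN x. ennreal (\<bar>f2 x\<bar> powr p)) <= (NN x. ennreal (H powr p)*indicator (Q1 :: (real^'n) set) x)"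
   proof (intro nn_integral_mono)
   fix x :: "real^'n"
   show "ennreal (\<bar>f2 x\<bar> powr p) <= ennreal (H powr p)*indicator Q1 x"
   using powr_mono2[OF p0(2) _ H(2)[of x]] f20[of x] by(cases "x \<in> Q1") (auto intro!: ennreal_leI)
   qed
   then show ?thesis unfolding Lbd_def Q1b .
  qed
  have f2i: "integrable lborel f2"
  proof (rule integrableI_bounded)
   have "(NN x. ennreal (norm (f2 x))) <= (NN x. ennreal H*indicator (Q1 :: (real^'n) set) x)"
   proof (intro nn_integral_mono)
   fix x :: "real^'n"
   show "ennreal (norm (f2 x)) <= ennreal H*indicator Q1 x" using H(2)[of x] f20[of x] by(cases "x \<in> Q1") (auto intro!: ennreal_leI)
   qed
   then show "(NN x. ennreal (norm (f2 x))) < \<infinity>" unfolding Q1b using le_less_trans[OF _ ennreal_less_top] by simp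
  qed measurable
  have f1i: "integrable lborel f1" using Fi f2i unfolding f1_def f2_def by simp
  \<comment> \<open>\<open>Lbd_add\<close> is stated for sums; sign changes reduce differences to
    it.\<close>
  have neg: "Lbd p (%x. - u x) a = Lbd p u a" for u :: "real^'n => real" and a by(simp add: Lbd_def)
  have f1fin: "(NN x. ennreal (\<bar>f1 x\<bar> powr p)) < \<infinity>"
  proof -
   have "Lbd p (%x. F x + - f2 x) (4*(v + H))" by(rule Lbd_add[OF _ _ p]) (use Fv f2H H neg[of f2 H] in auto)
   then have "(NN x. ennreal (\<bar>f1 x\<bar> powr p)) <= ennreal ((4*(v + H)) powr p)" by(simp add: Lbd_def f1_def f2_def)
   then show ?thesis using le_less_trans[OF _ ennreal_less_top] by simp
  qed
  have ddF: "dd f1 l J t xi z = dd F l J t xi z" and dd2: "dd f2 l J t xi z = dd (%_. 0) l J t xi z" if J: "J ~= {}" for J t xi z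
  proof -
   let ?m = "mdiff (chiJ J l) (restr_vec J xi)"
   have "?m f2 z = 0 \<and> ?m f1 z = ?m F z" if z: "z \<in> shrunk Q1 (chiJ J l) (restr_vec J xi)"
   proof -
   have "?m f2 z = ?m P z" by(rule mdiff_local[OF z]) (simp add: f2_def)
   then have 0: "?m f2 z = 0" using mdiff_poly_zero[OF P l1 J] by simp
   have "f1 = (%x. F x - f2 x)" by(simp add: f1_def f2_def fun_eq_iff)
   then show ?thesis using 0 by(simp add: mdiff_diff)
   qed
   moreover have "?m (%_. 0) z = 0" by(simp add: mdiff_def)
   ultimately show "dd f1 l J t xi z = dd F l J t xi z" "dd f2 l J t xi z = dd (%_. 0) l J t xi z" by(simp_all add: dd_def)
  qed
  have dd0: "dd (%_. 0) l J t xi z = 0" for J t and xi :: "'n => real" and z by(simp add: dd_def mdiff_def)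
  have Dt2: "Dt f2 p l J t = 0" if "J ~= {}" for J t unfolding Dt_dd_cong(1)[OF dd2[OF that]] by(simp add: Dt_def dd0)
  have WJ2: "WJ f2 p l lam ?s c J = 0" if "J ~= {}" for J unfolding WJ_def Dt2[OF that] by(simp cong: if_cong)
  have Dt1: "Dt f1 p l J t = Dt F p l J t" if "J ~= {}" for J t by(rule Dt_dd_cong(1)[OF ddF[OF that]])
  have W1: "WT (- {{}}) f1 p lam ?s <= ennreal w"
  proof -
   have "WT (- {{}}) f1 p lam ?s = WT (- {{}}) F p lam ?s" unfolding WT_def by(intro sum.cong refl Dt_dd_cong(2)[OF ddF]) auto
   then show ?thesis using W by simp
  qed
  have f1C: "Lbd p f1 (C*w)" unfolding Lbd_def
  proof (rule C(2)[OF f1m f10 f1fin _ _ W1 W(2)])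
   fix h assume h: "h \<in> poly_space (%j. l j - 1)"
   have "(LI x. indicator Q1 x*(f1 x*h x)) = (LI x. indicator Q1 x*((F x - P x)*h x))" by(intro BI_cong refl) (auto simp: f1_def indicator_def)
   then show "(LI x. indicator Q1 x*(f1 x*h x)) = 0" using orth[OF h] by simp
  qed (use Dt1 fin in auto)
  have Cw: "0 <= C*w" using C W by simp
  have f2C: "Lbd p f2 (4*(v + C*w))"
  proof -
   have "Lbd p (%x. F x + - f1 x) (4*(v + C*w))" by(rule Lbd_add[OF _ _ p]) (use Fv f1C Cw neg[of f1 "C*w"] in auto)
   then show ?thesis by(simp add: Lbd_def f1_def f2_def)
  qed
  have root: "epow (NN x. ennreal (\<bar>u x\<bar> powr p)) (1/p) <= ennreal a" if "Lbd p u a" "0 <= a" for u :: "real^'n => real" and a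
  proof -
   have "epow (NN x. ennreal (\<bar>u x\<bar> powr p)) (1/p) <= epow (ennreal (a powr p)) (1/p)" using that p0 by(intro epow_mono) (auto simp: Lbd_def)
   also have "... = ennreal a" using that p0 by(simp add: epow_ennreal powr_powr)
   finally show ?thesis .
  qed
  have U: "(UNIV :: 'n set set) = insert {} (- {{}})" by auto
  have WU: "WT UNIV u p lam ?s = WJ u p l lam ?s c {} + WT (- {{}}) u p lam ?s" for u unfolding WT_def U by(subst sum.insert) auto
  have WU1: "WT UNIV f1 p lam ?s <= ennreal (C*w + w)"
  proof -
   have "WJ f1 p l lam ?s c {} = epow (NN x. ennreal (\<bar>f1 x\<bar> powr p)) (1/p)" by(rule WJ_empty[OF f10 p0(1)])
   then have "WJ f1 p l lam ?s c {} <= ennreal (C*w)" using root[OF f1C Cw] by(simp only:)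
   then show ?thesis unfolding WU ennreal_plus[OF Cw W(2)] by(rule add_mono[OF _ W1])
  qed
  have B0: "0 <= 4*(v + C*w)" using Fv Cw by simp
  have WU2: "WT UNIV f2 p lam ?s <= ennreal (4*(v + C*w))"
  proof -
   have "WT (- {{}}) f2 p lam ?s = 0" unfolding WT_def by(intro sum.neutral) (use WJ2 in auto)
   moreover have "WJ f2 p l lam ?s c {} = epow (NN x. ennreal (\<bar>f2 x\<bar> powr p)) (1/p)" by(rule WJ_empty[OF f20 p0(1)])
   ultimately show ?thesis unfolding WU using root[OF f2C B0] by(simp only: add_0_right)
  qed
  have fin1: "Dt f1 p l J t < \<infinity>" if "t \<in> space (LJ J)" "inbox c J t" for J t
   using Dt_empty[where f = f1, OF f10 p0(1)] f1fin Dt1 fin[OF _ that] by(cases "J = {}") auto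
  have fin2: "Dt f2 p l J t < \<infinity>" for J t
  proof (cases "J = {}")
   case True
   then show ?thesis using Dt_empty[where f = f2, OF f20 p0(1)] f2H le_less_trans[OF _ ennreal_less_top] by(simp add: Lbd_def)
  qed (simp add: Dt2)
  have HH1: "(NN x. (if x \<in> Q1 then HH f1 l lam c J x else 0)) < \<infinity>" for J
   by(rule HH_finite[OF f1m p le_less_trans[OF order_trans[OF WJ_le_WT[OF UNIV_I] WU1] ennreal_less_top, unfolded infinity_ennreal_def[symmetric]] s fin1])
  have HH2: "(NN x. (if x \<in> Q1 then HH f2 l lam c J x else 0)) < \<infinity>" for J
   by(rule HH_finite[OF f2m p le_less_trans[OF order_trans[OF WJ_le_WT[OF UNIV_I] WU2] ennreal_less_top, unfolded infinity_ennreal_def[symmetric]] s fin2])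
  \<comment> \<open>The full index set includes the empty \<open>J\<close>, whose share of W is the
    L_p norm of f1 or f2.\<close>
  let ?g1 = "gg UNIV lam f1" and ?h = "gg UNIV lam f2"
  have L1: "LB q ?g1 (CG lam*(C*w + w))" by(rule gg_LB[OF f1m p q WU1 _ fin1]) (use Cw W in auto)
  have L2: "LB q ?h (CG lam*(4*(v + C*w)))" by(rule gg_LB[OF f2m p q WU2 B0 fin2])
  have b1: "0 <= CG lam*(C*w + w)" "0 <= CG lam*(4*(v + C*w))" using CG_nonneg[of lam] Cw W B0 by auto
  have L3: "LB q (%x. ?g1 x + ?h x) (4*(CG lam*(C*w + w) + CG lam*(4*(v + C*w))))" by(rule LB_add[OF _ _ q L1 L2 b1]) measurable
  have pr: "0 <= CG lam*C*w" "0 <= CG lam*w" "0 <= CG lam * v" "0 <= CG lam*C * v" "0 <= C * v" using CG_nonneg[of lam] C W Fv by auto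
  have Ke: "K*a = 20*(CG lam*C*a) + 20*(CG lam*a) + 20*(C*a) + 20*a" for a unfolding K_def by(simp add: algebra_simps)
  have e1: "CG lam*(C*w + w) = CG lam*C*w + CG lam*w" by(simp add: algebra_simps)
  have k1: "CG lam*(C*w + w) <= K*w" unfolding Ke e1 using pr Cw W(2) by linarith
  have e2: "4*(CG lam*(C*w + w) + CG lam*(4*(v + C*w))) = 20*(CG lam*C*w) + 4*(CG lam*w) + 16*(CG lam * v)" by(simp add: algebra_simps)
  have k2: "4*(CG lam*(C*w + w) + CG lam*(4*(v + C*w))) <= K*(v + w)" unfolding distrib_left[of K v w] unfolding Ke e2 using pr Cw W(2) Fv(2) by linarith
  \<comment> \<open>Integrability of \<open>gg\<close> is stated under a test function; the zero
    function is enough to extract it.\<close>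
  have triv: "test_fun Q1 (%_::real^'n. 0)"
  proof -
   have "partial_list js (%_::real^'n. 0) = (%_. 0)" for js :: "'n list" by(induction js) (simp_all add: partial_def fun_eq_iff)
   then show ?thesis by(simp add: test_fun_def)
  qed
  have g1i: "integrable lborel ?g1" by(rule weak_deriv_gg(2)[OF f1m f1i f10 HH1 lam triv])
  have hi: "integrable lborel ?h" by(rule weak_deriv_gg(2)[OF f2m f2i f20 HH2 lam triv])
  show "unit_estimate (%j. l j - 1) q lam F (K*w) (K*(v + w))" unfolding unit_estimate_def
  proof (rule exI[of _ P], rule exI[of _ "%x. ?g1 x + ?h x"], rule exI[of _ ?h], intro conjI ballI allI impI)
   show "LB q (%x. ?g1 x + ?h x - ?h x) (K*w)" using LB_mono[OF L1 b1(1) k1] by simp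
   show "LB q (%x. ?g1 x + ?h x) (K*(v + w))" by(rule LB_mono[OF L3 _ k2]) (use b1 in simp)
   fix \<phi>' :: "real^'n => real" assume t: "test_fun Q1 \<phi>'"
   have w1: "(LI x. f1 x*partial_mi lam \<phi>' x) = (-1)^(\<Sum>j\<in>UNIV. lam j)*(LI x. ?g1 x*\<phi>' x)" by(rule weak_deriv_gg(1)[OF f1m f1i f10 HH1 lam t])
   have w2: "(LI x. f2 x*partial_mi lam \<phi>' x) = (-1)^(\<Sum>j\<in>UNIV. lam j)*(LI x. ?h x*\<phi>' x)" by(rule weak_deriv_gg(1)[OF f2m f2i f20 HH2 lam t])
   show "(LI x. (indicator Q1 x*P x)*partial_mi lam \<phi>' x) = (-1)^(\<Sum>j\<in>UNIV. lam j)*(LI x. ?h x*\<phi>' x)" using w2 unfolding f2_def .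
   obtain js where js: "partial_mi lam \<phi>' = partial_list js \<phi>'" by(rule partial_mi_list[where lam = lam and \<phi> = \<phi>'])
   have bi: "integrable lborel (%x. u x*partial_list js' \<phi>' x)" if "integrable lborel u" for u js'
   proof -
   obtain b where b: "0 <= b" "\<And>x. \<bar>partial_list js' \<phi>' x\<bar> <= b" using test_fun_facts(3)[OF t, of js'] by blast
   have [measurable]: "u \<in> BM borel" using borel_measurable_integrable[OF that] by simp
   have [measurable]: "partial_list js' \<phi>' \<in> BM borel" by(rule test_fun_facts(4)[OF t])
   show ?thesis
   proof (rule Bochner_Integration.integrable_bound[of _ "%x. b*u x"])
   show "AE x in lborel. norm (u x*partial_list js' \<phi>' x) <= norm (b*u x)" using b by(intro AE_I2) (simp add: abs_mult mult.commute[of b] mult_left_mono)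
   qed (use that in auto)
   qed
   have "(LI x. F x*partial_mi lam \<phi>' x) = (LI x. f1 x*partial_mi lam \<phi>' x + f2 x*partial_mi lam \<phi>' x)"
   by(intro BI_cong refl) (simp add: f1_def f2_def algebra_simps)
   also have "... = (LI x. f1 x*partial_mi lam \<phi>' x) + (LI x. f2 x*partial_mi lam \<phi>' x)"
   unfolding js by(rule Bochner_Integration.integral_add[OF bi[OF f1i] bi[OF f2i]])
   also have "... = (-1)^(\<Sum>j\<in>UNIV. lam j)*((LI x. ?g1 x*\<phi>' x) + (LI x. ?h x*\<phi>' x))" unfolding w1 w2 by(simp only: distrib_left)
   also have "(LI x. ?g1 x*\<phi>' x) + (LI x. ?h x*\<phi>' x) = (LI x. (?g1 x + ?h x)*\<phi>' x)"
   proof -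
   have "(LI x. (?g1 x + ?h x)*\<phi>' x) = (LI x. ?g1 x*\<phi>' x + ?h x*\<phi>' x)" by(intro BI_cong refl distrib_right)
   then show ?thesis
   using Bochner_Integration.integral_add[OF bi[OF g1i, of "[]", unfolded partial_list.simps] bi[OF hi, of "[]", unfolded partial_list.simps]] by(simp only:)
   qed
   finally show "(LI x. F x*partial_mi lam \<phi>' x) = (-1)^(\<Sum>j\<in>UNIV. lam j)*(LI x. (?g1 x + ?h x)*\<phi>' x)" .
  next
   show "P \<in> poly_space (%j. l j - 1)" by(rule P)
   show "integrable lborel ?h" by(rule hi)
   show "integrable lborel (%x. ?g1 x + ?h x)" by(rule Bochner_Integration.integrable_add[OF g1i hi])
   fix hh :: "real^'n => real" assume "hh \<in> poly_space (%j. l j - 1)"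
   then show "(LI x. indicator Q1 x*((F x - P x)*hh x)) = 0" by(rule orth)
  qed
 qed
qed

end

section \<open>Change of variables to an arbitrary cube\<close>

lemma AE_translate:
 fixes a :: "'a::euclidean_space"
 assumes "AE x in lborel. Q x"
 shows "AE x in lborel. Q (x + a)"
proof -
 from AE_E[OF assms] obtain N where N: "{x \<in> space lborel. \<not> Q x} \<subseteq> N" "emeasure lborel N = 0" "N \<in> sets lborel" by blast
 have [measurable]: "N \<in> sets borel" using N(3) by simp
 have "(NN x. indicator N (x + a)) = (NN x. indicator N x)" by(rule nn_integral_translate) measurable
 also have "... = 0" using N by simp
 finally have "AE x in lborel. indicator N (x + a) = (0::ennreal)" by(subst (asm) nn_integral_0_iff_AE) auto
 then show ?thesis by eventually_elim (use N(1) in \<open>auto simp: indicator_def split: if_splits\<close>)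
qed

text \<open>A difference uses finitely many translates, and null sets are translation invariant; on
  the shrunk set all translated points lie in \<open>G\<close>. This permits replacing f by a Borel
  function that vanishes off the cube.\<close>

lemma diff_int_cong_AE:
 fixes f g :: "real^'n::finite => real"
 assumes ae: "AE x in lborel. x \<in> G --> f x = g x"
 shows "diff_int f G p l J t = diff_int g G p l J t" unfolding diff_int_def
proof (rule nn_integral_cong, rule arg_cong2[of _ _ _ _ "(*)"], rule refl)
 fix xi :: "'n => real"
 let ?m = "chiJ J l" and ?h = "restr_vec J xi"
 have "AE z in lborel. \<forall>k\<in>{k. \<forall>j. k j <= ?m j}. z + (\<chi> j. real (k j)*?h$j) \<in> G -->
   f (z + (\<chi> j. real (k j)*?h$j)) = g (z + (\<chi> j. real (k j)*?h$j))" by(rule AE_finite_allI[OF finite_multi]) (rule AE_translate[OF ae])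
 then have "AE z in lborel. z \<in> shrunk G ?m ?h --> mdiff ?m ?h f z = mdiff ?m ?h g z"
 proof eventually_elim
  case (elim z)
  show ?case
  proof
   assume z: "z \<in> shrunk G ?m ?h"
   show "mdiff ?m ?h f z = mdiff ?m ?h g z" unfolding mdiff_def
   proof (intro sum.cong refl arg_cong2[of _ _ _ _ "(*)"])
   fix k assume k: "k \<in> {k. \<forall>j. k j <= ?m j}"
   then have kj: "k j <= ?m j" for j by blast
   have "z + (\<chi> j. real (k j)*?h$j) \<in> G" by(rule shrunk_point[OF z kj])
   then show "f (z + (\<chi> j. real (k j)*?h$j)) = g (z + (\<chi> j. real (k j)*?h$j))" using elim k by blast
   qed
  qed
 qed
 then have "AE z in lebesgue. z \<in> shrunk G ?m ?h --> mdiff ?m ?h f z = mdiff ?m ?h g z" by(rule AE_completion)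
 then have "AE z in lebesgue. ennreal (\<bar>mdiff ?m ?h f z\<bar> powr p)*indicator (shrunk G ?m ?h) z = ennreal (\<bar>mdiff ?m ?h g z\<bar> powr p)*indicator (shrunk G ?m ?h) z"
  by eventually_elim (auto simp: indicator_def)
 then show "(\<integral>\<^sup>+z\<in>shrunk G ?m ?h. ennreal (\<bar>mdiff ?m ?h f z\<bar> powr p) \<partial>lebesgue) = (\<integral>\<^sup>+z\<in>shrunk G ?m ?h. ennreal (\<bar>mdiff ?m ?h g z\<bar> powr p) \<partial>lebesgue)"
  by(rule nn_integral_cong_AE)
qed

lemma poly_space_affine:
 fixes g :: "real^'n::finite => real"
 assumes "g \<in> poly_space k"
 shows "(%x. g (\<chi> j. a j + b j*x$j)) \<in> poly_space k"
proof -
 obtain A where A: "g = (%x. \<Sum>m\<in>{m. \<forall>j. m j <= k j}. A m*(\<Prod>j\<in>UNIV. (x$j)^m j))" using assms by(auto simp: poly_space_def)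
 have "(%x::real^'n. \<Prod>j\<in>UNIV. poly ([:a j, b j:]^m j) (x$j)) \<in> poly_space k" if m: "m \<in> {m. \<forall>j. m j <= k j}" for m
 proof (rule poly_space_prod)
  fix j
  have "degree ([:a j, b j:]^m j) <= degree [:a j, b j:]*m j" by(rule degree_power_le)
  also have "... <= 1*m j" by(rule mult_right_mono) auto
  also have "... <= k j" using m by auto
  finally show "degree ([:a j, b j:]^m j) <= k j" .
 qed
 then have "(%x. \<Sum>m\<in>{m. \<forall>j. m j <= k j}. A m*(\<Prod>j\<in>UNIV. poly ([:a j, b j:]^m j) (x$j))) \<in> poly_space k"
  by(intro poly_space_sum finite_multi poly_space_cmult)
 then show ?thesis unfolding A by(simp add: poly_power mult.commute)
qed

lemma prod_list_count:
 fixes \<delta> :: "'n::finite => real"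
 shows "prod_list (map \<delta> js) = (\<Prod>j\<in>UNIV. \<delta> j^count_list js j)"
proof (induction js)
 case (Cons a js)
 have "(\<Prod>j\<in>UNIV. \<delta> j^count_list (a # js) j) = (\<Prod>j\<in>UNIV. (if j = a then \<delta> a else 1)*\<delta> j^count_list js j)" by(intro prod.cong) auto
 also have "... = \<delta> a*(\<Prod>j\<in>UNIV. \<delta> j^count_list js j)" unfolding prod.distrib by simp
 finally show ?case using Cons by simp
qed simp

locale affine_cube =
 fixes \<delta> :: "'n::finite => real" and x0 :: "real^'n"
 assumes dpos: "\<And>j. 0 < \<delta> j"
begin

definition aff :: "real^'n => real^'n" where "aff y = x0 + (\<chi> j. \<delta> j*y$j)"
definition ainv :: "real^'n => real^'n" where "ainv x = (\<chi> j. (x$j - x0$j)/\<delta> j)"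
definition vol :: real where "vol = (\<Prod>j\<in>UNIV. \<delta> j)"

lemma vol_pos: "0 < vol" unfolding vol_def by(intro prod_pos) (use dpos in auto)

lemma aff_ainv: "aff (ainv x) = x" and ainv_aff: "ainv (aff y) = y" using dpos less_imp_neq[OF dpos] by(simp_all add: aff_def ainv_def vec_eq_iff)

lemma aff_cube: "aff y \<in> cube \<delta> x0 \<longleftrightarrow> y \<in> Q1"
proof -
 have "0 < \<delta> j*y$j \<longleftrightarrow> 0 < y$j" "\<delta> j*y$j < \<delta> j \<longleftrightarrow> y$j < 1" for j
  using dpos[of j] by(simp_all add: zero_less_mult_iff)
 then show ?thesis by(simp add: mem_cube aff_def)
qed

lemma measurable_aff [measurable]: "aff \<in> borel \<rightarrow>\<^sub>M borel"
proof -
 have "(%y::real^'n. \<chi> j. \<delta> j*y$j) \<in> BM borel" by(rule measurable_vec_lambda) measurable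
 then show ?thesis unfolding aff_def by measurable
qed

lemma measurable_ainv [measurable]: "ainv \<in> borel \<rightarrow>\<^sub>M borel" unfolding ainv_def by(rule measurable_vec_lambda) measurable

lemma continuous_aff: "continuous_on S aff"
proof -
 have "continuous_on S (%y::real^'n. \<chi> j. \<delta> j*y$j)" by(subst continuous_on_componentwise) (auto simp: Basis_vec_def inner_axis intro!: continuous_intros)
 then show ?thesis unfolding aff_def by(intro continuous_intros)
qed

lemma continuous_ainv: "continuous_on S ainv" unfolding ainv_def
 by(subst continuous_on_componentwise) (use less_imp_neq[OF dpos] in \<open>auto simp: Basis_vec_def inner_axis intro!: continuous_intros\<close>)

lemma lborel_aff: "lborel = density (distr lborel borel aff) (%_. ennreal vol)"
proof -
 have T: "x0 + (\<Sum>b\<in>Basis. (((\<chi> j. \<delta> j) \<bullet> b)*(x \<bullet> b)) *\<^sub>R b) = aff x" for x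
 proof -
  have "(\<Sum>b\<in>Basis. (((\<chi> j. \<delta> j) \<bullet> b)*(x \<bullet> b)) *\<^sub>R b) = (\<Sum>b\<in>Basis. ((\<chi> j. \<delta> j*x$j) \<bullet> b) *\<^sub>R b)"
   by(intro sum.cong refl) (auto simp: Basis_vec_def inner_axis)
  then show ?thesis by(simp add: aff_def euclidean_representation)
 qed
 have "(\<Prod>b\<in>Basis. \<bar>(\<chi> j. \<delta> j) \<bullet> (b :: real^'n)\<bar>) = vol"
  unfolding prod_Basis_vec vol_def by(intro prod.cong refl) (simp add: inner_axis abs_of_pos[OF dpos])
 moreover have "lborel = density (distr lborel borel (%x. x0 + (\<Sum>b\<in>Basis. (((\<chi> j. \<delta> j) \<bullet> b)*(x \<bullet> b)) *\<^sub>R b))) (%_. ennreal (\<Prod>b\<in>Basis. \<bar>(\<chi> j. \<delta> j) \<bullet> (b :: real^'n)\<bar>))"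
  by(rule lborel_affine_euclidean) (use less_imp_neq[OF dpos] in \<open>auto simp: Basis_vec_def inner_axis\<close>)
 ultimately show ?thesis by(simp add: T)
qed

lemma nn_integral_aff:
 assumes [measurable]: "F \<in> BM borel"
 shows "(NN x. F x) = ennreal vol*(NN y. F (aff y))" by(subst lborel_aff) (simp add: nn_integral_density nn_integral_distr nn_integral_cmult)

lemma integral_aff:
 fixes F :: "real^'n => real"
 assumes [measurable]: "F \<in> BM borel"
 shows "(LI x. F x) = vol*(LI y. F (aff y))" using vol_pos by(subst lborel_aff) (simp add: integral_density integral_distr)

lemma integrable_aff:
 fixes F :: "real^'n => real"
 assumes [measurable]: "F \<in> BM borel"
 shows "integrable lborel F \<longleftrightarrow> integrable lborel (%y. F (aff y))"
 using vol_pos by(subst (1) lborel_aff) (simp add: integrable_density integrable_distr_eq)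

lemma mdiff_aff:
 assumes "\<And>j. j \<in> J ==> xi j = \<delta> j*\<eta> j"
 shows "mdiff m (restr_vec J xi) f (aff y) = mdiff m (restr_vec J \<eta>) (%y. f (aff y)) y"
proof -
 have "aff y + (\<chi> j. real (k j)*restr_vec J xi$j) = aff (y + (\<chi> j. real (k j)*restr_vec J \<eta>$j))" for k
  using assms by(auto simp: aff_def vec_eq_iff restr_vec_def algebra_simps)
 then show ?thesis unfolding mdiff_def by simp
qed

lemma shrunk_aff:
 assumes "\<And>j. j \<in> J ==> xi j = \<delta> j*\<eta> j"
 shows "aff y \<in> shrunk (cube \<delta> x0) (chiJ J l) (restr_vec J xi) \<longleftrightarrow> y \<in> shrunk Q1 (chiJ J l) (restr_vec J \<eta>)"
proof -
 have "0 < \<delta> j*y$j + real (l j)*xi j \<longleftrightarrow> 0 < y$j + real (l j)*\<eta> j" 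
  "\<delta> j*y$j + real (l j)*xi j < \<delta> j \<longleftrightarrow> y$j + real (l j)*\<eta> j < 1" if "j \<in> J" for j
 proof -
  have e: "\<delta> j*y$j + real (l j)*xi j = \<delta> j*(y$j + real (l j)*\<eta> j)" using assms[OF that] by(simp add: algebra_simps)
  show "0 < \<delta> j*y$j + real (l j)*xi j \<longleftrightarrow> 0 < y$j + real (l j)*\<eta> j" 
   "\<delta> j*y$j + real (l j)*xi j < \<delta> j \<longleftrightarrow> y$j + real (l j)*\<eta> j < 1" unfolding e using dpos[of j] by(simp_all add: zero_less_mult_iff)
 qed
 then show ?thesis unfolding shrunk_cube aff_cube by(simp add: aff_def add.assoc)
qed

text \<open>Induction on the index set with one-dimensional dilations. The restricted abstraction
  keeps the scaled functions in the space of the product measure.\<close>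

lemma PiM_scale:
 assumes "G \<in> BM (LJ J)"
 shows "(nn_integral (LJ J) (%xi. G xi)) = ennreal (\<Prod>j\<in>J. \<delta> j)*(nn_integral (LJ J) (%\<eta>. G (\<lambda>j\<in>J. \<delta> j*\<eta> j)))"
proof -
 interpret PS: product_sigma_finite "%_::'n. lborel::real measure" by standard
 have "finite J" by simp
 then show ?thesis using assms
 proof (induction J arbitrary: G rule: finite_induct)
  case empty
  have "(%_::'n. undefined::real) = (\<lambda>j\<in>{}. \<delta> j*undefined)" by(simp add: restrict_def)
  then show ?case unfolding PiM_empty_nn_integral by(simp add: restrict_def)
 next
  case (insert i J)
  note Gm[measurable] = insert.prems
  let ?P = "LJ J"
  have upd[measurable]: "(%w. (fst w)(i := snd w)) \<in> ?P \<Otimes>\<^sub>M lborel \<rightarrow>\<^sub>M LJ (insert i J)"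
   using measurable_add_dim[of i J "%_. lborel::real measure"] by(simp add: split_beta')
  have sc[measurable]: "(%\<eta>. \<lambda>j\<in>A. \<delta> j*\<eta> j) \<in> LJ A \<rightarrow>\<^sub>M LJ A" for A
   by(intro measurable_restrict) (simp add: measurable_component_singleton)
  have Gm2[measurable]: "(%w. G ((fst w)(i := snd w))) \<in> BM (?P \<Otimes>\<^sub>M lborel)" by(rule measurable_compose[OF upd Gm])
  have H[measurable]: "(%x. \<integral>\<^sup>+y. G (x(i := y)) \<partial>lborel) \<in> borel_measurable ?P" using lborel.borel_measurable_nn_integral_fst[OF Gm2] by simp
  have Gs[measurable]: "(%\<eta>. G (\<lambda>j\<in>insert i J. \<delta> j*\<eta> j)) \<in> BM (LJ (insert i J))" by(rule measurable_compose[OF sc Gm])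
  have "(nn_integral (LJ (insert i J)) (%xi. G xi)) = (nn_integral ?P (%x. (NN y. G (x(i := y)))))" by(rule PS.product_nn_integral_insert[OF insert.hyps Gm])
  also have "... = ennreal (\<Prod>j\<in>J. \<delta> j)*(nn_integral ?P (%x. (NN y. G ((\<lambda>j\<in>J. \<delta> j*x j)(i := y)))))" by(rule insert.IH[OF H])
  also have "(nn_integral ?P (%x. (NN y. G ((\<lambda>j\<in>J. \<delta> j*x j)(i := y)))))
   = (nn_integral ?P (%x. ennreal (\<delta> i)*(NN y. G (\<lambda>j\<in>insert i J. \<delta> j*(x(i := y)) j))))"
  proof (rule nn_integral_cong)
   fix x assume x: "x \<in> space ?P"
   have x': "(\<lambda>j\<in>J. \<delta> j*x j) \<in> space ?P" using measurable_space[OF sc x] .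
   have Gx: "(%y. G ((\<lambda>j\<in>J. \<delta> j*x j)(i := y))) \<in> BM borel" using measurable_compose[OF measurable_Pair1'[OF x'] Gm2] by simp
   have e: "(\<lambda>j\<in>J. \<delta> j*x j)(i := 0 + \<delta> i*y) = (\<lambda>j\<in>insert i J. \<delta> j*(x(i := y)) j)" for y
   using insert.hyps by(auto simp: fun_eq_iff restrict_def)
   have d: "\<delta> i ~= 0" using dpos[of i] by simp
   show "(NN y. G ((\<lambda>j\<in>J. \<delta> j*x j)(i := y))) = ennreal (\<delta> i)*(NN y. G (\<lambda>j\<in>insert i J. \<delta> j*(x(i := y)) j))"
   unfolding nn_integral_real_affine[OF Gx d, of 0] e using dpos[of i] by simp
  qed
  also have "... = ennreal (\<delta> i)*(nn_integral ?P (%x. (NN y. G (\<lambda>j\<in>insert i J. \<delta> j*(x(i := y)) j))))"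
  proof (rule nn_integral_cmult)
   have "(%w. G (\<lambda>j\<in>insert i J. \<delta> j*((fst w)(i := snd w)) j)) \<in> BM (?P \<Otimes>\<^sub>M lborel)" by(rule measurable_compose[OF upd Gs])
   from lborel.borel_measurable_nn_integral_fst[OF this]
   show "(%x. \<integral>\<^sup>+y. G (\<lambda>j\<in>insert i J. \<delta> j*(x(i := y)) j) \<partial>lborel) \<in> borel_measurable ?P" by simp
  qed
  also have "(nn_integral ?P (%x. (NN y. G (\<lambda>j\<in>insert i J. \<delta> j*(x(i := y)) j)))) = (nn_integral (LJ (insert i J)) (%\<eta>. G (\<lambda>j\<in>insert i J. \<delta> j*\<eta> j)))"
   by(rule PS.product_nn_integral_insert[OF insert.hyps Gs, symmetric])
  moreover have "ennreal (\<Prod>j\<in>insert i J. \<delta> j) = ennreal (\<Prod>j\<in>J. \<delta> j)*ennreal (\<delta> i)"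
   using insert.hyps less_imp_le[OF dpos] by(simp add: ennreal_mult prod_nonneg mult.commute)
  ultimately show ?case by(simp only: mult.assoc)
 qed
qed

text \<open>Rescaling the steps in \<open>J\<close> contributes the product of the delta_j over
  \<open>J\<close>, rescaling the base point the whole volume.\<close>

lemma diff_int_aff:
 assumes f[measurable]: "f \<in> BM borel" and p: "0 < p" and t: "t \<in> space (LJ J)"
 shows "diff_int f (cube \<delta> x0) p l J t = ennreal ((\<Prod>j\<in>J. \<delta> j) * vol)*Dt (%y. f (aff y)) p l J (\<lambda>j\<in>J. t j/\<delta> j)"
proof -
 let ?P = "LJ J"
 interpret P: sigma_finite_measure ?P by(rule sigma_finite_PiM_lborel)
 define dg where "dg xi z = (if (\<forall>j\<in>J. \<bar>xi j\<bar> <= t j) \<and> z \<in> shrunk (cube \<delta> x0) (chiJ J l) (restr_vec J xi)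
  then ennreal (\<bar>mdiff (chiJ J l) (restr_vec J xi) f z\<bar> powr p) else 0)" for xi z
 have dgm: "(%w. dg (xi w) (z w)) \<in> BM M"
  if xi[measurable]: "xi \<in> M \<rightarrow>\<^sub>M ?P" and [measurable]: "z \<in> BM M" for xi z and M :: "'b measure"
 proof -
  have "Measurable.pred M (%w. \<forall>j\<in>J. \<bar>xi w j\<bar> <= t j)"
  proof (rule pred_ball_fin)
   fix j assume j: "j \<in> J"
   note [measurable] = measurable_PiM_component[OF xi j]
   show "Measurable.pred M (%w. \<bar>xi w j\<bar> <= t j)" by measurable
  qed
  note [measurable] = this
  show ?thesis unfolding dg_def by measurable
 qed
 have "diff_int f (cube \<delta> x0) p l J t = (nn_integral ?P (%xi. (NN z. dg xi z)))" unfolding diff_int_def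
 proof (rule nn_integral_cong)
  fix xi assume xi: "xi \<in> space ?P"
  have box: "xi \<in> PiE J (%j. {- t j..t j}) \<longleftrightarrow> (\<forall>j\<in>J. \<bar>xi j\<bar> <= t j)"
   using xi by(auto simp: PiE_def Pi_def space_PiM abs_le_iff)
  show "indicator (PiE J (%j. {- t j..t j})) xi*(\<integral>\<^sup>+z\<in>shrunk (cube \<delta> x0) (chiJ J l) (restr_vec J xi). ennreal (\<bar>mdiff (chiJ J l) (restr_vec J xi) f z\<bar> powr p) \<partial>lebesgue) = (NN z. dg xi z)"
   unfolding nn_integral_completion
  proof (cases "\<forall>j\<in>J. \<bar>xi j\<bar> <= t j")
   case True
   then show "indicator (PiE J (%j. {- t j..t j})) xi*(\<integral>\<^sup>+z\<in>shrunk (cube \<delta> x0) (chiJ J l) (restr_vec J xi). ennreal (\<bar>mdiff (chiJ J l) (restr_vec J xi) f z\<bar> powr p) \<partial>lborel) = (NN z. dg xi z)"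
   using box by(simp add: dg_def) (intro nn_integral_cong, simp add: indicator_def)
  next
   case False
   then show "indicator (PiE J (%j. {- t j..t j})) xi*(\<integral>\<^sup>+z\<in>shrunk (cube \<delta> x0) (chiJ J l) (restr_vec J xi). ennreal (\<bar>mdiff (chiJ J l) (restr_vec J xi) f z\<bar> powr p) \<partial>lborel) = (NN z. dg xi z)"
   proof -
   have "dg xi z = 0" for z unfolding dg_def using False by(intro if_not_P) blast
   then show ?thesis using box False by simp
   qed
  qed
 qed
 also have "... = (nn_integral ?P (%xi. ennreal vol*(NN y. dg xi (aff y))))"
 proof (intro nn_integral_cong nn_integral_aff)
  fix xi assume "xi \<in> space ?P"
  then have c: "(%z::real^'n. xi) \<in> borel \<rightarrow>\<^sub>M ?P" by simp
  show "dg xi \<in> BM borel" by(rule dgm[OF c]) simp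
 qed
 also have "... = ennreal vol*(nn_integral ?P (%xi. (NN y. dg xi (aff y))))"
 proof (rule nn_integral_cmult)
  have "(%w. dg (fst w) (aff (snd w))) \<in> BM (?P \<Otimes>\<^sub>M lborel)" by(rule dgm) measurable
  from lborel.borel_measurable_nn_integral_fst[OF this]
  show "(%xi. \<integral>\<^sup>+y. dg xi (aff y) \<partial>lborel) \<in> borel_measurable ?P" by simp
 qed
 also have "(nn_integral ?P (%xi. (NN y. dg xi (aff y)))) = ennreal (\<Prod>j\<in>J. \<delta> j)*(nn_integral ?P (%\<eta>. (NN y. dg (\<lambda>j\<in>J. \<delta> j*\<eta> j) (aff y))))"
 proof (rule PiM_scale)
  have "(%w. dg (fst w) (aff (snd w))) \<in> BM (?P \<Otimes>\<^sub>M lborel)" by(rule dgm) measurable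
  from lborel.borel_measurable_nn_integral_fst[OF this]
  show "(%xi. \<integral>\<^sup>+y. dg xi (aff y) \<partial>lborel) \<in> borel_measurable ?P" by simp
 qed
 also have "(nn_integral ?P (%\<eta>. (NN y. dg (\<lambda>j\<in>J. \<delta> j*\<eta> j) (aff y)))) = Dt (%y. f (aff y)) p l J (\<lambda>j\<in>J. t j/\<delta> j)"
  unfolding Dt_def
 proof (intro nn_integral_cong)
  fix \<eta> :: "'n => real" and y
  let ?xi = "\<lambda>j\<in>J. \<delta> j*\<eta> j"
  have s: "aff y \<in> shrunk (cube \<delta> x0) (chiJ J l) (restr_vec J ?xi) \<longleftrightarrow> y \<in> shrunk Q1 (chiJ J l) (restr_vec J \<eta>)"
   by(rule shrunk_aff) simp
  have m: "mdiff (chiJ J l) (restr_vec J ?xi) f (aff y) = mdiff (chiJ J l) (restr_vec J \<eta>) (%y. f (aff y)) y" by(rule mdiff_aff) simp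
  have c: "(\<forall>j\<in>J. \<bar>?xi j\<bar> <= t j) \<longleftrightarrow> (\<forall>j\<in>J. \<bar>\<eta> j\<bar> <= (\<lambda>j\<in>J. t j/\<delta> j) j)"
   using dpos by(intro ball_cong refl) (simp add: abs_mult abs_of_pos[OF dpos] pos_le_divide_eq mult.commute)
  show "dg ?xi (aff y) = epow (dd (%y. f (aff y)) l J (\<lambda>j\<in>J. t j/\<delta> j) \<eta> y) p" unfolding dg_def dd_def c s m by(simp add: epow_ennreal)
 qed
 finally show ?thesis using vol_pos less_imp_le[OF dpos] by(simp add: ennreal_mult prod_nonneg mult_ac)
qed

lemma partial_aff:
 assumes d: "(%s. \<psi> (aff y + s *\<^sub>R axis j 1)) differentiable (at 0)"
 shows "partial j (%y. a*\<psi> (aff y)) y = \<delta> j*a*partial j \<psi> (aff y)"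
  and "(%s. a*\<psi> (aff (y + s *\<^sub>R axis j 1))) differentiable (at 0)"
proof -
 let ?u = "%s. \<psi> (aff y + s *\<^sub>R axis j 1)"
 have e: "aff (y + s *\<^sub>R axis j 1) = aff y + (\<delta> j * s) *\<^sub>R axis j 1" for s by(auto simp: aff_def vec_eq_iff axis_def algebra_simps)
 have D: "DERIV ?u 0 :> deriv ?u 0" using d DERIV_deriv_iff_real_differentiable by blast
 have L: "DERIV (%s. \<delta> j * s) 0 :> \<delta> j" by(auto intro!: derivative_eq_intros)
 have "DERIV (%s. ?u (\<delta> j * s)) 0 :> deriv ?u 0*\<delta> j" by(rule DERIV_chain'[OF L]) (use D in simp)
 from DERIV_cmult[OF this, of a]
 have F: "DERIV (%s. a*\<psi> (aff (y + s *\<^sub>R axis j 1))) 0 :> a*(deriv ?u 0*\<delta> j)" unfolding e .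
 show "partial j (%y. a*\<psi> (aff y)) y = \<delta> j*a*partial j \<psi> (aff y)" unfolding partial_def using DERIV_imp_deriv[OF F] by simp
 show "(%s. a*\<psi> (aff (y + s *\<^sub>R axis j 1))) differentiable (at 0)" using F real_differentiable_def by blast
qed

lemma partial_list_aff:
 assumes t: "test_fun G \<phi>"
 shows "partial_list js (%y. \<phi> (aff y)) = (%y. prod_list (map \<delta> js)*partial_list js \<phi> (aff y))"
proof (induction js)
 case (Cons j js)
 have d: "(%s. partial_list js \<phi> (x + s *\<^sub>R axis j 1)) differentiable (at 0)" for x using t unfolding test_fun_def by blast
 show ?case by(simp add: Cons fun_eq_iff partial_aff(1)[OF d] mult_ac)
qed simp

lemma test_fun_aff:
 assumes t: "test_fun (cube \<delta> x0) \<phi>"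
 shows "test_fun Q1 (%y. \<phi> (aff y))" unfolding test_fun_def
proof (intro conjI allI)
 fix js j and x :: "real^'n"
 have d: "(%s. partial_list js \<phi> (x + s *\<^sub>R axis j 1)) differentiable (at 0)" for x using t unfolding test_fun_def by blast
 show "(%s. partial_list js (%y. \<phi> (aff y)) (x + s *\<^sub>R axis j 1)) differentiable (at 0)" unfolding partial_list_aff[OF t] by(rule partial_aff(2)[OF d])
 show "continuous_on UNIV (partial_list js (%y. \<phi> (aff y)))" unfolding partial_list_aff[OF t]
  by(intro continuous_intros continuous_on_compose2[OF test_fun_facts(1)[OF t] continuous_aff]) auto
next
 let ?S = "closure {x. \<phi> x ~= 0}"
 have S: "compact ?S" "?S \<subseteq> cube \<delta> x0" using t unfolding test_fun_def by auto
 have c: "compact (ainv ` ?S)" by(rule compact_continuous_image[OF continuous_ainv S(1)])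
 have "{y. \<phi> (aff y) ~= 0} \<subseteq> ainv ` ?S"
 proof
  fix y assume "y \<in> {y. \<phi> (aff y) ~= 0}"
  then have "aff y \<in> ?S" using closure_subset[of "{x. \<phi> x ~= 0}"] by blast
  then show "y \<in> ainv ` ?S" by(intro image_eqI[of _ _ "aff y"]) (simp_all add: ainv_aff)
 qed
 then have sub: "closure {y. \<phi> (aff y) ~= 0} \<subseteq> ainv ` ?S" by(rule closure_minimal) (rule compact_imp_closed[OF c])
 show "compact (closure {y. \<phi> (aff y) ~= 0})" using compact_Int_closed[OF c closed_closure[of "{y. \<phi> (aff y) ~= 0}"]] sub by(simp add: Int_absorb1)
 show "closure {y. \<phi> (aff y) ~= 0} \<subseteq> Q1"
 proof
  fix y assume "y \<in> closure {y. \<phi> (aff y) ~= 0}"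
  then obtain x where "x \<in> ?S" "y = ainv x" using sub by blast
  then show "y \<in> Q1" using S(2) aff_cube[of y] by(auto simp: aff_ainv)
 qed
qed

lemma cube_sets [measurable]: "cube \<delta> x0 \<in> sets borel" "cube \<delta> x0 \<in> sets lebesgue" "cube \<delta> x0 \<inter> space lebesgue \<in> sets lebesgue"
 by(simp_all add: cube_def)

lemma integral_lebesgue_on_cube:
 fixes u u0 :: "real^'n => real"
 assumes u: "u \<in> BM (lebesgue_on (cube \<delta> x0))" and u0: "u0 \<in> BM borel" "\<And>x. x \<notin> cube \<delta> x0 ==> u0 x = 0"
  and ae: "AE x in lborel. x \<in> cube \<delta> x0 --> u x = u0 x"
 shows "(\<integral>x. u x \<partial>lebesgue_on (cube \<delta> x0)) = (LI x. u0 x)"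
proof -
 let ?Q = "cube \<delta> x0"
 have "(\<integral>x. u x \<partial>lebesgue_on ?Q) = (\<integral>x. indicator ?Q x *\<^sub>R u x \<partial>lebesgue)" by(rule integral_restrict_space[OF cube_sets(3)])
 also have "... = (\<integral>x. u0 x \<partial>lebesgue)"
 proof (rule integral_cong_AE)
  show "(%x. indicator ?Q x *\<^sub>R u x) \<in> BM lebesgue" using u borel_measurable_restrict_space_iff[OF cube_sets(3)] by blast
  show "u0 \<in> BM lebesgue" using u0(1) by(simp add: measurable_completion)
  from AE_completion[OF ae] show "AE x in lebesgue. indicator ?Q x *\<^sub>R u x = u0 x" by eventually_elim (use u0(2) in \<open>auto simp: indicator_def\<close>)
 qed
 also have "... = (LI x. u0 x)" by(rule integral_completion) (use u0(1) in simp)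
 finally show ?thesis .
qed

lemma measurable_lebesgue_on_cube: "h \<in> BM borel ==> h \<in> BM (lebesgue_on (cube \<delta> x0))" by(intro measurable_restrict_space1 measurable_completion) simp

text \<open>Each derivative of the transported test function brings out a factor delta_j. Dividing
  by the resulting product gives the factor in front of \<open>g1\<close>; the volume occurs on both
  sides.\<close>

lemma weak_deriv_aff:
 fixes u u0 g1 :: "real^'n => real"
 assumes u: "u \<in> BM (lebesgue_on (cube \<delta> x0))" and u0[measurable]: "u0 \<in> BM borel" and off: "\<And>x. x \<notin> cube \<delta> x0 ==> u0 x = 0"
  and ae: "AE x in lborel. x \<in> cube \<delta> x0 --> u x = u0 x"
  and g1: "integrable lborel g1"
  and wd: "\<And>\<phi>. test_fun Q1 \<phi> ==> (LI y. u0 (aff y)*partial_mi lam \<phi> y) = (-1)^(\<Sum>j\<in>UNIV. lam j)*(LI y. g1 y*\<phi> y)"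
 shows "weak_deriv (cube \<delta> x0) lam u (%x. (\<Prod>j\<in>UNIV. \<delta> j powr (- real (lam j)))*g1 (ainv x))"
proof -
 let ?Q = "cube \<delta> x0"
 define cl where "cl = (\<Prod>j\<in>UNIV. \<delta> j powr (- real (lam j)))"
 define D where "D = (\<Prod>j\<in>UNIV. \<delta> j^lam j)"
 have D: "0 < D" unfolding D_def by(intro prod_pos) (use dpos in auto)
 have cl: "cl = 1/D"
 proof -
  have "\<delta> j powr (- real (lam j)) = 1/\<delta> j^lam j" for j using dpos[of j] by(simp add: powr_minus powr_realpow inverse_eq_divide)
  then show ?thesis unfolding cl_def D_def by(simp add: prod_dividef)
 qed
 have g1m[measurable]: "g1 \<in> BM borel" using borel_measurable_integrable[OF g1] by simp
 define g where "g x = cl*g1 (ainv x)" for x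
 have gm[measurable]: "g \<in> BM borel" unfolding g_def by measurable
 have ga: "g (aff y) = cl*g1 y" for y by(simp add: g_def ainv_aff)
 have gi: "integrable lborel g" unfolding integrable_aff[OF gm] ga using g1 by simp
 have K: "integrable (lebesgue_on K) g" if "compact K" for K
 proof -
  have Ks: "K \<in> sets lebesgue" using that by(simp add: borel_compact)
  have "integrable lebesgue g" using gi integrable_completion[of g lborel] by simp
  from integrable_mult_indicator[OF Ks this] show ?thesis using Ks by(subst integrable_restrict_space) auto
 qed
 have W: "(\<integral>x. u x*partial_mi lam \<phi> x \<partial>lebesgue_on ?Q) = (-1)^(\<Sum>j\<in>UNIV. lam j)*(\<integral>x. g x*\<phi> x \<partial>lebesgue_on ?Q)" if t: "test_fun ?Q \<phi>" for \<phi>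
 proof -
  define js where "js = (SOME js. \<forall>j::'n. count_list js j = lam j)"
  have js: "\<forall>j. count_list js j = lam j" unfolding js_def by(rule someI_ex[OF exists_list_counts])
  have mi: "partial_mi lam \<psi> = partial_list js \<psi>" for \<psi> unfolding partial_mi_def js_def ..
  have pl: "prod_list (map \<delta> js) = D" unfolding prod_list_count D_def using js by simp
  note t1 = test_fun_aff[OF t]
  have pm[measurable]: "partial_list js \<phi> \<in> BM borel" "\<phi> \<in> BM borel" using test_fun_facts(4)[OF t, of js] test_fun_facts(4)[OF t, of "[]"] by simp_all
  have off\<phi>: "x \<notin> ?Q ==> \<phi> x = 0" for x using test_fun_facts(2)[OF t, of x "[]"] by simp
  have e: "u0 (aff y)*partial_list js (%y. \<phi> (aff y)) y = D*(u0 (aff y)*partial_list js \<phi> (aff y))" for y unfolding partial_list_aff[OF t] pl by simp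
  have A: "D*(LI y. u0 (aff y)*partial_list js \<phi> (aff y)) = (-1)^(\<Sum>j\<in>UNIV. lam j)*(LI y. g1 y*\<phi> (aff y))" using wd[OF t1] unfolding mi e by simp
  have "(\<integral>x. u x*partial_mi lam \<phi> x \<partial>lebesgue_on ?Q) = (LI x. u0 x*partial_list js \<phi> x)" unfolding mi
  proof (rule integral_lebesgue_on_cube)
   show "(%x. u x*partial_list js \<phi> x) \<in> BM (lebesgue_on ?Q)" by(intro borel_measurable_times u measurable_lebesgue_on_cube pm)
   from ae show "AE x in lborel. x \<in> ?Q --> u x*partial_list js \<phi> x = u0 x*partial_list js \<phi> x" by eventually_elim simp
  qed (use off in auto)
  also have "... = vol*(LI y. u0 (aff y)*partial_list js \<phi> (aff y))" by(rule integral_aff) measurable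
  also have "... = vol*(cl*(D*(LI y. u0 (aff y)*partial_list js \<phi> (aff y))))" using D by(simp add: cl)
  also have "... = (-1)^(\<Sum>j\<in>UNIV. lam j)*(vol*(LI y. g (aff y)*\<phi> (aff y)))" unfolding A ga by(simp add: mult_ac)
  also have "vol*(LI y. g (aff y)*\<phi> (aff y)) = (LI x. g x*\<phi> x)" by(rule integral_aff[symmetric]) measurable
  also have "... = (\<integral>x. g x*\<phi> x \<partial>lebesgue_on ?Q)"
   by(rule integral_lebesgue_on_cube[symmetric]) (use off\<phi> in \<open>auto intro: measurable_lebesgue_on_cube\<close>)
  finally show ?thesis .
 qed
 have "weak_deriv ?Q lam u g" unfolding weak_deriv_def using K W by blast
 then show ?thesis unfolding g_def[abs_def] cl_def .
qed

lemma Lq_norm_aff: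
 fixes g1 :: "real^'n => real"
 assumes [measurable]: "g1 \<in> BM borel" and q: "1 <= q" and b: "LB q g1 b" "0 <= b" and a: "0 <= a"
 shows "Lq_norm (cube \<delta> x0) q (%x. a*g1 (ainv x)) <= ennreal (a * vol powr (inv_exp q)*b)"
proof (cases "q = \<infinity>")
 case True
 have "esssup (lebesgue_on (cube \<delta> x0)) (%x. ennreal \<bar>a*g1 (ainv x)\<bar>) <= ennreal (a*b)"
 proof (rule esssup_I)
  have "(%x. a*g1 (ainv x)) \<in> BM (lebesgue_on (cube \<delta> x0))" by(rule measurable_lebesgue_on_cube) measurable
  then show "(%x. ennreal \<bar>a*g1 (ainv x)\<bar>) \<in> BM (lebesgue_on (cube \<delta> x0))" by measurable
  show "AE x in lebesgue_on (cube \<delta> x0). ennreal \<bar>a*g1 (ainv x)\<bar> <= ennreal (a*b)"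
   using b a True by(intro AE_I2 ennreal_leI) (auto simp: LB_def abs_mult intro: mult_left_mono)
 qed
 then show ?thesis using True vol_pos by(simp add: Lq_norm_def inv_exp_def)
next
 case False
 define r where "r = enn2real q"
 have r: "1 <= r" unfolding r_def by(rule enn2real_ge1[OF q False])
 have v: "0 < vol" by(rule vol_pos)
 have "(\<integral>\<^sup>+x\<in>cube \<delta> x0. ennreal (\<bar>a*g1 (ainv x)\<bar> powr r) \<partial>lebesgue) <= (NN x. ennreal (\<bar>a*g1 (ainv x)\<bar> powr r))"
  unfolding nn_integral_completion by(intro nn_integral_mono) (auto simp: indicator_def)
 also have "... = ennreal vol*(NN y. ennreal (a powr r)*ennreal (\<bar>g1 y\<bar> powr r))"
  using a by(subst nn_integral_aff) (simp_all add: ainv_aff abs_mult powr_mult ennreal_mult)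
 also have "... = ennreal vol*(ennreal (a powr r)*(NN y. ennreal (\<bar>g1 y\<bar> powr r)))" by(subst nn_integral_cmult) simp_all
 also have "... <= ennreal vol*(ennreal (a powr r)*ennreal (b powr r))" by(intro mult_left_mono) (use b False in \<open>auto simp: LB_def Lbd_def r_def\<close>)
 also have "... = ennreal (vol*(a*b) powr r)" using v a b by(simp add: ennreal_mult[symmetric] powr_mult)
 finally have "epow (\<integral>\<^sup>+x\<in>cube \<delta> x0. ennreal (\<bar>a*g1 (ainv x)\<bar> powr r) \<partial>lebesgue) (1/r) <= epow (ennreal (vol*(a*b) powr r)) (1/r)"
  using r by(intro epow_mono) auto
 also have "... = ennreal (a * vol powr (1/r)*b)" using v a b r by(simp add: epow_ennreal powr_mult powr_powr mult_ac)
 finally show ?thesis using False by(simp add: Lq_norm_def Lp_norm_def enn_root_epow inv_exp_def r_def)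
qed

text \<open>In order the factors are the weight in \<open>Wf\<close>, the substitution in the
  scales, the kernel weight and the root of the substitution in the steps; their exponents sum to 0
  in every coordinate.\<close>

lemma powr_cancel:
 "(\<Prod>j\<in>J. \<delta> j powr (a j + s))*(\<Prod>j\<in>J. \<delta> j)*(\<Prod>j\<in>J. \<delta> j powr (- a j - r - s - 1))*(\<Prod>j\<in>J. \<delta> j) powr r = 1"
proof -
 have "(\<Prod>j\<in>J. \<delta> j) powr r = (\<Prod>j\<in>J. \<delta> j powr r)" by(rule prod_powr_distrib)
 moreover have "\<delta> j powr (a j + s)*\<delta> j*\<delta> j powr (- a j - r - s - 1)*\<delta> j powr r = 1" for j
 proof -
  have "\<delta> j powr (a j + s)*\<delta> j powr 1*\<delta> j powr (- a j - r - s - 1)*\<delta> j powr r = \<delta> j powr 0"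
   unfolding powr_add[symmetric] by(rule arg_cong2[of _ _ _ _ "(powr)"]) auto
  then show ?thesis using dpos[of j] by simp
 qed
 ultimately show ?thesis by(simp add: prod.distrib[symmetric])
qed

text \<open>By \<open>powr_cancel\<close> nothing of the side lengths in \<open>J\<close> is left.
  The remaining power of the volume is the same for all \<open>J\<close>, so the whole of
  \<open>Wf\<close> scales like the L_p norm.\<close>

lemma Wf_term_aff:
 assumes f[measurable]: "f \<in> BM borel" and p: "1 <= p"
 shows "ennreal (\<Prod>j\<in>J. \<delta> j powr (real (lam j) + s)) *
   (\<integral>\<^sup>+ t. indicator (PiE J (%j. {0 <..< c1*\<delta> j})) t *
   ennreal (\<Prod>j\<in>J. t j powr (- real (lam j) - 1/p - s - 1)) *
   enn_root p (diff_int f (cube \<delta> x0) p l J t) \<partial>(LJ J))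
  = ennreal (vol powr (1/p))*WJ (%y. f (aff y)) p l lam s c1 J"
proof -
 let ?P = "LJ J"
 let ?a = "%j. - real (lam j) - 1/p - s - 1"
 let ?F = "%y. f (aff y)"
 define dJ where "dJ = (\<Prod>j\<in>J. \<delta> j)"
 have dJ: "0 < dJ" unfolding dJ_def by(intro prod_pos) (use dpos in auto)
 have p0: "0 < p" using p by simp
 have Fm[measurable]: "?F \<in> BM borel" by measurable
 define H where "H t = (if (\<forall>j\<in>J. 0 < t j \<and> t j < c1*\<delta> j) then ennreal (\<Prod>j\<in>J. t j powr ?a j)*epow (ennreal (dJ * vol)*Dt ?F p l J (\<lambda>j\<in>J. t j/\<delta> j)) (1/p) else 0)" for t
 have sc[measurable]: "(%t. \<lambda>j\<in>J. t j/\<delta> j) \<in> ?P \<rightarrow>\<^sub>M ?P" by(intro measurable_restrict) (simp add: measurable_component_singleton)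
 have Hm: "H \<in> borel_measurable ?P"
 proof -
  have "Measurable.pred ?P (%t. \<forall>j\<in>J. 0 < t j \<and> t j < c1*\<delta> j)"
  proof (rule pred_ball_fin)
   fix j assume j: "j \<in> J"
   have [measurable]: "(%t. t j) \<in> borel_measurable ?P" by(rule measurable_PiM_component[OF _ j]) simp
   show "Measurable.pred ?P (%t. 0 < t j \<and> t j < c1*\<delta> j)" by measurable
  qed
  note [measurable] = this
  have [measurable]: "(%t. \<Prod>j\<in>J. t j powr ?a j) \<in> borel_measurable ?P" by(rule measurable_prod_powr) measurable
  show ?thesis unfolding H_def by measurable
 qed
 have "(\<integral>\<^sup>+ t. indicator (PiE J (%j. {0 <..< c1*\<delta> j})) t*ennreal (\<Prod>j\<in>J. t j powr ?a j) *
   enn_root p (diff_int f (cube \<delta> x0) p l J t) \<partial>?P) = (nn_integral ?P (%t. H t))"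
 proof (rule nn_integral_cong)
  fix t assume t: "t \<in> space ?P"
  have "t \<in> PiE J (%j. {0 <..< c1*\<delta> j}) \<longleftrightarrow> (\<forall>j\<in>J. 0 < t j \<and> t j < c1*\<delta> j)"
   using t by(auto simp: space_PiM PiE_def Pi_def)
  then show "indicator (PiE J (%j. {0 <..< c1*\<delta> j})) t*ennreal (\<Prod>j\<in>J. t j powr ?a j) *
   enn_root p (diff_int f (cube \<delta> x0) p l J t) = H t" unfolding H_def enn_root_epow diff_int_aff[OF f p0 t] dJ_def[symmetric] by(auto simp: indicator_def)
 qed
 also have "... = ennreal dJ*(nn_integral ?P (%\<tau>. H (\<lambda>j\<in>J. \<delta> j*\<tau> j)))" unfolding dJ_def by(rule PiM_scale[OF Hm])
 also have "(nn_integral ?P (%\<tau>. H (\<lambda>j\<in>J. \<delta> j*\<tau> j))) = (nn_integral ?P (%\<tau>. ennreal ((\<Prod>j\<in>J. \<delta> j powr ?a j)*(dJ * vol) powr (1/p)) *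
   (if inbox c1 J \<tau> then ennreal (\<Prod>j\<in>J. \<tau> j powr ?a j)*epow (Dt ?F p l J \<tau>) (1/p) else 0)))"
 proof (rule nn_integral_cong)
  fix \<tau> assume t: "\<tau> \<in> space ?P"
  let ?t = "\<lambda>j\<in>J. \<delta> j*\<tau> j"
  have ext: "\<tau> \<in> extensional J" using t by(auto simp: space_PiM PiE_def)
  have r: "(\<lambda>j\<in>J. ?t j/\<delta> j) = \<tau>"
  proof
   fix j show "(\<lambda>j\<in>J. ?t j/\<delta> j) j = \<tau> j" using ext dpos[of j] by(cases "j \<in> J") (auto simp: extensional_def)
  qed
  have b: "(\<forall>j\<in>J. 0 < ?t j \<and> ?t j < c1*\<delta> j) \<longleftrightarrow> inbox c1 J \<tau>"
  proof -
   have "0 < \<delta> j*\<tau> j \<longleftrightarrow> 0 < \<tau> j" "\<delta> j*\<tau> j < c1*\<delta> j \<longleftrightarrow> \<tau> j < c1" for j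
   using dpos[of j] by(simp_all add: zero_less_mult_iff mult.commute[of "\<delta> j"])
   then show ?thesis unfolding inbox_def by simp
  qed
  show "H ?t = ennreal ((\<Prod>j\<in>J. \<delta> j powr ?a j)*(dJ * vol) powr (1/p)) *
   (if inbox c1 J \<tau> then ennreal (\<Prod>j\<in>J. \<tau> j powr ?a j)*epow (Dt ?F p l J \<tau>) (1/p) else 0)"
  proof (cases "inbox c1 J \<tau>")
   case True
   have pr: "(\<Prod>j\<in>J. ?t j powr ?a j) = (\<Prod>j\<in>J. \<delta> j powr ?a j)*(\<Prod>j\<in>J. \<tau> j powr ?a j)"
   unfolding prod.distrib[symmetric] using True less_imp_le[OF dpos] by(intro prod.cong refl) (auto simp: inbox_def powr_mult less_imp_le)
   have ep: "epow (ennreal (dJ * vol)*Dt ?F p l J \<tau>) (1/p) = ennreal ((dJ * vol) powr (1/p))*epow (Dt ?F p l J \<tau>) (1/p)"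
   using p0 dJ vol_pos by(simp add: epow_mult epow_ennreal)
   show ?thesis unfolding H_def b r pr ep using True by(simp add: ennreal_mult prod_nonneg mult_ac)
  next
   case False
   then show ?thesis unfolding H_def b r by simp
  qed
 qed
 also have "... = ennreal ((\<Prod>j\<in>J. \<delta> j powr ?a j)*(dJ * vol) powr (1/p))*WJ ?F p l lam s c1 J"
 proof -
  have [measurable]: "(%t. \<Prod>j\<in>J. t j powr ?a j) \<in> borel_measurable ?P" by(rule measurable_prod_powr) measurable
  show ?thesis unfolding WJ_def by(rule nn_integral_cmult) measurable
 qed
 finally have e: "(\<integral>\<^sup>+ t. indicator (PiE J (%j. {0 <..< c1*\<delta> j})) t*ennreal (\<Prod>j\<in>J. t j powr ?a j) *
   enn_root p (diff_int f (cube \<delta> x0) p l J t) \<partial>?P) = ennreal dJ*(ennreal ((\<Prod>j\<in>J. \<delta> j powr ?a j)*(dJ * vol) powr (1/p))*WJ ?F p l lam s c1 J)" .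
 define A B where "A = (\<Prod>j\<in>J. \<delta> j powr (real (lam j) + s))" and "B = (\<Prod>j\<in>J. \<delta> j powr ?a j)"
 have AB: "0 <= A" "0 <= B" unfolding A_def B_def by(auto intro: prod_nonneg)
 have c: "A*dJ*(B*(dJ * vol) powr (1/p)) = vol powr (1/p)"
 proof -
  have "A*dJ*B*dJ powr (1/p) = 1" unfolding A_def B_def dJ_def by(rule powr_cancel)
  moreover have "(dJ * vol) powr (1/p) = dJ powr (1/p) * vol powr (1/p)" using dJ vol_pos by(simp add: powr_mult)
  ultimately show ?thesis by(simp add: mult.assoc[symmetric])
 qed
 have "ennreal A*(ennreal dJ*(ennreal (B*(dJ * vol) powr (1/p))*WJ ?F p l lam s c1 J)) = ennreal (A*dJ*(B*(dJ * vol) powr (1/p)))*WJ ?F p l lam s c1 J"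
  using AB dJ by(simp only: ennreal_mult mult_nonneg_nonneg less_imp_le powr_ge_zero mult.assoc)
 from this[unfolded c, unfolded A_def B_def] show ?thesis unfolding e .
qed

lemma continuous_integrable_cube:
 fixes h :: "real^'n => real"
 assumes "continuous_on UNIV h"
 shows "integrable lborel (%x. indicator (cube \<delta> x0) x*h x)" "\<exists>H\<ge>0. \<forall>x\<in>cube \<delta> x0. \<bar>h x\<bar> <= H"
proof -
 let ?S = "cbox x0 (x0 + (\<chi> j. \<delta> j))"
 have sub: "cube \<delta> x0 \<subseteq> ?S" unfolding cube_def by(rule box_subset_cbox)
 have c: "continuous_on ?S h" by(rule continuous_on_subset[OF assms]) simp
 have "integrable lborel (%x. indicator ?S x *\<^sub>R h x)" by(rule borel_integrable_compact[OF compact_cbox c])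
 from integrable_mult_indicator[OF _ this, of "cube \<delta> x0"]
 have "integrable lborel (%x. indicator (cube \<delta> x0) x *\<^sub>R (indicator ?S x *\<^sub>R h x))" by simp
 moreover have e: "indicator (cube \<delta> x0) x *\<^sub>R (indicator ?S x *\<^sub>R h x) = indicator (cube \<delta> x0) x*h x" for x
  using sub by(auto simp: indicator_def)
 ultimately show "integrable lborel (%x. indicator (cube \<delta> x0) x*h x)" unfolding e by(simp only:)
 have "bounded (h ` ?S)" by(rule compact_imp_bounded[OF compact_continuous_image[OF c compact_cbox]])
 then obtain H where "\<And>y. y \<in> h ` ?S ==> norm y <= H" unfolding bounded_iff by blast
 then show "\<exists>H\<ge>0. \<forall>x\<in>cube \<delta> x0. \<bar>h x\<bar> <= H" using sub by(intro exI[of _ "max H 0"]) (auto simp: le_max_iff_disj)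
qed

lemma poly_space_L2_zero:
 fixes r :: "real^'n => real"
 assumes r: "r \<in> poly_space k" and z: "(LI x. indicator (cube \<delta> x0) x*(r x*r x)) = 0"
 shows "r = (%_. 0)"
proof -
 let ?Q = "cube \<delta> x0"
 have c: "continuous_on UNIV r" by(rule poly_space_continuous[OF r])
 have i: "integrable lborel (%x. indicator ?Q x*(r x*r x))" by(rule continuous_integrable_cube) (intro continuous_intros c)
 define A where "A = {x \<in> ?Q. r x ~= 0}"
 have oA: "open A"
 proof -
  have "A = ?Q \<inter> r -` (- {0})" by(auto simp: A_def)
  moreover have "open ?Q" unfolding cube_def by(rule open_box)
  ultimately show ?thesis using continuous_open_preimage[OF continuous_on_subset[OF c subset_UNIV], of ?Q "- {0}"] by(simp add: open_Compl)
 qed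
 have "AE x in lborel. indicator ?Q x*(r x*r x) = 0" using integral_nonneg_eq_0_iff_AE[OF i] z by(auto simp: indicator_def)
 then have "AE x in lborel. x \<notin> A" by eventually_elim (auto simp: A_def)
 moreover have Am: "A \<in> sets lborel" using oA by simp
 ultimately have "A \<in> null_sets lborel" using AE_iff_null_sets[OF Am] by blast
 then have "negligible A" by(simp add: negligible_iff_null_sets null_sets_completionI)
 then have "A = {}" using open_not_negligible[OF oA] by blast
 then have "\<And>x. x \<in> ?Q ==> r x = 0" by(auto simp: A_def)
 then have "r y = 0" for y by(rule poly_space_zero_on_cube[OF r dpos])
 then show ?thesis by(simp add: fun_eq_iff)
qed

text \<open>The definite description calls for uniqueness: the difference of two candidates is a
  polynomial orthogonal to itself, hence zero on the cube and everywhere.\<close>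

lemma poly_proj_aff:
 fixes f f0 P :: "real^'n => real"
 assumes f: "f \<in> BM (lebesgue_on (cube \<delta> x0))" and f0[measurable]: "f0 \<in> BM borel" and off: "\<And>x. x \<notin> cube \<delta> x0 ==> f0 x = 0"
  and ae: "AE x in lborel. x \<in> cube \<delta> x0 --> f x = f0 x" and fi: "integrable lborel f0"
  and P: "P \<in> poly_space k" and orth: "\<And>h. h \<in> poly_space k ==> (LI y. indicator Q1 y*((f0 (aff y) - P y)*h y)) = 0"
 shows "poly_proj k \<delta> x0 f = (%x. P (ainv x))" "(%x. P (ainv x)) \<in> poly_space k"
proof -
 let ?Q = "cube \<delta> x0" and ?p = "%x. P (ainv x)"
 have "(%x. P (\<chi> j. (- x0$j/\<delta> j) + (1/\<delta> j)*x$j)) \<in> poly_space k" by(rule poly_space_affine[OF P])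
 moreover have "ainv x = (\<chi> j. (- x0$j/\<delta> j) + (1/\<delta> j)*x$j)" for x by(simp add: ainv_def vec_eq_iff diff_divide_distrib)
 ultimately show pq: "?p \<in> poly_space k" by simp
 have tr: "(\<integral>x. (f x - g x)*h x \<partial>lebesgue_on ?Q) = (LI x. indicator ?Q x*((f0 x - g x)*h x))"
  if g: "g \<in> poly_space k" and h: "h \<in> poly_space k" for g h
 proof (rule integral_lebesgue_on_cube)
  note [measurable] = poly_space_measurable[OF g] poly_space_measurable[OF h]
  show "(%x. (f x - g x)*h x) \<in> BM (lebesgue_on ?Q)"
   by(intro borel_measurable_times borel_measurable_diff f measurable_lebesgue_on_cube poly_space_measurable[OF g] poly_space_measurable[OF h])
  show "(%x. indicator ?Q x*((f0 x - g x)*h x)) \<in> BM borel" by measurable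
  from ae show "AE x in lborel. x \<in> ?Q --> (f x - g x)*h x = indicator ?Q x*((f0 x - g x)*h x)" by eventually_elim simp
 qed simp
 have int: "integrable lborel (%x. indicator ?Q x*((f0 x - g x)*h x))" if g: "g \<in> poly_space k" and h: "h \<in> poly_space k" for g h
 proof -
  note [measurable] = poly_space_measurable[OF g] poly_space_measurable[OF h]
  obtain H where H: "0 <= H" "\<And>x. x \<in> ?Q ==> \<bar>h x\<bar> <= H" using continuous_integrable_cube(2)[OF poly_space_continuous[OF h]] by blast
  have 1: "integrable lborel (%x. indicator ?Q x*(f0 x*h x))"
  proof (rule Bochner_Integration.integrable_bound[of _ "%x. H*f0 x"])
   show "AE x in lborel. norm (indicator ?Q x*(f0 x*h x)) <= norm (H*f0 x)"
   proof (intro AE_I2)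
   fix x show "norm (indicator ?Q x*(f0 x*h x)) <= norm (H*f0 x)"
   using H(2)[of x] H(1) by(cases "x \<in> ?Q") (auto simp: abs_mult mult.commute[of H] intro!: mult_left_mono)
   qed
  qed (use fi in auto)
  have 2: "integrable lborel (%x. indicator ?Q x*(g x*h x))"
   by(rule continuous_integrable_cube) (intro continuous_intros poly_space_continuous[OF g] poly_space_continuous[OF h])
  have "indicator ?Q x*((f0 x - g x)*h x) = indicator ?Q x*(f0 x*h x) - indicator ?Q x*(g x*h x)" for x by(simp add: algebra_simps)
  then show ?thesis using Bochner_Integration.integrable_diff[OF 1 2] by simp
 qed
 have pz: "(LI x. indicator ?Q x*((f0 x - ?p x)*h x)) = 0" if h: "h \<in> poly_space k" for h
 proof -
  note [measurable] = poly_space_measurable[OF pq] poly_space_measurable[OF h]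
  have ha: "(%y. h (aff y)) \<in> poly_space k"
  proof -
   have "aff y = (\<chi> j. x0$j + \<delta> j*y$j)" for y by(simp add: aff_def vec_eq_iff)
   then show ?thesis using poly_space_affine[OF h, of "%j. x0$j" \<delta>] by simp
  qed
  have "(LI x. indicator ?Q x*((f0 x - ?p x)*h x)) = vol*(LI y. indicator ?Q (aff y)*((f0 (aff y) - ?p (aff y))*h (aff y)))" by(rule integral_aff) measurable
  also have "(LI y. indicator ?Q (aff y)*((f0 (aff y) - ?p (aff y))*h (aff y))) = (LI y. indicator Q1 y*((f0 (aff y) - P y)*h (aff y)))"
   by(simp add: ainv_aff indicator_def aff_cube)
  also have "... = 0" by(rule orth[OF ha])
  finally show ?thesis by simp
 qed
 show "poly_proj k \<delta> x0 f = ?p" unfolding poly_proj_def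
 proof (rule the_equality, intro conjI ballI)
  show "?p \<in> poly_space k" by(rule pq)
  show "(\<integral>x. (f x - ?p x)*h x \<partial>lebesgue_on ?Q) = 0" if "h \<in> poly_space k" for h unfolding tr[OF pq that] by(rule pz[OF that])
  fix g assume "g \<in> poly_space k \<and> (\<forall>h\<in>poly_space k. (\<integral>x. (f x - g x)*h x \<partial>lebesgue_on ?Q) = 0)"
  then have g: "g \<in> poly_space k" and gz: "\<And>h. h \<in> poly_space k ==> (LI x. indicator ?Q x*((f0 x - g x)*h x)) = 0" using tr by auto
  have r: "(%x. ?p x - g x) \<in> poly_space k" by(rule poly_space_diff[OF pq g])
  have "(LI x. indicator ?Q x*((?p x - g x)*(?p x - g x))) = (LI x. indicator ?Q x*((f0 x - g x)*(?p x - g x)) - indicator ?Q x*((f0 x - ?p x)*(?p x - g x)))"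
   by(intro BI_cong refl) (simp add: algebra_simps)
  also have "... = 0" using Bochner_Integration.integral_diff[OF int[OF g r] int[OF pq r]] gz[OF r] pz[OF r] by simp
  finally have "(%x. ?p x - g x) = (%_. 0)" by(rule poly_space_L2_zero[OF r])
  then show "g = ?p" by(auto simp: fun_eq_iff)
 qed
qed

end

section \<open>Finiteness of W for functions of the class\<close>

lemma ennreal_mult_le_divide:
 assumes "0 < A" "ennreal A*Y <= ennreal C" "0 <= C"
 shows "Y <= ennreal (C/A)"
proof (cases Y)
 case (real y)
 then have "ennreal (A*y) <= ennreal C" using assms by(simp add: ennreal_mult)
 then have "A*y <= C" using assms(3) by(simp add: ennreal_le_iff)
 then have "y <= C/A" using assms(1) by(simp add: pos_le_divide_eq mult.commute)
 then show ?thesis using real by(simp add: ennreal_leI)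
next
 case top
 then show ?thesis using assms by(simp add: ennreal_mult_top top_unique)
qed

lemma SH'_bound:
 fixes f :: "real^'n::finite => real"
 assumes f: "f \<in> SH' \<alpha> p G" and p: "1 <= p" and J: "J ~= {}"
 shows "\<exists>C\<ge>0. \<forall>t. (\<forall>j\<in>J. 0 < t j) --> epow (diff_int f G p (lvec \<alpha>) J t) (1/p) <= ennreal (C*(\<Prod>j\<in>J. t j powr (\<alpha> j + 1/p)))"
proof -
 obtain C where C: "\<And>t. (\<forall>j\<in>J. 0 < t j) ==> ennreal (\<Prod>j\<in>J. t j powr (- \<alpha> j))*Omega' f G p (lvec \<alpha>) J t <= ennreal C"
  using f J unfolding SH'_def by blast
 \<comment> \<open>Compensates the factors (2 t_j)^(-1/p) of the averages in \<open>Omega'\<close>,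
   together with the summand 1/p in the exponent of t_j.\<close>
 define E where "E = (\<Prod>j\<in>J. (2::real) powr (1/p))"
 have E: "0 < E" unfolding E_def by(intro prod_pos) auto
 have "epow (diff_int f G p (lvec \<alpha>) J t) (1/p) <= ennreal ((max C 0*E)*(\<Prod>j\<in>J. t j powr (\<alpha> j + 1/p)))" if t: "\<forall>j\<in>J. 0 < t j" for t
 proof -
  let ?X = "diff_int f G p (lvec \<alpha>) J t"
  define A where "A = (\<Prod>j\<in>J. t j powr (- \<alpha> j))*(\<Prod>j\<in>J. 1/(2*t j)) powr (1/p)"
  have A: "0 < A" unfolding A_def using t by(intro mult_pos_pos prod_pos) (auto simp: prod_zero_iff)
  have pn: "0 <= (\<Prod>j\<in>J. 1/(2*t j))" using t by(intro prod_nonneg) (auto intro: less_imp_le)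
  have "ennreal A*epow ?X (1/p) = ennreal (\<Prod>j\<in>J. t j powr (- \<alpha> j))*Omega' f G p (lvec \<alpha>) J t"
   using p pn unfolding A_def Omega'_def enn_root_epow by(simp add: epow_mult epow_ennreal ennreal_mult prod_nonneg mult.assoc)
  also have "... <= ennreal (max C 0)" by(rule order_trans[OF C[OF t]]) (simp add: ennreal_leI)
  finally have "epow ?X (1/p) <= ennreal (max C 0/A)" by(rule ennreal_mult_le_divide[OF A]) simp
  moreover have "A*(E*(\<Prod>j\<in>J. t j powr (\<alpha> j + 1/p))) = 1"
  proof -
   have pd: "(\<Prod>j\<in>J. 1/(2*t j)) powr (1/p) = (\<Prod>j\<in>J. (1/(2*t j)) powr (1/p))" by(rule prod_powr_distrib)
   have "A*(E*(\<Prod>j\<in>J. t j powr (\<alpha> j + 1/p))) = (\<Prod>j\<in>J. t j powr (- \<alpha> j)*(1/(2*t j)) powr (1/p)*(2 powr (1/p)*t j powr (\<alpha> j + 1/p)))"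
   unfolding A_def E_def pd prod.distrib by(rule refl)
   moreover have "t j powr (- \<alpha> j)*(1/(2*t j)) powr (1/p)*(2 powr (1/p)*t j powr (\<alpha> j + 1/p)) = 1" if "j \<in> J" for j
   proof -
   have tj: "0 < t j" using t that by blast
   have "(1/(2*t j)) powr (1/p) = 1/(2 powr (1/p)*t j powr (1/p))" using tj by(simp add: powr_divide powr_mult)
   then show ?thesis using tj by(simp add: powr_add powr_minus)
   qed
   ultimately show ?thesis by(simp add: prod.neutral)
  qed
  then have "max C 0/A = (max C 0*E)*(\<Prod>j\<in>J. t j powr (\<alpha> j + 1/p))" using A by(simp add: field_simps)
  ultimately show ?thesis by simp
 qed
 then show ?thesis using E by(intro exI[of _ "max C 0*E"]) auto
qed

text \<open>The integrand is at most a product of powers t_j^(alpha_j - lam_j - s - 1), and the gap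
  makes each exponent larger than -1.\<close>

lemma WJ_finite:
 fixes F :: "real^'n::finite => real"
 assumes C: "0 <= C" and b: "\<And>t. t \<in> space (LJ J) ==> inbox c J t ==> epow (Dt F p l J t) (1/p) <= ennreal (C*(\<Prod>j\<in>J. t j powr (\<alpha> j + 1/p)))"
  and gap: "\<And>j. real (lam j) + s < \<alpha> j" and c: "0 < c"
 shows "WJ F p l lam s c J < \<infinity>"
proof -
 let ?P = "LJ J"
 interpret PS: product_sigma_finite "%_::'n. lborel::real measure" by standard
 let ?b = "%j. \<alpha> j - real (lam j) - s - 1"
 let ?w = "%j \<tau>. ennreal (\<tau> powr ?b j)*indicator {0..c} \<tau>"
 have "WJ F p l lam s c J <= (nn_integral ?P (%t. ennreal C*(\<Prod>j\<in>J. ?w j (t j))))" unfolding WJ_def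
 proof (rule nn_integral_mono)
  fix t assume t: "t \<in> space ?P"
  show "(if inbox c J t then ennreal (\<Prod>j\<in>J. t j powr (- real (lam j) - 1/p - s - 1))*epow (Dt F p l J t) (1/p) else 0) <= ennreal C*(\<Prod>j\<in>J. ?w j (t j))"
  proof (cases "inbox c J t")
   case True
   have "ennreal (\<Prod>j\<in>J. t j powr (- real (lam j) - 1/p - s - 1))*epow (Dt F p l J t) (1/p) <= ennreal (\<Prod>j\<in>J. t j powr (- real (lam j) - 1/p - s - 1))*ennreal (C*(\<Prod>j\<in>J. t j powr (\<alpha> j + 1/p)))"
   by(intro mult_left_mono b[OF t True]) simp
   also have "... = ennreal (C*(\<Prod>j\<in>J. t j powr ?b j))"
   proof -
   have "(\<Prod>j\<in>J. t j powr (- real (lam j) - 1/p - s - 1))*(\<Prod>j\<in>J. t j powr (\<alpha> j + 1/p)) = (\<Prod>j\<in>J. t j powr ?b j)"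
   unfolding prod.distrib[symmetric] powr_add[symmetric] by(intro prod.cong refl arg_cong2[of _ _ _ _ "(powr)"]) simp
   then show ?thesis using C by(simp add: ennreal_mult[symmetric] prod_nonneg mult.left_commute)
   qed
   also have "... = ennreal C*(\<Prod>j\<in>J. ennreal (t j powr ?b j))" using C by(simp add: ennreal_mult prod_nonneg prod_ennreal)
   also have "(\<Prod>j\<in>J. ennreal (t j powr ?b j)) = (\<Prod>j\<in>J. ?w j (t j))" using True by(intro prod.cong refl) (auto simp: inbox_def)
   finally show ?thesis using True by simp
  qed simp
 qed
 also have "... = ennreal C*(nn_integral ?P (%t. (\<Prod>j\<in>J. ?w j (t j))))"
 proof (rule nn_integral_cmult)
  show "(%t. \<Prod>j\<in>J. ?w j (t j)) \<in> borel_measurable ?P"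
  proof (rule borel_measurable_prod_ennreal)
   fix j assume j: "j \<in> J"
   have [measurable]: "(%t. t j) \<in> borel_measurable ?P" by(rule measurable_PiM_component[OF _ j]) simp
   show "(%t. ?w j (t j)) \<in> borel_measurable ?P" by measurable
  qed
 qed
 also have "(nn_integral ?P (%t. (\<Prod>j\<in>J. ?w j (t j)))) = (\<Prod>j\<in>J. \<integral>\<^sup>+\<tau>. ?w j \<tau> \<partial>lborel)"
  by(rule PS.product_nn_integral_prod) auto
 also have "... = (\<Prod>j\<in>J. ennreal (c powr (?b j + 1)/(?b j + 1)))"
 proof (intro prod.cong refl nn_integral_has_integral_lebesgue')
  fix j show "((%\<tau>. \<tau> powr ?b j) has_integral c powr (?b j + 1)/(?b j + 1)) {0..c}" by(rule has_integral_powr_from_0) (use gap[of j] c in auto)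
 qed auto
 also have "ennreal C*... < \<infinity>"
 proof -
  have "(\<Prod>j\<in>J. ennreal (c powr (?b j + 1)/(?b j + 1))) = ennreal (\<Prod>j\<in>J. c powr (?b j + 1)/(?b j + 1))"
   by(rule prod_ennreal) (use gap in \<open>auto intro!: divide_nonneg_nonneg simp: less_imp_le algebra_simps\<close>)
  then show ?thesis by(simp add: ennreal_mult_less_top)
 qed
 finally show ?thesis .
qed

context affine_cube
begin

text \<open>The constant may depend on the cube and on f: it guarantees finiteness only and does not
  enter the final estimates.\<close>

lemma Dt_bound_SH':
 assumes f: "f \<in> SH' \<alpha> p (cube \<delta> x0)" and p: "1 <= p" and J: "J ~= {}"
  and f0: "f0 \<in> BM borel" and ae: "AE x in lborel. x \<in> cube \<delta> x0 --> f x = f0 x"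
 shows "\<exists>C\<ge>0. \<forall>\<tau>. \<tau> \<in> space (LJ J) --> inbox c J \<tau> -->
  epow (Dt (%y. f0 (aff y)) p (lvec \<alpha>) J \<tau>) (1/p) <= ennreal (C*(\<Prod>j\<in>J. \<tau> j powr (\<alpha> j + 1/p)))"
proof -
 obtain C where C: "0 <= C" "\<And>t. (\<forall>j\<in>J. 0 < t j) ==> epow (diff_int f (cube \<delta> x0) p (lvec \<alpha>) J t) (1/p) <= ennreal (C*(\<Prod>j\<in>J. t j powr (\<alpha> j + 1/p)))"
  using SH'_bound[OF f p J] by blast
 have p0: "0 < p" using p by simp
 define k where "k = (\<Prod>j\<in>J. \<delta> j) * vol"
 have k: "0 < k" unfolding k_def by(intro mult_pos_pos prod_pos vol_pos) (use dpos in auto)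
 define d where "d = (\<Prod>j\<in>J. \<delta> j powr (\<alpha> j + 1/p))"
 have d: "0 <= d" unfolding d_def by(intro prod_nonneg) auto
 have "epow (Dt (%y. f0 (aff y)) p (lvec \<alpha>) J \<tau>) (1/p) <= ennreal ((C*d/k powr (1/p))*(\<Prod>j\<in>J. \<tau> j powr (\<alpha> j + 1/p)))"
  if t: "\<tau> \<in> space (LJ J)" and i: "inbox c J \<tau>" for \<tau>
 proof -
  let ?t = "\<lambda>j\<in>J. \<delta> j*\<tau> j"
  have ts: "?t \<in> space (LJ J)" by(simp add: space_PiM)
  have ext: "\<tau> \<in> extensional J" using t by(auto simp: space_PiM PiE_def)
  have r: "(\<lambda>j\<in>J. ?t j/\<delta> j) = \<tau>"
  proof
   fix j show "(\<lambda>j\<in>J. ?t j/\<delta> j) j = \<tau> j" using ext dpos[of j] by(cases "j \<in> J") (auto simp: extensional_def)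
  qed
  have pr: "(\<Prod>j\<in>J. ?t j powr (\<alpha> j + 1/p)) = d*(\<Prod>j\<in>J. \<tau> j powr (\<alpha> j + 1/p))"
   unfolding d_def prod.distrib[symmetric] using i less_imp_le[OF dpos] by(intro prod.cong refl) (auto simp: inbox_def powr_mult less_imp_le)
  have "epow (diff_int f (cube \<delta> x0) p (lvec \<alpha>) J ?t) (1/p) <= ennreal (C*(\<Prod>j\<in>J. ?t j powr (\<alpha> j + 1/p)))"
   by(rule C(2)) (use i dpos in \<open>auto simp: inbox_def\<close>)
  then have "ennreal (k powr (1/p))*epow (Dt (%y. f0 (aff y)) p (lvec \<alpha>) J \<tau>) (1/p) <= ennreal (C*(d*(\<Prod>j\<in>J. \<tau> j powr (\<alpha> j + 1/p))))"
   unfolding diff_int_cong_AE[OF ae] diff_int_aff[OF f0 p0 ts] r pr k_def[symmetric] using p0 k by(simp add: epow_mult epow_ennreal)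
  from ennreal_mult_le_divide[OF _ this] show ?thesis using k C d by(simp add: prod_nonneg mult_ac)
 qed
 then show ?thesis using C d by(intro exI[of _ "C*d/k powr (1/p)"]) auto
qed

end

section \<open>Choice of the constants and transfer from the unit cube\<close>

theorem theorem2p1p2:
  fixes \<alpha> :: "'n::finite \<Rightarrow> real"
  assumes "\<forall>j. 0 < \<alpha> j"
  shows "\<exists>c1>0. \<forall>(p::real) (q::ennreal) (lam::'n \<Rightarrow> nat).
     1 \<le> p \<longrightarrow> 1 \<le> q \<longrightarrow>
     (\<forall>j. \<alpha> j - real (lam j) - max 0 (1 / p - inv_exp q) > 0) \<longrightarrow>
     (\<exists>c2>0. \<exists>c3>0. \<forall>(\<delta>::'n \<Rightarrow> real) (x0::real^'n) f.
        (\<forall>j. 0 < \<delta> j) \<longrightarrow> f \<in> SH' \<alpha> p (cube \<delta> x0) \<longrightarrow>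
        (\<exists>g h. weak_deriv (cube \<delta> x0) lam f g \<and>
           weak_deriv (cube \<delta> x0) lam (poly_proj (\<lambda>j. lvec \<alpha> j - 1) \<delta> x0 f) h \<and>
           Lq_norm (cube \<delta> x0) q (\<lambda>x. g x - h x) \<le>
             ennreal (c2 * (\<Prod>j\<in>UNIV. \<delta> j powr (- real (lam j) - 1 / p + inv_exp q))) *
             Wf \<alpha> p q lam c1 \<delta> x0 f \<and>
           Lq_norm (cube \<delta> x0) q g \<le>
             ennreal (c3 * (\<Prod>j\<in>UNIV. \<delta> j powr (- real (lam j) - 1 / p + inv_exp q))) *
             (Lp_norm (cube \<delta> x0) p f + Wf \<alpha> p q lam c1 \<delta> x0 f)))"
proof -
 let ?l = "lvec \<alpha>"
 have l: "\<alpha> j < real (?l j)" for j unfolding lvec_def by(rule LeastI_ex) (rule reals_Archimedean2)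
 have l1: "1 <= ?l j" for j
 proof -
  have "0 < real (?l j)" using l[of j] assms by(meson less_trans)
  then show ?thesis by simp
 qed
 \<comment> \<open>\<open>S\<close> dominates every \<open>l j\<close>, and therefore every
   admissible \<open>lam j\<close>. The scale \<open>c\<close> and the order of the bump are thus
   fixed by alpha alone, before p, q and lam.\<close>
 define S where "S = (\<Sum>j\<in>UNIV. ?l j)"
 have lS: "?l j <= S" for j unfolding S_def by(rule member_le_sum) auto
 have S1: "1 <= S" using l1[of undefined] lS[of undefined] by linarith
 define c where "c = 1/(2*real S)"
 have c0: "0 < c" and cle: "c <= 1" using S1 by(simp_all add: c_def divide_le_eq)
 have lc: "2*real (?l j)*c <= 1" for j using lS[of j] S1 by(simp add: c_def divide_le_eq)
 obtain \<phi> B where bump: "bump (S + 1) \<phi> B" using bump_exists by blast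
 interpret bump "S + 1" \<phi> B by(rule bump)
 interpret rep "S + 1" \<phi> B ?l c by unfold_locales (use l1 c0 cle lc in auto)
 show ?thesis
 proof (rule exI[of _ c], rule conjI[OF c0], intro allI impI)
  fix p :: real and q :: ennreal and lam :: "'n => nat"
  assume p: "1 <= p" and q: "1 <= q" and gap: "\<forall>j. \<alpha> j - real (lam j) - max 0 (1/p - inv_exp q) > 0"
  have p0: "0 < p" using p by simp
  let ?s = "sobgap p q"
  have s0: "0 <= ?s" by(simp add: sobgap_def)
  have gap': "real (lam j) + ?s < \<alpha> j" for j using gap[rule_format, of j] unfolding sobgap_def by linarith
  \<comment> \<open>The gap forces lam j < alpha j < l j, so a bump of order S + 1 has enough
    derivatives.\<close>
  have lamN: "lam j < S + 1" for j
  proof -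
   have "real (lam j) < real (?l j)" using gap'[of j] s0 l[of j] by linarith
   then show ?thesis using lS[of j] by linarith
  qed
  show "\<exists>c2>0. \<exists>c3>0. \<forall>\<delta> x0 f. (\<forall>j. 0 < \<delta> j) --> f \<in> SH' \<alpha> p (cube \<delta> x0) -->
   (\<exists>g h. weak_deriv (cube \<delta> x0) lam f g \<and>
   weak_deriv (cube \<delta> x0) lam (poly_proj (%j. lvec \<alpha> j - 1) \<delta> x0 f) h \<and>
   Lq_norm (cube \<delta> x0) q (%x. g x - h x) \<le>
   ennreal (c2*(\<Prod>j\<in>UNIV. \<delta> j powr (- real (lam j) - 1/p + inv_exp q))) *
   Wf \<alpha> p q lam c \<delta> x0 f \<and>
   Lq_norm (cube \<delta> x0) q g \<le>
   ennreal (c3*(\<Prod>j\<in>UNIV. \<delta> j powr (- real (lam j) - 1/p + inv_exp q))) *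
   (Lp_norm (cube \<delta> x0) p f + Wf \<alpha> p q lam c \<delta> x0 f))"
  proof (rule unit_cube[where lam = lam, OF p q lamN], goal_cases)
  case (1 K)
  note K = 1(1) and unit = 1(2)
  show ?case
  proof (rule exI[of _ K], rule conjI[OF K], rule exI[of _ K], rule conjI[OF K], intro allI impI, goal_cases)
   case (1 \<delta> x0 f)
   note \<delta> = 1(1) and f = 1(2)
   interpret A: affine_cube \<delta> x0 by unfold_locales (use \<delta> in blast)
   let ?Q = "cube \<delta> x0"
   have Qm[measurable]: "?Q \<in> sets borel" by(rule A.cube_sets)
   have fm: "f \<in> BM (lebesgue_on ?Q)" and ffin: "(\<integral>\<^sup>+x\<in>?Q. ennreal (\<bar>f x\<bar> powr p) \<partial>lebesgue) < \<infinity>"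
   using f unfolding SH'_def in_Lp_def by auto
   have "(%x. indicator ?Q x *\<^sub>R f x) \<in> BM lebesgue" using fm borel_measurable_restrict_space_iff[OF A.cube_sets(3)] by blast
   \<comment> \<open>A Borel representative of f on the cube, set to 0 outside, since the estimates
     on the unit cube are stated for Borel functions on the whole space.\<close>
   from completion_ex_borel_measurable_real[OF this] obtain g0
   where g0': "g0 \<in> BM lborel" and g0ae: "AE x in lborel. indicator ?Q x *\<^sub>R f x = g0 x" by(rule bexE)
   have g0[measurable]: "g0 \<in> BM borel" using g0' by simp
   define f0 where "f0 x = indicator ?Q x*g0 x" for x
   have f0m[measurable]: "f0 \<in> BM borel" unfolding f0_def by measurable
   have off: "f0 x = 0" if "x \<notin> ?Q" for x using that by(simp add: f0_def)
   have ae: "AE x in lborel. x \<in> ?Q --> f x = f0 x" using g0ae by eventually_elim (auto simp: f0_def)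
   define F where "F y = f0 (A.aff y)" for y
   have Fm[measurable]: "F \<in> BM borel" unfolding F_def by measurable
   have F0: "F y = 0" if "y \<notin> Q1" for y using that A.aff_cube[of y] off by(simp add: F_def)
   have FI: "(\<integral>\<^sup>+x\<in>?Q. ennreal (\<bar>f x\<bar> powr p) \<partial>lebesgue) = ennreal A.vol*(NN y. ennreal (\<bar>F y\<bar> powr p))"
   proof -
   have "(\<integral>\<^sup>+x\<in>?Q. ennreal (\<bar>f x\<bar> powr p) \<partial>lebesgue) = (NN x. ennreal (\<bar>f0 x\<bar> powr p))" unfolding nn_integral_completion
   proof (rule nn_integral_cong_AE)
   from ae show "AE x in lborel. ennreal (\<bar>f x\<bar> powr p)*indicator ?Q x = ennreal (\<bar>f0 x\<bar> powr p)"
   by eventually_elim (use p0 off in \<open>auto simp: indicator_def\<close>)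
   qed
   also have "... = ennreal A.vol*(NN y. ennreal (\<bar>F y\<bar> powr p))" unfolding F_def by(rule A.nn_integral_aff) measurable
   finally show ?thesis .
   qed
   have "(NN y. ennreal (\<bar>F y\<bar> powr p)) ~= \<infinity>" using ffin A.vol_pos unfolding FI by(auto simp: ennreal_mult_top)
   then obtain i where i: "(NN y. ennreal (\<bar>F y\<bar> powr p)) = ennreal i" "0 <= i"
   by(cases "\<integral>\<^sup>+y. ennreal (\<bar>F y\<bar> powr p) \<partial>lborel") auto
   define v where "v = i powr (1/p)"
   have v: "0 <= v" "v powr p = i" using i p0 by(simp_all add: v_def powr_powr)
   have Fv: "Lbd p F v" unfolding Lbd_def v i by simp
   define V where "V = A.vol powr (1/p)"
   have V: "0 < V" using A.vol_pos by(simp add: V_def)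
   have Lp: "Lp_norm ?Q p f = ennreal (V * v)" unfolding Lp_norm_def FI i enn_root_epow v_def V_def using A.vol_pos i
   by(simp add: ennreal_mult[symmetric] epow_ennreal powr_mult)
   have bnd: "\<exists>C\<ge>0. \<forall>\<tau>. \<tau> \<in> space (LJ J) --> inbox c J \<tau> -->
   epow (Dt F p ?l J \<tau>) (1/p) <= ennreal (C*(\<Prod>j\<in>J. \<tau> j powr (\<alpha> j + 1/p)))" if "J ~= {}" for J
   unfolding F_def by(rule A.Dt_bound_SH'[OF f p that f0m ae])
   \<comment> \<open>Membership in the class enters here and in \<open>Wfin\<close>, where it
     ensures that W can be represented by a real number.\<close>
   have Dfin: "Dt F p ?l J t < \<infinity>" if J: "J ~= {}" and t: "t \<in> space (LJ J)" "inbox c J t" for J t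
   proof -
   obtain C where "epow (Dt F p ?l J t) (1/p) <= ennreal C" using bnd[OF J] t by blast
   then show ?thesis by(auto simp: epow_def less_top top_unique split: if_splits)
   qed
   have Wfin: "WJ F p ?l lam ?s c J < \<infinity>" if J: "J ~= {}" for J
   proof -
   obtain C where "0 <= C" "\<And>\<tau>. \<tau> \<in> space (LJ J) ==> inbox c J \<tau> ==>
   epow (Dt F p ?l J \<tau>) (1/p) <= ennreal (C*(\<Prod>j\<in>J. \<tau> j powr (\<alpha> j + 1/p)))" using bnd[OF J] by blast
   then show ?thesis by(rule WJ_finite[OF _ _ gap' c0])
   qed
   have "WT (- {{}}) F p lam ?s ~= \<infinity>" unfolding WT_def using Wfin by(auto simp: less_top)
   then obtain w where w: "WT (- {{}}) F p lam ?s = ennreal w" "0 <= w" by(cases "WT (- {{}}) F p lam ?s") auto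
   have Wf: "Wf \<alpha> p q lam c \<delta> x0 f = ennreal (V*w)"
   proof -
   have "Wf \<alpha> p q lam c \<delta> x0 f = (\<Sum>J\<in>- {{}}. ennreal V*WJ F p ?l lam ?s c J)"
   unfolding Wf_def Let_def V_def F_def diff_int_cong_AE[OF ae] sobgap_def[symmetric] A.Wf_term_aff[OF f0m p] by(rule sum.cong) auto
   also have "... = ennreal V*ennreal w" unfolding w(1)[symmetric] WT_def by(simp add: sum_distrib_left)
   finally show ?thesis using V w by(simp add: ennreal_mult)
   qed
   have "unit_estimate (%j. ?l j - 1) q lam F (K*w) (K*(v + w))" by(rule unit[OF Fm F0 Fv v(1) Dfin eq_refl[OF w(1)] w(2)])
   then obtain P g1 h1 where P: "P \<in> poly_space (%j. ?l j - 1)"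
   and orth: "\<And>hh. hh \<in> poly_space (%j. ?l j - 1) ==> (LI x. indicator Q1 x*((F x - P x)*hh x)) = 0"
   and gi: "integrable lborel g1" and hi: "integrable lborel h1"
   and wg: "\<And>\<phi>'. test_fun Q1 \<phi>' ==> (LI x. F x*partial_mi lam \<phi>' x) = (-1)^(\<Sum>j\<in>UNIV. lam j)*(LI x. g1 x*\<phi>' x)"
   and wh: "\<And>\<phi>'. test_fun Q1 \<phi>' ==> (LI x. (indicator Q1 x*P x)*partial_mi lam \<phi>' x) = (-1)^(\<Sum>j\<in>UNIV. lam j)*(LI x. h1 x*\<phi>' x)"
   and b1: "LB q (%x. g1 x - h1 x) (K*w)" and b2: "LB q g1 (K*(v + w))" unfolding unit_estimate_def by blast
   have Fi: "integrable lborel F" by(rule integrable_of_Lbd[OF Fm F0 Fv v(1) p])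
   have f0i: "integrable lborel f0" using Fi unfolding A.integrable_aff[OF f0m] F_def .
   have orth': "(LI y. indicator Q1 y*((f0 (A.aff y) - P y)*hh y)) = 0" if "hh \<in> poly_space (%j. ?l j - 1)" for hh using orth[OF that] unfolding F_def .
   have proj: "poly_proj (%j. ?l j - 1) \<delta> x0 f = (%x. P (A.ainv x))" by(rule A.poly_proj_aff(1)[OF fm f0m off ae f0i P orth'])
   have projm[measurable]: "(%x. P (A.ainv x)) \<in> BM borel" by(rule poly_space_measurable[OF A.poly_proj_aff(2)[OF fm f0m off ae f0i P orth']])
   define cl where "cl = (\<Prod>j\<in>UNIV. \<delta> j powr (- real (lam j)))"
   have cl: "0 <= cl" unfolding cl_def by(intro prod_nonneg) auto
   have W1: "weak_deriv ?Q lam f (%x. cl*g1 (A.ainv x))" unfolding cl_def by(rule A.weak_deriv_aff[OF fm f0m off ae gi]) (use wg in \<open>auto simp: F_def\<close>)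
   have W2: "weak_deriv ?Q lam (poly_proj (%j. ?l j - 1) \<delta> x0 f) (%x. cl*h1 (A.ainv x))" unfolding cl_def proj
   proof (rule A.weak_deriv_aff[where ?u0.0 = "%x. indicator ?Q x*P (A.ainv x)", OF A.measurable_lebesgue_on_cube[OF projm] _ _ _ hi])
   fix \<phi>' :: "real^'n => real" assume t: "test_fun Q1 \<phi>'"
   have "indicator ?Q (A.aff y)*P (A.ainv (A.aff y)) = indicator Q1 y*P y" for y by(simp add: A.ainv_aff indicator_def A.aff_cube)
   then show "(LI y. indicator ?Q (A.aff y)*P (A.ainv (A.aff y))*partial_mi lam \<phi>' y) = (-1)^(\<Sum>j\<in>UNIV. lam j)*(LI y. h1 y*\<phi>' y)"
   using wh[OF t] by(simp only:)
   qed auto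
   have g1m[measurable]: "g1 \<in> BM borel" and h1m[measurable]: "h1 \<in> BM borel"
   using borel_measurable_integrable[OF gi] borel_measurable_integrable[OF hi] by simp_all
   define Z where "Z = (\<Prod>j\<in>UNIV. \<delta> j powr (- real (lam j) - 1/p + inv_exp q))"
   have Z0: "0 <= Z" unfolding Z_def by(intro prod_nonneg) auto
   \<comment> \<open>The common factor vol^(1/p) of the L_p norm and of W cancels the -1/p in the
     exponent of the statement, leaving the scaling of the derivative and of the L_q norm.\<close>
   have Z: "Z*V = cl*A.vol powr (inv_exp q)"
   proof -
   have "Z*V = (\<Prod>j\<in>UNIV. \<delta> j powr (- real (lam j) - 1/p + inv_exp q)*\<delta> j powr (1/p))"
   unfolding Z_def V_def A.vol_def prod.distrib by(simp add: prod_powr_distrib)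
   also have "... = (\<Prod>j\<in>UNIV. \<delta> j powr (- real (lam j))*\<delta> j powr (inv_exp q))" unfolding powr_add[symmetric] by simp
   also have "... = cl*A.vol powr (inv_exp q)" unfolding cl_def A.vol_def prod.distrib by(simp add: prod_powr_distrib)
   finally show ?thesis .
   qed
   have N1: "Lq_norm ?Q q (%x. cl*g1 (A.ainv x) - cl*h1 (A.ainv x)) <= ennreal (K*Z)*Wf \<alpha> p q lam c \<delta> x0 f"
   proof -
   have "Lq_norm ?Q q (%x. cl*(%y. g1 y - h1 y) (A.ainv x)) <= ennreal (cl*A.vol powr (inv_exp q)*(K*w))" by(rule A.Lq_norm_aff[OF _ q b1 _ cl]) (use K w in auto)
   also have "cl*A.vol powr (inv_exp q)*(K*w) = K*Z*(V*w)" unfolding Z[symmetric] by simp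
   also have "ennreal (K*Z*(V*w)) = ennreal (K*Z)*Wf \<alpha> p q lam c \<delta> x0 f" unfolding Wf using K Z0 V w by(intro ennreal_mult) auto
   finally show ?thesis by(simp add: right_diff_distrib)
   qed
   have N2: "Lq_norm ?Q q (%x. cl*g1 (A.ainv x)) <= ennreal (K*Z)*(Lp_norm ?Q p f + Wf \<alpha> p q lam c \<delta> x0 f)"
   proof -
   have "Lq_norm ?Q q (%x. cl*g1 (A.ainv x)) <= ennreal (cl*A.vol powr (inv_exp q)*(K*(v + w)))" by(rule A.Lq_norm_aff[OF g1m q b2 _ cl]) (use K w v in auto)
   also have "cl*A.vol powr (inv_exp q)*(K*(v + w)) = K*Z*(V * v + V*w)" unfolding Z[symmetric] by(simp add: algebra_simps)
   also have "ennreal (K*Z*(V * v + V*w)) = ennreal (K*Z)*(ennreal (V * v) + ennreal (V*w))"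
   proof -
   have "ennreal (V * v + V*w) = ennreal (V * v) + ennreal (V*w)" by(rule ennreal_plus) (use V v w in auto)
   moreover have "ennreal (K*Z*(V * v + V*w)) = ennreal (K*Z)*ennreal (V * v + V*w)" by(rule ennreal_mult) (use K Z0 V v w in auto)
   ultimately show ?thesis by(simp only:)
   qed
   finally show ?thesis unfolding Lp Wf .
   qed
   show ?case unfolding Z_def[symmetric] by(rule exI[of _ "%x. cl*g1 (A.ainv x)"], rule exI[of _ "%x. cl*h1 (A.ainv x)"])
   (intro conjI W1 W2 N1 N2)
  qed
  qed
 qed
qed

end
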